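(* Let $d\ge1$ be an integer, let $\mathcal M=\mathbb R^d$ or $\mathcal M=\mathbb T^d$, let $0<\beta<\infty$, let $k\in\mathbb N$ (a positive integer) and let $1\le p\le\infty$. Assume that $u_0\in\widehat w^{p,1}(\mathcal M)$. Then there exists $T_1>0$ such that the problem $$\partial_t u+(-\Delta)^{\beta/2}u=u^k,\qquad u(0,\cdot)=u_0,\qquad (t,x)\in\mathbb R^+\times\mathcal M,$$ has a unique solution $u\in C([0,T_1),\widehat w^{p,1}(\mathcal M))$.
   Context: $\mathbb T^d=\mathbb R^d/\mathbb Z^d$. The dual group is $\widehat{\mathcal M}=\mathbb R^d$ (Lebesgue measure) if $\mathcal M=\mathbb R^d$, and $\widehat{\mathcal M}=\mathbb Z^d$ (counting measure) if $\mathcal M=\mathbb T^d$. $\mathcal F f(\xi)=\int_{\mathcal M}f(x)e^{-2\pi i x\cdot\xi}\,dx$, extended to the tempered distributions $\mathcal S'(\mathcal M)$. The fractional Laplacian is the Fourier multiplier $\mathcal F[(-\Delta)^{\beta/2}u](\xi)=|\xi|^\beta\mathcal Fu(\xi)$, and the propagator is $U_\beta(t)f=e^{-t(-\Delta)^{\beta/2}}f=\mathcal F^{-1}(e^{-t|\xi|^\beta}\mathcal Ff)$. A solution on $[0,T)$ is a function $u\in C([0,T),\widehat w^{p,1}(\mathcal M))$ satisfying $u(t)=U_\beta(t)u_0+\int_0^tU_\beta(t-s)\,u(s)^k\,ds$ for $0\le t<T$ (the space $\widehat w^{p,1}(\mathcal M)$ is an algebra under pointwise multiplication). Fourier amalgam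 space: for $1\le p,q\le\infty$, $\widehat w^{p,q}(\mathcal M)$ is the space of $f\in\mathcal S'(\mathcal M)$ with $\|f\|_{\widehat w^{p,q}}=\big\|\,\|\chi_{n+(-1/2,1/2]^d}(\xi)\,\mathcal Ff(\xi)\|_{L^p_\xi(\widehat{\mathcal M})}\big\|_{\ell^q_n(\mathbb Z^d)}<\infty$, where $\chi_A$ is the indicator function of $A$. *)

theory Defs
  imports "HOL-Analysis.Analysis" "HOL-Probability.Essential_Supremum"
begin

text \<open>
  The underlying group is either \<open>\<real>\<^sup>d\<close> or \<open>\<real>\<^sup>d/\<int>\<^sup>d\<close>, with \<open>d = CARD('n)\<close>.  Functions on the torus
  are \<open>\<int>\<^sup>d\<close>-periodic functions on \<^typ>\<open>real^'n\<close>; functions on its dual group are functions on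
  \<^typ>\<open>real^'n\<close> of which only the values on the integer lattice matter.
\<close>

datatype domain = Rd | Td

definition int_lattice :: "(real^'n) set" where
  "int_lattice = {x. \<forall>i. x $ i \<in> \<int>}"

definition periodic :: "(real^'n \<Rightarrow> complex) \<Rightarrow> bool" where
  "periodic \<phi> \<longleftrightarrow> (\<forall>x. \<forall>n\<in>int_lattice. \<phi> (x + n) = \<phi> x)"

fun domain_measure :: "domain \<Rightarrow> (real^'n) measure" where
  "domain_measure Rd = lborel"
| "domain_measure Td = restrict_space lborel (cbox 0 1)"

fun dual_measure :: "domain \<Rightarrow> (real^'n) measure" where
  "dual_measure Rd = lborel"
| "dual_measure Td = count_space int_lattice"


subsection \<open>Test functions and tempered distributions\<close>

definition partial_deriv :: "'n \<Rightarrow> (real^'n \<Rightarrow> complex) \<Rightarrow> real^'n \<Rightarrow> complex" where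
  "partial_deriv i \<phi> = (\<lambda>x. frechet_derivative \<phi> (at x) (axis i 1))"

fun partial_derivs :: "'n list \<Rightarrow> (real^'n \<Rightarrow> complex) \<Rightarrow> real^'n \<Rightarrow> complex" where
  "partial_derivs [] \<phi> = \<phi>"
| "partial_derivs (i # js) \<phi> = partial_deriv i (partial_derivs js \<phi>)"

definition smooth :: "(real^'n \<Rightarrow> complex) \<Rightarrow> bool" where
  "smooth \<phi> \<longleftrightarrow> (\<forall>js x. partial_derivs js \<phi> differentiable (at x))"

definition schwartz :: "(real^'n \<Rightarrow> complex) set" where
  "schwartz = {\<phi>. smooth \<phi> \<and>
     (\<forall>N js. bounded (range (\<lambda>x. (1 + norm x) ^ N *\<^sub>R partial_derivs js \<phi> x)))}"

fun test_space :: "domain \<Rightarrow> (real^'n \<Rightarrow> complex) set" where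
  "test_space Rd = schwartz"
| "test_space Td = {\<phi>. smooth \<phi> \<and> periodic \<phi>}"

fun seminorm :: "domain \<Rightarrow> nat \<Rightarrow> 'n list \<Rightarrow> (real^'n \<Rightarrow> complex) \<Rightarrow> real" where
  "seminorm Rd N js \<phi> = (SUP x. (1 + norm x) ^ N * norm (partial_derivs js \<phi> x))"
| "seminorm Td N js \<phi> = (SUP x. norm (partial_derivs js \<phi> x))"

type_synonym 'n functional = "(real^'n \<Rightarrow> complex) \<Rightarrow> complex"

text \<open>
  Functionals are total functions in HOL; they are normalised to vanish off the test space, so that
  equality of distributions is equality of functions.  The last conjunct is continuity for the
  Frechet topology given by the seminorms.
\<close>

definition tempered :: "domain \<Rightarrow> 'n::finite functional set" where
  "tempered M = {f.
     (\<forall>\<phi>. \<phi> \<notin> test_space M \<longrightarrow> f \<phi> = 0) \<and>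
     (\<forall>\<phi>\<in>test_space M. \<forall>\<psi>\<in>test_space M. f (\<lambda>x. \<phi> x + \<psi> x) = f \<phi> + f \<psi>) \<and>
     (\<forall>c. \<forall>\<phi>\<in>test_space M. f (\<lambda>x. c * \<phi> x) = c * f \<phi>) \<and>
     (\<exists>C N. \<forall>\<phi>\<in>test_space M. norm (f \<phi>) \<le> C * (\<Sum>js | length js \<le> N. seminorm M N js \<phi>))}"

definition regular_dist :: "domain \<Rightarrow> (real^'n \<Rightarrow> complex) \<Rightarrow> 'n functional" where
  "regular_dist M v = (\<lambda>\<phi>. if \<phi> \<in> test_space M then (LINT x|domain_measure M. v x * \<phi> x) else 0)"


subsection \<open>Fourier transform\<close>

definition fourier :: "(real^'n \<Rightarrow> complex) \<Rightarrow> real^'n \<Rightarrow> complex" where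
  "fourier \<phi> = (\<lambda>\<xi>. LINT x|lborel. \<phi> x * cis (- 2 * pi * (x \<bullet> \<xi>)))"

text \<open>
  \<open>is_fourier M f g\<close>: the Fourier transform of the distribution \<open>f\<close> is the function \<open>g\<close> on the dual
  group.  On \<open>\<real>\<^sup>d\<close> the transform of \<open>f\<close> is the distribution \<open>\<phi> \<mapsto> f (fourier \<phi>)\<close>; on the torus it
  is the family of Fourier coefficients, obtained by testing \<open>f\<close> against the characters.
\<close>

fun is_fourier :: "domain \<Rightarrow> 'n functional \<Rightarrow> (real^'n \<Rightarrow> complex) \<Rightarrow> bool" where
  "is_fourier Rd f g \<longleftrightarrow> g \<in> borel_measurable lborel \<and>
     (\<forall>\<phi>\<in>schwartz. integrable lborel (\<lambda>\<xi>. g \<xi> * \<phi> \<xi>) \<and>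
        f (fourier \<phi>) = (LINT \<xi>|lborel. g \<xi> * \<phi> \<xi>))"
| "is_fourier Td f g \<longleftrightarrow> (\<forall>\<xi>\<in>int_lattice. g \<xi> = f (\<lambda>x. cis (- 2 * pi * (x \<bullet> \<xi>))))"

definition fourier_fun :: "domain \<Rightarrow> 'n::finite functional \<Rightarrow> real^'n \<Rightarrow> complex" where
  "fourier_fun M f = (SOME g. is_fourier M f g)"

definition inverse_fourier :: "domain \<Rightarrow> (real^'n \<Rightarrow> complex) \<Rightarrow> 'n::finite functional" where
  "inverse_fourier M g = (THE f. f \<in> tempered M \<and> is_fourier M f g)"

definition propagator :: "domain \<Rightarrow> real \<Rightarrow> real \<Rightarrow> 'n::finite functional \<Rightarrow> 'n functional" where
  "propagator M \<beta> t f =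
     inverse_fourier M (\<lambda>\<xi>. of_real (exp (- t * norm \<xi> powr \<beta>)) * fourier_fun M f \<xi>)"


subsection \<open>Fourier amalgam spaces\<close>

definition enn_powr :: "ennreal \<Rightarrow> real \<Rightarrow> ennreal" where
  "enn_powr x r = (if x = \<infinity> then \<infinity> else ennreal (enn2real x powr r))"

definition Lp_norm :: "ennreal \<Rightarrow> 'a measure \<Rightarrow> ('a \<Rightarrow> ennreal) \<Rightarrow> ennreal" where
  "Lp_norm p M h = (if p = \<infinity> then esssup M h
     else enn_powr (\<integral>\<^sup>+x. enn_powr (h x) (enn2real p) \<partial>M) (1 / enn2real p))"

definition unit_cube :: "real^'n \<Rightarrow> (real^'n) set" where
  "unit_cube n = {\<xi>. \<forall>i. n $ i - 1/2 < \<xi> $ i \<and> \<xi> $ i \<le> n $ i + 1/2}"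

definition amalgam_norm :: "domain \<Rightarrow> ennreal \<Rightarrow> ennreal \<Rightarrow> (real^'n \<Rightarrow> complex) \<Rightarrow> ennreal" where
  "amalgam_norm M p q g = Lp_norm q (count_space int_lattice)
     (\<lambda>n. Lp_norm p (dual_measure M) (\<lambda>\<xi>. ennreal (norm (indicat_real (unit_cube n) \<xi> *\<^sub>R g \<xi>))))"

text \<open>
  All functions representing the transform of \<open>f\<close> agree almost everywhere, so the infimum ranges
  over at most one value; it is \<open>\<infinity>\<close> if the transform of \<open>f\<close> is not a function.
\<close>

definition w_norm :: "domain \<Rightarrow> ennreal \<Rightarrow> ennreal \<Rightarrow> 'n::finite functional \<Rightarrow> ennreal" where
  "w_norm M p q f = (INF g\<in>{g. is_fourier M f g}. amalgam_norm M p q g)"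

definition w_space :: "domain \<Rightarrow> ennreal \<Rightarrow> ennreal \<Rightarrow> 'n::finite functional set" where
  "w_space M p q = {f \<in> tempered M. w_norm M p q f < \<infinity>}"


subsection \<open>Solutions\<close>

text \<open>
  Distributions with integrable transform, in particular the elements of \<open>w_space M p 1\<close>, are given
  by a unique bounded continuous function; pointwise powers are taken of that function.
\<close>

definition cont_rep :: "domain \<Rightarrow> 'n::finite functional \<Rightarrow> real^'n \<Rightarrow> complex" where
  "cont_rep M f = (THE v. continuous_on UNIV v \<and> bounded (range v) \<and>
     (M = Td \<longrightarrow> periodic v) \<and> f = regular_dist M v)"

definition dist_power :: "domain \<Rightarrow> 'n::finite functional \<Rightarrow> nat \<Rightarrow> 'n functional" where
  "dist_power M f k = regular_dist M (\<lambda>x. cont_rep M f x ^ k)"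

text \<open>
  The Riemann integral of a \<open>w_space M p q\<close>-valued function, with convergence in norm.  The spaces
  depend on the parameters \<open>p\<close> and \<open>q\<close> and are thus not types, so the library integrals for
  Banach-space-valued functions do not apply directly.
\<close>

definition has_w_integral ::
  "domain \<Rightarrow> ennreal \<Rightarrow> ennreal \<Rightarrow> (real \<Rightarrow> 'n::finite functional) \<Rightarrow> real \<Rightarrow> real \<Rightarrow> 'n functional \<Rightarrow> bool"
where
  "has_w_integral M p q F a b I \<longleftrightarrow>
     (\<forall>s\<in>{a..b}. F s \<in> w_space M p q) \<and> I \<in> w_space M p q \<and>
     (\<forall>e>0. \<exists>\<delta>>0. \<forall>D. D tagged_division_of {a..b} \<and> (\<lambda>s. ball s \<delta>) fine D \<longrightarrow>
        w_norm M p q (\<lambda>\<phi>. (\<Sum>(s, K)\<in>D. of_real (measure lborel K) * F s \<phi>) - I \<phi>) < ennreal e)"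

definition w_continuous_on ::
  "domain \<Rightarrow> ennreal \<Rightarrow> ennreal \<Rightarrow> real set \<Rightarrow> (real \<Rightarrow> 'n::finite functional) \<Rightarrow> bool"
where
  "w_continuous_on M p q S u \<longleftrightarrow> (\<forall>t\<in>S. u t \<in> w_space M p q \<and>
     ((\<lambda>s. w_norm M p q (\<lambda>\<phi>. u s \<phi> - u t \<phi>)) \<longlongrightarrow> 0) (at t within S))"

text \<open>
  The Duhamel formula \<open>u(t) = U(t) u\<^sub>0 + \<integral>\<^sub>0\<^sup>t U(t-s) u(s)\<^sup>k ds\<close>, for \<open>u\<close> in \<open>C([0,T), w_space M p 1)\<close>.
\<close>

definition is_solution ::
  "domain \<Rightarrow> ennreal \<Rightarrow> real \<Rightarrow> nat \<Rightarrow> 'n::finite functional \<Rightarrow> real \<Rightarrow> (real \<Rightarrow> 'n functional) \<Rightarrow> bool"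
where
  "is_solution M p \<beta> k u\<^sub>0 T u \<longleftrightarrow>
     w_continuous_on M p 1 {0..<T} u \<and>
     (\<forall>t\<in>{0..<T}. has_w_integral M p 1
        (\<lambda>s. propagator M \<beta> (t - s) (dist_power M (u s) k)) 0 t
        (\<lambda>\<phi>. u t \<phi> - propagator M \<beta> t u\<^sub>0 \<phi>))"

end

theory Submission
  imports Defs "HOL-Probability.Sinc_Integral" "HOL-Probability.Characteristic_Functions"
begin

text \<open>
  On the Fourier side the elements of the space are integrable functions on the dual group, pointwise
  products are convolutions, and the problem is the integral equation
  \<open>G t \<xi> = exp (- t |\<xi>|\<^sup>\<beta>) g\<^sub>0 \<xi> + \<integral>\<^sub>0\<^sup>t exp (- (t - s) |\<xi>|\<^sup>\<beta>) (G s * \<dots> * G s) \<xi> ds\<close>, with \<open>k\<close> factors.  The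
  amalgam norm is submultiplicative under convolution up to the number of neighbours of a cube
  (\<open>amalg_nconv\<close>), and the heat factors are at most one.

  Existence.  Picard iteration is run separately at each frequency.  A convolution power is a
  polynomial with nonnegative coefficients, so the iterates and their increments are dominated by
  those of the equation \<open>h = |g\<^sub>0| + T (h * \<dots> * h)\<close>, in which time no longer occurs.  For
  small \<open>T\<close> the latter increase to a solution \<open>hmaj\<close> of finite amalgam norm (\<open>hmaj_fixpoint\<close>,
  \<open>amalg_hmaj\<close>), which is finite at almost all frequencies.  There the original iterates converge,
  and the limit \<open>G\<close> solves the equation (\<open>G_fixpoint\<close>).  Monotone convergence takes the place of a
  contraction argument in a Banach space.  The majorant also bounds, frequency by frequency, how far
  \<open>G\<close> moves in time \<open>\<delta>\<close> (\<open>G_modulus\<close>) and by how much a Riemann sum of mesh \<open>\<delta>\<close> misses the Duhamel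
  integral (\<open>duhamel_oscillation\<close>, \<open>riemann_sum_error\<close>).  Both bounds tend to zero in norm with
  \<open>\<delta>\<close>, since low frequencies hardly move in a short time and high frequencies carry little of the norm
  (\<open>amalg_damped_small\<close>).

  Uniqueness.  The convolution power is Lipschitz on bounded sets (\<open>anorm_cpow_diff_le\<close>).
  Riemann sums of the two Duhamel integrals over a common partition bound the distance of two
  solutions by a multiple of its own integral (\<open>solution_diff_le\<close>), and Gronwall's argument makes it
  vanish (\<open>gronwall_zero\<close>).

  The translation to the Fourier side rests on three facts.  An integrable function is the transform
  of exactly one tempered distribution, namely of the bounded continuous function given by the
  inversion integral (\<open>is_fourier_ft_dist\<close>, \<open>is_fourier_imp_eq_ft_dist\<close>); the transform of a
  distribution is unique up to null sets (\<open>is_fourier_unique\<close>); and a bounded continuous function is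
  determined by the distribution it represents (\<open>regular_dist_inj\<close>).  On \<open>\<real>\<^sup>d\<close> they follow
  from Fourier inversion for Schwartz functions, obtained from Gaussian approximate identities.  On the
  torus they follow from the approximation of smooth periodic functions, with all derivatives, by
  trigonometric polynomials (\<open>trig_approx\<close>).
\<close>

section \<open>Extended nonnegative powers and the Lebesgue norm\<close>

lemma enn_powr_top [simp]: "enn_powr \<infinity> r = \<infinity>" "enn_powr top r = top"
  by (simp_all add: enn_powr_def)

lemma enn_powr_ennreal: "0 \<le> x \<Longrightarrow> enn_powr (ennreal x) r = ennreal (x powr r)"
  by (simp add: enn_powr_def)

lemma enn_powr_0 [simp]: "enn_powr 0 r = 0"
  by (simp add: enn_powr_def)

lemma enn_powr_mono: assumes "x \<le> y" "0 < r" shows "enn_powr x r \<le> enn_powr y r"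
proof (cases "y = \<infinity>")
  case False
  then have "x \<noteq> \<infinity>" using assms by (auto simp: top_unique)
  then show ?thesis using False assms
    by (auto simp: enn_powr_def intro!: ennreal_leI powr_mono2 enn2real_mono simp: less_top)
qed simp

lemma enn_powr_inverse: "0 < r \<Longrightarrow> enn_powr (enn_powr x r) (1/r) = x"
  by (cases x rule: ennreal_cases) (auto simp: enn_powr_ennreal powr_powr)

lemma enn_powr_inverse': "0 < r \<Longrightarrow> enn_powr (enn_powr x (1/r)) r = x"
  by (cases x rule: ennreal_cases) (auto simp: enn_powr_ennreal powr_powr)

lemma enn_powr_eq_0_iff: "0 < r \<Longrightarrow> enn_powr x r = 0 \<longleftrightarrow> x = 0"
  by (cases x rule: ennreal_cases) (auto simp: enn_powr_ennreal)

lemma enn_powr_mult: "0 < r \<Longrightarrow> enn_powr (x * y) r = enn_powr x r * enn_powr y r"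
proof (cases "x = top \<or> y = top")
  case True
  assume r: "0 < r"
  \<comment> \<open>The cases \<open>0 * \<infinity>\<close> reduce to the vanishing of the finite factor.\<close>
  note * = enn_powr_eq_0_iff[OF r]
  from True show ?thesis
  proof
    assume "x = top"
    then show ?thesis by (cases "y = 0") (simp_all add: ennreal_top_mult *)
  next
    assume "y = top"
    then show ?thesis by (cases "x = 0") (simp_all add: ennreal_mult_top *)
  qed
next
  case False
  assume r: "0 < r"
  obtain a b where "x = ennreal a" "0 \<le> a" "y = ennreal b" "0 \<le> b"
    using False by (metis ennreal_cases)
  then show ?thesis
    by (auto simp: enn_powr_ennreal powr_mult simp flip: ennreal_mult)
qed

lemma enn_powr_le_iff: "0 < r \<Longrightarrow> enn_powr x r \<le> enn_powr y r \<longleftrightarrow> x \<le> y"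
  by (metis enn_powr_mono enn_powr_inverse zero_less_divide_1_iff)

lemma enn_powr_one [simp]: "enn_powr x 1 = x"
  by (cases x rule: ennreal_cases) (auto simp: enn_powr_ennreal)

lemma measurable_enn_powr [measurable]: "(\<lambda>x. enn_powr x r) \<in> borel_measurable borel"
  unfolding enn_powr_def by measurable

lemma enn_powr_SUP:
  fixes x :: "nat \<Rightarrow> ennreal"
  assumes "0 < r"
  shows "enn_powr (SUP i. x i) r = (SUP i. enn_powr (x i) r)"
proof (rule antisym)
  have "x i \<le> enn_powr (SUP i. enn_powr (x i) r) (1/r)" for i
  proof -
    have "x i = enn_powr (enn_powr (x i) r) (1/r)" by (simp add: enn_powr_inverse assms)
    also have "\<dots> \<le> enn_powr (SUP i. enn_powr (x i) r) (1/r)"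
      by (intro enn_powr_mono SUP_upper) (auto simp: assms)
    finally show ?thesis .
  qed
  then have "(SUP i. x i) \<le> enn_powr (SUP i. enn_powr (x i) r) (1/r)"
    by (intro SUP_least)
  then have "enn_powr (SUP i. x i) r \<le> enn_powr (enn_powr (SUP i. enn_powr (x i) r) (1/r)) r"
    by (intro enn_powr_mono assms)
  then show "enn_powr (SUP i. x i) r \<le> (SUP i. enn_powr (x i) r)"
    by (simp add: enn_powr_inverse' assms)
  show "(SUP i. enn_powr (x i) r) \<le> enn_powr (SUP i. x i) r"
    by (intro SUP_least enn_powr_mono SUP_upper) (auto simp: assms)
qed

text \<open>Convexity of the power, as its graph lying above the tangent at \<open>c\<close>; Young's inequality with
  conjugate exponents \<open>r\<close> and \<open>r / (r - 1)\<close> gives it.\<close>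

lemma enn_powr_tangent:
  assumes "1 \<le> r" "0 < c"
  shows "ennreal (r * c powr (r - 1)) * x \<le> enn_powr x r + ennreal ((r - 1) * c powr r)"
proof (cases x rule: ennreal_cases)
  case (real a)
  have "r * c powr (r - 1) * a \<le> a powr r + (r - 1) * c powr r"
  proof (cases "a = 0")
    case False
    with real have a: "a > 0" by simp
    have "(a powr r) powr (1/r) * (c powr r) powr (1 - 1/r) \<le> (1/r) * a powr r + (1 - 1/r) * c powr r"
      using assms a by (intro Youngs_inequality_0) (auto simp: field_simps)
    moreover have "(a powr r) powr (1/r) = a" using assms a by (simp add: powr_powr)
    moreover have "(c powr r) powr (1 - 1/r) = c powr (r - 1)"
    proof -
      have "r * (1 - 1/r) = r - 1" using assms by (simp add: field_simps)
      then show ?thesis by (simp add: powr_powr)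
    qed
    ultimately have "a * c powr (r - 1) \<le> (1/r) * a powr r + (1 - 1/r) * c powr r" by simp
    then have "r * (a * c powr (r - 1)) \<le> r * ((1/r) * a powr r + (1 - 1/r) * c powr r)"
      using assms by (intro mult_left_mono) auto
    moreover have "r * ((1/r) * a powr r + (1 - 1/r) * c powr r) = a powr r + (r - 1) * c powr r"
      using assms by (simp add: algebra_simps)
    ultimately show ?thesis by (simp add: mult.assoc mult.commute[of a])
  qed (use assms in auto)
  then show ?thesis using real assms
    by (simp add: enn_powr_ennreal flip: ennreal_mult ennreal_plus)
qed simp

text \<open>Jensen's inequality for extended nonnegative functions: integrate the tangent inequality and choose
  the tangent at the mean \<open>c\<close>.\<close>

lemma jensen_powr:
  assumes [measurable]: "w \<in> borel_measurable N" "y \<in> borel_measurable N"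
    and W: "(\<integral>\<^sup>+\<eta>. w \<eta> \<partial>N) = ennreal W" "0 < W" and r: "1 \<le> r"
  shows "enn_powr (\<integral>\<^sup>+\<eta>. w \<eta> * y \<eta> \<partial>N) r \<le> ennreal (W powr (r - 1)) * (\<integral>\<^sup>+\<eta>. w \<eta> * enn_powr (y \<eta>) r \<partial>N)"
proof -
  define Y where "Y = (\<integral>\<^sup>+\<eta>. w \<eta> * enn_powr (y \<eta>) r \<partial>N)"
  define Z where "Z = (\<integral>\<^sup>+\<eta>. w \<eta> * y \<eta> \<partial>N)"
  have tangent: "ennreal (r * c powr (r - 1)) * Z \<le> Y + ennreal ((r - 1) * c powr r) * ennreal W"
    if c: "0 < c" for c
  proof -
    have "ennreal (r * c powr (r - 1)) * Z = (\<integral>\<^sup>+\<eta>. w \<eta> * (ennreal (r * c powr (r - 1)) * y \<eta>) \<partial>N)"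
      unfolding Z_def by (subst nn_integral_cmult[symmetric]) (auto simp: ac_simps)
    also have "\<dots> \<le> (\<integral>\<^sup>+\<eta>. w \<eta> * (enn_powr (y \<eta>) r + ennreal ((r - 1) * c powr r)) \<partial>N)"
      by (intro nn_integral_mono mult_left_mono enn_powr_tangent r c) auto
    also have "\<dots> = Y + (\<integral>\<^sup>+\<eta>. ennreal ((r - 1) * c powr r) * w \<eta> \<partial>N)"
      unfolding Y_def by (subst nn_integral_add[symmetric]) (auto simp: distrib_left ac_simps)
    also have "\<dots> = Y + ennreal ((r - 1) * c powr r) * ennreal W"
      by (subst nn_integral_cmult) (auto simp: W)
    finally show ?thesis .
  qed
  show ?thesis
  proof (cases "Y = top")
    case True
    then show ?thesis using W by (simp add: Y_def[symmetric] ennreal_mult_top)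
  next
    case False
    then obtain y' where y': "Y = ennreal y'" "0 \<le> y'" by (metis ennreal_cases)
    have "Z \<noteq> top"
    proof
      assume "Z = top"
      with tangent[of 1] r y' have "top \<le> ennreal y' + ennreal (r - 1) * ennreal W"
        by (simp add: ennreal_mult_top)
      also have "\<dots> = ennreal (y' + (r - 1) * W)"
        using r y' W by (simp flip: ennreal_mult ennreal_plus)
      finally show False by (simp add: top_unique)
    qed
    then obtain z where z: "Z = ennreal z" "0 \<le> z" by (metis ennreal_cases)
    show ?thesis
    proof (cases "z = 0")
      case False
      with z have z0: "z > 0" by simp
      define c where "c = z / W"
      have c: "c > 0" "z = c * W" using z0 W by (auto simp: c_def)
      have "r * c powr (r - 1) * z \<le> y' + (r - 1) * c powr r * W"
        using tangent[OF c(1)] r W z y' by (simp flip: ennreal_mult ennreal_plus)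
      moreover have "c powr (r - 1) * z = c powr r * W"
        using c by (simp add: powr_diff)
      ultimately have "r * (c powr r * W) \<le> y' + (r - 1) * c powr r * W"
        by (metis mult.assoc)
      then have *: "c powr r * W \<le> y'" by (simp add: algebra_simps)
      have "z powr r = c powr r * W powr r" using c W by (simp add: powr_mult)
      also have "W powr r = W powr (r - 1) * W" using W by (simp add: powr_diff)
      finally have "z powr r = W powr (r - 1) * (c powr r * W)" by simp
      also have "\<dots> \<le> W powr (r - 1) * y'" using * by (intro mult_left_mono) auto
      finally show ?thesis
        using z y' by (simp add: Y_def[symmetric] Z_def[symmetric] enn_powr_ennreal flip: ennreal_mult)
    qed (use z in \<open>simp add: Z_def[symmetric]\<close>)
  qed
qed

lemma Lp_norm_top: "Lp_norm top M h = esssup M h"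
  by (simp add: Lp_norm_def)

lemma Lp_norm_le_iff:
  assumes "p \<noteq> top" "1 \<le> p"
  shows "Lp_norm p M h \<le> c \<longleftrightarrow> (\<integral>\<^sup>+x. enn_powr (h x) (enn2real p) \<partial>M) \<le> enn_powr c (enn2real p)"
proof -
  have r: "enn2real p > 0" using assms
    by (metis enn2real_positive_iff less_le_trans less_top zero_less_one)
  show ?thesis
    using enn_powr_le_iff[of "enn2real p" "Lp_norm p M h" c] assms(1) r
    by (simp add: Lp_norm_def enn_powr_inverse')
qed

lemma enn2real_ge_1: "1 \<le> p \<Longrightarrow> p \<noteq> top \<Longrightarrow> 1 \<le> enn2real p"
  by (metis enn2real_1 enn2real_mono less_top)

lemma Lp_norm_mono_AE:
  assumes "f \<in> borel_measurable M" "AE x in M. f x \<le> g x" "1 \<le> p"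
  shows "Lp_norm p M f \<le> Lp_norm p M g"
proof (cases "p = top")
  case True
  then show ?thesis using assms by (auto simp: Lp_norm_top intro: esssup_AE_mono)
next
  case False
  then have "1 \<le> enn2real p" using assms enn2real_ge_1 by auto
  then show ?thesis using False assms(2)
    unfolding Lp_norm_def by (auto intro!: enn_powr_mono nn_integral_mono_AE)
qed

lemma Lp_norm_cong_AE:
  assumes "f \<in> borel_measurable M" "g \<in> borel_measurable M" "AE x in M. f x = g x" "1 \<le> p"
  shows "Lp_norm p M f = Lp_norm p M g"
  using assms by (intro antisym Lp_norm_mono_AE) auto

lemma Lp_norm_cmult_le:
  assumes [measurable]: "f \<in> borel_measurable M" and p: "1 \<le> p"
  shows "Lp_norm p M (\<lambda>x. c * f x) \<le> c * Lp_norm p M f"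
proof (cases "p = top")
  case True
  have "AE x in M. c * f x \<le> c * esssup M f"
    using esssup_AE[of f M] by eventually_elim (auto intro: mult_left_mono)
  then show ?thesis using True by (auto simp: Lp_norm_top intro!: esssup_I)
next
  case False
  then have r: "1 \<le> enn2real p" using p enn2real_ge_1 by auto
  show ?thesis
    using r False
    by (simp add: Lp_norm_def enn_powr_mult nn_integral_cmult enn_powr_inverse)
qed

lemma Lp_norm_SUP_le:
  fixes f :: "nat \<Rightarrow> 'a \<Rightarrow> ennreal"
  assumes [measurable]: "\<And>i. f i \<in> borel_measurable M" and "incseq f" and p: "1 \<le> p"
    and c: "\<And>i. Lp_norm p M (f i) \<le> c"
  shows "Lp_norm p M (\<lambda>x. SUP i. f i x) \<le> c"
proof (cases "p = top")
  case True
  have "AE x in M. \<forall>i. f i x \<le> c"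
    unfolding AE_all_countable
  proof
    fix i
    show "AE x in M. f i x \<le> c"
      using esssup_AE[of "f i" M] c[of i] True by (auto simp: Lp_norm_top elim: eventually_mono)
  qed
  then have "AE x in M. (SUP i. f i x) \<le> c"
    by eventually_elim (auto intro: SUP_least)
  then show ?thesis using True by (auto simp: Lp_norm_top intro!: esssup_I)
next
  case False
  then have r: "0 < enn2real p" using p enn2real_ge_1[of p] by auto
  have "(\<integral>\<^sup>+x. enn_powr (SUP i. f i x) (enn2real p) \<partial>M) = (SUP i. \<integral>\<^sup>+x. enn_powr (f i x) (enn2real p) \<partial>M)"
    unfolding enn_powr_SUP[OF r]
    using assms(2) r by (intro nn_integral_monotone_convergence_SUP)
      (auto simp: incseq_def le_fun_def intro!: enn_powr_mono)
  also have "\<dots> \<le> enn_powr c (enn2real p)"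
    using c False p by (intro SUP_least) (simp add: Lp_norm_le_iff)
  finally show ?thesis using False p by (simp add: Lp_norm_le_iff)
qed

text \<open>Minkowski's integral inequality.  Writing \<open>k = w y\<close> reduces it to Jensen's inequality for the weight
  \<open>w\<close>, because every slice of \<open>y\<close> has norm at most one.\<close>

lemma Lp_norm_Minkowski:
  assumes "sigma_finite_measure M" "sigma_finite_measure N"
    and k [measurable]: "(\<lambda>(\<xi>, \<eta>). k \<xi> \<eta>) \<in> borel_measurable (M \<Otimes>\<^sub>M N)"
    and w [measurable]: "w \<in> borel_measurable N" and p: "1 \<le> p"
    and le: "\<And>\<eta>. \<eta> \<in> space N \<Longrightarrow> Lp_norm p M (\<lambda>\<xi>. k \<xi> \<eta>) \<le> w \<eta>"
  shows "Lp_norm p M (\<lambda>\<xi>. \<integral>\<^sup>+\<eta>. k \<xi> \<eta> \<partial>N) \<le> (\<integral>\<^sup>+\<eta>. w \<eta> \<partial>N)"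
proof (cases "(\<integral>\<^sup>+\<eta>. w \<eta> \<partial>N) = top")
  case fin: False
  interpret N: sigma_finite_measure N by fact
  interpret M: sigma_finite_measure M by fact
  interpret P: pair_sigma_finite M N ..
  have AE_swap: "AE \<xi> in M. AE \<eta> in N. k \<xi> \<eta> \<le> y \<xi> \<eta>"
    if "\<And>\<eta>. \<eta> \<in> space N \<Longrightarrow> AE \<xi> in M. k \<xi> \<eta> \<le> y \<xi> \<eta>"
      and [measurable]: "(\<lambda>(\<xi>, \<eta>). y \<xi> \<eta>) \<in> borel_measurable (M \<Otimes>\<^sub>M N)" for y
  proof -
    have "{x \<in> space (M \<Otimes>\<^sub>M N). k (fst x) (snd x) \<le> y (fst x) (snd x)} \<in> sets (M \<Otimes>\<^sub>M N)"
      using k that(2) by (auto simp: case_prod_unfold)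
    from P.AE_commute[OF this] show ?thesis using that(1) by auto
  qed
  show ?thesis
  proof (cases "p = top")
    case True
    have "AE \<xi> in M. AE \<eta> in N. k \<xi> \<eta> \<le> w \<eta>"
    proof (rule AE_swap)
      fix \<eta> assume "\<eta> \<in> space N"
      then have "esssup M (\<lambda>\<xi>. k \<xi> \<eta>) \<le> w \<eta>" using le True by (auto simp: Lp_norm_top)
      then show "AE \<xi> in M. k \<xi> \<eta> \<le> w \<eta>"
        using esssup_AE[of "\<lambda>\<xi>. k \<xi> \<eta>" M] by (auto elim: eventually_mono)
    qed measurable
    then have "AE \<xi> in M. (\<integral>\<^sup>+\<eta>. k \<xi> \<eta> \<partial>N) \<le> (\<integral>\<^sup>+\<eta>. w \<eta> \<partial>N)"
      by eventually_elim (intro nn_integral_mono_AE)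
    then show ?thesis using True by (auto simp: Lp_norm_top intro!: esssup_I)
  next
    case False
    define r where "r = enn2real p"
    have r: "1 \<le> r" using p False enn2real_ge_1 by (auto simp: r_def)
    have J: "(\<integral>\<^sup>+\<xi>. enn_powr (k \<xi> \<eta>) r \<partial>M) \<le> enn_powr (w \<eta>) r" if "\<eta> \<in> space N" for \<eta>
      using le[OF that] p False by (simp add: Lp_norm_le_iff r_def)
    define y where "y \<xi> \<eta> = k \<xi> \<eta> / w \<eta>" for \<xi> \<eta>
    have y [measurable]: "(\<lambda>(\<xi>, \<eta>). y \<xi> \<eta>) \<in> borel_measurable (M \<Otimes>\<^sub>M N)"
      unfolding y_def by measurable
    have w_top: "AE \<eta> in N. w \<eta> \<noteq> top"
      using fin nn_integral_PInf_AE[OF w] by auto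
    \<comment> \<open>Where \<open>w\<close> vanishes, so does \<open>k\<close>, hence \<open>k = w y\<close> almost everywhere.\<close>
    have k0: "AE \<xi> in M. k \<xi> \<eta> \<le> (if w \<eta> = 0 then 0 else top)" if "\<eta> \<in> space N" for \<eta>
    proof (cases "w \<eta> = 0")
      case True
      then have "(\<integral>\<^sup>+\<xi>. enn_powr (k \<xi> \<eta>) r \<partial>M) = 0" using J[OF that] by simp
      then have "AE \<xi> in M. enn_powr (k \<xi> \<eta>) r = 0"
        using that by (subst (asm) nn_integral_0_iff_AE) auto
      then show ?thesis
        by eventually_elim (use True r in \<open>simp add: enn_powr_eq_0_iff\<close>)
    qed simp
    have "AE \<xi> in M. AE \<eta> in N. k \<xi> \<eta> \<le> (if w \<eta> = 0 then 0 else top)"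
      by (rule AE_swap[OF k0]) auto
    then have kwy: "AE \<xi> in M. AE \<eta> in N. k \<xi> \<eta> = w \<eta> * y \<xi> \<eta>"
    proof eventually_elim
      case (elim \<xi>)
      from elim w_top show ?case
      proof eventually_elim
        case (elim \<eta>)
        then show ?case
          by (cases "w \<eta> = 0") (simp_all add: y_def ennreal_times_divide mult_divide_eq_ennreal mult.commute[of "w \<eta>"])
      qed
    qed
    have Jy: "w \<eta> * (\<integral>\<^sup>+\<xi>. enn_powr (y \<xi> \<eta>) r \<partial>M) \<le> w \<eta>" if "\<eta> \<in> space N" "w \<eta> \<noteq> top" for \<eta>
    proof (cases "w \<eta> = 0")
      case False
      have "(\<integral>\<^sup>+\<xi>. enn_powr (y \<xi> \<eta>) r \<partial>M) = (\<integral>\<^sup>+\<xi>. enn_powr (inverse (w \<eta>)) r * enn_powr (k \<xi> \<eta>) r \<partial>M)"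
        unfolding y_def divide_ennreal_def using r by (simp add: enn_powr_mult mult.commute)
      also have "\<dots> = enn_powr (inverse (w \<eta>)) r * (\<integral>\<^sup>+\<xi>. enn_powr (k \<xi> \<eta>) r \<partial>M)"
        using that by (intro nn_integral_cmult) auto
      also have "\<dots> \<le> enn_powr (inverse (w \<eta>)) r * enn_powr (w \<eta>) r"
        using J[OF that(1)] by (intro mult_left_mono) auto
      also have "\<dots> = enn_powr (inverse (w \<eta>) * w \<eta>) r"
        using r by (simp add: enn_powr_mult)
      also have "inverse (w \<eta>) * w \<eta> = 1"
        using False that mult_divide_eq_ennreal[of "w \<eta>" 1]
        by (simp add: divide_ennreal_def mult.commute)
      finally have "(\<integral>\<^sup>+\<xi>. enn_powr (y \<xi> \<eta>) r \<partial>M) \<le> 1"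
        by (simp add: enn_powr_def)
      then show ?thesis by (metis mult.right_neutral mult_left_mono zero_le)
    qed simp
    obtain W where W: "(\<integral>\<^sup>+\<eta>. w \<eta> \<partial>N) = ennreal W" "0 \<le> W"
      using fin by (metis ennreal_cases)
    have "(\<integral>\<^sup>+\<xi>. enn_powr (\<integral>\<^sup>+\<eta>. k \<xi> \<eta> \<partial>N) r \<partial>M) \<le> enn_powr (ennreal W) r"
    proof (cases "W = 0")
      case True
      then have w0: "AE \<eta> in N. w \<eta> = 0" using W by (simp add: nn_integral_0_iff_AE)
      have "AE \<xi> in M. (\<integral>\<^sup>+\<eta>. k \<xi> \<eta> \<partial>N) = 0"
        using kwy AE_space
      proof eventually_elim
        case (elim \<xi>)
        then have [measurable]: "k \<xi> \<in> borel_measurable N" by measurable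
        from elim(1) w0 have "AE \<eta> in N. k \<xi> \<eta> = 0" by eventually_elim simp
        then show ?case by (simp add: nn_integral_0_iff_AE)
      qed
      then have "(\<integral>\<^sup>+\<xi>. enn_powr (\<integral>\<^sup>+\<eta>. k \<xi> \<eta> \<partial>N) r \<partial>M) = (\<integral>\<^sup>+\<xi>. 0 \<partial>M)"
        by (intro nn_integral_cong_AE) auto
      then show ?thesis by simp
    next
      case False
      with W have W0: "0 < W" by simp
      have "(\<integral>\<^sup>+\<xi>. enn_powr (\<integral>\<^sup>+\<eta>. k \<xi> \<eta> \<partial>N) r \<partial>M) = (\<integral>\<^sup>+\<xi>. enn_powr (\<integral>\<^sup>+\<eta>. w \<eta> * y \<xi> \<eta> \<partial>N) r \<partial>M)"
      proof (rule nn_integral_cong_AE)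
        show "AE \<xi> in M. enn_powr (\<integral>\<^sup>+\<eta>. k \<xi> \<eta> \<partial>N) r = enn_powr (\<integral>\<^sup>+\<eta>. w \<eta> * y \<xi> \<eta> \<partial>N) r"
          using kwy by eventually_elim (intro arg_cong[where f="\<lambda>x. enn_powr x r"] nn_integral_cong_AE)
      qed
      also have "\<dots> \<le> (\<integral>\<^sup>+\<xi>. ennreal (W powr (r - 1)) * (\<integral>\<^sup>+\<eta>. w \<eta> * enn_powr (y \<xi> \<eta>) r \<partial>N) \<partial>M)"
        by (intro nn_integral_mono jensen_powr W W0 r) measurable
      also have "\<dots> = ennreal (W powr (r - 1)) * (\<integral>\<^sup>+\<xi>. (\<integral>\<^sup>+\<eta>. w \<eta> * enn_powr (y \<xi> \<eta>) r \<partial>N) \<partial>M)"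
        by (intro nn_integral_cmult) measurable
      also have "(\<integral>\<^sup>+\<xi>. (\<integral>\<^sup>+\<eta>. w \<eta> * enn_powr (y \<xi> \<eta>) r \<partial>N) \<partial>M) = (\<integral>\<^sup>+\<eta>. (\<integral>\<^sup>+\<xi>. w \<eta> * enn_powr (y \<xi> \<eta>) r \<partial>M) \<partial>N)"
        by (intro P.Fubini'[symmetric]) measurable
      also have "\<dots> = (\<integral>\<^sup>+\<eta>. w \<eta> * (\<integral>\<^sup>+\<xi>. enn_powr (y \<xi> \<eta>) r \<partial>M) \<partial>N)"
        by (intro nn_integral_cong nn_integral_cmult) measurable
      also have "\<dots> \<le> (\<integral>\<^sup>+\<eta>. w \<eta> \<partial>N)"
        using w_top AE_space by (intro nn_integral_mono_AE) (auto intro: Jy elim: eventually_elim2)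
      finally have "(\<integral>\<^sup>+\<xi>. enn_powr (\<integral>\<^sup>+\<eta>. k \<xi> \<eta> \<partial>N) r \<partial>M) \<le> ennreal (W powr (r - 1)) * ennreal W"
        using W by (simp add: mult_left_mono)
      also have "\<dots> = enn_powr (ennreal W) r"
        using W0 by (simp add: enn_powr_ennreal powr_diff flip: ennreal_mult)
      finally show ?thesis .
    qed
    then show ?thesis using p False W by (simp add: Lp_norm_le_iff r_def)
  qed
qed simp

text \<open>Minkowski's integral inequality over a two-point space.\<close>

lemma Lp_norm_triangle:
  assumes "sigma_finite_measure M" and [measurable]: "f \<in> borel_measurable M" "g \<in> borel_measurable M"
    and p: "1 \<le> p"
  shows "Lp_norm p M (\<lambda>x. f x + g x) \<le> Lp_norm p M f + Lp_norm p M g"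
proof -
  let ?N = "count_space (UNIV :: bool set)"
  interpret M: sigma_finite_measure M by fact
  have N: "sigma_finite_measure ?N" by (simp add: sigma_finite_measure_count_space)
  interpret P: pair_sigma_finite ?N M using assms(1) N by (simp add: pair_sigma_finite_def)
  have sum: "(\<integral>\<^sup>+b. h b \<partial>?N) = h True + h False" for h :: "bool \<Rightarrow> ennreal"
    by (subst nn_integral_count_space_finite) (auto simp: UNIV_bool)
  have "(\<lambda>(b, x). if b then f x else g x) \<in> borel_measurable (?N \<Otimes>\<^sub>M M)"
    by (rule measurable_pair_measure_countable1) auto
  then have "(\<lambda>(x, b). if b then f x else g x) \<in> borel_measurable (M \<Otimes>\<^sub>M ?N)"
    by (subst measurable_pair_swap_iff) (simp add: case_prod_unfold)
  from Lp_norm_Minkowski[OF assms(1) N this, of "\<lambda>b. if b then Lp_norm p M f else Lp_norm p M g" p] p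
  show ?thesis by (auto simp: sum)
qed

lemma Lp_norm_1: "Lp_norm 1 M h = (\<integral>\<^sup>+x. h x \<partial>M)"
  by (simp add: Lp_norm_def)

text \<open>Jensen's inequality on a set of measure at most one.  This embeds the amalgam space into the
  integrable functions.\<close>

lemma nn_integral_le_Lp_norm:
  assumes [measurable]: "h \<in> borel_measurable M" "A \<in> sets M" and A: "emeasure M A \<le> 1" and p: "1 \<le> p"
  shows "(\<integral>\<^sup>+x. indicator A x * h x \<partial>M) \<le> Lp_norm p M (\<lambda>x. indicator A x * h x)"
proof (cases "p = top")
  case True
  have "(\<integral>\<^sup>+x. indicator A x * h x \<partial>M) \<le> (\<integral>\<^sup>+x. esssup M (\<lambda>x. indicator A x * h x) * indicator A x \<partial>M)"
    using esssup_AE[of "\<lambda>x. indicator A x * h x" M]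
    by (intro nn_integral_mono_AE) (auto split: split_indicator elim!: eventually_mono)
  also have "\<dots> = esssup M (\<lambda>x. indicator A x * h x) * emeasure M A"
    by (simp add: nn_integral_cmult)
  also have "\<dots> \<le> esssup M (\<lambda>x. indicator A x * h x)"
    using A by (metis mult.right_neutral mult_left_mono zero_le)
  finally show ?thesis using True by (simp add: Lp_norm_top)
next
  case False
  define r where "r = enn2real p"
  have r: "1 \<le> r" using p False enn2real_ge_1 by (auto simp: r_def)
  have I: "(\<integral>\<^sup>+x. indicator A x \<partial>M) = emeasure M A" by simp
  have "emeasure M A \<noteq> top" using A by (auto simp: top_unique)
  then obtain W where W: "emeasure M A = ennreal W" "0 \<le> W" by (metis ennreal_cases)
  show ?thesis
  proof (cases "W = 0")
    case True
    then have "AE x in M. x \<notin> A" using W by (intro AE_not_in) (auto simp: null_sets_def)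
    then have "(\<integral>\<^sup>+x. indicator A x * h x \<partial>M) = (\<integral>\<^sup>+x. 0 \<partial>M)"
      by (intro nn_integral_cong_AE) (auto elim!: eventually_mono)
    then show ?thesis by simp
  next
    case False
    with W have W0: "0 < W" by simp
    have "W \<le> 1" using A W by (simp flip: ennreal_1)
    have "enn_powr (\<integral>\<^sup>+x. indicator A x * h x \<partial>M) r \<le> ennreal (W powr (r - 1)) * (\<integral>\<^sup>+x. indicator A x * enn_powr (h x) r \<partial>M)"
      using W W0 r by (intro jensen_powr) auto
    also have "\<dots> \<le> 1 * (\<integral>\<^sup>+x. indicator A x * enn_powr (h x) r \<partial>M)"
    proof (rule mult_right_mono)
      have "W powr (r - 1) \<le> 1" using \<open>W \<le> 1\<close> W0 r by (intro powr_le1) auto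
      then show "ennreal (W powr (r - 1)) \<le> 1" by (simp flip: ennreal_1)
    qed simp
    also have "(\<integral>\<^sup>+x. indicator A x * enn_powr (h x) r \<partial>M) = (\<integral>\<^sup>+x. enn_powr (indicator A x * h x) r \<partial>M)"
      by (intro nn_integral_cong) (auto split: split_indicator)
    finally have "enn_powr (\<integral>\<^sup>+x. indicator A x * h x \<partial>M) r \<le> (\<integral>\<^sup>+x. enn_powr (indicator A x * h x) r \<partial>M)"
      by simp
    then have "enn_powr (enn_powr (\<integral>\<^sup>+x. indicator A x * h x \<partial>M) r) (1/r) \<le> enn_powr (\<integral>\<^sup>+x. enn_powr (indicator A x * h x) r \<partial>M) (1/r)"
      using r by (intro enn_powr_mono) auto
    then show ?thesis using \<open>p \<noteq> top\<close> r by (simp add: enn_powr_inverse Lp_norm_def r_def)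
  qed
qed

section \<open>Lattice, cubes and the dual group\<close>

lemma int_lattice_eq: "(int_lattice :: (real^'n) set) = range (\<lambda>f :: 'n \<Rightarrow> int. \<chi> i. of_int (f i))"
proof (intro set_eqI iffI)
  fix x :: "real^'n" assume "x \<in> int_lattice"
  then have "\<forall>i. \<exists>k::int. x $ i = of_int k" by (auto simp: int_lattice_def Ints_def)
  then obtain f :: "'n \<Rightarrow> int" where "\<forall>i. x $ i = of_int (f i)" by metis
  then show "x \<in> range (\<lambda>f :: 'n \<Rightarrow> int. \<chi> i. of_int (f i))"
    by (intro image_eqI[of _ _ f]) (auto simp: vec_eq_iff)
qed (auto simp: int_lattice_def)

lemma countable_int_lattice [simp]: "countable (int_lattice :: (real^'n) set)"
  unfolding int_lattice_eq by simp

lemma int_lattice_simps [simp]: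
  "0 \<in> int_lattice" "x \<in> int_lattice \<Longrightarrow> y \<in> int_lattice \<Longrightarrow> x + y \<in> int_lattice"
  "x \<in> int_lattice \<Longrightarrow> y \<in> int_lattice \<Longrightarrow> x - y \<in> int_lattice"
  "x \<in> int_lattice \<Longrightarrow> - x \<in> int_lattice" "axis i 1 \<in> int_lattice"
  by (auto simp: int_lattice_def axis_def)

text \<open>The index of the half-open unit cube that contains the point.\<close>

definition nearest :: "real^'n \<Rightarrow> real^'n" where
  "nearest \<xi> = (\<chi> i. of_int \<lceil>\<xi> $ i - 1/2\<rceil>)"

lemma nearest_in_lattice [simp]: "nearest \<xi> \<in> int_lattice"
  by (auto simp: nearest_def int_lattice_def)

lemma unit_cube_iff: "n \<in> int_lattice \<Longrightarrow> \<xi> \<in> unit_cube n \<longleftrightarrow> n = nearest \<xi>"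
proof
  assume n: "n \<in> int_lattice" and \<xi>: "\<xi> \<in> unit_cube n"
  have "n $ i = of_int \<lceil>\<xi> $ i - 1/2\<rceil>" for i
  proof -
    obtain k :: int where k: "n $ i = of_int k" using n by (auto simp: int_lattice_def Ints_def)
    have "\<lceil>\<xi> $ i - 1/2\<rceil> = k"
      using \<xi> k by (intro ceiling_unique) (auto simp: unit_cube_def dest!: spec[of _ i])
    then show ?thesis by (simp add: k)
  qed
  then show "n = nearest \<xi>" by (simp add: nearest_def vec_eq_iff)
next
  assume "n = nearest \<xi>"
  then show "\<xi> \<in> unit_cube n"
    unfolding unit_cube_def nearest_def using le_of_int_ceiling ceiling_correct
    by (auto simp: algebra_simps) (smt (verit) ceiling_correct field_sum_of_halves)+
qed

lemma unit_cube_self: "n \<in> unit_cube n"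
  by (simp add: unit_cube_def)

lemma borel_unit_cube [measurable]: "unit_cube n \<in> sets (borel :: (real^'n) measure)"
  unfolding unit_cube_def by measurable

lemma nn_integral_indicator_unit_cube:
  "(\<integral>\<^sup>+n. indicator (unit_cube n) \<xi> * c n \<partial>count_space int_lattice) = c (nearest \<xi>)"
proof -
  have "(\<integral>\<^sup>+n. indicator (unit_cube n) \<xi> * c n \<partial>count_space int_lattice)
      = (\<integral>\<^sup>+n. c n * indicator {nearest \<xi>} n \<partial>count_space int_lattice)"
    by (intro nn_integral_cong) (auto simp: unit_cube_iff split: split_indicator)
  also have "\<dots> = c (nearest \<xi>)"
    by (subst nn_integral_count_space'[of "{nearest \<xi>}"]) auto
  finally show ?thesis .
qed

text \<open>The offsets from a cube to itself and its neighbours.\<close>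

definition unit_steps :: "(real^'n) set" where
  "unit_steps = {e. \<forall>i. e $ i \<in> {-1, 0, 1}}"

lemma unit_steps_in_lattice: "e \<in> unit_steps \<Longrightarrow> e \<in> int_lattice"
  by (auto simp: unit_steps_def int_lattice_def) (metis Ints_0 Ints_1 Ints_minus)

lemma finite_unit_steps [simp]: "finite (unit_steps :: (real^'n) set)"
proof -
  have "unit_steps \<subseteq> (\<lambda>f :: 'n \<Rightarrow> real. \<chi> i. f i) ` (UNIV \<rightarrow>\<^sub>E {-1, 0, 1})"
  proof
    fix e :: "real^'n" assume "e \<in> unit_steps"
    then show "e \<in> (\<lambda>f :: 'n \<Rightarrow> real. \<chi> i. f i) ` (UNIV \<rightarrow>\<^sub>E {-1, 0, 1})"
      by (intro image_eqI[of _ _ "\<lambda>i. e $ i"]) (auto simp: unit_steps_def PiE_def)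
  qed
  then show ?thesis by (rule finite_subset) (intro finite_imageI finite_PiE, auto)
qed

text \<open>Each coordinate of a difference of two cubes is an interval of length two about the difference
  of the centres, hence covered by that cube and its neighbours.\<close>

lemma nearest_diff_steps: "nearest (\<xi> - \<eta>) - (nearest \<xi> - nearest \<eta>) \<in> unit_steps"
proof -
  have "of_int \<lceil>\<xi> $ i - \<eta> $ i - 1/2\<rceil> - (of_int \<lceil>\<xi> $ i - 1/2\<rceil> - of_int \<lceil>\<eta> $ i - 1/2\<rceil>) \<in> {-1, 0, 1::real}" for i
  proof -
    define a b c where "a = \<lceil>\<xi> $ i - \<eta> $ i - 1/2\<rceil>" "b = \<lceil>\<xi> $ i - 1/2\<rceil>" "c = \<lceil>\<eta> $ i - 1/2\<rceil>"
    have "of_int a - 1 < \<xi> $ i - \<eta> $ i - 1/2" "\<xi> $ i - \<eta> $ i - 1/2 \<le> of_int a"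
      "of_int b - 1 < \<xi> $ i - 1/2" "\<xi> $ i - 1/2 \<le> of_int b"
      "of_int c - 1 < \<eta> $ i - 1/2" "\<eta> $ i - 1/2 \<le> of_int c"
      unfolding a_b_c_def using ceiling_correct by blast+
    then have "- 2 < real_of_int (a - (b - c))" "real_of_int (a - (b - c)) < 2" by auto
    then have "a - (b - c) \<in> {-1, 0, 1}" by auto
    then have "real_of_int (a - (b - c)) \<in> {-1, 0, 1}" by auto
    then show ?thesis unfolding a_b_c_def[symmetric] by simp
  qed
  then show ?thesis by (simp add: unit_steps_def nearest_def)
qed

lemma space_dual_measure: "space (dual_measure M) = (if M = Rd then UNIV else int_lattice)"
  by (cases M) auto

lemma dual_measure_closed:
  "\<xi> \<in> space (dual_measure M) \<Longrightarrow> \<eta> \<in> space (dual_measure M) \<Longrightarrow> \<xi> - \<eta> \<in> space (dual_measure M)"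
  by (auto simp: space_dual_measure split: if_splits)

lemma sigma_finite_dual_measure: "sigma_finite_measure (dual_measure M)"
  by (cases M) (auto intro: sigma_finite_lborel sigma_finite_measure_count_space_countable)

interpretation dual: sigma_finite_measure "dual_measure M" for M
  by (rule sigma_finite_dual_measure)

interpretation dual_pair: pair_sigma_finite "dual_measure M" "dual_measure M" for M
  by unfold_locales

lemma measurable_dual_borel [measurable (raw)]:
  "f \<in> borel_measurable borel \<Longrightarrow> f \<in> borel_measurable (dual_measure M)"
  by (cases M) auto

lemma unit_cube_in_dual: "{\<xi> \<in> space (dual_measure M). \<xi> \<in> unit_cube n} \<in> sets (dual_measure M)"
  by (cases M) (auto simp: borel_unit_cube)

lemma measurable_indicator_unit_cube [measurable]:
  "(indicator (unit_cube n) :: _ \<Rightarrow> 'a::real_normed_algebra_1) \<in> borel_measurable (dual_measure M)"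
  "(indicator (unit_cube n) :: _ \<Rightarrow> ennreal) \<in> borel_measurable (dual_measure M)"
  by (auto intro!: measurable_dual_borel borel_measurable_indicator borel_unit_cube)

text \<open>On the integer lattice this uses countability, since the count space has all subsets as
  measurable sets.\<close>

lemma measurable_dual_diff [measurable]:
  "(\<lambda>x. fst x - snd x) \<in> measurable (dual_measure M \<Otimes>\<^sub>M dual_measure M) (dual_measure M)"
proof (cases M)
  case Td
  then show ?thesis by (auto simp: pair_measure_countable)
qed auto

lemma measurable_dual_diff' [measurable (raw)]:
  assumes [measurable]: "f \<in> measurable N (dual_measure M)" "g \<in> measurable N (dual_measure M)"
  shows "(\<lambda>x. f x - g x) \<in> measurable N (dual_measure M)"
  using measurable_compose[OF measurable_Pair[OF assms] measurable_dual_diff] by simp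

lemma distr_dual_diff:
  assumes "\<eta> \<in> space (dual_measure M)"
  shows "distr (dual_measure M) (dual_measure M) (\<lambda>\<xi>. \<xi> - \<eta>) = dual_measure M"
proof (cases M)
  case Rd
  have "distr lborel lborel (\<lambda>\<xi>. \<xi> - \<eta>) = distr lborel borel ((+) (- \<eta>))"
    by (intro distr_cong) auto
  then show ?thesis using Rd by (simp add: lborel_distr_plus)
next
  case Td
  have "bij_betw (\<lambda>\<xi>. \<xi> - \<eta>) int_lattice int_lattice"
    using assms Td by (intro bij_betwI[of _ _ _ "\<lambda>\<xi>. \<xi> + \<eta>"]) auto
  then show ?thesis using Td by (simp add: distr_bij_count_space)
qed

lemma measurable_shift: "\<eta> \<in> space (dual_measure M) \<Longrightarrow> (\<lambda>\<xi>. \<xi> - \<eta>) \<in> measurable (dual_measure M) (dual_measure M)"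
  by (intro measurable_dual_diff') auto

lemma nn_integral_dual_shift:
  assumes "h \<in> borel_measurable (dual_measure M)" "\<eta> \<in> space (dual_measure M)"
  shows "(\<integral>\<^sup>+\<xi>. h (\<xi> - \<eta>) \<partial>dual_measure M) = (\<integral>\<^sup>+\<xi>. h \<xi> \<partial>dual_measure M)"
  using nn_integral_distr[OF measurable_shift[OF assms(2)], of h] assms(1)
  by (simp add: distr_dual_diff[OF assms(2)])

lemma Lp_norm_shift:
  assumes [measurable]: "h \<in> borel_measurable (dual_measure M)" and \<eta>: "\<eta> \<in> space (dual_measure M)" and p: "1 \<le> p"
  shows "Lp_norm p (dual_measure M) (\<lambda>\<xi>. h (\<xi> - \<eta>)) \<le> Lp_norm p (dual_measure M) h"
proof (cases "p = top")
  case True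
  let ?c = "esssup (dual_measure M) h"
  note [measurable] = measurable_shift[OF \<eta>]
  have "AE \<xi> in distr (dual_measure M) (dual_measure M) (\<lambda>\<xi>. \<xi> - \<eta>). h \<xi> \<le> ?c"
    unfolding distr_dual_diff[OF \<eta>] by (rule esssup_AE)
  then have "AE \<xi> in dual_measure M. h (\<xi> - \<eta>) \<le> ?c"
    by (subst (asm) AE_distr_iff) measurable
  then show ?thesis using True by (simp add: Lp_norm_top) (intro esssup_I, measurable)
next
  case False
  then show ?thesis
    using nn_integral_dual_shift[of "\<lambda>\<xi>. enn_powr (h \<xi>) (enn2real p)" M \<eta>] \<eta>
    by (simp add: Lp_norm_def)
qed

lemma emeasure_unit_cube_le:
  assumes "n \<in> int_lattice"
  shows "emeasure (dual_measure M) {\<xi> \<in> space (dual_measure M). \<xi> \<in> unit_cube n} \<le> 1"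
proof (cases M)
  case Rd
  have "emeasure lborel {\<xi>. \<xi> \<in> unit_cube n} \<le> emeasure lborel (cbox (n - (\<chi> i. 1/2)) (n + (\<chi> i. 1/2)))"
    by (intro emeasure_mono) (auto simp: unit_cube_def mem_box_cart less_imp_le)
  also have "\<dots> = 1"
  proof -
    have "(\<Prod>b\<in>Basis. ((n + (\<chi> i. 1/2)) - (n - (\<chi> i. 1/2))) \<bullet> b) = 1"
      by (rule prod.neutral) (auto simp: Basis_vec_def inner_axis)
    then show ?thesis
      by (subst emeasure_lborel_cbox) (auto simp: Basis_vec_def inner_axis)
  qed
  finally show ?thesis using Rd by (simp add: space_dual_measure)
next
  case Td
  have "{\<xi> \<in> int_lattice. \<xi> \<in> unit_cube n} \<subseteq> {n}"
  proof
    fix \<xi> assume \<xi>: "\<xi> \<in> {\<xi> \<in> int_lattice. \<xi> \<in> unit_cube n}"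
    then have "\<xi> = nearest \<xi>" using unit_cube_self[of \<xi>] by (auto simp: unit_cube_iff)
    then show "\<xi> \<in> {n}" using \<xi> assms by (auto simp: unit_cube_iff)
  qed
  then have "emeasure (count_space int_lattice) {\<xi> \<in> int_lattice. \<xi> \<in> unit_cube n} \<le> emeasure (count_space int_lattice) {n}"
    using assms by (intro emeasure_mono) auto
  also have "\<dots> = 1" using assms by simp
  finally show ?thesis using Td by simp
qed

section \<open>The amalgam norm of a nonnegative function\<close>

text \<open>The amalgam norm with outer exponent one depends on the modulus only.  In this form it applies to
  majorants, which may take the value \<open>\<infinity>\<close>.\<close>

definition amalg :: "domain \<Rightarrow> ennreal \<Rightarrow> (real^'n \<Rightarrow> ennreal) \<Rightarrow> ennreal" where
  "amalg M p h = (\<integral>\<^sup>+n. Lp_norm p (dual_measure M) (\<lambda>\<xi>. indicator (unit_cube n) \<xi> * h \<xi>) \<partial>count_space int_lattice)"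

lemma amalgam_norm_eq: "amalgam_norm M p 1 g = amalg M p (\<lambda>\<xi>. ennreal (norm (g \<xi>)))"
proof -
  have "ennreal (norm (indicat_real (unit_cube n) \<xi> *\<^sub>R g \<xi>)) = indicator (unit_cube n) \<xi> * ennreal (norm (g \<xi>))" for n \<xi>
    by (auto split: split_indicator)
  then show ?thesis by (simp add: amalgam_norm_def amalg_def Lp_norm_1)
qed

lemma amalg_mono_AE:
  assumes [measurable]: "f \<in> borel_measurable (dual_measure M)"
    and "AE \<xi> in dual_measure M. f \<xi> \<le> g \<xi>" and p: "1 \<le> p"
  shows "amalg M p f \<le> amalg M p g"
  unfolding amalg_def
proof (intro nn_integral_mono Lp_norm_mono_AE p)
  fix n
  show "AE \<xi> in dual_measure M. indicator (unit_cube n) \<xi> * f \<xi> \<le> indicator (unit_cube n) \<xi> * g \<xi>"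
    using assms(2) by eventually_elim (intro mult_left_mono, auto)
qed measurable

lemma amalg_mono:
  assumes "f \<in> borel_measurable (dual_measure M)" "\<And>\<xi>. \<xi> \<in> space (dual_measure M) \<Longrightarrow> f \<xi> \<le> g \<xi>" "1 \<le> p"
  shows "amalg M p f \<le> amalg M p g"
  using assms by (intro amalg_mono_AE AE_I2)

lemma amalg_add:
  assumes [measurable]: "f \<in> borel_measurable (dual_measure M)" "g \<in> borel_measurable (dual_measure M)"
    and p: "1 \<le> p"
  shows "amalg M p (\<lambda>\<xi>. f \<xi> + g \<xi>) \<le> amalg M p f + amalg M p g"
proof -
  have "amalg M p (\<lambda>\<xi>. f \<xi> + g \<xi>) \<le> (\<integral>\<^sup>+n. Lp_norm p (dual_measure M) (\<lambda>\<xi>. indicator (unit_cube n) \<xi> * f \<xi>)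
      + Lp_norm p (dual_measure M) (\<lambda>\<xi>. indicator (unit_cube n) \<xi> * g \<xi>) \<partial>count_space int_lattice)"
    unfolding amalg_def distrib_left
    by (intro nn_integral_mono Lp_norm_triangle sigma_finite_dual_measure p) measurable
  also have "\<dots> = amalg M p f + amalg M p g"
    unfolding amalg_def by (intro nn_integral_add) auto
  finally show ?thesis .
qed

lemma amalg_cmult:
  assumes [measurable]: "f \<in> borel_measurable (dual_measure M)" and p: "1 \<le> p"
  shows "amalg M p (\<lambda>\<xi>. c * f \<xi>) \<le> c * amalg M p f"
proof -
  have "amalg M p (\<lambda>\<xi>. c * f \<xi>) = (\<integral>\<^sup>+n. Lp_norm p (dual_measure M) (\<lambda>\<xi>. c * (indicator (unit_cube n) \<xi> * f \<xi>)) \<partial>count_space int_lattice)"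
    unfolding amalg_def by (simp add: ac_simps)
  also have "\<dots> \<le> (\<integral>\<^sup>+n. c * Lp_norm p (dual_measure M) (\<lambda>\<xi>. indicator (unit_cube n) \<xi> * f \<xi>) \<partial>count_space int_lattice)"
    by (intro nn_integral_mono Lp_norm_cmult_le p) measurable
  also have "\<dots> = c * amalg M p f"
    unfolding amalg_def by (intro nn_integral_cmult) auto
  finally show ?thesis .
qed

lemma Lp_norm_zero: "1 \<le> p \<Longrightarrow> Lp_norm p M (\<lambda>x. 0) = 0"
  using Lp_norm_cmult_le[of "\<lambda>_. 0" M p 0] by simp

lemma amalg_zero [simp]: "1 \<le> p \<Longrightarrow> amalg M p (\<lambda>\<xi>. 0) = 0"
  by (simp add: amalg_def Lp_norm_zero)

lemma amalg_SUP_le: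
  fixes f :: "nat \<Rightarrow> real^'n \<Rightarrow> ennreal"
  assumes [measurable]: "\<And>i. f i \<in> borel_measurable (dual_measure M)" and "incseq f" and p: "1 \<le> p"
    and c: "\<And>i. amalg M p (f i) \<le> c"
  shows "amalg M p (\<lambda>\<xi>. SUP i. f i \<xi>) \<le> c"
proof -
  let ?L = "\<lambda>i n. Lp_norm p (dual_measure M) (\<lambda>\<xi>. indicator (unit_cube n) \<xi> * f i \<xi>)"
  have inc: "incseq (\<lambda>i \<xi>. indicator (unit_cube n) \<xi> * f i \<xi>)" for n :: "real^'n"
    using \<open>incseq f\<close> by (auto simp: incseq_def le_fun_def intro: mult_left_mono)
  have "amalg M p (\<lambda>\<xi>. SUP i. f i \<xi>) \<le> (\<integral>\<^sup>+n. (SUP i. ?L i n) \<partial>count_space int_lattice)"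
    unfolding amalg_def SUP_mult_left_ennreal
    by (intro nn_integral_mono Lp_norm_SUP_le inc p SUP_upper) auto
  also have "\<dots> = (SUP i. \<integral>\<^sup>+n. ?L i n \<partial>count_space int_lattice)"
  proof (intro nn_integral_monotone_convergence_SUP)
    show "incseq ?L"
    proof (intro incseq_SucI le_funI Lp_norm_mono_AE AE_I2 p)
      show "indicator (unit_cube n) \<xi> * f i \<xi> \<le> indicator (unit_cube n) \<xi> * f (Suc i) \<xi>" for i n \<xi>
        using inc[of n] by (auto simp: incseq_def le_fun_def)
    qed measurable
  qed auto
  also have "\<dots> \<le> c" using c by (intro SUP_least) (simp add: amalg_def)
  finally show ?thesis .
qed

text \<open>Cubes have measure at most one, so on each of them the integral is below the local norm.\<close>

lemma nn_integral_le_amalg: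
  assumes [measurable]: "h \<in> borel_measurable (dual_measure M)" and p: "1 \<le> p"
  shows "(\<integral>\<^sup>+\<xi>. h \<xi> \<partial>dual_measure M) \<le> amalg M p h"
proof -
  have "(\<integral>\<^sup>+\<xi>. h \<xi> \<partial>dual_measure M) = (\<integral>\<^sup>+\<xi>. (\<integral>\<^sup>+n. indicator (unit_cube n) \<xi> * h \<xi> \<partial>count_space int_lattice) \<partial>dual_measure M)"
    by (simp add: nn_integral_indicator_unit_cube)
  also have "\<dots> = (\<integral>\<^sup>+n. (\<integral>\<^sup>+\<xi>. indicator (unit_cube n) \<xi> * h \<xi> \<partial>dual_measure M) \<partial>count_space int_lattice)"
  proof -
    interpret Q: pair_sigma_finite "count_space (int_lattice :: (real^'a) set)" "dual_measure M :: (real^'a) measure"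
      by (intro pair_sigma_finite.intro sigma_finite_measure_count_space_countable) (auto simp: sigma_finite_dual_measure)
    show ?thesis
      by (intro Q.Fubini' measurable_pair_measure_countable1) (auto simp: split_beta')
  qed
  also have "\<dots> \<le> amalg M p h"
    unfolding amalg_def
  proof (intro nn_integral_mono)
    fix n :: "real^'a" assume n: "n \<in> space (count_space int_lattice)"
    let ?A = "{\<xi> \<in> space (dual_measure M). \<xi> \<in> unit_cube n}"
    have "(\<integral>\<^sup>+\<xi>. indicator ?A \<xi> * h \<xi> \<partial>dual_measure M) \<le> Lp_norm p (dual_measure M) (\<lambda>\<xi>. indicator ?A \<xi> * h \<xi>)"
      using n by (intro nn_integral_le_Lp_norm emeasure_unit_cube_le unit_cube_in_dual p) auto
    also have "\<dots> \<le> Lp_norm p (dual_measure M) (\<lambda>\<xi>. indicator (unit_cube n) \<xi> * h \<xi>)"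
    proof (intro Lp_norm_mono_AE AE_I2 p)
      have [measurable]: "?A \<in> sets (dual_measure M)" by (rule unit_cube_in_dual)
      show "(\<lambda>\<xi>. indicator ?A \<xi> * h \<xi>) \<in> borel_measurable (dual_measure M)" by measurable
    qed (auto split: split_indicator)
    also have "(\<integral>\<^sup>+\<xi>. indicator ?A \<xi> * h \<xi> \<partial>dual_measure M) = (\<integral>\<^sup>+\<xi>. indicator (unit_cube n) \<xi> * h \<xi> \<partial>dual_measure M)"
      by (intro nn_integral_cong) (auto split: split_indicator)
    finally show "(\<integral>\<^sup>+\<xi>. indicator (unit_cube n) \<xi> * h \<xi> \<partial>dual_measure M)
      \<le> Lp_norm p (dual_measure M) (\<lambda>\<xi>. indicator (unit_cube n) \<xi> * h \<xi>)" .
  qed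
  finally show ?thesis .
qed

text \<open>Dominated convergence over the cubes: on the cube around \<open>n\<close> the factor is at most
  \<open>\<delta> (|n| + d)\<^sup>\<beta>\<close>, which tends to zero with \<open>\<delta>\<close>, and it never exceeds one.\<close>

lemma amalg_damped_small:
  fixes h :: "real^'n \<Rightarrow> ennreal"
  assumes [measurable]: "h \<in> borel_measurable (dual_measure M)" and p: "1 \<le> p"
    and fin: "amalg M p h < \<infinity>" and \<beta>: "0 < \<beta>" and e: "0 < e"
  shows "\<exists>\<delta>>0. amalg M p (\<lambda>\<xi>. ennreal (min 1 (\<delta> * norm \<xi> powr \<beta>)) * h \<xi>) < e"
proof -
  let ?L = "\<lambda>n. Lp_norm p (dual_measure M) (\<lambda>\<xi>. indicator (unit_cube n) \<xi> * h \<xi>)"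
  let ?c = "\<lambda>j (n::real^'n). min 1 (1 / real (Suc j) * (norm n + real CARD('n)) powr \<beta>)"
  have c: "?c j n \<ge> 0" for j n by auto
  have le: "amalg M p (\<lambda>\<xi>. ennreal (min 1 (1 / real (Suc j) * norm \<xi> powr \<beta>)) * h \<xi>)
      \<le> (\<integral>\<^sup>+n. ennreal (?c j n) * ?L n \<partial>count_space int_lattice)" for j
    unfolding amalg_def
  proof (intro nn_integral_mono)
    fix n :: "real^'n"
    have "Lp_norm p (dual_measure M) (\<lambda>\<xi>. indicator (unit_cube n) \<xi> * (ennreal (min 1 (1 / real (Suc j) * norm \<xi> powr \<beta>)) * h \<xi>))
      \<le> Lp_norm p (dual_measure M) (\<lambda>\<xi>. ennreal (?c j n) * (indicator (unit_cube n) \<xi> * h \<xi>))"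
    proof (intro Lp_norm_mono_AE AE_I2 p)
      fix \<xi> :: "real^'n"
      show "indicator (unit_cube n) \<xi> * (ennreal (min 1 (1 / real (Suc j) * norm \<xi> powr \<beta>)) * h \<xi>)
        \<le> ennreal (?c j n) * (indicator (unit_cube n) \<xi> * h \<xi>)"
      proof (cases "\<xi> \<in> unit_cube n")
        case True
        have "norm (\<xi> - n) \<le> (\<Sum>i\<in>UNIV. \<bar>(\<xi> - n) $ i\<bar>)" by (rule norm_le_l1_cart)
        also have "\<dots> \<le> (\<Sum>i\<in>(UNIV::'n set). 1)"
        proof (rule sum_mono)
          fix i show "\<bar>(\<xi> - n) $ i\<bar> \<le> 1"
            using True by (auto simp: unit_cube_def abs_le_iff dest!: spec[of _ i])
        qed
        finally have "norm \<xi> \<le> norm n + real CARD('n)"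
          using norm_triangle_ineq[of n "\<xi> - n"] by simp
        then have "norm \<xi> powr \<beta> \<le> (norm n + real CARD('n)) powr \<beta>"
          using \<beta> by (intro powr_mono2) auto
        then have "min 1 (1 / real (Suc j) * norm \<xi> powr \<beta>) \<le> ?c j n"
          by (intro min.mono order_refl mult_left_mono) auto
        then show ?thesis using True by (auto intro!: mult_right_mono ennreal_leI)
      qed simp
    qed measurable
    also have "\<dots> \<le> ennreal (?c j n) * ?L n" by (intro Lp_norm_cmult_le p) measurable
    finally show "Lp_norm p (dual_measure M) (\<lambda>\<xi>. indicator (unit_cube n) \<xi> * (ennreal (min 1 (1 / real (Suc j) * norm \<xi> powr \<beta>)) * h \<xi>))
      \<le> ennreal (?c j n) * ?L n" .
  qed
  have L_fin: "AE n in count_space int_lattice. ?L n < top"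
    using fin nn_integral_PInf_AE[of ?L "count_space int_lattice"]
    by (simp add: amalg_def less_top)
  have "(\<lambda>j. \<integral>\<^sup>+n. ennreal (?c j n) * ?L n \<partial>count_space int_lattice) \<longlonglongrightarrow> (\<integral>\<^sup>+n. 0 \<partial>count_space (int_lattice::(real^'n) set))"
  proof (rule nn_integral_dominated_convergence[where w = ?L])
    show "(\<integral>\<^sup>+n. ?L n \<partial>count_space int_lattice) < \<infinity>" using fin by (simp add: amalg_def)
    show "AE n in count_space int_lattice. ennreal (?c j n) * ?L n \<le> ?L n" for j
    proof (rule AE_I2)
      fix n :: "real^'n"
      have "ennreal (?c j n) \<le> 1" by (simp flip: ennreal_1)
      then have "ennreal (?c j n) * ?L n \<le> 1 * ?L n" by (intro mult_right_mono) auto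
      then show "ennreal (?c j n) * ?L n \<le> ?L n" by simp
    qed
    show "AE n in count_space int_lattice. (\<lambda>j. ennreal (?c j n) * ?L n) \<longlonglongrightarrow> 0"
      using L_fin
    proof eventually_elim
      case (elim n)
      have "(\<lambda>j. 1 / real (Suc j) * (norm n + real CARD('n)) powr \<beta>) \<longlonglongrightarrow> 0 * (norm n + real CARD('n)) powr \<beta>"
        by (intro tendsto_mult LIMSEQ_Suc[OF lim_1_over_n] tendsto_const)
      then have "(\<lambda>j. ?c j n) \<longlonglongrightarrow> min 1 0"
        by (intro tendsto_min tendsto_const) simp
      then have "(\<lambda>j. ennreal (?c j n)) \<longlonglongrightarrow> 0" using tendsto_ennrealI by fastforce
      then have "(\<lambda>j. ennreal (?c j n) * ?L n) \<longlonglongrightarrow> 0 * ?L n"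
        using elim by (intro tendsto_mult_ennreal tendsto_const) auto
      then show ?case by simp
    qed
  qed auto
  then have "(\<lambda>j. \<integral>\<^sup>+n. ennreal (?c j n) * ?L n \<partial>count_space int_lattice) \<longlonglongrightarrow> 0" by simp
  from order_tendstoD(2)[OF this e] obtain j where "(\<integral>\<^sup>+n. ennreal (?c j n) * ?L n \<partial>count_space int_lattice) < e"
    by (auto simp: eventually_sequentially)
  with le[of j] have "amalg M p (\<lambda>\<xi>. ennreal (min 1 (1 / real (Suc j) * norm \<xi> powr \<beta>)) * h \<xi>) < e" by simp
  then show ?thesis by (intro exI[of _ "1 / real (Suc j)"]) auto
qed

section \<open>Convolution of nonnegative functions\<close>

definition nconv :: "domain \<Rightarrow> (real^'n \<Rightarrow> ennreal) \<Rightarrow> (real^'n \<Rightarrow> ennreal) \<Rightarrow> real^'n \<Rightarrow> ennreal" where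
  "nconv M f g \<xi> = (\<integral>\<^sup>+\<eta>. f \<eta> * g (\<xi> - \<eta>) \<partial>dual_measure M)"

lemma measurable_nconv [measurable (raw)]:
  assumes [measurable]: "f \<in> borel_measurable (dual_measure M)" "g \<in> borel_measurable (dual_measure M)"
  shows "nconv M f g \<in> borel_measurable (dual_measure M)"
  unfolding nconv_def by measurable

lemma Lp_norm_sum:
  assumes "sigma_finite_measure M" and [measurable]: "\<And>i. i \<in> I \<Longrightarrow> f i \<in> borel_measurable M"
    and p: "1 \<le> p" and "finite I"
  shows "Lp_norm p M (\<lambda>x. \<Sum>i\<in>I. f i x) \<le> (\<Sum>i\<in>I. Lp_norm p M (f i))"
  using \<open>finite I\<close> assms(2)
proof (induction rule: finite_induct)
  case (insert i I)
  have "Lp_norm p M (\<lambda>x. f i x + (\<Sum>i\<in>I. f i x)) \<le> Lp_norm p M (f i) + Lp_norm p M (\<lambda>x. \<Sum>i\<in>I. f i x)"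
    using insert by (intro Lp_norm_triangle assms(1) p) auto
  also have "\<dots> \<le> Lp_norm p M (f i) + (\<Sum>i\<in>I. Lp_norm p M (f i))"
    using insert by (intro add_left_mono) auto
  finally show ?case using insert by simp
qed (simp add: Lp_norm_zero p)

lemma measurable_nearest [measurable]:
  "nearest \<in> measurable (dual_measure M) (count_space (int_lattice :: (real^'n) set))"
  unfolding measurable_count_space_eq_countable[OF countable_int_lattice]
proof (intro conjI ballI)
  fix n :: "real^'n" assume "n \<in> int_lattice"
  then have "nearest -` {n} \<inter> space (dual_measure M) = {\<xi> \<in> space (dual_measure M). \<xi> \<in> unit_cube n}"
    by (auto simp: unit_cube_iff)
  then show "nearest -` {n} \<inter> space (dual_measure M) \<in> sets (dual_measure M)"
    using unit_cube_in_dual by simp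
qed auto

lemma amalg_nconv_le:
  fixes f g :: "real^'n \<Rightarrow> ennreal"
  assumes [measurable]: "f \<in> borel_measurable (dual_measure M)" "g \<in> borel_measurable (dual_measure M)" and p: "1 \<le> p"
  shows "amalg M p (nconv M f g) \<le> of_nat (card (unit_steps :: (real^'n) set)) * (\<integral>\<^sup>+\<eta>. f \<eta> \<partial>dual_measure M) * amalg M p g"
proof -
  let ?\<mu> = "dual_measure M :: (real^'n) measure"
  let ?B = "\<lambda>n. Lp_norm p ?\<mu> (\<lambda>\<xi>. indicator (unit_cube n) \<xi> * g \<xi>)"
  let ?L = "count_space (int_lattice :: (real^'n) set)"
  interpret Q: pair_sigma_finite ?L ?\<mu>
    by (intro pair_sigma_finite.intro sigma_finite_measure_count_space_countable) (auto simp: sigma_finite_dual_measure)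
  have B [measurable]: "(\<lambda>\<eta>. ?B (n - nearest \<eta> + e)) \<in> borel_measurable ?\<mu>" for n e
    by (rule measurable_compose[OF measurable_nearest, of "\<lambda>m. ?B (n - m + e)"]) auto
  have "Lp_norm p ?\<mu> (\<lambda>\<xi>. indicator (unit_cube n) \<xi> * nconv M f g \<xi>)
      \<le> (\<integral>\<^sup>+\<eta>. f \<eta> * (\<Sum>e\<in>unit_steps. ?B (n - nearest \<eta> + e)) \<partial>?\<mu>)" if n: "n \<in> int_lattice" for n
  proof -
    have "Lp_norm p ?\<mu> (\<lambda>\<xi>. indicator (unit_cube n) \<xi> * nconv M f g \<xi>)
      = Lp_norm p ?\<mu> (\<lambda>\<xi>. \<integral>\<^sup>+\<eta>. indicator (unit_cube n) \<xi> * (f \<eta> * g (\<xi> - \<eta>)) \<partial>?\<mu>)"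
    proof (intro Lp_norm_cong_AE AE_I2 p)
      fix \<xi> assume [simp]: "\<xi> \<in> space ?\<mu>"
      have [measurable]: "(\<lambda>\<eta>. \<xi> - \<eta>) \<in> measurable ?\<mu> ?\<mu>" by measurable
      show "indicator (unit_cube n) \<xi> * nconv M f g \<xi> = (\<integral>\<^sup>+\<eta>. indicator (unit_cube n) \<xi> * (f \<eta> * g (\<xi> - \<eta>)) \<partial>?\<mu>)"
        unfolding nconv_def by (intro nn_integral_cmult[symmetric]) measurable
    qed measurable
    also have "\<dots> \<le> (\<integral>\<^sup>+\<eta>. f \<eta> * (\<Sum>e\<in>unit_steps. ?B (n - nearest \<eta> + e)) \<partial>?\<mu>)"
    proof (rule Lp_norm_Minkowski[OF sigma_finite_dual_measure sigma_finite_dual_measure _ _ p])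
      fix \<eta> assume \<eta>: "\<eta> \<in> space ?\<mu>"
      note [measurable] = measurable_shift[OF \<eta>]
      let ?g = "\<lambda>e \<xi>. indicator (unit_cube (n - nearest \<eta> + e)) (\<xi> - \<eta>) * g (\<xi> - \<eta>)"
      have [measurable]: "?g e \<in> borel_measurable ?\<mu>" for e
        by (rule measurable_compose[OF measurable_shift[OF \<eta>], of "\<lambda>\<xi>. indicator (unit_cube (n - nearest \<eta> + e)) \<xi> * g \<xi>"]) measurable
      have "Lp_norm p ?\<mu> (\<lambda>\<xi>. indicator (unit_cube n) \<xi> * (f \<eta> * g (\<xi> - \<eta>)))
          \<le> Lp_norm p ?\<mu> (\<lambda>\<xi>. f \<eta> * (\<Sum>e\<in>unit_steps. ?g e \<xi>))"
      proof (intro Lp_norm_mono_AE AE_I2 p)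
        fix \<xi>
        show "indicator (unit_cube n) \<xi> * (f \<eta> * g (\<xi> - \<eta>)) \<le> f \<eta> * (\<Sum>e\<in>unit_steps. ?g e \<xi>)"
        proof (cases "\<xi> \<in> unit_cube n")
          case True
          \<comment> \<open>The one neighbour that contains \<open>\<xi> - \<eta>\<close>.\<close>
          define e where "e = nearest (\<xi> - \<eta>) - (nearest \<xi> - nearest \<eta>)"
          have e: "e \<in> unit_steps" unfolding e_def by (rule nearest_diff_steps)
          have "n = nearest \<xi>" using True n by (simp add: unit_cube_iff)
          then have "n - nearest \<eta> + e = nearest (\<xi> - \<eta>)" by (simp add: e_def)
          then have "\<xi> - \<eta> \<in> unit_cube (n - nearest \<eta> + e)" by (simp add: unit_cube_iff)
          then have "g (\<xi> - \<eta>) = ?g e \<xi>" by simp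
          also have "\<dots> \<le> (\<Sum>e\<in>unit_steps. ?g e \<xi>)" using e by (intro member_le_sum) auto
          finally show ?thesis using True by (auto intro: mult_left_mono)
        qed simp
      qed measurable
      also have "\<dots> \<le> f \<eta> * Lp_norm p ?\<mu> (\<lambda>\<xi>. \<Sum>e\<in>unit_steps. ?g e \<xi>)"
        by (intro Lp_norm_cmult_le p) measurable
      also have "\<dots> \<le> f \<eta> * (\<Sum>e\<in>unit_steps. Lp_norm p ?\<mu> (?g e))"
        by (intro mult_left_mono Lp_norm_sum sigma_finite_dual_measure p) auto
      also have "\<dots> \<le> f \<eta> * (\<Sum>e\<in>unit_steps. ?B (n - nearest \<eta> + e))"
        using \<eta> by (intro mult_left_mono sum_mono Lp_norm_shift[of "\<lambda>\<xi>. indicator (unit_cube _) \<xi> * g \<xi>"] p) auto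
      finally show "Lp_norm p ?\<mu> (\<lambda>\<xi>. indicator (unit_cube n) \<xi> * (f \<eta> * g (\<xi> - \<eta>)))
          \<le> f \<eta> * (\<Sum>e\<in>unit_steps. ?B (n - nearest \<eta> + e))" .
    qed measurable
    finally show ?thesis .
  qed
  then have "amalg M p (nconv M f g) \<le> (\<integral>\<^sup>+n. (\<integral>\<^sup>+\<eta>. f \<eta> * (\<Sum>e\<in>unit_steps. ?B (n - nearest \<eta> + e)) \<partial>?\<mu>) \<partial>?L)"
    unfolding amalg_def by (intro nn_integral_mono) auto
  also have "\<dots> = (\<integral>\<^sup>+\<eta>. (\<integral>\<^sup>+n. f \<eta> * (\<Sum>e\<in>unit_steps. ?B (n - nearest \<eta> + e)) \<partial>?L) \<partial>?\<mu>)"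
    by (intro Q.Fubini'[symmetric] measurable_pair_measure_countable1) (auto simp: split_beta')
  also have "\<dots> = (\<integral>\<^sup>+\<eta>. f \<eta> * (of_nat (card (unit_steps :: (real^'n) set)) * amalg M p g) \<partial>?\<mu>)"
  proof (intro nn_integral_cong)
    fix \<eta> :: "real^'n"
    have "(\<integral>\<^sup>+n. ?B (n - nearest \<eta> + e) \<partial>?L) = amalg M p g" if "e \<in> unit_steps" for e
    proof -
      have "bij_betw (\<lambda>n. n - nearest \<eta> + e) int_lattice int_lattice"
        using unit_steps_in_lattice[OF that] by (intro bij_betwI[of _ _ _ "\<lambda>n. n + nearest \<eta> - e"]) auto
      from nn_integral_bij_count_space[OF this, of ?B] show ?thesis by (simp add: amalg_def)
    qed
    then show "(\<integral>\<^sup>+n. f \<eta> * (\<Sum>e\<in>unit_steps. ?B (n - nearest \<eta> + e)) \<partial>?L) = f \<eta> * (of_nat (card (unit_steps :: (real^'n) set)) * amalg M p g)"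
      by (simp add: nn_integral_cmult nn_integral_sum)
  qed
  also have "\<dots> = of_nat (card (unit_steps :: (real^'n) set)) * (\<integral>\<^sup>+\<eta>. f \<eta> \<partial>?\<mu>) * amalg M p g"
    by (subst nn_integral_multc) (auto simp: ac_simps)
  finally show ?thesis .
qed

lemma amalg_nconv:
  fixes f g :: "real^'n \<Rightarrow> ennreal"
  assumes [measurable]: "f \<in> borel_measurable (dual_measure M)" "g \<in> borel_measurable (dual_measure M)" and p: "1 \<le> p"
  shows "amalg M p (nconv M f g) \<le> of_nat (card (unit_steps :: (real^'n) set)) * amalg M p f * amalg M p g"
  using amalg_nconv_le[OF assms] nn_integral_le_amalg[OF assms(1) p]
  by (meson mult_left_mono mult_right_mono order_trans zero_le)

section \<open>Schwartz functions\<close>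

lemma differentiable_has_derivative:
  "f differentiable (at x) \<Longrightarrow> (f has_derivative frechet_derivative f (at x)) (at x)"
  by (simp add: frechet_derivative_works[symmetric])

lemma partial_deriv_eq:
  "(\<phi> has_derivative D) (at x) \<Longrightarrow> partial_deriv i \<phi> x = D (axis i 1)"
  unfolding partial_deriv_def by (metis frechet_derivative_at)

lemma partial_derivs_closed:
  assumes "\<phi> \<in> S" and "\<And>\<phi> i. \<phi> \<in> S \<Longrightarrow> partial_deriv i \<phi> \<in> S"
  shows "partial_derivs js \<phi> \<in> S"
  by (induction js) (use assms in auto)

lemma partial_derivs_snoc: "partial_derivs js (partial_deriv i \<phi>) = partial_derivs (js @ [i]) \<phi>"
  by (induction js) auto

text \<open>Smoothness speaks of iterated partial derivatives.  A set of differentiable functions that is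
  closed under partial derivatives consists of smooth functions, so it suffices to guess such a set.\<close>

lemma smooth_coinduct:
  assumes "\<phi> \<in> S" and "\<And>\<phi> i. \<phi> \<in> S \<Longrightarrow> partial_deriv i \<phi> \<in> S"
    and "\<And>\<phi> x. \<phi> \<in> S \<Longrightarrow> \<phi> differentiable (at x)"
  shows "smooth \<phi>"
  using assms(3)[OF partial_derivs_closed[OF assms(1,2)]] by (auto simp: smooth_def)

lemma smooth_differentiable: "smooth \<phi> \<Longrightarrow> \<phi> differentiable (at x)"
  unfolding smooth_def by (metis partial_derivs.simps(1))

lemma smooth_partial_deriv: "smooth \<phi> \<Longrightarrow> smooth (partial_deriv i \<phi>)"
  unfolding smooth_def partial_derivs_snoc by blast

lemma smooth_continuous: "smooth \<phi> \<Longrightarrow> continuous_on UNIV \<phi>"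
  by (meson continuous_at_imp_continuous_on differentiable_imp_continuous_within smooth_differentiable)

text \<open>The decay condition of the Schwartz space for the function alone, without its derivatives.\<close>

definition rapid :: "(real^'n \<Rightarrow> complex) \<Rightarrow> bool" where
  "rapid \<phi> \<longleftrightarrow> (\<forall>N. \<exists>C. \<forall>x. (1 + norm x) ^ N * norm (\<phi> x) \<le> C)"

lemma rapid_bounded_iff: "rapid \<phi> \<longleftrightarrow> (\<forall>N. bounded (range (\<lambda>x. (1 + norm x) ^ N *\<^sub>R \<phi> x)))"
  by (simp add: rapid_def bounded_iff)

lemma schwartz_coinduct:
  assumes "\<phi> \<in> S" and "\<And>\<phi> i. \<phi> \<in> S \<Longrightarrow> partial_deriv i \<phi> \<in> S"
    and "\<And>\<phi> x. \<phi> \<in> S \<Longrightarrow> \<phi> differentiable (at x)" and "\<And>\<phi>. \<phi> \<in> S \<Longrightarrow> rapid \<phi>"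
  shows "\<phi> \<in> schwartz"
  using smooth_coinduct[OF assms(1,2,3)] assms(4)[OF partial_derivs_closed[OF assms(1,2)]]
  by (auto simp: schwartz_def rapid_bounded_iff)

lemma schwartz_smooth: "\<phi> \<in> schwartz \<Longrightarrow> smooth \<phi>"
  by (simp add: schwartz_def)

lemmas schwartz_differentiable = smooth_differentiable[OF schwartz_smooth]
lemmas schwartz_continuous = smooth_continuous[OF schwartz_smooth]

lemma schwartz_rapid: "\<phi> \<in> schwartz \<Longrightarrow> rapid \<phi>"
  unfolding schwartz_def rapid_bounded_iff by clarify (metis partial_derivs.simps(1))

lemma schwartz_partial_deriv: "\<phi> \<in> schwartz \<Longrightarrow> partial_deriv i \<phi> \<in> schwartz"
  by (auto simp: schwartz_def partial_derivs_snoc smooth_partial_deriv)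

lemma measurable_schwartz [measurable_dest]: "\<phi> \<in> schwartz \<Longrightarrow> \<phi> \<in> borel_measurable borel"
  by (intro borel_measurable_continuous_onI schwartz_continuous)

lemma partial_deriv_add:
  assumes "f differentiable (at x)" "g differentiable (at x)"
  shows "partial_deriv i (\<lambda>x. f x + g x) x = partial_deriv i f x + partial_deriv i g x"
  using has_derivative_add[OF differentiable_has_derivative[OF assms(1)] differentiable_has_derivative[OF assms(2)]]
  by (subst partial_deriv_eq) (auto simp: partial_deriv_def)

lemma partial_deriv_mult:
  assumes "f differentiable (at x)" "g differentiable (at x)"
  shows "partial_deriv i (\<lambda>x. f x * g x) x = f x * partial_deriv i g x + partial_deriv i f x * g x"
  using has_derivative_mult[OF differentiable_has_derivative[OF assms(1)] differentiable_has_derivative[OF assms(2)]]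
  by (subst partial_deriv_eq) (auto simp: partial_deriv_def)

lemma rapid_add: "rapid f \<Longrightarrow> rapid g \<Longrightarrow> rapid (\<lambda>x. f x + g x)"
  unfolding rapid_def
proof
  fix N assume f: "\<forall>N. \<exists>C. \<forall>x. (1 + norm x) ^ N * norm (f x) \<le> C" and g: "\<forall>N. \<exists>C. \<forall>x. (1 + norm x) ^ N * norm (g x) \<le> C"
  then obtain C D where C: "\<And>x. (1 + norm x) ^ N * norm (f x) \<le> C" and D: "\<And>x. (1 + norm x) ^ N * norm (g x) \<le> D"
    by meson
  have "(1 + norm x) ^ N * norm (f x + g x) \<le> C + D" for x
  proof -
    have "(1 + norm x) ^ N * norm (f x + g x) \<le> (1 + norm x) ^ N * (norm (f x) + norm (g x))"
      by (intro mult_left_mono norm_triangle_ineq) auto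
    also have "\<dots> \<le> C + D" using C[of x] D[of x] by (simp add: algebra_simps)
    finally show ?thesis .
  qed
  then show "\<exists>C. \<forall>x. (1 + norm x) ^ N * norm (f x + g x) \<le> C" by blast
qed

definition poly_growth :: "(real^'n \<Rightarrow> complex) \<Rightarrow> bool" where
  "poly_growth m \<longleftrightarrow> (\<exists>C K. \<forall>x. norm (m x) \<le> C * (1 + norm x) ^ K)"

lemma rapid_mult: assumes "poly_growth m" "rapid f" shows "rapid (\<lambda>x. m x * f x)"
  unfolding rapid_def
proof
  fix N
  obtain C K where C: "\<And>x. norm (m x) \<le> C * (1 + norm x) ^ K"
    using assms(1) by (auto simp: poly_growth_def)
  obtain D where D: "\<And>x. (1 + norm x) ^ (N + K) * norm (f x) \<le> D"
    using assms(2) by (auto simp: rapid_def)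
  have "0 \<le> norm (m 0)" by simp
  also have "\<dots> \<le> C" using C[of 0] by simp
  finally have C0: "0 \<le> C" .
  have "(1 + norm x) ^ N * norm (m x * f x) \<le> C * D" for x
  proof -
    have "(1 + norm x) ^ N * norm (m x * f x) \<le> (1 + norm x) ^ N * ((C * (1 + norm x) ^ K) * norm (f x))"
      unfolding norm_mult by (intro mult_left_mono mult_right_mono C) auto
    also have "\<dots> = C * ((1 + norm x) ^ (N + K) * norm (f x))" by (simp add: power_add ac_simps)
    also have "\<dots> \<le> C * D" by (intro mult_left_mono D C0)
    finally show ?thesis .
  qed
  then show "\<exists>C. \<forall>x. (1 + norm x) ^ N * norm (m x * f x) \<le> C" by blast
qed

text \<open>Sums are included because the derivative of a product has two terms, and a coinduction needs a set
  closed under derivatives.\<close>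

inductive_set multiples :: "(real^'n \<Rightarrow> complex) set \<Rightarrow> (real^'n \<Rightarrow> complex) set" for \<M> where
  base: "m \<in> \<M> \<Longrightarrow> \<phi> \<in> schwartz \<Longrightarrow> (\<lambda>x. m x * \<phi> x) \<in> multiples \<M>"
| add: "f \<in> multiples \<M> \<Longrightarrow> g \<in> multiples \<M> \<Longrightarrow> (\<lambda>x. f x + g x) \<in> multiples \<M>"

lemma multiples_subset_schwartz:
  assumes diff: "\<And>m x. m \<in> \<M> \<Longrightarrow> m differentiable (at x)"
    and closed: "\<And>m i. m \<in> \<M> \<Longrightarrow> partial_deriv i m \<in> \<M>"
    and growth: "\<And>m. m \<in> \<M> \<Longrightarrow> poly_growth m"
  shows "multiples \<M> \<subseteq> schwartz"
proof
  have d: "f differentiable (at x)" if "f \<in> multiples \<M>" for f x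
    using that
  proof induction
    case (base m \<phi>)
    then show ?case by (intro differentiable_mult diff schwartz_differentiable)
  next
    case (add f g)
    then show ?case by (intro differentiable_add)
  qed
  fix f assume "f \<in> multiples \<M>"
  then show "f \<in> schwartz"
  proof (rule schwartz_coinduct)
    fix f i assume "f \<in> multiples \<M>"
    then show "partial_deriv i f \<in> multiples \<M>"
    proof induction
      case (base m \<phi>)
      have "partial_deriv i (\<lambda>x. m x * \<phi> x) = (\<lambda>x. m x * partial_deriv i \<phi> x + partial_deriv i m x * \<phi> x)"
        using base by (intro ext partial_deriv_mult diff schwartz_differentiable)
      then show ?case using base by (simp add: multiples.intros closed schwartz_partial_deriv)
    next
      case (add f g)
      have "partial_deriv i (\<lambda>x. f x + g x) = (\<lambda>x. partial_deriv i f x + partial_deriv i g x)"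
        using add by (intro ext partial_deriv_add d)
      then show ?case using add by (simp add: multiples.intros)
    qed
  next
    fix f assume "f \<in> multiples \<M>"
    then show "rapid f"
    proof induction
      case (base m \<phi>)
      then show ?case by (intro rapid_mult growth schwartz_rapid)
    next
      case (add f g)
      then show ?case by (intro rapid_add)
    qed
  qed (rule d)
qed

lemma partial_deriv_const [simp]: "partial_deriv i (\<lambda>x. c) = (\<lambda>x. 0)"
  by (intro ext) (subst partial_deriv_eq[OF has_derivative_const], simp)

lemma poly_growth_const: "poly_growth (\<lambda>x. c)"
  unfolding poly_growth_def by (intro exI[of _ "norm c"] exI[of _ 0]) simp

lemma multiples_const_subset: "multiples (range (\<lambda>c x. c)) \<subseteq> schwartz"
  by (rule multiples_subset_schwartz) (auto simp: poly_growth_const)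

lemma schwartz_cmult: "\<phi> \<in> schwartz \<Longrightarrow> (\<lambda>x. c * \<phi> x) \<in> schwartz"
  using multiples_const_subset multiples.base[of "\<lambda>x. c" "range (\<lambda>c x. c)" \<phi>] by auto

lemma schwartz_add: assumes "\<phi> \<in> schwartz" "\<psi> \<in> schwartz" shows "(\<lambda>x. \<phi> x + \<psi> x) \<in> schwartz"
proof -
  have "(\<lambda>x. 1 * \<phi> x + 1 * \<psi> x) \<in> multiples (range (\<lambda>c x. c))"
    by (intro multiples.add multiples.base[of "\<lambda>x. 1"] assms) auto
  then show ?thesis using multiples_const_subset by auto
qed

lemma has_derivative_coord: "((\<lambda>x::real^'n. complex_of_real (x $ j)) has_derivative (\<lambda>h. of_real (h $ j))) (at x)"
  by (auto intro!: derivative_eq_intros bounded_linear.has_derivative[OF bounded_linear_vec_nth] )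

lemma partial_deriv_coord: "partial_deriv i (\<lambda>x::real^'n. complex_of_real (x $ j)) = (\<lambda>x. if i = j then 1 else 0)"
  by (intro ext, subst partial_deriv_eq[OF has_derivative_coord]) (simp add: axis_def)

lemma poly_growth_coord: "poly_growth (\<lambda>x::real^'n. complex_of_real (x $ j))"
  unfolding poly_growth_def
proof (intro exI[of _ 1] allI)
  fix x :: "real^'n"
  show "norm (complex_of_real (x $ j)) \<le> 1 * (1 + norm x) ^ 1"
    using component_le_norm_cart[of x j] by simp
qed

lemma schwartz_coord: assumes "\<phi> \<in> schwartz" shows "(\<lambda>x. complex_of_real (x $ j) * \<phi> x) \<in> schwartz"
proof -
  let ?M = "insert (\<lambda>x. complex_of_real (x $ j)) (range (\<lambda>c x. c))"
  have "multiples ?M \<subseteq> schwartz"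
  proof (rule multiples_subset_schwartz)
    fix m x assume "m \<in> ?M"
    moreover have "(\<lambda>x. complex_of_real (x $ j)) differentiable (at x)"
      using has_derivative_coord[of j x] by (auto simp: differentiable_def)
    ultimately show "m differentiable (at x)" by auto
  next
    fix m i assume "m \<in> ?M"
    then show "partial_deriv i m \<in> ?M" by (auto simp: partial_deriv_coord)
  qed (auto simp: poly_growth_const poly_growth_coord)
  then show ?thesis using multiples.base[of "\<lambda>x. complex_of_real (x $ j)" ?M, OF _ assms] by auto
qed

text \<open>The character \<open>x \<mapsto> exp (2 \<pi> i x \<cdot> a)\<close>; it is symmetric in its arguments.\<close>

definition chi :: "real^'n \<Rightarrow> real^'n \<Rightarrow> complex" where
  "chi a x = cis (2 * pi * (x \<bullet> a))"

lemma norm_chi [simp]: "norm (chi a x) = 1"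
  by (simp add: chi_def)

lemma chi_0 [simp]: "chi 0 x = 1" "chi a 0 = 1"
  by (simp_all add: chi_def)

lemma chi_add: "chi (a + b) x = chi a x * chi b x" "chi a (x + y) = chi a x * chi a y"
  by (simp_all add: chi_def inner_add_left inner_add_right ring_distribs flip: cis_mult)

lemma chi_minus: "chi (- a) x = chi a (- x)" "chi a (- x) = cnj (chi a x)" "chi a x * chi a (- x) = 1" 
  by (simp_all add: chi_def cis_mult cis_cnj)

lemma fourier_eq: "fourier \<phi> \<xi> = (LINT x|lborel. \<phi> x * chi (- \<xi>) x)"
  by (simp add: fourier_def chi_def)

lemma has_derivative_chi:
  "(chi a has_derivative (\<lambda>h. 2 * pi * \<i> * of_real (h \<bullet> a) * chi a x)) (at x)"
  unfolding chi_def
  by (auto intro!: derivative_eq_intros simp: scaleR_conv_of_real)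

lemma differentiable_chi: "chi a differentiable (at x)"
  using has_derivative_chi differentiable_def by blast

lemma partial_deriv_chi: "partial_deriv i (chi a) x = 2 * pi * \<i> * of_real (a $ i) * chi a x"
  by (subst partial_deriv_eq[OF has_derivative_chi]) (simp add: inner_axis' )

lemma continuous_on_chi [continuous_intros]:
  "continuous_on S f \<Longrightarrow> continuous_on S g \<Longrightarrow> continuous_on S (\<lambda>x. chi (f x) (g x))"
  unfolding chi_def cis_conv_exp by (intro continuous_intros)

lemma measurable_chi [measurable (raw)]:
  "f \<in> borel_measurable N \<Longrightarrow> g \<in> borel_measurable N \<Longrightarrow> (\<lambda>x. chi (f x) (g x)) \<in> borel_measurable N"
  unfolding chi_def cis_conv_exp by measurable

lemma schwartz_chi: assumes "\<phi> \<in> schwartz" shows "(\<lambda>x. \<phi> x * chi a x) \<in> schwartz"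
proof -
  let ?M = "range (\<lambda>c x. c * chi a x)"
  have pd: "partial_deriv i (\<lambda>x. c * chi a x) = (\<lambda>x. (2 * pi * \<i> * of_real (a $ i) * c) * chi a x)" for i c
    by (rule ext, subst partial_deriv_mult) (auto simp: differentiable_chi partial_deriv_chi)
  have "multiples ?M \<subseteq> schwartz"
  proof (rule multiples_subset_schwartz)
    fix m i assume "m \<in> ?M"
    then obtain c where m: "m = (\<lambda>x. c * chi a x)" by auto
    show "partial_deriv i m \<in> ?M" unfolding m pd by (rule rangeI)
  next
    fix m assume "m \<in> ?M"
    then obtain c where "m = (\<lambda>x. c * chi a x)" by auto
    then show "poly_growth m"
      unfolding poly_growth_def by (intro exI[of _ "norm c"] exI[of _ 0]) (simp add: norm_mult)
  qed (auto intro!: differentiable_mult differentiable_chi)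
  moreover have "(\<lambda>x. 1 * chi a x) \<in> ?M" by (rule rangeI)
  ultimately have "(\<lambda>x. (1 * chi a x) * \<phi> x) \<in> schwartz" using multiples.base[of "\<lambda>x. 1 * chi a x" ?M, OF _ assms] by auto
  then show ?thesis by (simp add: mult.commute)
qed

lemma rapid_poly_growth: "rapid f \<Longrightarrow> poly_growth f"
  unfolding rapid_def poly_growth_def by (metis (no_types) mult.left_neutral mult.right_neutral power_0)

lemma schwartz_mult: assumes "\<phi> \<in> schwartz" "\<psi> \<in> schwartz" shows "(\<lambda>x. \<phi> x * \<psi> x) \<in> schwartz"
proof -
  have "multiples schwartz \<subseteq> schwartz"
    by (rule multiples_subset_schwartz) (auto intro: schwartz_differentiable schwartz_partial_deriv rapid_poly_growth schwartz_rapid)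
  then show ?thesis using multiples.base[OF assms] by auto
qed

lemma schwartz_affine:
  assumes "\<phi> \<in> schwartz" "a \<noteq> 0"
  shows "(\<lambda>x. \<phi> (a *\<^sub>R x + b)) \<in> schwartz"
proof -
  \<comment> \<open>The constant \<open>c\<close> absorbs the factor \<open>a\<close> that each derivative produces.\<close>
  let ?S = "{\<lambda>x. c * \<phi> (a *\<^sub>R x + b) |c \<phi>. \<phi> \<in> schwartz}"
  have d: "((\<lambda>x. c * \<phi> (a *\<^sub>R x + b)) has_derivative (\<lambda>h. c * frechet_derivative \<phi> (at (a *\<^sub>R x + b)) (a *\<^sub>R h))) (at x)"
    if "\<phi> \<in> schwartz" for c \<phi> x
  proof -
    have "(\<phi> has_derivative frechet_derivative \<phi> (at (a *\<^sub>R x + b))) (at (a *\<^sub>R x + b))"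
      using schwartz_differentiable[OF that] by (rule differentiable_has_derivative)
    then have "((\<lambda>x. \<phi> (a *\<^sub>R x + b)) has_derivative (\<lambda>h. frechet_derivative \<phi> (at (a *\<^sub>R x + b)) (a *\<^sub>R h))) (at x)"
      by (rule has_derivative_compose[rotated]) (auto intro!: derivative_eq_intros)
    then show ?thesis by (rule has_derivative_mult_right)
  qed
  have "(\<lambda>x. 1 * \<phi> (a *\<^sub>R x + b)) \<in> ?S" using assms(1)
    by (intro CollectI exI[of _ 1] exI[of _ \<phi>] conjI refl)
  then have "(\<lambda>x. 1 * \<phi> (a *\<^sub>R x + b)) \<in> schwartz"
  proof (rule schwartz_coinduct)
    fix f i assume "f \<in> ?S"
    then obtain c \<phi> where f: "f = (\<lambda>x. c * \<phi> (a *\<^sub>R x + b))" "\<phi> \<in> schwartz" by blast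
    have "partial_deriv i f = (\<lambda>x. (c * a) * partial_deriv i \<phi> (a *\<^sub>R x + b))"
    proof
      fix x
      have "linear (frechet_derivative \<phi> (at (a *\<^sub>R x + b)))"
        by (intro linear_frechet_derivative schwartz_differentiable f)
      moreover have "partial_deriv i f x = c * frechet_derivative \<phi> (at (a *\<^sub>R x + b)) (a *\<^sub>R axis i 1)"
        unfolding f(1) by (rule partial_deriv_eq[OF d[OF f(2)]])
      ultimately show "partial_deriv i f x = (c * a) * partial_deriv i \<phi> (a *\<^sub>R x + b)"
        by (simp only: linear_cmul partial_deriv_def[of i \<phi>]) (simp only: mult.assoc mult_scaleR_right scaleR_conv_of_real[where 'a=complex])
    qed
    then show "partial_deriv i f \<in> ?S" using schwartz_partial_deriv[OF f(2)] by (intro CollectI exI conjI)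
  next
    fix f x assume "f \<in> ?S"
    then obtain c \<phi> where "f = (\<lambda>x. c * \<phi> (a *\<^sub>R x + b))" "\<phi> \<in> schwartz" by blast
    then show "f differentiable (at x)" using d[of \<phi> c x] unfolding differentiable_def by blast
  next
    fix f assume "f \<in> ?S"
    then obtain c \<phi> where f: "f = (\<lambda>x. c * \<phi> (a *\<^sub>R x + b))" "\<phi> \<in> schwartz" by blast
    show "rapid f"
      unfolding rapid_def
    proof
      fix N
      obtain C where C: "\<And>x. (1 + norm x) ^ N * norm (\<phi> x) \<le> C"
        using schwartz_rapid[OF f(2)] by (auto simp: rapid_def)
      define L where "L = 1 + norm b / \<bar>a\<bar> + 1 / \<bar>a\<bar>"
      have L: "1 + norm x \<le> L * (1 + norm (a *\<^sub>R x + b))" for x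
      proof -
        have "norm x = norm ((a *\<^sub>R x + b) - b) / \<bar>a\<bar>" using assms by simp
        also have "\<dots> \<le> (norm (a *\<^sub>R x + b) + norm b) / \<bar>a\<bar>"
          by (intro divide_right_mono norm_triangle_ineq4) auto
        finally have "norm x \<le> norm (a *\<^sub>R x + b) / \<bar>a\<bar> + norm b / \<bar>a\<bar>" by (simp add: add_divide_distrib)
        moreover have "0 \<le> norm b / \<bar>a\<bar> * norm (a *\<^sub>R x + b)" "0 \<le> norm (a *\<^sub>R x + b)" "0 \<le> 1 / \<bar>a\<bar>"
          by simp_all
        moreover have "L * (1 + norm (a *\<^sub>R x + b)) = 1 + norm b / \<bar>a\<bar> + 1 / \<bar>a\<bar>
            + norm (a *\<^sub>R x + b) + norm b / \<bar>a\<bar> * norm (a *\<^sub>R x + b) + norm (a *\<^sub>R x + b) / \<bar>a\<bar>"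
          by (simp add: L_def ring_distribs)
        ultimately show ?thesis by linarith
      qed
      have L0: "L \<ge> 0" by (simp add: L_def)
      have "(1 + norm x) ^ N * norm (f x) \<le> L ^ N * (norm c * C)" for x
      proof -
        have "(1 + norm x) ^ N * norm (f x) \<le> (L * (1 + norm (a *\<^sub>R x + b))) ^ N * norm (f x)"
          by (intro mult_right_mono power_mono L) auto
        also have "\<dots> = L ^ N * (norm c * ((1 + norm (a *\<^sub>R x + b)) ^ N * norm (\<phi> (a *\<^sub>R x + b))))"
          by (simp add: f(1) norm_mult power_mult_distrib)
        also have "\<dots> \<le> L ^ N * (norm c * C)"
          by (intro mult_left_mono C) (auto simp: L0)
        finally show ?thesis .
      qed
      then show "\<exists>C. \<forall>x. (1 + norm x) ^ N * norm (f x) \<le> C" by blast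
    qed
  qed
  then show ?thesis by simp
qed

section \<open>The Gaussian\<close>

definition gauss :: "real^'n \<Rightarrow> complex" where
  "gauss x = of_real (exp (- pi * (x \<bullet> x)))"

lemma has_derivative_gauss: "(gauss has_derivative (\<lambda>h. of_real (- 2 * pi * (h \<bullet> x)) * gauss x)) (at x)"
  unfolding gauss_def
  by (auto intro!: derivative_eq_intros simp: inner_commute algebra_simps)

lemma partial_deriv_gauss: "partial_deriv i gauss x = of_real (- 2 * pi) * (of_real (x $ i) * gauss x)"
  by (subst partial_deriv_eq[OF has_derivative_gauss]) (simp add: inner_axis')

text \<open>The factors that differentiation places in front of a Gaussian.\<close>

inductive_set poly_fun :: "(real^'n \<Rightarrow> complex) set" where
  const: "(\<lambda>x. c) \<in> poly_fun"
| coord: "f \<in> poly_fun \<Longrightarrow> (\<lambda>x. of_real (x $ j) * f x) \<in> poly_fun"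
| add: "f \<in> poly_fun \<Longrightarrow> g \<in> poly_fun \<Longrightarrow> (\<lambda>x. f x + g x) \<in> poly_fun"

lemma poly_fun_cmult: "f \<in> poly_fun \<Longrightarrow> (\<lambda>x. c * f x) \<in> poly_fun"
proof (induction rule: poly_fun.induct)
  case (coord f j)
  then show ?case using poly_fun.coord[OF coord.IH, of j] by (simp add: ac_simps)
qed (auto intro: poly_fun.intros simp: distrib_left)

lemma poly_growth_coord_mult:
  assumes "poly_growth f" shows "poly_growth (\<lambda>x. complex_of_real (x $ j) * f x)"
proof -
  obtain C K where C: "\<And>x. norm (f x) \<le> C * (1 + norm x) ^ K" using assms by (auto simp: poly_growth_def)
  have "norm (complex_of_real (x $ j) * f x) \<le> C * (1 + norm x) ^ Suc K" for x
  proof -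
    have "norm (complex_of_real (x $ j) * f x) \<le> (1 + norm x) * (C * (1 + norm x) ^ K)"
      unfolding norm_mult using component_le_norm_cart[of x j] by (intro mult_mono C) auto
    then show ?thesis by (simp add: ac_simps)
  qed
  then show ?thesis unfolding poly_growth_def by blast
qed

lemma poly_growth_add:
  assumes "poly_growth f" "poly_growth g" shows "poly_growth (\<lambda>x. f x + g x)"
proof -
  obtain C K where C: "\<And>x. norm (f x) \<le> C * (1 + norm x) ^ K" using assms by (auto simp: poly_growth_def)
  obtain D J where D: "\<And>x. norm (g x) \<le> D * (1 + norm x) ^ J" using assms by (auto simp: poly_growth_def)
  have "norm (f x + g x) \<le> (\<bar>C\<bar> + \<bar>D\<bar>) * (1 + norm x) ^ (K + J)" for x
  proof -
    have "norm (f x) \<le> \<bar>C\<bar> * (1 + norm x) ^ K" by (rule order_trans[OF C]) (intro mult_right_mono, auto)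
    also have "\<dots> \<le> \<bar>C\<bar> * (1 + norm x) ^ (K + J)" by (intro mult_left_mono power_increasing) auto
    finally have 1: "norm (f x) \<le> \<bar>C\<bar> * (1 + norm x) ^ (K + J)" .
    have "norm (g x) \<le> \<bar>D\<bar> * (1 + norm x) ^ J" by (rule order_trans[OF D]) (intro mult_right_mono, auto)
    also have "\<dots> \<le> \<bar>D\<bar> * (1 + norm x) ^ (K + J)" by (intro mult_left_mono power_increasing) auto
    finally show ?thesis using 1 norm_triangle_ineq[of "f x" "g x"] by (simp add: distrib_right)
  qed
  then show ?thesis unfolding poly_growth_def by blast
qed

lemma poly_fun_props:
  assumes "f \<in> poly_fun"
  shows "f differentiable (at x) \<and> partial_deriv i f \<in> poly_fun \<and> poly_growth f"
  using assms
proof (induction arbitrary: x rule: poly_fun.induct)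
  case (coord f j)
  have d: "(\<lambda>x. complex_of_real (x $ j)) differentiable (at x)" for x
    using has_derivative_coord differentiable_def by blast
  have "partial_deriv i (\<lambda>x. of_real (x $ j) * f x) = (\<lambda>x. of_real (x $ j) * partial_deriv i f x + (if i = j then 1 else 0) * f x)"
    using coord d by (intro ext) (auto simp: partial_deriv_mult partial_deriv_coord)
  moreover have "\<dots> \<in> poly_fun" using coord by (auto intro!: poly_fun.intros poly_fun_cmult)
  ultimately show ?case using coord d by (auto intro: differentiable_mult poly_growth_coord_mult)
next
  case (add f g)
  have "partial_deriv i (\<lambda>x. f x + g x) = (\<lambda>x. partial_deriv i f x + partial_deriv i g x)"
    using add by (intro ext partial_deriv_add) auto
  moreover have "\<dots> \<in> poly_fun" using add by (auto intro!: poly_fun.intros)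
  ultimately show ?case using add by (auto intro: differentiable_add poly_growth_add)
qed (auto intro: poly_fun.intros poly_growth_const)

lemma power_div_fact_le_exp:
  assumes "0 \<le> (x::real)" shows "x ^ n / fact n \<le> exp x"
proof -
  have "(\<Sum>k\<in>{n}. x ^ k /\<^sub>R fact k) \<le> exp x"
    unfolding exp_def using assms by (intro sum_le_suminf summable_exp_generic) auto
  then show ?thesis by (simp add: divide_inverse mult.commute)
qed

lemma rapid_gauss: "rapid (gauss :: real^'n \<Rightarrow> complex)"
  unfolding rapid_def
proof
  fix N
  have "(1 + norm x) ^ N * norm (gauss x) \<le> fact N * exp 2" for x :: "real^'n"
  proof -
    let ?r = "norm x"
    have "(1 + ?r) ^ N / fact N \<le> exp (1 + ?r)" by (intro power_div_fact_le_exp) auto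
    then have "(1 + ?r) ^ N \<le> fact N * exp (1 + ?r)" by (simp add: field_simps)
    then have "(1 + ?r) ^ N * norm (gauss x) \<le> fact N * exp (1 + ?r) * exp (- pi * ?r\<^sup>2)"
      by (simp add: gauss_def power2_norm_eq_inner mult_right_mono)
    also have "\<dots> = fact N * exp (1 + ?r - pi * ?r\<^sup>2)" by (simp add: mult_exp_exp)
    also have "\<dots> \<le> fact N * exp 2"
    proof -
      have "?r - 1 * ?r\<^sup>2 \<le> 1"
        using zero_le_power2[of "?r - 1/2"] by (simp add: power2_eq_square algebra_simps)
      moreover have "1 * ?r\<^sup>2 \<le> pi * ?r\<^sup>2" using pi_gt3 by (intro mult_right_mono) auto
      ultimately show ?thesis by simp
    qed
    finally show ?thesis .
  qed
  then show "\<exists>C. \<forall>x. (1 + norm x) ^ N * norm ((gauss :: real^'n \<Rightarrow> complex) x) \<le> C" by blast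
qed

text \<open>Polynomials times the Gaussian are closed under derivatives and decay rapidly.\<close>

lemma schwartz_gauss: "(gauss :: real^'n \<Rightarrow> complex) \<in> schwartz"
proof -
  let ?S = "{\<lambda>x. f x * gauss x |f. f \<in> poly_fun} :: (real^'n \<Rightarrow> complex) set"
  have d: "gauss differentiable (at x)" for x :: "real^'n" using has_derivative_gauss differentiable_def by blast
  have "(\<lambda>x. 1 * gauss x) \<in> ?S" using poly_fun.const[of 1]
    by (intro CollectI exI[of _ "\<lambda>x. 1"] conjI refl)
  then have "(\<lambda>x. 1 * gauss x) \<in> (schwartz :: (real^'n \<Rightarrow> complex) set)"
  proof (rule schwartz_coinduct)
    fix g :: "real^'n \<Rightarrow> complex" and i assume "g \<in> ?S"
    then obtain f where f: "f \<in> poly_fun" "g = (\<lambda>x. f x * gauss x)" by blast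
    have "partial_deriv i g = (\<lambda>x. (of_real (- 2 * pi) * (of_real (x $ i) * f x) + partial_deriv i f x) * gauss x)"
      unfolding f(2) using poly_fun_props[OF f(1)] d
      by (intro ext) (auto simp: partial_deriv_mult partial_deriv_gauss algebra_simps)
    moreover have "(\<lambda>x. of_real (- 2 * pi) * (of_real (x $ i) * f x) + partial_deriv i f x) \<in> poly_fun"
      using poly_fun_props[OF f(1)] f(1) by (intro poly_fun.intros poly_fun_cmult) auto
    ultimately show "partial_deriv i g \<in> ?S" by (intro CollectI exI conjI)
  next
    fix g :: "real^'n \<Rightarrow> complex" and x assume "g \<in> ?S"
    then obtain f where f: "f \<in> poly_fun" "g = (\<lambda>x. f x * gauss x)" by blast
    show "g differentiable (at x)"
      unfolding f(2) using poly_fun_props[OF f(1)] d by (intro differentiable_mult) auto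
  next
    fix g :: "real^'n \<Rightarrow> complex" assume "g \<in> ?S"
    then obtain f where f: "f \<in> poly_fun" "g = (\<lambda>x. f x * gauss x)" by blast
    show "rapid g"
      unfolding f(2) using poly_fun_props[OF f(1)] rapid_gauss by (intro rapid_mult) auto
  qed
  then show ?thesis by simp
qed

section \<open>Fourier transform of Schwartz functions\<close>

text \<open>The integrand is at most the product of \<open>1 / (1 + x\<^sub>i\<^sup>2)\<close> over the coordinates.\<close>

lemma integrable_inverse_power:
  "integrable lborel (\<lambda>x::real^'n. inverse ((1 + norm x) ^ (2 * CARD('n))))"
proof (rule integrableI_bounded)
  have 1: "(\<integral>\<^sup>+t. ennreal (inverse (1 + t\<^sup>2)) \<partial>lborel) < \<infinity>"
    using integrable_inverse_1_plus_square
    by (simp add: set_integrable_def einterval_def integrable_iff_bounded)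
  have "(\<integral>\<^sup>+x. ennreal (norm (inverse ((1 + norm (x::real^'n)) ^ (2 * CARD('n))))) \<partial>lborel)
    \<le> (\<integral>\<^sup>+x. (\<Prod>b\<in>(Basis::(real^'n) set). ennreal (inverse (1 + (x \<bullet> b)\<^sup>2))) \<partial>lborel)"
  proof (intro nn_integral_mono)
    fix x :: "real^'n"
    have "(\<Prod>b\<in>(Basis::(real^'n) set). inverse ((1 + norm x)\<^sup>2)) \<le> (\<Prod>b\<in>Basis. inverse (1 + (x \<bullet> b)\<^sup>2))"
    proof (intro prod_mono conjI le_imp_inverse_le)
      fix b :: "real^'n" assume "b \<in> Basis"
      then have "(x \<bullet> b)\<^sup>2 \<le> (norm x)\<^sup>2"
        using Basis_le_norm[of b x] by (metis abs_ge_zero power2_abs power_mono)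
      then show "1 + (x \<bullet> b)\<^sup>2 \<le> (1 + norm x)\<^sup>2" by (simp add: power2_sum add_increasing2)
      show "0 < 1 + (x \<bullet> b)\<^sup>2" by (simp add: add_pos_nonneg)
    qed auto
    then have "inverse ((1 + norm x) ^ (2 * CARD('n))) \<le> (\<Prod>b\<in>Basis. inverse (1 + (x \<bullet> b)\<^sup>2))"
      by (simp add: power_mult power_inverse)
    then show "ennreal (norm (inverse ((1 + norm x) ^ (2 * CARD('n))))) \<le> (\<Prod>b\<in>Basis. ennreal (inverse (1 + (x \<bullet> b)\<^sup>2)))"
      by (subst prod_ennreal) (auto intro: ennreal_leI simp: add_nonneg_nonneg)
  qed
  also have "\<dots> = (\<Prod>b\<in>(Basis::(real^'n) set). (\<integral>\<^sup>+t. ennreal (inverse (1 + t\<^sup>2)) \<partial>lborel))"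
    by (rule nn_integral_lborel_prod) auto
  also have "\<dots> < \<infinity>"
  proof -
    obtain c where "(\<integral>\<^sup>+t. ennreal (inverse (1 + t\<^sup>2)) \<partial>lborel) = ennreal c" "0 \<le> c"
      using 1 by (metis ennreal_cases infinity_ennreal_def less_irrefl)
    then show ?thesis by (simp add: ennreal_power)
  qed
  finally show "(\<integral>\<^sup>+x. ennreal (norm (inverse ((1 + norm (x::real^'n)) ^ (2 * CARD('n))))) \<partial>lborel) < \<infinity>" .
qed measurable

lemma rapid_bound:
  fixes \<phi> :: "real^'n \<Rightarrow> complex"
  assumes "rapid \<phi>"
  shows "\<exists>C. \<forall>x. norm (\<phi> x) \<le> C * inverse ((1 + norm x) ^ K)"
proof -
  obtain C where C: "\<And>x. (1 + norm x) ^ K * norm (\<phi> x) \<le> C"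
    using assms by (auto simp: rapid_def)
  have "norm (\<phi> x) \<le> C * inverse ((1 + norm x) ^ K)" for x
  proof -
    have "(1 + norm x) ^ K > 0" by (intro zero_less_power) (auto simp: add_pos_nonneg)
    then show ?thesis using C[of x] by (simp add: field_simps)
  qed
  then show ?thesis by blast
qed

lemma integrable_rapid:
  fixes \<phi> :: "real^'n \<Rightarrow> complex"
  assumes "rapid \<phi>" and [measurable]: "\<phi> \<in> borel_measurable borel"
  shows "integrable lborel \<phi>"
proof -
  obtain C where "\<And>x. norm (\<phi> x) \<le> C * inverse ((1 + norm x) ^ (2 * CARD('n)))"
    using rapid_bound[OF assms(1)] by blast
  then show ?thesis
    by (intro Bochner_Integration.integrable_bound[OF integrable_mult_right[OF integrable_inverse_power, of C]])
      (auto intro!: AE_I2 intro: order_trans[OF _ abs_ge_self])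
qed

lemma integrable_schwartz: "\<phi> \<in> schwartz \<Longrightarrow> integrable lborel \<phi>"
  by (intro integrable_rapid schwartz_rapid measurable_schwartz)

lemma bounded_schwartz: "\<phi> \<in> schwartz \<Longrightarrow> \<exists>C. \<forall>x. norm (\<phi> x) \<le> C"
  using rapid_bound[OF schwartz_rapid, of \<phi> 0] by simp

text \<open>The difference quotients of \<open>\<psi>\<close> have integral zero by invariance, and they converge to the
  derivative under the dominating function \<open>w\<close>.  This serves as integration by parts both on the whole
  space and, for periodic functions, on a period cell.\<close>

lemma integral_partial_deriv_eq_0:
  fixes \<psi> :: "real^'n \<Rightarrow> complex"
  assumes diff: "\<And>x. \<psi> differentiable (at x)"
    and M: "sets M = sets borel \<or> sets M = sets (restrict_space borel (space M))"
    and [measurable]: "partial_deriv j \<psi> \<in> borel_measurable borel"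
    and int: "\<And>h. 0 \<le> h \<Longrightarrow> h \<le> 1 \<Longrightarrow> integrable M (\<lambda>x. \<psi> (x + h *\<^sub>R axis j 1))"
    and inv: "\<And>h. 0 \<le> h \<Longrightarrow> h \<le> 1 \<Longrightarrow> (LINT x|M. \<psi> (x + h *\<^sub>R axis j 1)) = (LINT x|M. \<psi> x)"
    and w: "integrable M w"
    and le: "\<And>x s. 0 \<le> s \<Longrightarrow> s \<le> 1 \<Longrightarrow> norm (partial_deriv j \<psi> (x + s *\<^sub>R axis j 1)) \<le> w x"
  shows "(LINT x|M. partial_deriv j \<psi> x) = 0"
proof -
  let ?e = "axis j 1 :: real^'n"
  let ?q = "\<lambda>m x. of_nat (Suc m) * (\<psi> (x + (1 / real (Suc m)) *\<^sub>R ?e) - \<psi> x)"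
  have line: "((\<lambda>s. \<psi> (x + s *\<^sub>R ?e)) has_vector_derivative partial_deriv j \<psi> (x + s *\<^sub>R ?e)) (at s)" for x s
  proof -
    let ?D = "frechet_derivative \<psi> (at (x + s *\<^sub>R ?e))"
    have D: "(\<psi> has_derivative ?D) (at (x + s *\<^sub>R ?e))"
      by (intro differentiable_has_derivative diff)
    have "((\<lambda>s. \<psi> (x + s *\<^sub>R ?e)) has_derivative (\<lambda>h. ?D (h *\<^sub>R ?e))) (at s)"
      by (rule has_derivative_compose[where f="\<lambda>s. x + s *\<^sub>R ?e" and g=\<psi>, OF _ D]) (auto intro!: derivative_eq_intros)
    moreover have "?D (h *\<^sub>R ?e) = h *\<^sub>R ?D ?e" for h
      by (rule linear_cmul[OF has_derivative_linear[OF D]])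
    ultimately show ?thesis by (simp add: has_vector_derivative_def partial_deriv_def)
  qed
  have cont: "continuous_on UNIV \<psi>"
    using diff by (meson continuous_at_imp_continuous_on differentiable_imp_continuous_within)
  have borel: "f \<in> borel_measurable M" if f: "f \<in> borel_measurable borel" for f :: "real^'n \<Rightarrow> complex"
  proof (cases "sets M = sets borel")
    case True
    show ?thesis unfolding measurable_cong_sets[OF True refl] by (rule f)
  next
    case False
    with M have "sets M = sets (restrict_space borel (space M))" by simp
    show ?thesis
      unfolding measurable_cong_sets[OF \<open>sets M = sets (restrict_space borel (space M))\<close> refl]
      by (rule measurable_restrict_space1[OF f])
  qed
  have "(\<lambda>m. LINT x|M. ?q m x) \<longlonglongrightarrow> (LINT x|M. partial_deriv j \<psi> x)"
  proof (rule integral_dominated_convergence[OF _ _ w])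
    show "partial_deriv j \<psi> \<in> borel_measurable M" by (rule borel) measurable
    show "?q m \<in> borel_measurable M" for m
      by (intro borel borel_measurable_continuous_onI continuous_intros continuous_on_compose2[OF cont]) auto
    show "AE x in M. (\<lambda>m. ?q m x) \<longlonglongrightarrow> partial_deriv j \<psi> x"
    proof (rule AE_I2)
      fix x
      let ?D = "frechet_derivative \<psi> (at x)"
      let ?h = "\<lambda>m. (1 / real (Suc m)) *\<^sub>R ?e"
      have D: "(\<psi> has_derivative ?D) (at x)" by (intro differentiable_has_derivative diff)
      then have "((\<lambda>h. norm (\<psi> (x + h) - \<psi> x - ?D h) / norm h) \<longlongrightarrow> 0) (at 0)"
        by (simp add: has_derivative_at)
      moreover have "filterlim ?h (at 0) sequentially"
      proof (rule filterlim_atI)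
        have "(\<lambda>m. (1 / real (Suc m)) *\<^sub>R ?e) \<longlonglongrightarrow> 0 *\<^sub>R ?e"
          by (intro tendsto_scaleR tendsto_const LIMSEQ_Suc[OF lim_1_over_n])
        then show "?h \<longlonglongrightarrow> 0" by simp
      qed (simp add: axis_eq_0_iff)
      ultimately have "(\<lambda>m. norm (\<psi> (x + ?h m) - \<psi> x - ?D (?h m)) / norm (?h m)) \<longlonglongrightarrow> 0"
        by (rule filterlim_compose)
      moreover have "norm (\<psi> (x + ?h m) - \<psi> x - ?D (?h m)) / norm (?h m) = norm (?q m x - partial_deriv j \<psi> x)" for m
      proof -
        have "?D (?h m) = (1 / real (Suc m)) *\<^sub>R partial_deriv j \<psi> x"
          unfolding partial_deriv_def by (rule linear_cmul[OF has_derivative_linear[OF D]])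
        then have "?q m x - partial_deriv j \<psi> x = of_nat (Suc m) * (\<psi> (x + ?h m) - \<psi> x - ?D (?h m))"
          by (simp add: scaleR_conv_of_real field_simps del: of_nat_Suc)
        then show ?thesis by (simp add: norm_mult del: of_nat_Suc)
      qed
      ultimately have "(\<lambda>m. norm (?q m x - partial_deriv j \<psi> x)) \<longlonglongrightarrow> 0" by (simp only:)
      then show "(\<lambda>m. ?q m x) \<longlonglongrightarrow> partial_deriv j \<psi> x"
        by (rule LIM_zero_cancel[OF tendsto_norm_zero_cancel])
    qed
    show "AE x in M. norm (?q m x) \<le> w x" for m
    proof (rule AE_I2)
      fix x
      have "norm (\<psi> (x + (1 / real (Suc m)) *\<^sub>R ?e) - \<psi> (x + 0 *\<^sub>R ?e)) \<le> w x * norm (1 / real (Suc m) - 0)"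
      proof (rule differentiable_bound[of "{0..1}" "\<lambda>s. \<psi> (x + s *\<^sub>R ?e)" "\<lambda>s h. h *\<^sub>R partial_deriv j \<psi> (x + s *\<^sub>R ?e)"])
        show "((\<lambda>s. \<psi> (x + s *\<^sub>R ?e)) has_derivative (\<lambda>h. h *\<^sub>R partial_deriv j \<psi> (x + s *\<^sub>R ?e))) (at s within {0..1})" for s
          using line[of x s] by (auto simp: has_vector_derivative_def intro: has_derivative_at_withinI)
        show "onorm (\<lambda>h. h *\<^sub>R partial_deriv j \<psi> (x + s *\<^sub>R ?e)) \<le> w x" if "s \<in> {0..1}" for s
          using le[of s x] that
          by (intro onorm_le) (auto simp: mult.commute intro: mult_left_mono)
      qed auto
      then show "norm (?q m x) \<le> w x"
        unfolding norm_mult norm_of_nat by (simp add: field_simps del: of_nat_Suc)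
    qed
  qed
  moreover have "(LINT x|M. ?q m x) = 0" for m
  proof -
    have "(LINT x|M. ?q m x) = of_nat (Suc m) * ((LINT x|M. \<psi> (x + (1 / real (Suc m)) *\<^sub>R ?e)) - (LINT x|M. \<psi> x))"
      using int[of "1 / real (Suc m)"] int[of 0] by simp
    then show ?thesis using inv[of "1 / real (Suc m)"] by simp
  qed
  ultimately have "(\<lambda>m. 0) \<longlonglongrightarrow> (LINT x|M. partial_deriv j \<psi> x)" by (simp only:)
  then show ?thesis by (simp add: LIMSEQ_const_iff)
qed

lemma integral_lborel_translate:
  fixes f :: "real^'n \<Rightarrow> complex"
  shows "(LINT x|lborel. f (x + a)) = (LINT x|lborel. f x)"
proof -
  have "(LINT x|lborel. f x) = (LINT x|distr lborel borel ((+) a). f x)" by (simp add: lborel_distr_plus)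
  also have "\<dots> = (LINT x|lborel. f (a + x))"
  proof (cases "f \<in> borel_measurable borel")
    case True
    then show ?thesis by (intro integral_distr) auto
  next
    case False
    have "(\<lambda>x. f (a + x)) \<notin> borel_measurable borel"
    proof
      assume "(\<lambda>x. f (a + x)) \<in> borel_measurable borel"
      then have "(\<lambda>x. f (a + (x - a))) \<in> borel_measurable borel" by measurable
      then show False using False by simp
    qed
    then show ?thesis using False
      by (simp add: lborel_distr_plus not_integrable_integral_eq borel_measurable_integrable integrable_iff_bounded)
  qed
  finally show ?thesis by (simp add: add.commute)
qed

lemma integral_partial_deriv_schwartz:
  fixes \<psi> :: "real^'n \<Rightarrow> complex"
  assumes "\<psi> \<in> schwartz" shows "(LINT x|lborel. partial_deriv j \<psi> x) = 0"
proof -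
  let ?K = "2 * CARD('n)"
  obtain C where C: "\<And>x. norm (partial_deriv j \<psi> x) \<le> C * inverse ((1 + norm x) ^ ?K)"
    using rapid_bound[OF schwartz_rapid[OF schwartz_partial_deriv[OF assms]]] by blast
  have "0 \<le> norm (partial_deriv j \<psi> 0)" by simp
  also have "\<dots> \<le> C" using C[of 0] by simp
  finally have C0: "0 \<le> C" .
  show ?thesis
  proof (rule integral_partial_deriv_eq_0)
    show "integrable lborel (\<lambda>x::real^'n. C * 2 ^ ?K * inverse ((1 + norm x) ^ ?K))"
      by (intro integrable_mult_right integrable_inverse_power)
    fix x :: "real^'n" and s :: real assume s: "0 \<le> s" "s \<le> 1"
    let ?y = "x + s *\<^sub>R axis j 1"
    have "norm x = norm (?y - s *\<^sub>R axis j 1)" by simp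
    also have "\<dots> \<le> norm ?y + norm (s *\<^sub>R axis j 1 :: real^'n)" by (rule norm_triangle_ineq4)
    also have "\<dots> \<le> norm ?y + 1" using s by simp
    finally have "norm x \<le> norm ?y + 1" .
    moreover have "1 + a \<le> 2 * (1 + b)" if "a \<le> b + 1" "0 \<le> b" for a b :: real
      using that by simp
    ultimately have "1 + norm x \<le> 2 * (1 + norm ?y)" using norm_ge_zero by blast
    then have "(1 + norm x) ^ ?K \<le> (2 * (1 + norm ?y)) ^ ?K" by (intro power_mono) auto
    then have "inverse ((2 * (1 + norm ?y)) ^ ?K) \<le> inverse ((1 + norm x) ^ ?K)"
      by (intro le_imp_inverse_le zero_less_power) (auto simp: add_pos_nonneg)
    then have "2 ^ ?K * inverse ((2 * (1 + norm ?y)) ^ ?K) \<le> 2 ^ ?K * inverse ((1 + norm x) ^ ?K)"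
      by (intro mult_left_mono) auto
    moreover have "2 ^ ?K * inverse ((2 * b) ^ ?K) = inverse (b ^ ?K)" for b :: real
      by (simp add: power_mult_distrib)
    ultimately have "inverse ((1 + norm ?y) ^ ?K) \<le> 2 ^ ?K * inverse ((1 + norm x) ^ ?K)" by (simp only:)
    then have "C * inverse ((1 + norm ?y) ^ ?K) \<le> C * (2 ^ ?K * inverse ((1 + norm x) ^ ?K))"
      using C0 by (rule mult_left_mono)
    then show "norm (partial_deriv j \<psi> ?y) \<le> C * 2 ^ ?K * inverse ((1 + norm x) ^ ?K)"
      using C[of ?y] by (simp add: mult.assoc)
  next
    fix h :: real
    have "(\<lambda>x. \<psi> (1 *\<^sub>R x + h *\<^sub>R axis j 1)) \<in> schwartz" using assms by (rule schwartz_affine) simp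
    then show "integrable lborel (\<lambda>x. \<psi> (x + h *\<^sub>R axis j 1))" by (simp add: integrable_schwartz)
  qed (use assms in \<open>auto intro: schwartz_differentiable measurable_schwartz schwartz_partial_deriv integral_lborel_translate\<close>)
qed

text \<open>The derivative of \<open>\<phi>\<close> times a character has integral zero.\<close>

lemma fourier_partial_deriv:
  assumes "\<phi> \<in> schwartz"
  shows "fourier (partial_deriv j \<phi>) \<xi> = 2 * pi * \<i> * of_real (\<xi> $ j) * fourier \<phi> \<xi>"
proof -
  let ?\<psi> = "\<lambda>x. \<phi> x * chi (- \<xi>) x"
  have s: "?\<psi> \<in> schwartz" "(\<lambda>x. partial_deriv j \<phi> x * chi (- \<xi>) x) \<in> schwartz"
    by (intro schwartz_chi schwartz_partial_deriv assms)+
  have "partial_deriv j ?\<psi> x = partial_deriv j \<phi> x * chi (- \<xi>) x - (2 * pi * \<i> * of_real (\<xi> $ j)) * ?\<psi> x" for x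
    by (subst partial_deriv_mult) (auto simp: schwartz_differentiable[OF assms] differentiable_chi partial_deriv_chi)
  then have "(LINT x|lborel. partial_deriv j ?\<psi> x)
      = fourier (partial_deriv j \<phi>) \<xi> - 2 * pi * \<i> * of_real (\<xi> $ j) * fourier \<phi> \<xi>"
    using s by (simp add: fourier_eq integrable_schwartz del: of_real_mult)
  then show ?thesis using integral_partial_deriv_schwartz[OF s(1), of j] by simp
qed

lemma norm_fourier_le: "norm (fourier \<phi> \<xi>) \<le> (LINT x|lborel. norm (\<phi> x))"
  unfolding fourier_eq by (rule order_trans[OF integral_norm_bound]) (simp add: norm_mult)

lemma chi_taylor: "norm (chi a x - 1 - 2 * pi * \<i> * of_real (x \<bullet> a)) \<le> 2 * pi\<^sup>2 * (norm x * norm a)\<^sup>2"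
proof -
  let ?t = "2 * pi * (x \<bullet> a)"
  have "norm (chi a x - 1 - 2 * pi * \<i> * of_real (x \<bullet> a)) = norm (iexp ?t - (\<Sum>k\<le>1. (\<i> * of_real ?t) ^ k / fact k))"
    by (simp add: chi_def cis_conv_exp algebra_simps)
  also have "\<dots> \<le> \<bar>?t\<bar> ^ Suc 1 / fact (Suc 1)" by (rule iexp_approx1)
  also have "\<dots> = 2 * pi\<^sup>2 * (x \<bullet> a)\<^sup>2" by (simp add: power2_eq_square)
  also have "\<dots> \<le> 2 * pi\<^sup>2 * (norm x * norm a)\<^sup>2"
    using Cauchy_Schwarz_ineq2[of x a] by (intro mult_left_mono) (auto simp: abs_le_square_iff[symmetric] abs_mult)
  finally show ?thesis .
qed

text \<open>The second-order remainder of the character is at most quadratic in the frequency increment, with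
  an integrable coefficient.\<close>

lemma has_derivative_fourier:
  fixes \<phi> :: "real^'n \<Rightarrow> complex"
  assumes "\<phi> \<in> schwartz"
  defines "m \<equiv> \<lambda>j x. - 2 * pi * \<i> * (of_real (x $ j) * \<phi> x)"
  shows "(fourier \<phi> has_derivative (\<lambda>h. \<Sum>j\<in>UNIV. of_real (h $ j) * fourier (m j) \<xi>)) (at \<xi>)"
proof -
  let ?D = "\<lambda>h. \<Sum>j\<in>UNIV. of_real (h $ j) * fourier (m j) \<xi>"
  have m: "m j \<in> schwartz" for j
    unfolding m_def by (intro schwartz_cmult schwartz_coord assms)
  have bl: "bounded_linear ?D"
    by (intro bounded_linear_sum bounded_linear_mult_const bounded_linear_compose[OF bounded_linear_of_real bounded_linear_vec_nth])
  let ?w = "\<lambda>x. norm x * norm x * norm (\<phi> x)"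
  have w: "integrable lborel ?w"
  proof -
    have "rapid (\<lambda>x. of_real (norm x * norm x) * \<phi> x)"
    proof (rule rapid_mult[OF _ schwartz_rapid[OF assms(1)]])
      show "poly_growth (\<lambda>x. of_real (norm x * norm x))"
        unfolding poly_growth_def
        by (intro exI[of _ 1] exI[of _ 2]) (auto simp: power2_eq_square norm_mult intro!: mult_mono)
    qed
    then have "integrable lborel (\<lambda>x. of_real (norm x * norm x) * \<phi> x)"
      using measurable_schwartz[OF assms(1)] by (intro integrable_rapid) measurable
    from integrable_norm[OF this] show ?thesis by (simp add: norm_mult)
  qed
  define C where "C = 2 * pi\<^sup>2 * (LINT x|lborel. ?w x)"
  have main: "norm (fourier \<phi> \<zeta> - fourier \<phi> \<xi> - ?D (\<zeta> - \<xi>)) \<le> C * norm (\<zeta> - \<xi>) ^ 2" for \<zeta>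
  proof -
    let ?h = "\<zeta> - \<xi>"
    let ?r = "\<lambda>x. \<phi> x * chi (- \<xi>) x * (chi (- ?h) x - 1 - 2 * pi * \<i> * of_real (x \<bullet> (- ?h)))"
    have int: "integrable lborel (\<lambda>x. m j x * chi (- \<xi>) x)" "integrable lborel (\<lambda>x. \<phi> x * chi (- \<xi>) x)"
      "integrable lborel (\<lambda>x. \<phi> x * chi (- \<zeta>) x)" for j
      by (intro integrable_schwartz schwartz_chi m assms)+
    have "?r x = \<phi> x * chi (- \<zeta>) x - \<phi> x * chi (- \<xi>) x - (\<Sum>j\<in>UNIV. of_real (?h $ j) * (m j x * chi (- \<xi>) x))" for x
    proof -
      have 1: "chi (- \<zeta>) x = chi (- \<xi>) x * chi (- ?h) x"
        by (simp flip: chi_add(1))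
      have "(\<Sum>j\<in>UNIV. of_real (x $ j * (?h $ j))) = complex_of_real (x \<bullet> ?h)"
        by (simp add: inner_vec_def)
      moreover have "(\<Sum>j\<in>UNIV. of_real (?h $ j) * (m j x * chi (- \<xi>) x))
          = (- 2 * pi * \<i>) * (\<Sum>j\<in>UNIV. of_real (x $ j * (?h $ j))) * (\<phi> x * chi (- \<xi>) x)"
        unfolding m_def sum_distrib_left sum_distrib_right by (intro sum.cong) (auto simp: ac_simps)
      ultimately have 2: "(\<Sum>j\<in>UNIV. of_real (?h $ j) * (m j x * chi (- \<xi>) x))
          = (- 2 * pi * \<i>) * of_real (x \<bullet> ?h) * (\<phi> x * chi (- \<xi>) x)" by (simp only:)
      show ?thesis unfolding 1 2 inner_minus_right of_real_minus by (simp add: algebra_simps)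
    qed
    then have "(LINT x|lborel. ?r x) = fourier \<phi> \<zeta> - fourier \<phi> \<xi> - ?D ?h"
      using int by (simp add: fourier_eq)
    moreover have "norm (LINT x|lborel. ?r x) \<le> (LINT x|lborel. 2 * pi\<^sup>2 * norm ?h ^ 2 * ?w x)"
    proof (rule Bochner_Integration.integral_norm_bound_integral)
      have "integrable lborel (\<lambda>x. \<phi> x * chi (- \<zeta>) x - \<phi> x * chi (- \<xi>) x - (\<Sum>j\<in>UNIV. of_real (?h $ j) * (m j x * chi (- \<xi>) x)))"
        by (intro Bochner_Integration.integrable_diff Bochner_Integration.integrable_sum integrable_mult_right int)
      then show "integrable lborel ?r" using \<open>\<And>x. ?r x = _\<close> by simp
      show "integrable lborel (\<lambda>x. 2 * pi\<^sup>2 * norm ?h ^ 2 * ?w x)" using w by (rule integrable_mult_right)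
      fix x
      have "norm (?r x) = norm (\<phi> x) * norm (chi (- ?h) x - 1 - 2 * pi * \<i> * of_real (x \<bullet> (- ?h)))"
        by (simp only: norm_mult norm_chi mult_1_right)
      also have "\<dots> \<le> norm (\<phi> x) * (2 * pi\<^sup>2 * (norm x * norm (- ?h))\<^sup>2)"
        by (intro mult_left_mono chi_taylor) auto
      finally show "norm (?r x) \<le> 2 * pi\<^sup>2 * norm ?h ^ 2 * ?w x"
        by (simp only: norm_minus_cancel power2_eq_square) (simp only: ac_simps)
    qed
    ultimately show ?thesis by (simp only: integral_mult_right_zero C_def) (simp only: ac_simps)
  qed
  show ?thesis
  proof (rule has_derivativeI_sandwich[where e=1 and H="\<lambda>\<zeta>. C * norm (\<zeta> - \<xi>)"])
    fix \<zeta> assume "\<zeta> \<noteq> \<xi>"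
    then have "norm (\<zeta> - \<xi>) > 0" by simp
    then show "norm (fourier \<phi> \<zeta> - fourier \<phi> \<xi> - ?D (\<zeta> - \<xi>)) / norm (\<zeta> - \<xi>) \<le> C * norm (\<zeta> - \<xi>)"
      using main[of \<zeta>] by (simp add: pos_divide_le_eq power2_eq_square mult.assoc)
  next
    have "((\<lambda>\<zeta>. C * norm (\<zeta> - \<xi>)) \<longlongrightarrow> C * norm (\<xi> - \<xi>)) (at \<xi>)" by (intro tendsto_intros)
    then show "((\<lambda>\<zeta>. C * norm (\<zeta> - \<xi>)) \<longlongrightarrow> 0) (at \<xi>)" by simp
  qed (auto simp: bl)
qed

lemma partial_deriv_fourier:
  assumes "\<phi> \<in> schwartz"
  shows "partial_deriv j (fourier \<phi>) = fourier (\<lambda>x. - 2 * pi * \<i> * (of_real (x $ j) * \<phi> x))"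
proof
  fix \<xi>
  have "partial_deriv j (fourier \<phi>) \<xi> = (\<Sum>i\<in>UNIV. of_real (axis j 1 $ i) * fourier (\<lambda>x. - 2 * pi * \<i> * (of_real (x $ i) * \<phi> x)) \<xi>)"
    by (rule partial_deriv_eq[OF has_derivative_fourier[OF assms]])
  also have "\<dots> = (\<Sum>i\<in>UNIV. if i = j then fourier (\<lambda>x. - 2 * pi * \<i> * (of_real (x $ i) * \<phi> x)) \<xi> else 0)"
    by (intro sum.cong) (auto simp: axis_def)
  finally show "partial_deriv j (fourier \<phi>) \<xi> = fourier (\<lambda>x. - 2 * pi * \<i> * (of_real (x $ j) * \<phi> x)) \<xi>"
    by simp
qed

text \<open>Each power of \<open>\<xi>\<close> is traded for a derivative of \<open>\<phi>\<close>, whose transform is bounded.\<close>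

lemma rapid_fourier:
  fixes \<phi> :: "real^'n \<Rightarrow> complex"
  assumes "\<phi> \<in> schwartz" shows "rapid (fourier \<phi>)"
  unfolding rapid_def
proof
  fix N
  show "\<exists>C. \<forall>\<xi>. (1 + norm \<xi>) ^ N * norm (fourier \<phi> \<xi>) \<le> C"
    using assms
  proof (induction N arbitrary: \<phi>)
    case 0
    then show ?case using norm_fourier_le by auto
  next
    case (Suc N)
    obtain C where C: "\<And>\<xi>. (1 + norm \<xi>) ^ N * norm (fourier \<phi> \<xi>) \<le> C" using Suc by blast
    have "\<forall>j. \<exists>C. \<forall>\<xi>. (1 + norm \<xi>) ^ N * norm (fourier (partial_deriv j \<phi>) \<xi>) \<le> C"
      using Suc schwartz_partial_deriv by blast
    then obtain D where D: "\<And>j \<xi>. (1 + norm \<xi>) ^ N * norm (fourier (partial_deriv j \<phi>) \<xi>) \<le> D j" by metis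
    have "(1 + norm \<xi>) ^ Suc N * norm (fourier \<phi> \<xi>) \<le> C + (\<Sum>j\<in>UNIV. D j)" for \<xi>
    proof -
      have "(1 + norm \<xi>) * norm (fourier \<phi> \<xi>) \<le> (1 + (\<Sum>j\<in>UNIV. \<bar>\<xi> $ j\<bar>)) * norm (fourier \<phi> \<xi>)"
        by (intro mult_right_mono add_left_mono norm_le_l1_cart) auto
      also have "\<dots> \<le> norm (fourier \<phi> \<xi>) + (\<Sum>j\<in>UNIV. norm (fourier (partial_deriv j \<phi>) \<xi>))"
      proof -
        have "\<bar>\<xi> $ j\<bar> * norm (fourier \<phi> \<xi>) \<le> norm (fourier (partial_deriv j \<phi>) \<xi>)" for j
        proof -
          have "1 * (\<bar>\<xi> $ j\<bar> * norm (fourier \<phi> \<xi>)) \<le> (2 * pi) * (\<bar>\<xi> $ j\<bar> * norm (fourier \<phi> \<xi>))"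
            using pi_gt3 by (intro mult_right_mono) auto
          then show ?thesis by (simp add: fourier_partial_deriv Suc.prems norm_mult)
        qed
        then show ?thesis by (simp add: distrib_right sum_distrib_right sum_mono)
      qed
      finally have "(1 + norm \<xi>) ^ N * ((1 + norm \<xi>) * norm (fourier \<phi> \<xi>))
        \<le> (1 + norm \<xi>) ^ N * (norm (fourier \<phi> \<xi>) + (\<Sum>j\<in>UNIV. norm (fourier (partial_deriv j \<phi>) \<xi>)))"
        by (intro mult_left_mono) auto
      also have "\<dots> \<le> C + (\<Sum>j\<in>UNIV. D j)"
        unfolding distrib_left sum_distrib_left by (intro add_mono C sum_mono D)
      finally show ?thesis by (simp add: ac_simps)
    qed
    then show ?case by blast
  qed
qed

lemma fourier_schwartz: assumes "\<phi> \<in> schwartz" shows "fourier \<phi> \<in> schwartz"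
proof (rule schwartz_coinduct)
  show "fourier \<phi> \<in> fourier ` schwartz" using assms by blast
next
  fix f :: "real^'n \<Rightarrow> complex" and i assume "f \<in> fourier ` schwartz"
  then obtain \<phi> where "f = fourier \<phi>" "\<phi> \<in> schwartz" by blast
  then show "partial_deriv i f \<in> fourier ` schwartz"
    by (simp only: partial_deriv_fourier) (intro imageI schwartz_cmult schwartz_coord)
next
  fix f :: "real^'n \<Rightarrow> complex" and x assume "f \<in> fourier ` schwartz"
  then show "f differentiable (at x)" using has_derivative_fourier unfolding differentiable_def by blast
qed (auto intro: rapid_fourier)

section \<open>Fourier inversion and uniqueness on the whole space\<close>

lemma Fubini_kernel:
  fixes f :: "'a \<Rightarrow> complex" and g :: "'b \<Rightarrow> complex"
  assumes "pair_sigma_finite M1 M2" and f: "integrable M1 f" and g: "integrable M2 g"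
    and k [measurable]: "(\<lambda>(x, y). k x y) \<in> borel_measurable (M1 \<Otimes>\<^sub>M M2)"
    and C: "\<And>x y. norm (k x y) \<le> C"
  shows "(LINT x|M1. f x * (LINT y|M2. g y * k x y)) = (LINT y|M2. g y * (LINT x|M1. f x * k x y))"
proof -
  interpret P: pair_sigma_finite M1 M2 by fact
  note [measurable] = borel_measurable_integrable[OF f] borel_measurable_integrable[OF g]
  let ?F = "\<lambda>x y. f x * (g y * k x y)"
  have int_y: "integrable M2 (?F x)" if "x \<in> space M1" for x
  proof -
    have [measurable]: "k x \<in> borel_measurable M2" using that by measurable
    show ?thesis
    proof (rule Bochner_Integration.integrable_bound[OF integrable_mult_right[OF g, of "f x * of_real C"]])
      show "AE y in M2. norm (?F x y) \<le> norm (f x * of_real C * g y)"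
      proof (rule AE_I2)
        fix y
        have "norm (g y * k x y) \<le> norm (g y) * \<bar>C\<bar>"
          unfolding norm_mult using C[of x y] by (intro mult_left_mono) auto
        then have "norm (f x) * norm (g y * k x y) \<le> norm (f x) * (norm (g y) * \<bar>C\<bar>)"
          by (intro mult_left_mono) auto
        then show "norm (?F x y) \<le> norm (f x * of_real C * g y)" by (simp add: norm_mult ac_simps)
      qed
    qed measurable
  qed
  have int: "integrable (M1 \<Otimes>\<^sub>M M2) (\<lambda>(x, y). ?F x y)"
  proof (rule P.Fubini_integrable)
    show "integrable M1 (\<lambda>x. LINT y|M2. norm (case (x, y) of (x, y) \<Rightarrow> ?F x y))"
    proof (rule Bochner_Integration.integrable_bound[OF integrable_mult_right[OF integrable_norm[OF f], of "\<bar>C\<bar> * (LINT y|M2. norm (g y))"]])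
      show "AE x in M1. norm (LINT y|M2. norm (case (x, y) of (x, y) \<Rightarrow> ?F x y)) \<le> norm (\<bar>C\<bar> * (LINT y|M2. norm (g y)) * norm (f x))"
      proof (rule AE_I2)
        fix x assume x: "x \<in> space M1"
        have "(LINT y|M2. norm (?F x y)) \<le> (LINT y|M2. norm (f x) * \<bar>C\<bar> * norm (g y))"
        proof (intro integral_mono integrable_norm int_y x integrable_mult_right g)
          fix y
          have "norm (g y * k x y) \<le> norm (g y) * \<bar>C\<bar>"
            unfolding norm_mult using C[of x y] by (intro mult_left_mono) auto
          then have "norm (f x) * norm (g y * k x y) \<le> norm (f x) * (norm (g y) * \<bar>C\<bar>)"
            by (intro mult_left_mono) auto
          then show "norm (?F x y) \<le> norm (f x) * \<bar>C\<bar> * norm (g y)" by (simp add: norm_mult ac_simps)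
        qed
        moreover have "0 \<le> (LINT y|M2. norm (?F x y))" by simp
        ultimately show "norm (LINT y|M2. norm (case (x, y) of (x, y) \<Rightarrow> ?F x y)) \<le> norm (\<bar>C\<bar> * (LINT y|M2. norm (g y)) * norm (f x))"
          by (simp add: ac_simps abs_mult)
      qed
    qed measurable
    show "AE x in M1. integrable M2 (\<lambda>y. case (x, y) of (x, y) \<Rightarrow> ?F x y)"
      using int_y by (intro AE_I2) auto
  qed measurable
  have "(LINT x|M1. f x * (LINT y|M2. g y * k x y)) = (LINT x|M1. (LINT y|M2. ?F x y))"
    by simp
  also have "\<dots> = (LINT y|M2. (LINT x|M1. ?F x y))"
    using P.Fubini_integral[OF int] by simp
  also have "\<dots> = (LINT y|M2. (LINT x|M1. g y * (f x * k x y)))"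
    by (simp add: ac_simps)
  finally show ?thesis by simp
qed

lemma integral_lborel_affine:
  fixes f :: "real^'n \<Rightarrow> complex"
  assumes [measurable]: "f \<in> borel_measurable borel" and a: "a \<noteq> 0"
  shows "(LINT x|lborel. f x) = of_real (\<bar>a\<bar> ^ CARD('n)) * (LINT x|lborel. f (b + a *\<^sub>R x))"
proof -
  have "(LINT x|lborel. f x) = (LINT x|density (distr lborel borel (\<lambda>x. b + a *\<^sub>R x)) (\<lambda>_. ennreal (\<bar>a\<bar> ^ DIM(real^'n))). f x)"
    using lborel_affine[OF a, of b] by (simp add: ennreal_power)
  also have "\<dots> = (LINT x|distr lborel borel (\<lambda>x. b + a *\<^sub>R x). (\<bar>a\<bar> ^ DIM(real^'n)) *\<^sub>R f x)"
    by (intro integral_density) auto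
  also have "\<dots> = (LINT x|lborel. (\<bar>a\<bar> ^ DIM(real^'n)) *\<^sub>R f (b + a *\<^sub>R x))"
    by (intro integral_distr) auto
  finally show ?thesis by (simp add: scaleR_conv_of_real)
qed

lemma measurable_gauss [measurable]: "gauss \<in> borel_measurable borel"
  by (rule measurable_schwartz[OF schwartz_gauss])

lemma integral_gauss: "(LINT x|lborel. gauss (x :: real^'n)) = 1"
proof -
  \<comment> \<open>The normal density with this standard deviation is \<open>exp (- \<pi> t\<^sup>2)\<close>.\<close>
  let ?\<sigma> = "1 / sqrt (2 * pi)"
  have nd: "normal_density 0 ?\<sigma> t = exp (- pi * t\<^sup>2)" for t
    by (simp add: normal_density_def power_divide field_simps)
  have 1: "(\<integral>\<^sup>+t. ennreal (exp (- pi * t\<^sup>2)) \<partial>lborel) = 1"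
  proof -
    interpret prob_space "density lborel (normal_density 0 ?\<sigma>)"
      by (rule prob_space_normal_density) simp
    show ?thesis using emeasure_space_1 by (simp add: emeasure_density nd)
  qed
  have "(\<integral>\<^sup>+x. ennreal (exp (- pi * ((x::real^'n) \<bullet> x))) \<partial>lborel) = (\<integral>\<^sup>+x. (\<Prod>b\<in>Basis. ennreal (exp (- pi * (x \<bullet> b)\<^sup>2))) \<partial>(lborel :: (real^'n) measure))"
  proof (intro nn_integral_cong)
    fix x :: "real^'n"
    have "x \<bullet> x = (\<Sum>b\<in>Basis. (x \<bullet> b)\<^sup>2)"
      by (subst euclidean_inner) (simp add: power2_eq_square)
    then show "ennreal (exp (- pi * (x \<bullet> x))) = (\<Prod>b\<in>Basis. ennreal (exp (- pi * (x \<bullet> b)\<^sup>2)))"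
      by (simp add: prod_ennreal exp_sum[symmetric] sum_distrib_left sum_negf)
  qed
  also have "\<dots> = (\<Prod>b\<in>(Basis :: (real^'n) set). (\<integral>\<^sup>+t. ennreal (exp (- pi * t\<^sup>2)) \<partial>lborel))"
    by (rule nn_integral_lborel_prod) auto
  finally have "(\<integral>\<^sup>+x. ennreal (exp (- pi * (x \<bullet> x))) \<partial>(lborel :: (real^'n) measure)) = 1"
    by (simp only: 1 prod.neutral_const)
  then have "(LINT x|lborel. exp (- pi * ((x::real^'n) \<bullet> x))) = 1"
    by (subst integral_eq_nn_integral) auto
  then show ?thesis by (simp add: gauss_def)
qed

text \<open>Transform and Gaussian solve the same linear first-order equation, so the transform times the
  inverse Gaussian is constant; the value at zero is the integral of the Gaussian.\<close>

lemma fourier_gauss: "fourier gauss = (gauss :: real^'n \<Rightarrow> complex)"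
proof -
  let ?F = "fourier (gauss :: real^'n \<Rightarrow> complex)"
  have m: "fourier (\<lambda>x. - 2 * pi * \<i> * (of_real (x $ j) * gauss x)) \<xi> = of_real (- 2 * pi * \<xi> $ j) * ?F \<xi>" for j and \<xi> :: "real^'n"
  proof -
    have "(\<lambda>x::real^'n. - 2 * pi * \<i> * (of_real (x $ j) * gauss x)) = (\<lambda>x. \<i> * partial_deriv j gauss x)"
      by (simp add: partial_deriv_gauss fun_eq_iff)
    moreover have "fourier (\<lambda>x. \<i> * partial_deriv j gauss x) \<xi> = \<i> * fourier (partial_deriv j gauss) \<xi>"
      by (simp add: fourier_eq mult.assoc)
    ultimately have "fourier (\<lambda>x. - 2 * pi * \<i> * (of_real (x $ j) * gauss x)) \<xi> = \<i> * (2 * pi * \<i> * of_real (\<xi> $ j) * ?F \<xi>)"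
      by (simp only: fourier_partial_deriv[OF schwartz_gauss])
    also have "\<dots> = (\<i> * \<i>) * (complex_of_real (2 * pi) * of_real (\<xi> $ j) * ?F \<xi>)" by (simp only: ac_simps)
    finally show ?thesis by simp
  qed
  have dF: "(?F has_derivative (\<lambda>h. of_real (- 2 * pi * (h \<bullet> \<xi>)) * ?F \<xi>)) (at \<xi>)" for \<xi>
  proof -
    have "(\<Sum>j\<in>UNIV. of_real (h $ j) * (of_real (- 2 * pi * \<xi> $ j) * ?F \<xi>)) = of_real (- 2 * pi * (h \<bullet> \<xi>)) * ?F \<xi>" for h
    proof -
      have "(\<Sum>j\<in>UNIV. of_real (h $ j) * (of_real (- 2 * pi * \<xi> $ j) * ?F \<xi>))
          = (\<Sum>j\<in>UNIV. of_real (h $ j * \<xi> $ j)) * (of_real (- 2 * pi) * ?F \<xi>)"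
        unfolding sum_distrib_right by (intro sum.cong refl) simp
      also have "(\<Sum>j\<in>UNIV. of_real (h $ j * \<xi> $ j)) = complex_of_real (h \<bullet> \<xi>)"
        by (simp add: inner_vec_def)
      finally show ?thesis by simp
    qed
    then show ?thesis using has_derivative_fourier[OF schwartz_gauss, of \<xi>] by (simp only: m)
  qed
  let ?E = "\<lambda>\<xi>::real^'n. complex_of_real (exp (pi * (\<xi> \<bullet> \<xi>)))"
  have dE: "(?E has_derivative (\<lambda>h. of_real (2 * pi * (h \<bullet> \<xi>)) * ?E \<xi>)) (at \<xi>)" for \<xi>
    by (auto intro!: derivative_eq_intros simp: inner_commute algebra_simps)
  have "((\<lambda>\<xi>. ?F \<xi> * ?E \<xi>) has_derivative (\<lambda>h. 0)) (at \<xi>)" for \<xi>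
    using has_derivative_mult[OF dF[of \<xi>] dE[of \<xi>]] by (simp add: algebra_simps)
  then have "\<exists>c. \<forall>\<xi>\<in>UNIV. ?F \<xi> * ?E \<xi> = c"
    by (rule has_derivative_zero_constant[OF convex_UNIV])
  then obtain c where c: "\<And>\<xi>. ?F \<xi> * ?E \<xi> = c" by auto
  have "c = 1"
    using c[of 0] by (simp add: fourier_eq integral_gauss)
  then have "?F \<xi> * ?E \<xi> = gauss \<xi> * ?E \<xi>" for \<xi>
    using c[of \<xi>] by (simp add: gauss_def flip: of_real_mult exp_add)
  then show ?thesis by (intro ext) simp
qed

lemma fourier_swap:
  fixes f g :: "real^'n \<Rightarrow> complex"
  assumes "integrable lborel f" "integrable lborel g"
  shows "(LINT \<xi>|lborel. fourier f \<xi> * g \<xi>) = (LINT x|lborel. f x * fourier g x)"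
proof -
  have "(LINT x|lborel. f x * (LINT \<xi>|lborel. g \<xi> * chi (- \<xi>) x)) = (LINT \<xi>|lborel. g \<xi> * (LINT x|lborel. f x * chi (- \<xi>) x))"
    by (rule Fubini_kernel[where C=1]) (use assms in \<open>auto simp: lborel_pair.pair_sigma_finite_axioms\<close>)
  moreover have "chi (- \<xi>) x = chi (- x) \<xi>" for \<xi> x :: "real^'n"
    by (simp add: chi_def inner_commute)
  ultimately show ?thesis by (simp add: fourier_eq mult.commute)
qed

text \<open>Dominated convergence: the argument of \<open>v\<close> tends to \<open>x\<close> for each fixed \<open>y\<close>, and the Gaussian has
  integral one.\<close>

lemma gauss_approx_identity:
  fixes v :: "real^'n \<Rightarrow> complex"
  assumes [measurable]: "v \<in> borel_measurable borel" and C: "\<And>x. norm (v x) \<le> C" and "isCont v x"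
  shows "(\<lambda>m. LINT y|lborel. v (x + (1 / real (Suc m)) *\<^sub>R y) * gauss y) \<longlonglongrightarrow> v x"
proof -
  have "(\<lambda>m. LINT y|lborel. v (x + (1 / real (Suc m)) *\<^sub>R y) * gauss y) \<longlonglongrightarrow> (LINT y|lborel. v x * gauss (y::real^'n))"
  proof (rule integral_dominated_convergence[where w="\<lambda>y::real^'n. C * norm (gauss y)"])
    show "integrable lborel (\<lambda>y::real^'n. C * norm (gauss y))"
      by (intro integrable_mult_right integrable_norm integrable_schwartz schwartz_gauss)
    show "AE y in lborel. (\<lambda>m. v (x + (1 / real (Suc m)) *\<^sub>R y) * gauss y) \<longlonglongrightarrow> v x * gauss y"
    proof (rule AE_I2)
      fix y :: "real^'n"
      have "(\<lambda>m. x + (1 / real (Suc m)) *\<^sub>R y) \<longlonglongrightarrow> x + 0 *\<^sub>R y"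
        by (intro tendsto_add tendsto_scaleR tendsto_const LIMSEQ_Suc[OF lim_1_over_n])
      then have "(\<lambda>m. v (x + (1 / real (Suc m)) *\<^sub>R y)) \<longlonglongrightarrow> v x"
        using \<open>isCont v x\<close> by (intro isCont_tendsto_compose[where g=v]) auto
      then show "(\<lambda>m. v (x + (1 / real (Suc m)) *\<^sub>R y) * gauss y) \<longlonglongrightarrow> v x * gauss y"
        by (intro tendsto_mult tendsto_const)
    qed
    show "AE y in lborel. norm (v (x + (1 / real (Suc m)) *\<^sub>R y) * gauss y) \<le> C * norm (gauss y)" for m
      unfolding norm_mult by (intro AE_I2 mult_right_mono C) auto
  qed measurable
  then show ?thesis by (simp add: integral_gauss)
qed

lemma integral_gauss_scaled:
  fixes v :: "real^'n \<Rightarrow> complex"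
  assumes [measurable]: "v \<in> borel_measurable borel"
  shows "(LINT z|lborel. v z * gauss (real (Suc m) *\<^sub>R (z - x)))
    = of_real ((1 / real (Suc m)) ^ CARD('n)) * (LINT y|lborel. v (x + (1 / real (Suc m)) *\<^sub>R y) * gauss y)"
  by (subst integral_lborel_affine[of _ "1 / real (Suc m)" x]) (auto simp del: of_nat_Suc)

text \<open>Fourier inversion at the origin.  The integral is regularised by a wide Gaussian; by
  \<open>fourier_swap\<close> this averages \<open>\<phi>\<close> against a narrow Gaussian about zero.\<close>

lemma integral_fourier:
  fixes \<phi> :: "real^'n \<Rightarrow> complex"
  assumes \<phi>: "\<phi> \<in> schwartz"
  shows "(LINT \<xi>|lborel. fourier \<phi> \<xi>) = \<phi> 0"
proof -
  note [measurable] = measurable_schwartz[OF \<phi>] measurable_schwartz[OF fourier_schwartz[OF \<phi>]]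
  let ?\<epsilon> = "\<lambda>m. 1 / real (Suc m)"
  have eq: "(LINT \<xi>|lborel. fourier \<phi> \<xi> * gauss (?\<epsilon> m *\<^sub>R \<xi>)) = (LINT y|lborel. \<phi> (0 + ?\<epsilon> m *\<^sub>R y) * gauss y)" for m
  proof -
    have sch: "(\<lambda>\<xi>::real^'n. gauss (?\<epsilon> m *\<^sub>R \<xi>)) \<in> schwartz"
      using schwartz_affine[OF schwartz_gauss, of "?\<epsilon> m" 0] by simp
    have sc: "fourier (\<lambda>\<xi>. gauss (?\<epsilon> m *\<^sub>R \<xi>)) y = of_real (real (Suc m) ^ CARD('n)) * gauss (real (Suc m) *\<^sub>R y)" for y :: "real^'n"
    proof -
      have "fourier (\<lambda>\<xi>. gauss (?\<epsilon> m *\<^sub>R \<xi>)) y = of_real (\<bar>real (Suc m)\<bar> ^ CARD('n)) * (LINT \<xi>|lborel. gauss (?\<epsilon> m *\<^sub>R (0 + real (Suc m) *\<^sub>R \<xi>)) * chi (- y) (0 + real (Suc m) *\<^sub>R \<xi>))"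
        unfolding fourier_eq by (intro integral_lborel_affine) auto
      also have "(\<lambda>\<xi>. chi (- y) (0 + real (Suc m) *\<^sub>R \<xi>)) = (\<lambda>\<xi>. chi (- (real (Suc m) *\<^sub>R y)) \<xi>)"
        by (simp add: chi_def mult.left_commute del: of_nat_Suc)
      then have "(LINT \<xi>|lborel. gauss (?\<epsilon> m *\<^sub>R (0 + real (Suc m) *\<^sub>R \<xi>)) * chi (- y) (0 + real (Suc m) *\<^sub>R \<xi>)) = fourier gauss (real (Suc m) *\<^sub>R y)"
        unfolding fourier_eq by (simp add: fun_eq_iff del: of_nat_Suc)
      finally show ?thesis by (simp add: fourier_gauss del: of_nat_Suc)
    qed
    have "(LINT \<xi>|lborel. fourier \<phi> \<xi> * gauss (?\<epsilon> m *\<^sub>R \<xi>)) = (LINT y|lborel. \<phi> y * fourier (\<lambda>\<xi>. gauss (?\<epsilon> m *\<^sub>R \<xi>)) y)"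
      by (intro fourier_swap integrable_schwartz \<phi> sch)
    also have "\<dots> = of_real (real (Suc m) ^ CARD('n)) * (LINT y|lborel. \<phi> y * gauss (real (Suc m) *\<^sub>R (y - 0)))"
      unfolding sc by (subst integral_mult_right_zero[symmetric]) (simp add: mult.left_commute del: of_nat_Suc)
    also have "\<dots> = (LINT y|lborel. \<phi> (0 + ?\<epsilon> m *\<^sub>R y) * gauss y)"
    proof -
      have "complex_of_real (real (Suc m) ^ CARD('n)) * of_real ((?\<epsilon> m) ^ CARD('n)) = 1"
        by (simp only: of_real_mult[symmetric] power_mult_distrib[symmetric]) (simp del: of_nat_Suc)
      moreover have "\<phi> \<in> borel_measurable borel" by measurable
      ultimately show ?thesis
        by (simp only: integral_gauss_scaled mult.assoc[symmetric] mult_1_left)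
    qed
    finally show ?thesis .
  qed
  obtain C where "\<And>x. norm (\<phi> x) \<le> C" using bounded_schwartz[OF \<phi>] by blast
  then have "(\<lambda>m. LINT y|lborel. \<phi> (0 + ?\<epsilon> m *\<^sub>R y) * gauss y) \<longlonglongrightarrow> \<phi> 0"
    using schwartz_continuous[OF \<phi>] by (intro gauss_approx_identity) (auto simp: continuous_on_eq_continuous_at)
  moreover have "(\<lambda>m. LINT \<xi>|lborel. fourier \<phi> \<xi> * gauss (?\<epsilon> m *\<^sub>R \<xi>)) \<longlonglongrightarrow> (LINT \<xi>|lborel. fourier \<phi> \<xi>)"
  proof (rule integral_dominated_convergence[where w="\<lambda>\<xi>. norm (fourier \<phi> \<xi>)"])
    show "integrable lborel (\<lambda>\<xi>. norm (fourier \<phi> \<xi>))"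
      by (intro integrable_norm integrable_schwartz fourier_schwartz \<phi>)
    show "AE \<xi> in lborel. (\<lambda>m. fourier \<phi> \<xi> * gauss (?\<epsilon> m *\<^sub>R \<xi>)) \<longlonglongrightarrow> fourier \<phi> \<xi>"
    proof (rule AE_I2)
      fix \<xi> :: "real^'n"
      have "(\<lambda>m. ?\<epsilon> m *\<^sub>R \<xi>) \<longlonglongrightarrow> 0 *\<^sub>R \<xi>"
        by (intro tendsto_scaleR tendsto_const LIMSEQ_Suc[OF lim_1_over_n])
      moreover have "isCont gauss (0 *\<^sub>R \<xi>)"
        using schwartz_continuous[OF schwartz_gauss] by (auto simp: continuous_on_eq_continuous_at)
      ultimately have "(\<lambda>m. gauss (?\<epsilon> m *\<^sub>R \<xi>)) \<longlonglongrightarrow> gauss (0 *\<^sub>R \<xi>)"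
        by (intro isCont_tendsto_compose[where g=gauss])
      then have "(\<lambda>m. fourier \<phi> \<xi> * gauss (?\<epsilon> m *\<^sub>R \<xi>)) \<longlonglongrightarrow> fourier \<phi> \<xi> * gauss (0 *\<^sub>R \<xi>)"
        by (intro tendsto_mult tendsto_const)
      then show "(\<lambda>m. fourier \<phi> \<xi> * gauss (?\<epsilon> m *\<^sub>R \<xi>)) \<longlonglongrightarrow> fourier \<phi> \<xi>" by (simp add: gauss_def)
    qed
    show "AE \<xi> in lborel. norm (fourier \<phi> \<xi> * gauss (?\<epsilon> m *\<^sub>R \<xi>)) \<le> norm (fourier \<phi> \<xi>)" for m
    proof (rule AE_I2)
      fix \<xi> :: "real^'n"
      have "norm (gauss (?\<epsilon> m *\<^sub>R \<xi>)) \<le> 1" by (simp add: gauss_def del: of_nat_Suc)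
      then show "norm (fourier \<phi> \<xi> * gauss (?\<epsilon> m *\<^sub>R \<xi>)) \<le> norm (fourier \<phi> \<xi>)"
        unfolding norm_mult by (rule mult_left_le) simp
    qed
  qed measurable
  ultimately show ?thesis unfolding eq by (rule LIMSEQ_unique[symmetric])
qed

text \<open>Translation turns inversion at \<open>x\<close> into inversion at the origin.\<close>

lemma fourier_inversion:
  fixes \<phi> :: "real^'n \<Rightarrow> complex"
  assumes \<phi>: "\<phi> \<in> schwartz"
  shows "(LINT \<xi>|lborel. fourier \<phi> \<xi> * chi x \<xi>) = \<phi> x"
proof -
  have s: "(\<lambda>y. \<phi> (y + x)) \<in> schwartz" using schwartz_affine[OF \<phi>, of 1 x] by simp
  have "fourier (\<lambda>y. \<phi> (y + x)) \<xi> = fourier \<phi> \<xi> * chi x \<xi>" for \<xi>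
  proof -
    have "fourier \<phi> \<xi> = (LINT y|lborel. \<phi> (y + x) * chi (- \<xi>) (y + x))"
      unfolding fourier_eq by (rule integral_lborel_translate[symmetric])
    also have "\<dots> = fourier (\<lambda>y. \<phi> (y + x)) \<xi> * chi (- \<xi>) x"
      by (simp add: fourier_eq chi_add mult.assoc flip: integral_mult_left_zero)
    finally have "fourier \<phi> \<xi> * chi x \<xi> = fourier (\<lambda>y. \<phi> (y + x)) \<xi> * (chi (- \<xi>) x * chi x \<xi>)" by simp
    also have "chi (- \<xi>) x * chi x \<xi> = 1"
      by (simp add: chi_def cis_mult inner_commute)
    finally show ?thesis by simp
  qed
  then show ?thesis using integral_fourier[OF s] by simp
qed

lemma fourier_surj:
  fixes \<psi> :: "real^'n \<Rightarrow> complex"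
  assumes "\<psi> \<in> schwartz" shows "\<exists>\<phi>\<in>schwartz. \<psi> = fourier \<phi>"
proof -
  have s: "(\<lambda>\<xi>. fourier \<psi> (- \<xi>)) \<in> schwartz"
    using schwartz_affine[OF fourier_schwartz[OF assms], of "-1" 0] by simp
  note [measurable] = measurable_schwartz[OF s] measurable_schwartz[OF fourier_schwartz[OF assms]]
  have "fourier (\<lambda>\<xi>. fourier \<psi> (- \<xi>)) x = \<psi> x" for x
  proof -
    have "\<psi> x = (LINT \<xi>|lborel. fourier \<psi> \<xi> * chi x \<xi>)" by (simp add: fourier_inversion assms)
    also have "\<dots> = (LINT \<xi>|lborel. fourier \<psi> (- \<xi>) * chi x (- \<xi>))"
      by (subst integral_lborel_affine[of _ "-1" 0]) auto
    finally show ?thesis by (simp add: fourier_eq chi_minus chi_def)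
  qed
  then show ?thesis using s by (intro bexI[of _ "\<lambda>\<xi>. fourier \<psi> (- \<xi>)"]) auto
qed

text \<open>Gaussian averages about a point are pairings with Schwartz functions, and they recover the value.\<close>

lemma continuous_eq_0_Rd:
  fixes v :: "real^'n \<Rightarrow> complex"
  assumes cont: "continuous_on UNIV v" and "bounded (range v)"
    and 0: "\<And>\<phi>. \<phi> \<in> schwartz \<Longrightarrow> (LINT x|lborel. v x * \<phi> x) = 0"
  shows "v x = 0"
proof -
  have [measurable]: "v \<in> borel_measurable borel" using cont by (rule borel_measurable_continuous_onI)
  obtain C where C: "\<And>x. norm (v x) \<le> C" using assms(2) by (auto simp: bounded_iff)
  have "(LINT y|lborel. v (x + (1 / real (Suc m)) *\<^sub>R y) * gauss y) = 0" for m
  proof -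
    have "(\<lambda>z. gauss (real (Suc m) *\<^sub>R z + (- (real (Suc m) *\<^sub>R x)))) \<in> schwartz"
      by (intro schwartz_affine schwartz_gauss) auto
    then have "(LINT z|lborel. v z * gauss (real (Suc m) *\<^sub>R (z - x))) = 0"
      using 0 by (simp add: scaleR_diff_right)
    then show ?thesis by (simp add: integral_gauss_scaled del: of_nat_Suc)
  qed
  moreover have "(\<lambda>m. LINT y|lborel. v (x + (1 / real (Suc m)) *\<^sub>R y) * gauss y) \<longlonglongrightarrow> v x"
    using cont C by (intro gauss_approx_identity[where C=C]) (auto simp: continuous_on_eq_continuous_at)
  ultimately have "(\<lambda>m. 0) \<longlonglongrightarrow> v x" by (simp only:)
  then show ?thesis by (simp add: LIMSEQ_const_iff)
qed

text \<open>Multiplication with a Gaussian makes \<open>h\<close> integrable.  The product annihilates the Gaussian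
  averages of the indicator of a box, which converge to it off its boundary; boxes generate the Borel
  sets.\<close>

lemma AE_eq_0_Rd:
  fixes h :: "real^'n \<Rightarrow> complex"
  assumes [measurable]: "h \<in> borel_measurable borel"
    and int: "\<And>\<phi>. \<phi> \<in> schwartz \<Longrightarrow> integrable lborel (\<lambda>\<xi>. h \<xi> * \<phi> \<xi>)"
    and 0: "\<And>\<phi>. \<phi> \<in> schwartz \<Longrightarrow> (LINT \<xi>|lborel. h \<xi> * \<phi> \<xi>) = 0"
  shows "AE \<xi> in lborel. h \<xi> = 0"
proof -
  let ?H = "\<lambda>\<xi>. h \<xi> * gauss \<xi>"
  have H: "integrable lborel ?H" by (intro int schwartz_gauss)
  have box: "(LINT \<xi>|lborel. indicator (box a b) \<xi> *\<^sub>R ?H \<xi>) = 0" for a b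
  proof -
    let ?v = "\<lambda>\<xi>. complex_of_real (indicator (box a b) \<xi>)"
    let ?J = "\<lambda>m \<xi>. LINT y|lborel. ?v (\<xi> + (1 / real (Suc m)) *\<^sub>R y) * gauss y"
    have [measurable]: "?J m \<in> borel_measurable borel" for m by measurable
    have "(\<lambda>m. LINT \<xi>|lborel. ?H \<xi> * ?J m \<xi>) \<longlonglongrightarrow> (LINT \<xi>|lborel. ?H \<xi> * ?v \<xi>)"
    proof (rule integral_dominated_convergence[where w="\<lambda>\<xi>. norm (?H \<xi>) * (LINT y|lborel. norm (gauss (y::real^'n)))"])
      show "integrable lborel (\<lambda>\<xi>. norm (?H \<xi>) * (LINT y|lborel. norm (gauss (y::real^'n))))"
        by (intro integrable_mult_left integrable_norm H)
      have "frontier (box a b) \<in> null_sets lborel"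
        using negligible_convex_frontier[of "box a b"] convex_box(2)
        by (auto simp: negligible_iff_null_sets null_sets_completion_iff)
      then have "AE \<xi> in lborel. \<xi> \<notin> frontier (box a b)" by (rule AE_not_in)
      then show "AE \<xi> in lborel. (\<lambda>m. ?H \<xi> * ?J m \<xi>) \<longlonglongrightarrow> ?H \<xi> * ?v \<xi>"
      proof eventually_elim
        case (elim \<xi>)
        have "isCont (indicator (box a b) :: _ \<Rightarrow> real) \<xi>"
          using elim by (simp add: isCont_indicator)
        then have "isCont ?v \<xi>" by (intro continuous_intros)
        then show ?case
          by (intro tendsto_mult tendsto_const gauss_approx_identity[where C=1]) (auto simp: indicator_def)
      qed
      show "AE \<xi> in lborel. norm (?H \<xi> * ?J m \<xi>) \<le> norm (?H \<xi>) * (LINT y|lborel. norm (gauss (y::real^'n)))" for m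
      proof (rule AE_I2)
        fix \<xi>
        have "norm (?J m \<xi>) \<le> (LINT y|lborel. norm (gauss (y::real^'n)))"
        proof (rule Bochner_Integration.integral_norm_bound_integral)
          have g: "integrable lborel (\<lambda>y::real^'n. norm (gauss y))"
            by (intro integrable_norm integrable_schwartz schwartz_gauss)
          show "integrable lborel (\<lambda>y::real^'n. norm (gauss y))" by (rule g)
          show *: "norm (?v (\<xi> + (1 / real (Suc m)) *\<^sub>R y) * gauss y) \<le> norm (gauss y)" for y :: "real^'n"
            by (simp add: norm_mult indicator_def)
          show "integrable lborel (\<lambda>y. ?v (\<xi> + (1 / real (Suc m)) *\<^sub>R y) * gauss y)"
            using * by (intro Bochner_Integration.integrable_bound[OF g]) auto
        qed
        then show "norm (?H \<xi> * ?J m \<xi>) \<le> norm (?H \<xi>) * (LINT y|lborel. norm (gauss (y::real^'n)))"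
          unfolding norm_mult[of "?H \<xi>"] by (rule mult_left_mono) simp
      qed
    qed measurable
    moreover have "(LINT \<xi>|lborel. ?H \<xi> * ?J m \<xi>) = 0" for m
    proof -
      let ?k = "\<lambda>\<xi> z. gauss (real (Suc m) *\<^sub>R (z - \<xi>))"
      have "integrable lborel ?v"
        by (intro integrable_of_real) (simp add: integrable_indicator_iff emeasure_lborel_box_eq)
      moreover have "norm (?k \<xi> z) \<le> 1" for \<xi> z :: "real^'n" by (simp add: gauss_def del: of_nat_Suc)
      ultimately have "(LINT \<xi>|lborel. ?H \<xi> * (LINT z|lborel. ?v z * ?k \<xi> z)) = (LINT z|lborel. ?v z * (LINT \<xi>|lborel. ?H \<xi> * ?k \<xi> z))"
        by (intro Fubini_kernel[where C=1] H) (auto simp: lborel_pair.pair_sigma_finite_axioms)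
      also have "\<dots> = 0"
      proof -
        have "(LINT \<xi>|lborel. ?H \<xi> * ?k \<xi> z) = 0" for z
        proof -
          have "(\<lambda>\<xi>. gauss ((- real (Suc m)) *\<^sub>R \<xi> + real (Suc m) *\<^sub>R z)) \<in> schwartz"
            by (intro schwartz_affine schwartz_gauss) auto
          from 0[OF schwartz_mult[OF schwartz_gauss this]] show ?thesis
            by (simp add: scaleR_diff_right mult.assoc del: of_nat_Suc)
        qed
        then show ?thesis by simp
      qed
      finally show ?thesis
        by (subst (asm) integral_gauss_scaled) (auto simp: mult.left_commute[of "h _ * gauss _"] simp del: of_nat_Suc)
    qed
    ultimately have "(\<lambda>m. 0) \<longlonglongrightarrow> (LINT \<xi>|lborel. ?H \<xi> * ?v \<xi>)" by (simp only:)
    then have "(LINT \<xi>|lborel. ?H \<xi> * ?v \<xi>) = 0" by (simp add: LIMSEQ_const_iff)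
    then show ?thesis by (simp add: scaleR_conv_of_real mult.commute)
  qed
  have all: "(LINT \<xi>|lborel. indicator A \<xi> *\<^sub>R ?H \<xi>) = 0" if "A \<in> sets borel" for A
  proof -
    let ?G = "range (\<lambda>(a, b). box a b :: (real^'n) set)"
    have gen: "sets borel = sigma_sets UNIV ?G"
      unfolding borel_eq_box by (rule sets_measure_of) simp
    have "Int_stable ?G"
      unfolding Int_stable_def
    proof clarsimp
      fix a b c d :: "real^'n"
      show "box a b \<inter> box c d \<in> ?G" unfolding box_Int_box by (rule range_eqI[of _ _ "(_, _)"]) simp
    qed
    moreover have "?G \<subseteq> Pow UNIV" by simp
    moreover have "A \<in> sigma_sets UNIV ?G" using that gen by simp
    ultimately show ?thesis
    proof (induction rule: sigma_sets_induct_disjoint)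
      case (basic A)
      then show ?case using box by auto
    next
      case (compl A)
      then have [measurable]: "A \<in> sets borel" by (simp add: gen)
      have "(LINT \<xi>|lborel. indicator (UNIV - A) \<xi> *\<^sub>R ?H \<xi>) = (LINT \<xi>|lborel. ?H \<xi> - indicator A \<xi> *\<^sub>R ?H \<xi>)"
        by (intro Bochner_Integration.integral_cong) (auto split: split_indicator)
      also have "\<dots> = (LINT \<xi>|lborel. ?H \<xi>) - (LINT \<xi>|lborel. indicator A \<xi> *\<^sub>R ?H \<xi>)"
        by (intro Bochner_Integration.integral_diff H integrable_mult_indicator) auto
      finally show ?case using compl 0[OF schwartz_gauss] by simp
    next
      case (union A)
      then have A [measurable]: "A i \<in> sets borel" for i
        by (auto simp: gen)
      have "set_integrable lborel (\<Union>i. A i) ?H"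
        unfolding set_integrable_def by (intro integrable_mult_indicator H) auto
      then have "(LINT \<xi>:(\<Union>i. A i)|lborel. ?H \<xi>) = (\<Sum>i. LINT \<xi>:A i|lborel. ?H \<xi>)"
        using union(1) by (intro lebesgue_integral_countable_add) (auto simp: disjoint_family_on_def)
      then show ?case using union by (simp add: set_lebesgue_integral_def)
    qed simp
  qed
  have "AE \<xi> in lborel. ?H \<xi> = 0"
    by (rule sigma_finite_measure.density_zero[OF sigma_finite_lborel H]) (auto simp: set_lebesgue_integral_def all)
  then show ?thesis by eventually_elim (simp add: gauss_def)
qed

section \<open>Fourier series\<close>

abbreviation torus :: "(real^'n) measure" where
  "torus \<equiv> restrict_space lborel (cbox 0 1)"

lemma space_torus: "space torus = cbox 0 (1 :: real^'n)"
  by (simp add: space_restrict_space)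

lemma emeasure_torus: "emeasure torus (cbox 0 (1 :: real^'n)) = 1"
proof -
  have "(\<Prod>b\<in>Basis. (1 :: real^'n) \<bullet> b) = 1"
    by (rule prod.neutral) (auto simp: Basis_vec_def inner_axis)
  then show ?thesis
    by (simp add: emeasure_restrict_space emeasure_lborel_cbox_eq) (auto simp: Basis_vec_def inner_axis)
qed

lemma finite_measure_torus: "finite_measure (torus :: (real^'n) measure)"
  by (rule finite_measureI) (simp add: space_torus emeasure_torus del: emeasure_restrict_space)

interpretation torus: finite_measure "torus :: (real^'n) measure"
  by (rule finite_measure_torus)

lemma measure_torus: "measure torus (space (torus :: (real^'n) measure)) = 1"
  by (simp add: space_torus measure_def emeasure_torus del: emeasure_restrict_space)

lemma measurable_torus: "f \<in> borel_measurable borel \<Longrightarrow> f \<in> borel_measurable torus"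
  by (simp add: measurable_restrict_space1)

lemma integrable_torus_bounded:
  fixes f :: "real^'n \<Rightarrow> 'b :: {banach, second_countable_topology}"
  assumes "f \<in> borel_measurable borel" "\<And>x. norm (f x) \<le> B"
  shows "integrable torus f"
  using assms by (intro torus.integrable_const_bound[of _ B] measurable_torus) auto

text \<open>The representative of a point in the period cell.\<close>

definition frac_vec :: "real^'n \<Rightarrow> real^'n" where
  "frac_vec x = (\<chi> i. frac (x $ i))"

lemma frac_vec: "x - frac_vec x \<in> int_lattice" "frac_vec x \<in> cbox 0 1"
proof -
  show "x - frac_vec x \<in> int_lattice" by (simp add: frac_vec_def int_lattice_def frac_def)
  show "frac_vec x \<in> cbox 0 1"
    by (simp add: frac_vec_def mem_box_cart less_imp_le[OF frac_lt_1])
qed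

lemma periodic_frac: "periodic f \<Longrightarrow> f (frac_vec x) = f x"
proof -
  assume "periodic f"
  then have "f (frac_vec x + (x - frac_vec x)) = f (frac_vec x)"
    using frac_vec(1)[of x] unfolding periodic_def by blast
  then show ?thesis by simp
qed

lemma periodic_bounded:
  assumes "periodic f" "continuous_on UNIV f" shows "\<exists>B. \<forall>x. norm (f x) \<le> B"
proof -
  have "compact (f ` cbox 0 1)"
    by (intro compact_continuous_image continuous_on_subset[OF assms(2)]) auto
  then obtain B where "\<And>x. x \<in> cbox 0 1 \<Longrightarrow> norm (f x) \<le> B"
    by (meson bounded_iff compact_imp_bounded imageI)
  then have "norm (f (frac_vec x)) \<le> B" for x using frac_vec(2) by blast
  then have "norm (f x) \<le> B" for x by (simp add: periodic_frac[OF assms(1)])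
  then show ?thesis by blast
qed

lemma integrable_torus_continuous:
  assumes "periodic f" "continuous_on UNIV f" shows "integrable torus f"
  using periodic_bounded[OF assms] borel_measurable_continuous_onI[OF assms(2)]
  by (auto intro: integrable_torus_bounded)

lemma periodic_partial_deriv:
  fixes \<phi> :: "real^'n \<Rightarrow> complex"
  assumes "periodic \<phi>" "\<And>x. \<phi> differentiable (at x)" shows "periodic (partial_deriv j \<phi>)"
  unfolding periodic_def
proof (intro allI ballI)
  fix x n :: "real^'n" assume n: "n \<in> int_lattice"
  have "(\<phi> has_derivative frechet_derivative \<phi> (at (x + n))) (at (x + n))"
    by (intro differentiable_has_derivative assms)
  then have "((\<lambda>x. \<phi> (x + n)) has_derivative frechet_derivative \<phi> (at (x + n))) (at x)"
    by (rule has_derivative_compose[where f="\<lambda>x. x + n", rotated]) (auto intro!: derivative_eq_intros)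
  moreover have "(\<lambda>x. \<phi> (x + n)) = \<phi>" using assms(1) n by (auto simp: periodic_def)
  ultimately have "(\<phi> has_derivative frechet_derivative \<phi> (at (x + n))) (at x)" by simp
  from partial_deriv_eq[OF this] show "partial_deriv j \<phi> (x + n) = partial_deriv j \<phi> x"
    by (simp add: partial_deriv_def)
qed

text \<open>The torus test functions under a name of their own, so that they are not unfolded by the
  equations of \<open>test_space\<close>.\<close>

definition smooth_periodic :: "(real^'n \<Rightarrow> complex) set" where
  "smooth_periodic = {\<phi>. smooth \<phi> \<and> periodic \<phi>}"

lemma smooth_periodicD:
  assumes "\<phi> \<in> smooth_periodic"
  shows "\<phi> differentiable (at x)" "continuous_on UNIV \<phi>" "periodic \<phi>" "partial_deriv j \<phi> \<in> smooth_periodic"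
  using assms smooth_differentiable smooth_continuous smooth_partial_deriv
    periodic_partial_deriv[OF _ smooth_differentiable]
  by (auto simp: smooth_periodic_def)

lemma smooth_periodic_coinduct:
  assumes "\<phi> \<in> S" and "\<And>\<phi> i. \<phi> \<in> S \<Longrightarrow> partial_deriv i \<phi> \<in> S"
    and "\<And>\<phi> x. \<phi> \<in> S \<Longrightarrow> \<phi> differentiable (at x)" and "periodic \<phi>"
  shows "\<phi> \<in> smooth_periodic"
  using smooth_coinduct[OF assms(1-3)] assms(4) by (simp add: smooth_periodic_def)

lemma partial_deriv_cmult:
  "f differentiable (at x) \<Longrightarrow> partial_deriv i (\<lambda>x. c * f x) x = c * partial_deriv i f x"
  by (subst partial_deriv_mult) auto

lemma smooth_periodic_lincomb:
  assumes "\<phi> \<in> smooth_periodic" "\<psi> \<in> smooth_periodic"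
  shows "(\<lambda>x. \<phi> x + c * \<psi> x) \<in> smooth_periodic"
proof (rule smooth_periodic_coinduct)
  let ?S = "{\<lambda>x. \<phi> x + c * \<psi> x |\<phi> \<psi>. \<phi> \<in> smooth_periodic \<and> \<psi> \<in> smooth_periodic}"
  show "(\<lambda>x. \<phi> x + c * \<psi> x) \<in> ?S" using assms by (intro CollectI exI[of _ \<phi>] exI[of _ \<psi>]) auto
  show "partial_deriv i f \<in> ?S" if "f \<in> ?S" for f i
  proof -
    obtain \<phi> \<psi> where f: "f = (\<lambda>x. \<phi> x + c * \<psi> x)" "\<phi> \<in> smooth_periodic" "\<psi> \<in> smooth_periodic"
      using \<open>f \<in> ?S\<close> by auto
    have "partial_deriv i f = (\<lambda>x. partial_deriv i \<phi> x + c * partial_deriv i \<psi> x)"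
      unfolding f(1) using smooth_periodicD(1)[OF f(2)] smooth_periodicD(1)[OF f(3)]
      by (intro ext) (auto simp: partial_deriv_add partial_deriv_cmult)
    then show ?thesis using smooth_periodicD(4)[OF f(2)] smooth_periodicD(4)[OF f(3)]
      by (intro CollectI exI conjI)
  qed
  show "f differentiable (at x)" if f: "f \<in> ?S" for f x
    using f smooth_periodicD(1) by (auto intro!: differentiable_add differentiable_mult)
  show "periodic (\<lambda>x. \<phi> x + c * \<psi> x)"
    using smooth_periodicD(3)[OF assms(1)] smooth_periodicD(3)[OF assms(2)] by (simp add: periodic_def)
qed

lemma chi_lattice: assumes "n \<in> int_lattice" "m \<in> int_lattice" shows "chi n m = 1"
proof -
  have "m \<bullet> n \<in> \<int>"
    using assms unfolding inner_vec_def by (intro Ints_sum) (auto simp: int_lattice_def)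
  then obtain k where "m \<bullet> n = of_int k" by (auto elim: Ints_cases)
  then show ?thesis by (simp add: chi_def cis_multiple_2pi)
qed

lemma periodic_chi: "n \<in> int_lattice \<Longrightarrow> periodic (chi n)"
  by (simp add: periodic_def chi_add chi_lattice)

lemma smooth_periodic_chi: assumes n: "n \<in> int_lattice" shows "chi n \<in> smooth_periodic"
proof (rule smooth_periodic_coinduct[OF _ _ _ periodic_chi[OF n]])
  let ?S = "range (\<lambda>c x. c * chi n x)"
  show "chi n \<in> ?S" by (rule range_eqI[of _ _ 1]) auto
  show "partial_deriv i f \<in> ?S" if "f \<in> ?S" for f i
  proof -
    obtain c where f: "f = (\<lambda>x. c * chi n x)" using \<open>f \<in> ?S\<close> by auto
    show ?thesis
      by (rule range_eqI[of _ _ "c * (2 * pi * \<i> * of_real (n $ i))"])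
        (auto simp: f partial_deriv_cmult differentiable_chi partial_deriv_chi)
  qed
qed (auto intro!: differentiable_mult differentiable_chi)

lemma smooth_periodic_cmult: "\<phi> \<in> smooth_periodic \<Longrightarrow> (\<lambda>x. c * \<phi> x) \<in> smooth_periodic"
  using smooth_periodic_lincomb[of \<phi> \<phi> "c - 1"] by (simp add: algebra_simps)

lemma smooth_periodic_add: "\<phi> \<in> smooth_periodic \<Longrightarrow> \<psi> \<in> smooth_periodic \<Longrightarrow> (\<lambda>x. \<phi> x + \<psi> x) \<in> smooth_periodic"
  using smooth_periodic_lincomb[of \<phi> \<psi> 1] by simp

text \<open>The translated cell differs from the cell by two slabs, and a unit translation, which leaves
  \<open>\<psi>\<close> unchanged, carries one to the other.\<close>

lemma integral_torus_translate:
  fixes \<psi> :: "real^'n \<Rightarrow> complex"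
  assumes per: "periodic \<psi>" and cont: "continuous_on UNIV \<psi>" and h: "0 \<le> h" "h \<le> 1"
  shows "(LINT x|torus. \<psi> (x + h *\<^sub>R axis j 1)) = (LINT x|torus. \<psi> x)"
proof -
  let ?e = "axis j 1 :: real^'n"
  let ?P = "\<lambda>x::real^'n. \<forall>i. i \<noteq> j \<longrightarrow> 0 \<le> x $ i \<and> x $ i \<le> 1"
  let ?S = "\<lambda>A. {x. ?P x \<and> x $ j \<in> A}"
  have [measurable]: "\<psi> \<in> borel_measurable borel" using cont by (rule borel_measurable_continuous_onI)
  obtain B where B: "\<And>x. norm (\<psi> x) \<le> B" using periodic_bounded[OF per cont] by blast
  have meas: "{x. ?P x \<and> Q (x $ j)} \<in> sets borel" if [measurable]: "Measurable.pred borel Q" for Q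
    by measurable
  have int: "integrable lborel (\<lambda>x. indicator (?S A) x *\<^sub>R \<psi> x)" if A: "A \<subseteq> {0..2}" "A \<in> sets borel" for A
  proof (rule Bochner_Integration.integrable_bound)
    have "emeasure lborel (cbox 0 (\<chi> i. 2) :: (real^'n) set) < \<infinity>" by (rule emeasure_lborel_cbox_finite)
    then show "integrable lborel (\<lambda>x::real^'n. B * indicator (cbox 0 (\<chi> i. 2)) x)"
      by (intro integrable_mult_right) (simp add: integrable_indicator_iff)
    show "(\<lambda>x. indicator (?S A) x *\<^sub>R \<psi> x) \<in> borel_measurable lborel"
      using meas[of "\<lambda>x. x \<in> A"] A by measurable
    show "AE x in lborel. norm (indicator (?S A) x *\<^sub>R \<psi> x) \<le> norm (B * indicator (cbox 0 (\<chi> i. 2)) x)"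
    proof (rule AE_I2)
      fix x :: "real^'n"
      have "x \<in> cbox 0 (\<chi> i. 2)" if "x \<in> ?S A"
      proof -
        have "0 \<le> x $ i \<and> x $ i \<le> 2" for i
        proof (cases "i = j")
          case True
          then show ?thesis using that A by auto
        next
          case False
          then have "0 \<le> x $ i \<and> x $ i \<le> 1" using that by auto
          then show ?thesis by linarith
        qed
        then show ?thesis by (simp add: mem_box_cart)
      qed
      then show "norm (indicator (?S A) x *\<^sub>R \<psi> x) \<le> norm (B * indicator (cbox 0 (\<chi> i. 2)) x)"
        using B[of x] by (auto split: split_indicator)
    qed
  qed
  have Q: "cbox 0 1 = ?S {0..1}"
  proof -
    have "(\<forall>i. 0 \<le> x $ i \<and> x $ i \<le> 1) \<longleftrightarrow> ?P x \<and> 0 \<le> x $ j \<and> x $ j \<le> 1" for x :: "real^'n"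
      by metis
    then show ?thesis by (auto simp: mem_box_cart)
  qed
  have shift_S: "x - a *\<^sub>R ?e \<in> ?S A \<longleftrightarrow> ?P x \<and> x $ j - a \<in> A" for x a A
    by (auto simp: axis_def)
  have "(LINT x|torus. \<psi> (x + h *\<^sub>R ?e)) = (LINT x|lborel. indicator (?S {0..1}) x *\<^sub>R \<psi> (x + h *\<^sub>R ?e))"
    by (subst integral_restrict_space) (simp_all add: Q)
  also have "\<dots> = (LINT x|lborel. indicator (?S {0..1}) (x - h *\<^sub>R ?e) *\<^sub>R \<psi> x)"
    using integral_lborel_translate[of "\<lambda>x. indicator (?S {0..1}) (x - h *\<^sub>R ?e) *\<^sub>R \<psi> x" "h *\<^sub>R ?e"] by simp
  also have "\<dots> = (LINT x|lborel. indicator (?S {h..1+h}) x *\<^sub>R \<psi> x)"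
  proof (intro Bochner_Integration.integral_cong refl)
    fix x
    have "x - h *\<^sub>R ?e \<in> ?S {0..1} \<longleftrightarrow> x \<in> ?S {h..1+h}" unfolding shift_S by auto
    then show "indicator (?S {0..1}) (x - h *\<^sub>R ?e) *\<^sub>R \<psi> x = indicator (?S {h..1+h}) x *\<^sub>R \<psi> x"
      by (simp add: indicator_def)
  qed
  also have "\<dots> = (LINT x|lborel. indicator (?S {0..1}) x *\<^sub>R \<psi> x + (indicator (?S {1..<1+h}) x *\<^sub>R \<psi> x - indicator (?S {0..<h}) x *\<^sub>R \<psi> x))"
  proof (rule integral_cong_AE)
    have "AE x in lborel. x \<bullet> ?e \<noteq> 1" "AE x in lborel. x \<bullet> ?e \<noteq> 1 + h"
      by (intro AE_lborel_inner_neq axis_in_Basis_iff[THEN iffD2]; simp)+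
    then show "AE x in lborel. indicator (?S {h..1+h}) x *\<^sub>R \<psi> x = indicator (?S {0..1}) x *\<^sub>R \<psi> x + (indicator (?S {1..<1+h}) x *\<^sub>R \<psi> x - indicator (?S {0..<h}) x *\<^sub>R \<psi> x)"
    proof eventually_elim
      case (elim x)
      then have "x $ j \<noteq> 1" "x $ j \<noteq> 1 + h" by (auto simp: inner_axis)
      then show ?case using h by (cases "?P x") (auto simp: indicator_def)
    qed
    show "(\<lambda>x. indicator (?S {h..1+h}) x *\<^sub>R \<psi> x) \<in> borel_measurable lborel"
      using int[of "{h..1+h}"] h by auto
    show "(\<lambda>x. indicator (?S {0..1}) x *\<^sub>R \<psi> x + (indicator (?S {1..<1+h}) x *\<^sub>R \<psi> x - indicator (?S {0..<h}) x *\<^sub>R \<psi> x)) \<in> borel_measurable lborel"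
      using h by (intro borel_measurable_integrable Bochner_Integration.integrable_add Bochner_Integration.integrable_diff int) auto
  qed
  also have "\<dots> = (LINT x|lborel. indicator (?S {0..1}) x *\<^sub>R \<psi> x) + ((LINT x|lborel. indicator (?S {1..<1+h}) x *\<^sub>R \<psi> x) - (LINT x|lborel. indicator (?S {0..<h}) x *\<^sub>R \<psi> x))"
  proof -
    have i1: "integrable lborel (\<lambda>x. indicator (?S {0..1}) x *\<^sub>R \<psi> x)" by (intro int) auto
    have i2: "integrable lborel (\<lambda>x. indicator (?S {1..<1+h}) x *\<^sub>R \<psi> x)" using h by (intro int) auto
    have i3: "integrable lborel (\<lambda>x. indicator (?S {0..<h}) x *\<^sub>R \<psi> x)" using h by (intro int) auto
    show ?thesis
      by (simp only: Bochner_Integration.integral_add[OF i1 Bochner_Integration.integrable_diff[OF i2 i3]]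
          Bochner_Integration.integral_diff[OF i2 i3])
  qed
  also have "(LINT x|lborel. indicator (?S {1..<1+h}) x *\<^sub>R \<psi> x) = (LINT x|lborel. indicator (?S {0..<h}) x *\<^sub>R \<psi> x)"
  proof -
    have "(LINT x|lborel. indicator (?S {1..<1+h}) x *\<^sub>R \<psi> x) = (LINT x|lborel. indicator (?S {1..<1+h}) (x + ?e) *\<^sub>R \<psi> (x + ?e))"
      by (rule integral_lborel_translate[symmetric])
    also have "\<dots> = (LINT x|lborel. indicator (?S {0..<h}) x *\<^sub>R \<psi> x)"
    proof (intro Bochner_Integration.integral_cong refl)
      fix x
      have "x + ?e \<in> ?S {1..<1+h} \<longleftrightarrow> x \<in> ?S {0..<h}" using shift_S[of x "-1" "{1..<1+h}"] by auto
      moreover have "\<psi> (x + ?e) = \<psi> x" using per by (simp add: periodic_def)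
      ultimately show "indicator (?S {1..<1+h}) (x + ?e) *\<^sub>R \<psi> (x + ?e) = indicator (?S {0..<h}) x *\<^sub>R \<psi> x"
        by (simp add: indicator_def)
    qed
    finally show ?thesis .
  qed
  also have "(LINT x|lborel. indicator (?S {0..1}) x *\<^sub>R \<psi> x) = (LINT x|torus. \<psi> x)"
    by (subst integral_restrict_space) (simp_all add: Q)
  finally show ?thesis by simp
qed

definition coef :: "(real^'n \<Rightarrow> complex) \<Rightarrow> real^'n \<Rightarrow> complex" where
  "coef \<phi> n = (LINT x|torus. \<phi> x * chi (- n) x)"

lemma coef_partial_deriv:
  fixes \<phi> :: "real^'n \<Rightarrow> complex"
  assumes \<phi>: "\<phi> \<in> smooth_periodic" and n: "n \<in> int_lattice"
  shows "coef (partial_deriv j \<phi>) n = 2 * pi * \<i> * of_real (n $ j) * coef \<phi> n"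
proof -
  let ?\<psi> = "\<lambda>x. \<phi> x * chi (- n) x"
  have n': "- n \<in> int_lattice" using n by simp
  note D = smooth_periodicD[OF \<phi>] and D' = smooth_periodicD[OF smooth_periodicD(4)[OF \<phi>]]
  have pd: "partial_deriv j ?\<psi> x = partial_deriv j \<phi> x * chi (- n) x - (2 * pi * \<i> * of_real (n $ j)) * ?\<psi> x" for x
    by (subst partial_deriv_mult) (auto simp: D differentiable_chi partial_deriv_chi)
  have per: "periodic ?\<psi>" "periodic (\<lambda>x. partial_deriv j \<phi> x * chi (- n) x)"
    using D(3) D'(3) periodic_chi[OF n'] by (simp_all add: periodic_def)
  have cont: "continuous_on UNIV ?\<psi>" "continuous_on UNIV (\<lambda>x. partial_deriv j \<phi> x * chi (- n) x)"
    by (intro continuous_intros D D')+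
  have pd': "partial_deriv j ?\<psi> = (\<lambda>x. partial_deriv j \<phi> x * chi (- n) x - (2 * pi * \<i> * of_real (n $ j)) * ?\<psi> x)"
    by (intro ext pd)
  have per_pd: "periodic (partial_deriv j ?\<psi>)" and cont_pd: "continuous_on UNIV (partial_deriv j ?\<psi>)"
    unfolding pd' using per by (auto simp: periodic_def intro!: continuous_intros cont D D')
  obtain B where B: "\<And>x. norm (partial_deriv j ?\<psi> x) \<le> B" using periodic_bounded[OF per_pd cont_pd] by blast
  have "(LINT x|torus. partial_deriv j ?\<psi> x) = 0"
  proof (rule integral_partial_deriv_eq_0)
    show "?\<psi> differentiable (at x)" for x by (intro differentiable_mult D differentiable_chi)
    show "partial_deriv j ?\<psi> \<in> borel_measurable borel" using cont_pd by (rule borel_measurable_continuous_onI)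
    show "integrable torus (\<lambda>x::real^'n. B)" by simp
    show "integrable torus (\<lambda>x. ?\<psi> (x + h *\<^sub>R axis j 1))" for h
    proof (rule integrable_torus_continuous)
      show "continuous_on UNIV (\<lambda>x. ?\<psi> (x + h *\<^sub>R axis j 1))"
        by (rule continuous_on_compose2[OF cont(1)]) (auto intro!: continuous_intros)
      have "?\<psi> (x + m + h *\<^sub>R axis j 1) = ?\<psi> (x + h *\<^sub>R axis j 1)" if "m \<in> int_lattice" for x m
      proof -
        have "x + m + h *\<^sub>R axis j 1 = (x + h *\<^sub>R axis j 1) + m" by simp
        moreover have "?\<psi> (y + m) = ?\<psi> y" for y using per(1) that unfolding periodic_def by blast
        ultimately show ?thesis by (simp only:)
      qed
      then show "periodic (\<lambda>x. ?\<psi> (x + h *\<^sub>R axis j 1))" by (simp add: periodic_def)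
    qed
  qed (use B in \<open>auto intro!: integral_torus_translate per cont simp: sets_restrict_space\<close>)
  moreover have "(LINT x|torus. partial_deriv j ?\<psi> x) = coef (partial_deriv j \<phi>) n - 2 * pi * \<i> * of_real (n $ j) * coef \<phi> n"
    unfolding pd' coef_def using integrable_torus_continuous[OF per(1) cont(1)] integrable_torus_continuous[OF per(2) cont(2)]
    by (subst Bochner_Integration.integral_diff) auto
  ultimately show ?thesis by simp
qed

text \<open>Orthogonality of the characters: by \<open>coef_partial_deriv\<close> the coefficients of the constant function
  one, whose derivatives vanish, are zero away from the origin.\<close>

lemma integral_chi:
  fixes n :: "real^'n"
  assumes n: "n \<in> int_lattice" shows "(LINT x|torus. chi n x) = (if n = 0 then 1 else 0)"
proof (cases "n = 0")
  case True
  then show ?thesis using measure_torus by (simp add: space_torus scaleR_conv_of_real)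
next
  case False
  then obtain j where j: "n $ j \<noteq> 0" by (auto simp: vec_eq_iff)
  have "chi (0 :: real^'n) = (\<lambda>x. 1)" by (simp add: fun_eq_iff)
  then have "(\<lambda>x::real^'n. 1) \<in> smooth_periodic" using smooth_periodic_chi[of "0 :: real^'n"] by simp
  from coef_partial_deriv[OF this, of "- n" j] n j have "coef (\<lambda>x. 1) (- n) = 0"
    by (simp add: coef_def)
  then show ?thesis using False by (simp add: coef_def)
qed

section \<open>Density of trigonometric polynomials\<close>

inductive_set trig :: "(real^'n \<Rightarrow> complex) set" where
  chi: "n \<in> int_lattice \<Longrightarrow> chi n \<in> trig"
| add: "k \<in> trig \<Longrightarrow> l \<in> trig \<Longrightarrow> (\<lambda>x. k x + l x) \<in> trig"
| cmult: "k \<in> trig \<Longrightarrow> (\<lambda>x. c * k x) \<in> trig"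

lemma trig_one: "(\<lambda>x. 1) \<in> (trig :: (real^'n \<Rightarrow> complex) set)"
proof -
  have "chi (0 :: real^'n) = (\<lambda>x. 1)" by (simp add: fun_eq_iff)
  then show ?thesis using trig.chi[of "0 :: real^'n"] by simp
qed

lemma trig_mult_chi: assumes "k \<in> trig" "n \<in> int_lattice" shows "(\<lambda>x. chi n x * k x) \<in> trig"
  using assms(1)
proof induction
  case (chi m)
  have "(\<lambda>x. chi n x * chi m x) = chi (n + m)" by (simp add: fun_eq_iff chi_add)
  then show ?case using chi assms(2) by (simp add: trig.chi)
next
  case (add k l)
  then show ?case using trig.add by (fastforce simp: distrib_left)
next
  case (cmult k c)
  then show ?case using trig.cmult[OF cmult.IH, of c] by (simp add: mult.left_commute)
qed

lemma trig_mult: assumes "k \<in> trig" "l \<in> trig" shows "(\<lambda>x. k x * l x) \<in> trig"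
  using assms(1)
proof induction
  case (chi n)
  then show ?case using trig_mult_chi assms(2) by blast
next
  case (add k k')
  then show ?case using trig.add[OF add.IH] by (simp add: distrib_right)
next
  case (cmult k c)
  then show ?case using trig.cmult[OF cmult.IH, of c] by (simp add: mult.assoc)
qed

lemma trig_power: "k \<in> trig \<Longrightarrow> (\<lambda>x. k x ^ N) \<in> trig"
  by (induction N) (auto intro: trig_one trig_mult)

lemma trig_smooth_periodic: "k \<in> trig \<Longrightarrow> k \<in> smooth_periodic"
  by (induction rule: trig.induct) (auto intro: smooth_periodic_chi smooth_periodic_add smooth_periodic_cmult)

text \<open>Convolution on the torus.\<close>

definition tconv :: "(real^'n \<Rightarrow> complex) \<Rightarrow> (real^'n \<Rightarrow> complex) \<Rightarrow> real^'n \<Rightarrow> complex" where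
  "tconv k w x = (LINT y|torus. k (x - y) * w y)"

lemma integrable_tconv:
  assumes k: "k \<in> trig" and w: "continuous_on UNIV w" "periodic w"
  shows "integrable torus (\<lambda>y. k (x - y) * w y)"
proof (rule integrable_torus_continuous)
  note K = smooth_periodicD[OF trig_smooth_periodic[OF k]]
  show "continuous_on UNIV (\<lambda>y. k (x - y) * w y)"
    by (intro continuous_intros w continuous_on_compose2[OF K(2)]) auto
  have "k (x - (y + n)) = k (x - y)" if "n \<in> int_lattice" for y n
  proof -
    have "k ((x - (y + n)) + n) = k (x - (y + n))" using K(3) that unfolding periodic_def by blast
    then show ?thesis by simp
  qed
  then show "periodic (\<lambda>y. k (x - y) * w y)" using w(2) by (simp add: periodic_def)
qed

lemma tconv_chi: "tconv (chi n) w = (\<lambda>x. coef w n * chi n x)"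
proof
  fix x
  have "chi n (x - y) * w y = chi n x * (w y * chi (- n) y)" for y
    using chi_add(2)[of n x "- y"] by (simp add: chi_minus(1) ac_simps)
  then have "(\<lambda>y. chi n (x - y) * w y) = (\<lambda>y. chi n x * (w y * chi (- n) y))" by (rule ext)
  then show "tconv (chi n) w x = coef w n * chi n x"
    by (simp add: tconv_def coef_def)
qed

lemma tconv_add:
  assumes "k \<in> trig" "l \<in> trig" "continuous_on UNIV w" "periodic w"
  shows "tconv (\<lambda>x. k x + l x) w = (\<lambda>x. tconv k w x + tconv l w x)"
  unfolding tconv_def using integrable_tconv[OF assms(1,3,4)] integrable_tconv[OF assms(2,3,4)]
  by (simp add: distrib_right)

lemma tconv_cmult: "tconv (\<lambda>x. c * k x) w = (\<lambda>x. c * tconv k w x)"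
  unfolding tconv_def by (simp add: mult.assoc)

text \<open>Convolution with a character is a multiple of the character.\<close>

lemma tconv_trig:
  assumes "k \<in> trig" and w: "continuous_on UNIV w" "periodic w"
  shows "tconv k w \<in> trig"
  using assms(1)
proof induction
  case (chi n)
  then show ?case by (simp add: tconv_chi trig.chi trig.cmult)
next
  case (add k l)
  then show ?case by (simp add: tconv_add[OF add.hyps w] trig.add)
next
  case (cmult k c)
  then show ?case by (simp add: tconv_cmult trig.cmult)
qed

text \<open>The derivative moves to the other factor, because on each character both sides are the same
  multiple of it.  Hence one kernel approximates a function together with all its derivatives.\<close>

lemma partial_deriv_tconv:
  assumes "k \<in> trig" and \<phi>: "\<phi> \<in> smooth_periodic"
  shows "partial_deriv j (tconv k \<phi>) = tconv k (partial_deriv j \<phi>)"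
  using assms(1)
proof induction
  note D = smooth_periodicD[OF \<phi>] and D' = smooth_periodicD[OF smooth_periodicD(4)[OF \<phi>]]
  case (chi n)
  then show ?case
    by (intro ext) (simp add: tconv_chi partial_deriv_cmult[OF differentiable_chi] partial_deriv_chi coef_partial_deriv[OF \<phi>])
next
  note D = smooth_periodicD[OF \<phi>] and D' = smooth_periodicD[OF smooth_periodicD(4)[OF \<phi>]]
  case (add k l)
  have "tconv k \<phi> differentiable (at x)" "tconv l \<phi> differentiable (at x)" for x
    using add.hyps by (auto intro!: smooth_periodicD(1) trig_smooth_periodic tconv_trig D)
  then show ?case
    by (intro ext) (simp add: tconv_add[OF add.hyps D(2,3)] tconv_add[OF add.hyps D'(2,3)] partial_deriv_add add.IH)
next
  note D = smooth_periodicD[OF \<phi>]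
  case (cmult k c)
  have "tconv k \<phi> differentiable (at x)" for x
    using cmult.hyps by (auto intro!: smooth_periodicD(1) trig_smooth_periodic tconv_trig D)
  then show ?case
    by (intro ext) (simp add: tconv_cmult partial_deriv_cmult cmult.IH)
qed

lemma integral_trig_reflect:
  assumes "k \<in> trig" shows "(LINT y|torus. k (x - y)) = (LINT y|torus. k (- y))"
  using assms
proof induction
  case (chi n)
  have "chi n (x - y) = chi n x * chi (- n) y" for y
    using chi_add(2)[of n x "- y"] by (simp add: chi_minus(1))
  then show ?case using chi by (simp add: integral_chi chi_minus(1)[symmetric])
next
  case (add k l)
  have "continuous_on UNIV (\<lambda>x. 1)" "periodic (\<lambda>x. 1)" by (auto simp: periodic_def)
  note int = integrable_tconv[OF add.hyps(1) this] integrable_tconv[OF add.hyps(2) this]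
  show ?case using int[of x] int[of 0] add.IH by simp
qed simp

text \<open>A trigonometric polynomial with values in \<open>[0, 1]\<close> and the value one exactly on the lattice, so that
  its high powers concentrate there.\<close>

definition kern :: "real^'n \<Rightarrow> real" where
  "kern x = (\<Prod>i\<in>UNIV. (1 + cos (2 * pi * x $ i)) / 2)"

lemma kern_factor: "0 \<le> (1 + cos (2 * pi * t)) / 2" "(1 + cos (2 * pi * t)) / 2 \<le> 1"
proof -
  have "- 1 \<le> cos (2 * pi * t)" "cos (2 * pi * t) \<le> 1" by simp_all
  then have "0 \<le> 1 + cos (2 * pi * t)" "1 + cos (2 * pi * t) \<le> 2" by linarith+
  then show "0 \<le> (1 + cos (2 * pi * t)) / 2" "(1 + cos (2 * pi * t)) / 2 \<le> 1" by simp_all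
qed

lemma kern_nonneg: "0 \<le> kern x" and kern_le_1: "kern x \<le> 1"
  unfolding kern_def by (auto intro!: prod_nonneg prod_le_1 kern_factor)

lemma kern_le_factor: "kern x \<le> (1 + cos (2 * pi * x $ i)) / 2"
proof -
  have "kern x = (1 + cos (2 * pi * x $ i)) / 2 * (\<Prod>i\<in>UNIV - {i}. (1 + cos (2 * pi * x $ i)) / 2)"
    unfolding kern_def by (rule prod.remove) auto
  also have "\<dots> \<le> (1 + cos (2 * pi * x $ i)) / 2 * 1"
    by (intro mult_left_mono prod_le_1 conjI kern_factor)
  finally show ?thesis by simp
qed

lemma kern_trig: "(\<lambda>x. complex_of_real (kern x)) \<in> (trig :: (real^'n \<Rightarrow> complex) set)"
proof -
  have factor: "(\<lambda>x. complex_of_real ((1 + cos (2 * pi * x $ i)) / 2)) \<in> trig" for i :: 'n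
  proof -
    let ?e = "axis i 1 :: real^'n"
    have "complex_of_real ((1 + cos (2 * pi * x $ i)) / 2) = (1/2) * 1 + (1/4) * (chi ?e x + chi (- ?e) x)" for x
      by (simp add: chi_def complex_eq_iff inner_axis cis.code field_simps)
    moreover have "(\<lambda>x. (1/2) * 1 + (1/4) * (chi ?e x + chi (- ?e) x)) \<in> trig"
      by (intro trig.add trig.cmult trig.chi trig_one) auto
    ultimately show ?thesis by (simp only:)
  qed
  have "(\<lambda>x. \<Prod>i\<in>I. complex_of_real ((1 + cos (2 * pi * x $ i)) / 2)) \<in> trig" for I :: "'n set"
  proof (induction I rule: infinite_finite_induct)
    case (insert i I)
    then show ?case using trig_mult[OF factor insert.IH] by simp
  qed (auto intro: trig_one)
  then show ?thesis by (simp add: kern_def)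
qed

lemma continuous_kern: "continuous_on UNIV kern"
  unfolding kern_def by (intro continuous_intros) auto

lemma kern_power_trig: "(\<lambda>x. complex_of_real (kern x ^ N)) \<in> trig"
  using trig_power[OF kern_trig] by simp

lemma kern_concentrated:
  assumes "0 < (\<delta>::real)"
  shows "\<exists>r. 0 \<le> r \<and> r < 1 \<and> (\<forall>x::real^'n. r < kern x \<longrightarrow> (\<exists>m\<in>int_lattice. norm (x - m) < \<delta>))"
proof -
  \<comment> \<open>Coordinatewise distances below \<open>\<delta> / d\<close> give norm below \<open>\<delta>\<close>; the bound \<open>1/4\<close> keeps the cosine monotone.\<close>
  define \<delta>' where "\<delta>' = min (\<delta> / real CARD('n)) (1/4)"
  have \<delta>': "0 < \<delta>'" "\<delta>' \<le> 1/4" "real CARD('n) * \<delta>' \<le> \<delta>"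
    using assms by (auto simp: \<delta>'_def min_def field_simps)
  define r where "r = (1 + cos (2 * pi * \<delta>')) / 2"
  have "cos (2 * pi * \<delta>') < cos 0"
    using \<delta>' pi_gt_zero by (intro cos_monotone_0_pi) auto
  then have r: "0 \<le> r" "r < 1" unfolding r_def using kern_factor(1) by auto
  have "\<exists>m\<in>int_lattice. norm (x - m) < \<delta>" if "r < kern x" for x :: "real^'n"
  proof (intro bexI)
    have "\<bar>(x - nearest x) $ i\<bar> < \<delta>'" for i
    proof -
      define m where "m = \<lceil>x $ i - 1/2\<rceil>"
      define t where "t = x $ i - of_int m"
      have "of_int m - 1 < x $ i - 1/2" "x $ i - 1/2 \<le> of_int m" unfolding m_def using ceiling_correct by blast+
      then have t: "\<bar>t\<bar> \<le> 1/2" unfolding t_def abs_le_iff by linarith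
      have "2 * pi * x $ i = 2 * pi * t + 2 * pi * of_int m" by (simp add: t_def algebra_simps)
      then have "cos (2 * pi * x $ i) = cos (2 * pi * t)"
        by (simp add: cos_add cos_int_2pin sin_int_2pin)
      then have "cos (2 * pi * \<delta>') < cos (2 * pi * \<bar>t\<bar>)"
        using that kern_le_factor[of x i] cos_abs_real[of "2 * pi * t"] by (simp add: r_def abs_mult)
      then have "\<bar>t\<bar> < \<delta>'"
      proof (rule contrapos_pp)
        assume "\<not> \<bar>t\<bar> < \<delta>'"
        then have "2 * pi * \<delta>' \<le> 2 * pi * \<bar>t\<bar>" by simp
        moreover have "2 * pi * \<bar>t\<bar> \<le> 2 * pi * (1/2)" using t by (intro mult_left_mono) auto
        ultimately show "\<not> cos (2 * pi * \<delta>') < cos (2 * pi * \<bar>t\<bar>)"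
          using \<delta>' cos_monotone_0_pi_le[of "2 * pi * \<delta>'" "2 * pi * \<bar>t\<bar>"] by simp
      qed
      then show ?thesis by (simp add: nearest_def t_def m_def)
    qed
    then have "(\<Sum>i\<in>UNIV. \<bar>(x - nearest x) $ i\<bar>) < (\<Sum>i\<in>(UNIV :: 'n set). \<delta>')"
      by (intro sum_strict_mono) auto
    then show "norm (x - nearest x) < \<delta>"
      using norm_le_l1_cart[of "x - nearest x"] \<delta>'(3) by simp
  qed simp
  then show ?thesis using r by blast
qed

lemma periodic_uniformly_continuous:
  fixes w :: "real^'n \<Rightarrow> complex"
  assumes w: "continuous_on UNIV w" "periodic w" and e: "0 < e"
  shows "\<exists>\<delta>>0. \<forall>x y. norm (x - y) < \<delta> \<longrightarrow> norm (w x - w y) < e"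
proof -
  \<comment> \<open>Contains the unit cell together with all points at distance at most one from it.\<close>
  let ?K = "cbox (\<chi> i. -1) (\<chi> i. 2) :: (real^'n) set"
  have "uniformly_continuous_on ?K w"
    by (intro compact_uniformly_continuous continuous_on_subset[OF w(1)]) auto
  from this[unfolded uniformly_continuous_on_def, rule_format, OF e]
  obtain d where "0 < d" "\<forall>x\<in>?K. \<forall>y\<in>?K. dist y x < d \<longrightarrow> dist (w y) (w x) < e"
    by (elim exE conjE)
  then have d: "0 < d" "\<And>x y. y \<in> ?K \<Longrightarrow> x \<in> ?K \<Longrightarrow> dist x y < d \<Longrightarrow> dist (w x) (w y) < e"
    by simp_all
  have "norm (w x - w y) < e" if xy: "norm (x - y) < min d 1" for x y
  proof -
    define n where "n = x - frac_vec x"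
    have n: "- n \<in> int_lattice" unfolding n_def by (rule int_lattice_simps(4)[OF frac_vec(1)])
    have x: "x + - n \<in> cbox 0 1" using frac_vec(2)[of x] by (simp add: n_def)
    have "x + - n \<in> ?K \<and> y + - n \<in> ?K"
      unfolding mem_box_cart
    proof (intro conjI allI)
      fix i
      have "0 $ i \<le> (x + - n) $ i \<and> (x + - n) $ i \<le> (1 :: real^'n) $ i" using x unfolding mem_box_cart by (rule spec)
      then have 1: "0 \<le> x $ i - n $ i" "x $ i - n $ i \<le> 1" by simp_all
      have "\<bar>(x - y) $ i\<bar> < 1" using xy by (intro le_less_trans[OF component_le_norm_cart]) simp
      then have 2: "x $ i - y $ i < 1" "y $ i - x $ i < 1" by (simp_all add: abs_less_iff)
      show "(\<chi> i. -1) $ i \<le> (x + - n) $ i" "(x + - n) $ i \<le> (\<chi> i. 2) $ i"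
        using 1 by simp_all
      show "(\<chi> i. -1) $ i \<le> (y + - n) $ i" "(y + - n) $ i \<le> (\<chi> i. 2) $ i"
        using 1 2 by simp_all
    qed
    moreover have "dist (x + - n) (y + - n) < d" using xy by (simp add: dist_norm)
    ultimately have "dist (w (x + - n)) (w (y + - n)) < e" by (intro d(2)) simp_all
    moreover have "w (x + - n) = w x" "w (y + - n) = w y"
      using w(2) n unfolding periodic_def by blast+
    ultimately show ?thesis by (simp only: dist_norm)
  qed
  then show ?thesis using d(1) by (intro exI[of _ "min d 1"]) auto
qed

text \<open>The reflection is that of the convolution at the origin, to which \<open>integral_trig_reflect\<close> reduces all
  others.\<close>

definition kern_mass :: "'n::finite itself \<Rightarrow> nat \<Rightarrow> real" where
  "kern_mass _ N = (LINT y|torus. kern (- y :: real^'n) ^ N)"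

text \<open>The kernel exceeds \<open>\<rho>\<close> on a small box with a corner at the origin.\<close>

lemma kern_mass_ge:
  assumes "0 \<le> \<rho>" "\<rho> < 1"
  shows "\<exists>v>0. \<forall>N. \<rho> ^ N * v \<le> kern_mass TYPE('n::finite) N"
proof -
  have "kern (0::real^'n) = 1" by (simp add: kern_def)
  moreover have "isCont (\<lambda>y::real^'n. kern (- y)) 0"
  proof -
    have "continuous_on UNIV (\<lambda>y::real^'n. kern (- y))"
      by (rule continuous_on_compose2[OF continuous_kern]) (auto intro: continuous_on_minus continuous_on_id)
    then show ?thesis by (simp add: continuous_on_eq_continuous_at)
  qed
  ultimately have "\<forall>\<^sub>F y in nhds (0::real^'n). \<rho> < kern (- y)"
  proof -
    assume "kern (0::real^'n) = 1" "isCont (\<lambda>y::real^'n. kern (- y)) 0"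
    from this(2) have "((\<lambda>y::real^'n. kern (- y)) \<longlongrightarrow> kern (- 0 :: real^'n)) (nhds 0)"
      unfolding isCont_def by (rule tendsto_at_iff_tendsto_nhds[where g="\<lambda>y::real^'n. kern (- y)", THEN iffD1])
    then show ?thesis
      using assms(2) \<open>kern (0::real^'n) = 1\<close> by (intro order_tendstoD(1)) auto
  qed
  then obtain d where d: "0 < d" "\<And>y::real^'n. norm y < d \<Longrightarrow> \<rho> < kern (- y)"
    unfolding eventually_nhds_metric by (auto simp: dist_norm)
  define \<eta> where "\<eta> = min 1 (d / (2 * real CARD('n)))"
  have \<eta>: "0 < \<eta>" "\<eta> \<le> 1" "real CARD('n) * \<eta> < d"
  proof -
    show "0 < \<eta>" "\<eta> \<le> 1" using d(1) by (auto simp: \<eta>_def)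
    have "real CARD('n) * \<eta> \<le> real CARD('n) * (d / (2 * real CARD('n)))"
      by (intro mult_left_mono) (auto simp: \<eta>_def)
    also have "\<dots> = d / 2" by simp
    also have "\<dots> < d" using d(1) by simp
    finally show "real CARD('n) * \<eta> < d" .
  qed
  let ?B = "cbox 0 (\<chi> i. \<eta>) :: (real^'n) set"
  have B: "\<rho> \<le> kern (- y)" if "y \<in> ?B" for y
  proof -
    have "norm y \<le> (\<Sum>i\<in>UNIV. \<bar>y $ i\<bar>)" by (rule norm_le_l1_cart)
    also have "\<dots> \<le> (\<Sum>i\<in>(UNIV::'n set). \<eta>)" using that by (intro sum_mono) (auto simp: mem_box_cart)
    also have "\<dots> < d" using \<eta>(3) by simp
    finally show ?thesis using d(2) by (simp add: less_imp_le)
  qed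
  have sub: "?B \<subseteq> cbox 0 1"
    unfolding subset_iff mem_box_cart using \<eta> by (auto intro: order_trans)
  define v where "v = measure torus ?B"
  have "v = measure lborel ?B"
    using sub by (simp add: v_def measure_restrict_space)
  also have "\<dots> = (\<Prod>b\<in>Basis. ((\<chi> i. \<eta>) - (0::real^'n)) \<bullet> b)"
    using \<eta>(1) by (intro measure_lborel_cbox_eq[THEN trans]) (auto simp: Basis_vec_def inner_axis)
  also have "\<dots> > 0"
    using \<eta>(1) by (intro prod_pos) (auto simp: Basis_vec_def inner_axis)
  finally have v: "0 < v" .
  have "\<rho> ^ N * v \<le> kern_mass TYPE('n) N" for N
  proof -
    have m: "(\<lambda>y::real^'n. kern (- y) ^ N) \<in> borel_measurable borel"
      by (intro borel_measurable_continuous_onI continuous_intros continuous_on_compose2[OF continuous_kern]) auto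
    have Bt: "?B \<in> sets torus" using sub by (auto simp: sets_restrict_space_iff)
    have "\<rho> ^ N * v = (LINT y|torus. \<rho> ^ N * indicator ?B y)"
      using Bt sub by (simp add: v_def space_torus Int_absorb2)
    also have "\<dots> \<le> (LINT y|torus. kern (- y :: real^'n) ^ N)"
    proof (rule integral_mono)
      show "integrable torus (\<lambda>y. \<rho> ^ N * indicator ?B y)"
        using assms by (intro integrable_torus_bounded[where B="\<rho> ^ N"]) (auto simp: indicator_def)
      show "integrable torus (\<lambda>y::real^'n. kern (- y) ^ N)"
        using m by (rule integrable_torus_bounded[where B=1]) (simp add: power_le_one kern_nonneg kern_le_1)
      fix y
      show "\<rho> ^ N * indicator ?B y \<le> kern (- y) ^ N"
        using B[of y] assms(1) by (cases "y \<in> ?B") (auto intro: power_mono simp: kern_nonneg)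
    qed
    finally show ?thesis by (simp add: kern_mass_def)
  qed
  then show ?thesis using v by blast
qed

text \<open>Off a neighbourhood of the lattice the powers of \<open>kern\<close> are at most \<open>r ^ N\<close>, while their mass is at
  least a multiple of \<open>\<rho> ^ N\<close> with \<open>r < \<rho>\<close>.\<close>

lemma kern_approx_identity:
  fixes w :: "real^'n \<Rightarrow> complex"
  assumes w: "continuous_on UNIV w" "periodic w" and e: "0 < e"
  shows "\<forall>\<^sub>F N in sequentially. 0 < kern_mass TYPE('n) N \<and>
    (\<forall>x. norm (tconv (\<lambda>x. complex_of_real (kern x ^ N)) w x - of_real (kern_mass TYPE('n) N) * w x) \<le> e * kern_mass TYPE('n) N)"
proof -
  obtain \<delta> where \<delta>: "0 < \<delta>" "\<And>x y. norm (x - y) < \<delta> \<Longrightarrow> norm (w x - w y) < e / 2"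
    using periodic_uniformly_continuous[OF w, of "e/2"] e by auto
  obtain r where r: "0 \<le> r" "r < 1" "\<And>x::real^'n. r < kern x \<Longrightarrow> \<exists>m\<in>int_lattice. norm (x - m) < \<delta>"
    using kern_concentrated[OF \<delta>(1)] by blast
  obtain B where B: "\<And>x. norm (w x) \<le> B" using periodic_bounded[OF w(2,1)] by blast
  have B0: "0 \<le> B" by (rule order_trans[OF norm_ge_zero B])
  \<comment> \<open>Strictly between \<open>r\<close> and one: the mass decays at worst like \<open>\<rho> ^ N\<close>, the tails like \<open>r ^ N\<close>.\<close>
  define \<rho> where "\<rho> = (1 + r) / 2"
  have \<rho>: "0 < \<rho>" "\<rho> < 1" "r < \<rho>" using r by (auto simp: \<rho>_def)
  obtain v where v: "0 < v" "\<And>N. \<rho> ^ N * v \<le> kern_mass TYPE('n) N"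
    using kern_mass_ge[of \<rho>] \<rho> by (metis less_imp_le)
  have "(\<lambda>N. 2 * B / v * (r / \<rho>) ^ N) \<longlonglongrightarrow> 2 * B / v * 0"
    using r \<rho> by (intro tendsto_mult tendsto_const LIMSEQ_power_zero) auto
  then have "\<forall>\<^sub>F N in sequentially. 2 * B / v * (r / \<rho>) ^ N < e / 2"
    using e by (intro order_tendstoD(2)[where y="2 * B / v * 0"]) auto
  then show ?thesis
  proof eventually_elim
    case (elim N)
    let ?c = "kern_mass TYPE('n) N"
    have c: "0 < ?c" using v(2)[of N] v(1) \<rho> by (intro less_le_trans[OF _ v(2)]) auto
    have small: "2 * B * r ^ N \<le> e / 2 * ?c"
    proof -
      have "2 * B * r ^ N = (2 * B / v * (r / \<rho>) ^ N) * (\<rho> ^ N * v)"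
        using v \<rho> by (simp add: power_divide)
      also have "\<dots> \<le> e / 2 * ?c"
        using elim v e \<rho> B0 r by (intro mult_mono) auto
      finally show ?thesis .
    qed
    have "norm (tconv (\<lambda>x. complex_of_real (kern x ^ N)) w x - of_real ?c * w x) \<le> e * ?c" for x
    proof -
      let ?k = "\<lambda>x. complex_of_real (kern x ^ N)"
      have one: "continuous_on UNIV (\<lambda>x::real^'n. 1::complex)" "periodic (\<lambda>x::real^'n. 1)" by (auto simp: periodic_def)
      note i1 = integrable_tconv[OF kern_power_trig[of N] w, of x]
        and i2 = integrable_tconv[OF kern_power_trig[of N] one, of x]
      have i2': "integrable torus (\<lambda>y. kern (x - y) ^ N)" using i2 by (simp add: complex_of_real_integrable_eq del: of_real_power)
      have mass: "(LINT y|torus. ?k (x - y)) = of_real ?c"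
        unfolding integral_trig_reflect[OF kern_power_trig] kern_mass_def
        by (simp only: integral_complex_of_real)
      then have mass': "(LINT y|torus. kern (x - y) ^ N) = ?c"
        by (simp only: integral_complex_of_real of_real_eq_iff)
      have "tconv ?k w x - of_real ?c * w x = (LINT y|torus. ?k (x - y) * (w y - w x))"
        unfolding tconv_def mass[symmetric] using i1 i2
        by (simp add: right_diff_distrib del: of_real_power)
      also have "norm \<dots> \<le> (LINT y|torus. e / 2 * kern (x - y) ^ N + 2 * B * r ^ N)"
      proof (rule Bochner_Integration.integral_norm_bound_integral)
        show "integrable torus (\<lambda>y. ?k (x - y) * (w y - w x))"
          using i1 integrable_mult_left[OF i2, of "w x"] by (simp add: right_diff_distrib)
        show "integrable torus (\<lambda>y. e / 2 * kern (x - y) ^ N + 2 * B * r ^ N)"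
          using i2' by auto
        fix y
        have nk: "norm (?k (x - y) * (w y - w x)) = kern (x - y) ^ N * norm (w y - w x)"
          by (simp add: norm_mult norm_power kern_nonneg)
        show "norm (?k (x - y) * (w y - w x)) \<le> e / 2 * kern (x - y) ^ N + 2 * B * r ^ N"
        proof (cases "r < kern (x - y)")
          case True
          then obtain m where m: "m \<in> int_lattice" "norm (x - y - m) < \<delta>" using r(3) by blast
          have "norm (y + m - x) < \<delta>" using m(2) by (metis diff_diff_eq norm_minus_commute)
          then have "norm (w (y + m) - w x) < e / 2" by (rule \<delta>(2))
          moreover have "w (y + m) = w y" using w(2) m(1) by (simp add: periodic_def)
          ultimately have "norm (w y - w x) \<le> e / 2" by simp
          then have "kern (x - y) ^ N * norm (w y - w x) \<le> kern (x - y) ^ N * (e / 2)"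
            by (intro mult_left_mono) (auto simp: kern_nonneg)
          moreover have "0 \<le> 2 * B * r ^ N" using B0 r(1) by simp
          ultimately show ?thesis unfolding nk mult.commute[of "e / 2"] by linarith
        next
          case False
          then have "kern (x - y) ^ N \<le> r ^ N" by (intro power_mono) (auto simp: kern_nonneg)
          moreover have "norm (w y - w x) \<le> 2 * B" using norm_triangle_ineq4[of "w y" "w x"] B[of x] B[of y] by linarith
          ultimately have "kern (x - y) ^ N * norm (w y - w x) \<le> r ^ N * (2 * B)"
            using r(1) by (intro mult_mono) auto
          moreover have "0 \<le> e / 2 * kern (x - y) ^ N" using e by (simp add: kern_nonneg)
          ultimately show ?thesis unfolding nk mult.commute[of "2 * B"] by linarith
        qed
      qed
      also have "\<dots> = e / 2 * ?c + 2 * B * r ^ N"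
        using i2' measure_torus[where 'n='n] by (simp add: mass' space_torus)
      also have "\<dots> \<le> e * ?c" using small by simp
      finally show ?thesis .
    qed
    then show ?case using c by blast
  qed
qed

text \<open>The hypothesis makes all Fourier coefficients vanish, hence all convolutions with trigonometric
  polynomials, and these approximate \<open>v\<close>.\<close>

lemma continuous_eq_0_Td:
  fixes v :: "real^'n \<Rightarrow> complex"
  assumes v: "continuous_on UNIV v" "periodic v"
    and 0: "\<And>\<phi>. \<phi> \<in> smooth_periodic \<Longrightarrow> (LINT x|torus. v x * \<phi> x) = 0"
  shows "v x = 0"
proof (rule ccontr)
  assume "v x \<noteq> 0"
  then have "0 < norm (v x) / 2" by simp
  from eventually_happens'[OF _ kern_approx_identity[OF v this]] obtain N where
    N: "0 < kern_mass TYPE('n) N" "norm (tconv (\<lambda>x. complex_of_real (kern x ^ N)) v x - of_real (kern_mass TYPE('n) N) * v x)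
      \<le> norm (v x) / 2 * kern_mass TYPE('n) N" by auto
  have "tconv k v x = 0" if "k \<in> trig" for k x
    using that
  proof induction
    case (chi n)
    then have "coef v n = 0" unfolding coef_def by (intro 0 smooth_periodic_chi) simp
    then show ?case by (simp add: tconv_chi)
  next
    case (add k l)
    then show ?case by (simp add: tconv_add[OF add.hyps v])
  qed (simp add: tconv_cmult)
  from this[OF kern_power_trig] N have "kern_mass TYPE('n) N * norm (v x) \<le> norm (v x) / 2 * kern_mass TYPE('n) N"
    by (simp add: norm_mult del: of_real_power)
  then show False using N(1) \<open>v x \<noteq> 0\<close> by (simp add: field_simps)
qed

section \<open>Distributions with integrable Fourier transform\<close>

lemma test_space_Td: "test_space Td = smooth_periodic"
  by (simp add: smooth_periodic_def)

lemma test_space_cmult: "\<phi> \<in> test_space M \<Longrightarrow> (\<lambda>x. c * \<phi> x) \<in> test_space M"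
  by (cases M) (auto simp: schwartz_cmult test_space_Td smooth_periodic_cmult simp del: test_space.simps(2))

lemma test_space_add: "\<phi> \<in> test_space M \<Longrightarrow> \<psi> \<in> test_space M \<Longrightarrow> (\<lambda>x. \<phi> x + \<psi> x) \<in> test_space M"
  by (cases M) (auto simp: schwartz_add test_space_Td smooth_periodic_add simp del: test_space.simps(2))

text \<open>The functions among which \<open>cont_rep\<close> selects.\<close>

definition bcont :: "domain \<Rightarrow> (real^'n \<Rightarrow> complex) set" where
  "bcont M = {v. continuous_on UNIV v \<and> bounded (range v) \<and> (M = Td \<longrightarrow> periodic v)}"

lemma integrable_bcont_test:
  assumes v: "v \<in> bcont M" and \<phi>: "\<phi> \<in> test_space M"
  shows "integrable (domain_measure M) (\<lambda>x. v x * \<phi> x)"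
proof (cases M)
  case Rd
  obtain B where B: "\<And>x. norm (v x) \<le> B" using v by (auto simp: bcont_def bounded_iff)
  have [measurable]: "v \<in> borel_measurable borel" "\<phi> \<in> borel_measurable borel"
    using v \<phi> Rd by (auto simp: bcont_def intro: borel_measurable_continuous_onI measurable_schwartz)
  have "integrable lborel (\<lambda>x. of_real B * \<phi> x)" using \<phi> Rd by (intro integrable_mult_right integrable_schwartz) auto
  then have "integrable lborel (\<lambda>x. v x * \<phi> x)"
  proof (rule Bochner_Integration.integrable_bound)
    show "AE x in lborel. norm (v x * \<phi> x) \<le> norm (of_real B * \<phi> x)"
      unfolding norm_mult by (intro AE_I2 mult_right_mono order_trans[OF B]) auto
  qed measurable
  then show ?thesis using Rd by simp
next
  case Td
  then have s: "\<phi> \<in> smooth_periodic" using \<phi> by (simp add: smooth_periodic_def)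
  have "integrable torus (\<lambda>x. v x * \<phi> x)"
    using v Td smooth_periodicD(2,3)[OF s]
    by (intro integrable_torus_continuous) (auto simp: bcont_def periodic_def intro!: continuous_intros)
  then show ?thesis using Td by simp
qed

lemma finite_multiindices: "finite {js :: 'n::finite list. length js \<le> N}"
  using finite_lists_length_le[of "UNIV :: 'n set" N] by simp

lemma partial_derivs_smooth_periodic: "\<phi> \<in> smooth_periodic \<Longrightarrow> partial_derivs js \<phi> \<in> smooth_periodic"
  by (rule partial_derivs_closed) (auto intro: smooth_periodicD(4))

lemma seminorm_ge:
  assumes "\<phi> \<in> test_space M"
  shows "(if M = Rd then (1 + norm x) ^ N else 1) * norm (partial_derivs js \<phi> x) \<le> seminorm M N js \<phi>"
proof (cases M)
  case Rd
  then have "bounded (range (\<lambda>x. (1 + norm x) ^ N *\<^sub>R partial_derivs js \<phi> x))" using assms by (auto simp: schwartz_def)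
  then obtain C where C: "\<And>x. (1 + norm x) ^ N * norm (partial_derivs js \<phi> x) \<le> C" by (auto simp: bounded_iff)
  show ?thesis using Rd by (auto intro!: cSUP_upper bdd_aboveI2[of _ _ C] C)
next
  case Td
  then have s: "partial_derivs js \<phi> \<in> smooth_periodic"
    using assms by (intro partial_derivs_smooth_periodic) (simp add: smooth_periodic_def)
  obtain C where C: "\<And>x. norm (partial_derivs js \<phi> x) \<le> C"
    using periodic_bounded[OF smooth_periodicD(3,2)[OF s]] by blast
  show ?thesis using Td by (auto intro!: cSUP_upper bdd_aboveI2[of _ _ C] C)
qed

lemma seminorm_nonneg: assumes "\<phi> \<in> test_space M" shows "0 \<le> seminorm M N js \<phi>"
proof -
  have "0 \<le> (if M = Rd then (1 + norm (0::real^'a)) ^ N else 1) * norm (partial_derivs js \<phi> 0)" by simp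
  also have "\<dots> \<le> seminorm M N js \<phi>" by (rule seminorm_ge[OF assms])
  finally show ?thesis .
qed

text \<open>On the whole space the seminorm of order \<open>2 d\<close> makes the test function integrable.\<close>

lemma regular_dist_tempered:
  fixes v :: "real^'n \<Rightarrow> complex"
  assumes v: "v \<in> bcont M" shows "regular_dist M v \<in> tempered M"
proof -
  obtain B where B: "\<And>x. norm (v x) \<le> B" using v by (auto simp: bcont_def bounded_iff)
  have B0: "0 \<le> B" by (rule order_trans[OF norm_ge_zero B])
  have "\<exists>C N. \<forall>\<phi>\<in>test_space M. norm (LINT x|domain_measure M. v x * \<phi> x) \<le> C * seminorm M N [] \<phi> \<and> 0 \<le> C"
  proof (cases M)
    case Rd
    let ?K = "2 * CARD('n)"
    let ?J = "LINT x|lborel. inverse ((1 + norm (x::real^'n)) ^ ?K)"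
    have "norm (LINT x|lborel. v x * \<phi> x) \<le> (B * ?J) * seminorm Rd ?K [] \<phi>" if \<phi>: "\<phi> \<in> schwartz" for \<phi>
    proof -
      let ?S = "seminorm Rd ?K [] \<phi>"
      have "norm (LINT x|lborel. v x * \<phi> x) \<le> (LINT x|lborel. B * ?S * inverse ((1 + norm (x::real^'n)) ^ ?K))"
      proof (rule Bochner_Integration.integral_norm_bound_integral)
        show "integrable lborel (\<lambda>x. v x * \<phi> x)" using integrable_bcont_test[OF v, of \<phi>] Rd \<phi> by simp
        show "integrable lborel (\<lambda>x::real^'n. B * ?S * inverse ((1 + norm x) ^ ?K))"
          by (intro integrable_mult_right integrable_inverse_power)
        fix x :: "real^'n"
        have pos: "(1 + norm x) ^ ?K > 0" by (intro zero_less_power) (auto simp: add_pos_nonneg)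
        have "(1 + norm x) ^ ?K * norm (\<phi> x) \<le> ?S" using seminorm_ge[of \<phi> Rd x ?K "[]"] \<phi> by simp
        then have "norm (\<phi> x) \<le> ?S * inverse ((1 + norm x) ^ ?K)"
          using pos by (simp add: field_simps)
        then have "norm (v x) * norm (\<phi> x) \<le> B * (?S * inverse ((1 + norm x) ^ ?K))"
          by (intro mult_mono B B0) auto
        then show "norm (v x * \<phi> x) \<le> B * ?S * inverse ((1 + norm x) ^ ?K)" by (simp add: norm_mult mult.assoc)
      qed
      then show ?thesis by (simp only: integral_mult_right_zero) (simp only: ac_simps)
    qed
    moreover have "0 \<le> B * ?J" using B0 by (intro mult_nonneg_nonneg integral_nonneg_AE AE_I2) auto
    ultimately show ?thesis using Rd by (intro exI[of _ "B * ?J"] exI[of _ ?K]) simp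
  next
    case Td
    have "norm (LINT x|torus. v x * \<phi> x) \<le> B * seminorm Td 0 [] \<phi>" if \<phi>: "\<phi> \<in> test_space Td" for \<phi>
    proof -
      have "norm (LINT x|torus. v x * \<phi> x) \<le> (LINT x|(torus :: (real^'n) measure). B * seminorm Td 0 [] \<phi>)"
      proof (rule Bochner_Integration.integral_norm_bound_integral)
        show "integrable torus (\<lambda>x. v x * \<phi> x)" using integrable_bcont_test[OF v, of \<phi>] Td \<phi> by simp
        fix x :: "real^'n"
        have "norm (\<phi> x) \<le> seminorm Td 0 [] \<phi>" using seminorm_ge[OF \<phi>, of x 0 "[]"] by simp
        then show "norm (v x * \<phi> x) \<le> B * seminorm Td 0 [] \<phi>"
          unfolding norm_mult by (intro mult_mono B B0) auto
      qed simp
      then show ?thesis using measure_torus[where 'n='n] by simp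
    qed
    then show ?thesis using Td B0 by (intro exI[of _ B] exI[of _ 0]) simp
  qed
  then obtain C N where C: "\<And>\<phi>. \<phi> \<in> test_space M \<Longrightarrow> norm (LINT x|domain_measure M. v x * \<phi> x) \<le> C * seminorm M N [] \<phi>"
    "0 \<le> C \<or> test_space M = ({} :: (real^'n \<Rightarrow> complex) set)" by blast
  have "norm (regular_dist M v \<phi>) \<le> C * (\<Sum>js | length js \<le> N. seminorm M N js \<phi>)" if \<phi>: "\<phi> \<in> test_space M" for \<phi>
  proof -
    have "seminorm M N [] \<phi> \<le> (\<Sum>js | length js \<le> N. seminorm M N js \<phi>)"
      using \<phi> finite_multiindices by (intro member_le_sum) (auto simp: seminorm_nonneg)
    then have "C * seminorm M N [] \<phi> \<le> C * (\<Sum>js | length js \<le> N. seminorm M N js \<phi>)"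
      using C(2) \<phi> by (intro mult_left_mono) auto
    then show ?thesis using C(1)[OF \<phi>] \<phi> by (simp add: regular_dist_def)
  qed
  then show ?thesis
    unfolding tempered_def
    by (auto simp: regular_dist_def test_space_add test_space_cmult distrib_left mult.left_commute integrable_bcont_test[OF v])
qed

lemma regular_dist_inj:
  fixes v :: "real^'n \<Rightarrow> complex"
  assumes v: "v \<in> bcont M" and w: "w \<in> bcont M" and eq: "regular_dist M v = regular_dist M w"
  shows "v = w"
proof
  fix x
  let ?d = "\<lambda>x. v x - w x"
  have 0: "(LINT x|domain_measure M. ?d x * \<phi> x) = 0" if \<phi>: "\<phi> \<in> test_space M" for \<phi>
    using integrable_bcont_test[OF v \<phi>] integrable_bcont_test[OF w \<phi>] fun_cong[OF eq, of \<phi>] \<phi>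
    by (simp add: regular_dist_def left_diff_distrib)
  have cont: "continuous_on UNIV ?d" using v w by (auto simp: bcont_def intro!: continuous_intros)
  have "?d x = 0"
  proof (cases M)
    case Rd
    obtain B where B: "\<And>x. norm (v x) \<le> B" using v by (auto simp: bcont_def bounded_iff)
    obtain D where D: "\<And>x. norm (w x) \<le> D" using w by (auto simp: bcont_def bounded_iff)
    have "norm (?d x) \<le> B + D" for x using norm_triangle_ineq4[of "v x" "w x"] B[of x] D[of x] by linarith
    then have "bounded (range ?d)" unfolding bounded_iff by blast
    then show ?thesis using continuous_eq_0_Rd[OF cont] 0 Rd by simp
  next
    case Td
    then have "periodic ?d" using v w by (simp add: bcont_def periodic_def)
    then show ?thesis using continuous_eq_0_Td[OF cont] 0 Td by (simp add: smooth_periodic_def)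
  qed
  then show "v x = w x" by simp
qed

text \<open>Convolution commutes with derivatives, so one normalised kernel approximates finitely many of them at
  once.\<close>

lemma trig_approx:
  fixes \<phi> :: "real^'n \<Rightarrow> complex"
  assumes \<phi>: "\<phi> \<in> smooth_periodic" and e: "0 < e"
  shows "\<exists>\<psi>\<in>trig. \<forall>js. length js \<le> N \<longrightarrow> seminorm Td N' js (\<lambda>x. \<phi> x + (- 1) * \<psi> x) \<le> e"
proof -
  let ?k = "\<lambda>N x::real^'n. complex_of_real (kern x ^ N)"
  let ?m = "\<lambda>N. kern_mass TYPE('n) N"
  have pd: "continuous_on UNIV (partial_derivs js \<phi>)" "periodic (partial_derivs js \<phi>)" for js
    using smooth_periodicD(2,3)[OF partial_derivs_smooth_periodic[OF \<phi>]] by auto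
  have "\<forall>\<^sub>F n in sequentially. \<forall>js\<in>{js. length js \<le> N}. 0 < ?m n \<and>
      (\<forall>x. norm (tconv (?k n) (partial_derivs js \<phi>) x - of_real (?m n) * partial_derivs js \<phi> x) \<le> e * ?m n)"
    using finite_multiindices by (rule eventually_ball_finite) (intro ballI kern_approx_identity pd e)
  then obtain n where n: "\<And>js. length js \<le> N \<Longrightarrow> 0 < ?m n \<and>
      (\<forall>x. norm (tconv (?k n) (partial_derivs js \<phi>) x - of_real (?m n) * partial_derivs js \<phi> x) \<le> e * ?m n)"
    using eventually_happens'[OF sequentially_bot] by fastforce
  have m: "0 < ?m n" using n[of "[]"] by simp
  define c where "c = 1 / complex_of_real (?m n)"
  define \<psi> where "\<psi> = (\<lambda>x. c * tconv (?k n) \<phi> x)"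
  have \<psi>: "\<psi> \<in> trig"
    unfolding \<psi>_def using pd[of "[]"] by (intro trig.cmult tconv_trig kern_power_trig) auto
  have deriv: "partial_derivs js (\<lambda>x. \<phi> x + (- 1) * \<psi> x) = (\<lambda>x. partial_derivs js \<phi> x + (- c) * tconv (?k n) (partial_derivs js \<phi>) x)" for js
  proof (induction js)
    case Nil
    show ?case by (simp add: \<psi>_def)
  next
    case (Cons i js)
    have d1: "partial_derivs js \<phi> differentiable (at x)" for x
      by (rule smooth_periodicD(1)[OF partial_derivs_smooth_periodic[OF \<phi>]])
    have d2: "tconv (?k n) (partial_derivs js \<phi>) differentiable (at x)" for x
      by (rule smooth_periodicD(1)[OF trig_smooth_periodic[OF tconv_trig[OF kern_power_trig pd]]])
    have d3: "(\<lambda>x. (- c) * tconv (?k n) (partial_derivs js \<phi>) x) differentiable (at x)" for x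
      by (intro differentiable_mult d2) simp
    have "partial_derivs (i # js) (\<lambda>x. \<phi> x + (- 1) * \<psi> x) = partial_deriv i (\<lambda>x. partial_derivs js \<phi> x + (- c) * tconv (?k n) (partial_derivs js \<phi>) x)"
      by (simp only: partial_derivs.simps Cons.IH)
    also have "\<dots> = (\<lambda>x. partial_deriv i (partial_derivs js \<phi>) x + (- c) * partial_deriv i (tconv (?k n) (partial_derivs js \<phi>)) x)"
      by (intro ext) (simp only: partial_deriv_add[OF d1 d3] partial_deriv_cmult[OF d2])
    also have "partial_deriv i (tconv (?k n) (partial_derivs js \<phi>)) = tconv (?k n) (partial_deriv i (partial_derivs js \<phi>))"
      by (intro partial_deriv_tconv kern_power_trig partial_derivs_smooth_periodic \<phi>)
    finally show ?case by simp
  qed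
  have "seminorm Td N' js (\<lambda>x. \<phi> x + (- 1) * \<psi> x) \<le> e" if "length js \<le> N" for js
  proof -
    have "norm (partial_derivs js \<phi> x + (- c) * tconv (?k n) (partial_derivs js \<phi>) x) \<le> e" for x
    proof -
      let ?z = "tconv (?k n) (partial_derivs js \<phi>) x - of_real (?m n) * partial_derivs js \<phi> x"
      have "partial_derivs js \<phi> x + (- c) * tconv (?k n) (partial_derivs js \<phi>) x = - c * ?z"
        using m by (simp add: c_def field_simps)
      then have "norm (partial_derivs js \<phi> x + (- c) * tconv (?k n) (partial_derivs js \<phi>) x) = norm ?z / ?m n"
        using m by (simp add: norm_mult norm_divide c_def)
      also have "\<dots> \<le> e" using n[OF that] m by (simp add: pos_divide_le_eq)
      finally show ?thesis .
    qed
    then show ?thesis unfolding seminorm.simps deriv by (intro cSUP_least) auto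
  qed
  then show ?thesis using \<psi> by blast
qed

text \<open>Both distributions are continuous in finitely many seminorms, in which trigonometric polynomials are
  dense.\<close>

lemma tempered_Td_eqI:
  fixes f g :: "'n::finite functional"
  assumes f: "f \<in> tempered Td" and g: "g \<in> tempered Td"
    and eq: "\<And>n. n \<in> int_lattice \<Longrightarrow> f (chi n) = g (chi n)"
  shows "f = g"
proof
  fix \<phi>
  show "f \<phi> = g \<phi>"
  proof (cases "\<phi> \<in> test_space Td")
    case False
    then show ?thesis using f g by (simp add: tempered_def)
  next
    case True
    then have \<phi>: "\<phi> \<in> smooth_periodic" by (simp add: smooth_periodic_def)
    note T = test_space_Td[symmetric]
    have lin: "h (\<lambda>x. \<phi> x + c * \<psi> x) = h \<phi> + c * h \<psi>"
      if "h \<in> tempered Td" "\<phi> \<in> smooth_periodic" "\<psi> \<in> smooth_periodic" for h :: "'n functional" and \<phi> \<psi> c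
      using that smooth_periodic_cmult[OF that(3), of c] unfolding tempered_def T by auto
    have trig: "f \<psi> = g \<psi>" if "\<psi> \<in> trig" for \<psi>
      using that
    proof induction
      case (add k l)
      note kl = trig_smooth_periodic[OF add.hyps(1)] trig_smooth_periodic[OF add.hyps(2)]
      show ?case using lin[OF f kl, of 1] lin[OF g kl, of 1] add.IH by simp
    next
      case (cmult k c)
      then have k: "k \<in> test_space Td" using trig_smooth_periodic test_space_Td by blast
      then show ?case using f g cmult.IH unfolding tempered_def by auto
    qed (rule eq)
    obtain C N where C: "\<And>\<phi>. \<phi> \<in> test_space Td \<Longrightarrow> norm (f \<phi>) \<le> C * (\<Sum>js | length js \<le> N. seminorm Td N js \<phi>)"
      using f unfolding tempered_def by blast
    obtain D J where D: "\<And>\<phi>. \<phi> \<in> test_space Td \<Longrightarrow> norm (g \<phi>) \<le> D * (\<Sum>js | length js \<le> J. seminorm Td J js \<phi>)"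
      using g unfolding tempered_def by blast
    define K where "K = \<bar>C\<bar> * real (card {js :: 'n list. length js \<le> N}) + \<bar>D\<bar> * real (card {js :: 'n list. length js \<le> J})"
    have "norm (f \<phi> - g \<phi>) \<le> 0 + e" if e: "0 < e" for e
    proof -
      define d where "d = e / (K + 1)"
      have K: "0 \<le> K" by (simp add: K_def)
      have d: "0 < d" using e K by (simp add: d_def)
      obtain \<psi> where \<psi>: "\<psi> \<in> trig" "\<And>js. length js \<le> max N J \<Longrightarrow> seminorm Td N js (\<lambda>x. \<phi> x + (- 1) * \<psi> x) \<le> d"
        using trig_approx[OF \<phi> d, of "max N J" N] by blast
      let ?r = "\<lambda>x. \<phi> x + (- 1) * \<psi> x"
      have r: "?r \<in> test_space Td" unfolding test_space_Td
        by (intro smooth_periodic_lincomb \<phi> trig_smooth_periodic \<psi>)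
      have bound: "A * (\<Sum>js | length js \<le> L. seminorm Td L' js ?r) \<le> \<bar>A\<bar> * real (card {js :: 'n list. length js \<le> L}) * d" if "L \<le> max N J" for A L L'
      proof -
        have eq: "seminorm Td L' js ?r = seminorm Td N js ?r" for js by simp
        have "(\<Sum>js | length js \<le> L. seminorm Td L' js ?r) \<le> (\<Sum>js :: 'n list | length js \<le> L. d)"
        proof (rule sum_mono)
          fix js :: "'n list" assume "js \<in> {js. length js \<le> L}"
          then have "length js \<le> max N J" using that by simp
          then show "seminorm Td L' js ?r \<le> d" unfolding eq by (rule \<psi>(2))
        qed
        moreover have pos: "0 \<le> (\<Sum>js | length js \<le> L. seminorm Td L' js ?r)" by (intro sum_nonneg seminorm_nonneg r)
        ultimately have "\<bar>A\<bar> * (\<Sum>js | length js \<le> L. seminorm Td L' js ?r) \<le> \<bar>A\<bar> * (real (card {js :: 'n list. length js \<le> L}) * d)"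
          by (intro mult_left_mono) simp_all
        moreover have "A * (\<Sum>js | length js \<le> L. seminorm Td L' js ?r) \<le> \<bar>A\<bar> * (\<Sum>js | length js \<le> L. seminorm Td L' js ?r)"
          by (intro mult_right_mono pos) simp
        ultimately show ?thesis by (simp only: mult.assoc)
      qed
      have "norm (f \<phi> - g \<phi>) = norm (f ?r - g ?r)"
        using lin[OF f \<phi> trig_smooth_periodic[OF \<psi>(1)], of "- 1"] lin[OF g \<phi> trig_smooth_periodic[OF \<psi>(1)], of "- 1"] trig[OF \<psi>(1)]
        by simp
      also have "\<dots> \<le> norm (f ?r) + norm (g ?r)" by (rule norm_triangle_ineq4)
      also have "\<dots> \<le> \<bar>C\<bar> * real (card {js :: 'n list. length js \<le> N}) * d + \<bar>D\<bar> * real (card {js :: 'n list. length js \<le> J}) * d"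
        by (intro add_mono order_trans[OF C[OF r] bound] order_trans[OF D[OF r] bound]) auto
      also have "\<dots> = K * d" by (simp add: K_def distrib_right)
      also have "\<dots> \<le> e" using K e by (simp add: d_def field_simps)
      finally show ?thesis by simp
    qed
    then have "norm (f \<phi> - g \<phi>) \<le> 0" by (rule field_le_epsilon)
    then show ?thesis by simp
  qed
qed

definition inv_ft :: "domain \<Rightarrow> (real^'n \<Rightarrow> complex) \<Rightarrow> real^'n \<Rightarrow> complex" where
  "inv_ft M g x = (LINT \<xi>|dual_measure M. g \<xi> * chi \<xi> x)"

lemma integrable_times_chi:
  assumes "integrable (dual_measure M) g"
  shows "integrable (dual_measure M) (\<lambda>\<xi>. g \<xi> * chi \<xi> x)"
proof (rule Bochner_Integration.integrable_bound[OF assms])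
  have [measurable]: "g \<in> borel_measurable (dual_measure M)" using assms by simp
  have [measurable]: "(\<lambda>\<xi>. chi \<xi> x) \<in> borel_measurable (dual_measure M)" by (intro measurable_dual_borel) measurable
  show "(\<lambda>\<xi>. g \<xi> * chi \<xi> x) \<in> borel_measurable (dual_measure M)" by measurable
qed (simp add: norm_mult)

text \<open>Continuity is dominated convergence.\<close>

lemma inv_ft_bcont:
  fixes g :: "real^'n \<Rightarrow> complex"
  assumes g: "integrable (dual_measure M) g" shows "inv_ft M g \<in> bcont M"
proof -
  have "norm (inv_ft M g x) \<le> (LINT \<xi>|dual_measure M. norm (g \<xi>))" for x
    unfolding inv_ft_def by (rule order_trans[OF integral_norm_bound]) (simp add: norm_mult)
  then have "bounded (range (inv_ft M g))" unfolding bounded_iff by blast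
  moreover have "continuous_on UNIV (inv_ft M g)"
  proof (rule continuous_at_imp_continuous_on, intro ballI continuous_at_sequentiallyI)
    fix x and u :: "nat \<Rightarrow> real^'n" assume u: "u \<longlonglongrightarrow> x"
    show "(\<lambda>i. inv_ft M g (u i)) \<longlonglongrightarrow> inv_ft M g x"
      unfolding inv_ft_def
    proof (rule integral_dominated_convergence[where w="\<lambda>\<xi>. norm (g \<xi>)"])
      show "AE \<xi> in dual_measure M. (\<lambda>i. g \<xi> * chi \<xi> (u i)) \<longlonglongrightarrow> g \<xi> * chi \<xi> x"
      proof (intro AE_I2 tendsto_mult tendsto_const)
        fix \<xi> :: "real^'n"
        have "isCont (chi \<xi>) x" by (rule differentiable_imp_continuous_within[OF differentiable_chi])
        then show "(\<lambda>i. chi \<xi> (u i)) \<longlonglongrightarrow> chi \<xi> x" using u by (rule isCont_tendsto_compose)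
      qed
    qed (use integrable_times_chi[OF g] g in \<open>auto simp: norm_mult\<close>)
  qed
  moreover have "periodic (inv_ft M g)" if "M = Td"
    unfolding periodic_def inv_ft_def using that
    by (intro allI ballI Bochner_Integration.integral_cong) (auto simp: chi_add chi_lattice space_dual_measure)
  ultimately show ?thesis by (simp add: bcont_def)
qed

text \<open>The distribution with transform \<open>g\<close>.\<close>

definition ft_dist :: "domain \<Rightarrow> (real^'n \<Rightarrow> complex) \<Rightarrow> 'n::finite functional" where
  "ft_dist M g = regular_dist M (inv_ft M g)"

lemma ft_dist_tempered: "integrable (dual_measure M) g \<Longrightarrow> ft_dist M g \<in> tempered M"
  unfolding ft_dist_def by (intro regular_dist_tempered inv_ft_bcont)

text \<open>Fubini's theorem, with Fourier inversion for the test function on the whole space and orthogonality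
  of the characters on the torus.\<close>

lemma is_fourier_ft_dist:
  fixes g :: "real^'n \<Rightarrow> complex"
  assumes g: "integrable (dual_measure M) g"
  shows "is_fourier M (ft_dist M g) g"
proof (cases M)
  case Rd
  then have g': "integrable lborel g" using g by simp
  then have [measurable]: "g \<in> borel_measurable borel" by simp
  have "integrable lborel (\<lambda>\<xi>. g \<xi> * \<phi> \<xi>) \<and> ft_dist Rd g (fourier \<phi>) = (LINT \<xi>|lborel. g \<xi> * \<phi> \<xi>)"
    if \<phi>: "\<phi> \<in> schwartz" for \<phi>
  proof
    have [measurable]: "\<phi> \<in> borel_measurable borel" by (rule measurable_schwartz[OF \<phi>])
    obtain B where B: "\<And>x. norm (\<phi> x) \<le> B" using bounded_schwartz[OF \<phi>] by blast
    show "integrable lborel (\<lambda>\<xi>. g \<xi> * \<phi> \<xi>)"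
    proof (rule Bochner_Integration.integrable_bound)
      show "integrable lborel (\<lambda>\<xi>. g \<xi> * of_real B)" using g' by (rule integrable_mult_left)
      show "AE \<xi> in lborel. norm (g \<xi> * \<phi> \<xi>) \<le> norm (g \<xi> * of_real B)"
        unfolding norm_mult by (intro AE_I2 mult_left_mono order_trans[OF B]) auto
    qed measurable
    have "ft_dist Rd g (fourier \<phi>) = (LINT x|lborel. fourier \<phi> x * (LINT \<xi>|lborel. g \<xi> * chi \<xi> x))"
      by (simp add: ft_dist_def regular_dist_def fourier_schwartz[OF \<phi>] inv_ft_def mult.commute)
    also have "\<dots> = (LINT \<xi>|lborel. g \<xi> * (LINT x|lborel. fourier \<phi> x * chi \<xi> x))"
      by (rule Fubini_kernel[where C=1])
        (auto intro!: g' integrable_schwartz fourier_schwartz \<phi> simp: lborel_pair.pair_sigma_finite_axioms)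
    also have "\<dots> = (LINT \<xi>|lborel. g \<xi> * \<phi> \<xi>)" by (simp add: fourier_inversion[OF \<phi>])
    finally show "ft_dist Rd g (fourier \<phi>) = (LINT \<xi>|lborel. g \<xi> * \<phi> \<xi>)" .
  qed
  then show ?thesis using Rd by simp
next
  case Td
  have "g \<xi> = ft_dist Td g (chi (- \<xi>))" if \<xi>: "\<xi> \<in> int_lattice" for \<xi>
  proof -
    have g': "integrable (count_space int_lattice) g" using g Td by simp
    have "chi (- \<xi>) \<in> test_space Td" unfolding test_space_Td using \<xi> by (intro smooth_periodic_chi) simp
    then have "ft_dist Td g (chi (- \<xi>)) = (LINT x|torus. chi (- \<xi>) x * (LINT \<eta>|count_space int_lattice. g \<eta> * chi \<eta> x))"
      by (simp add: ft_dist_def regular_dist_def inv_ft_def mult.commute del: test_space.simps)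
    also have "\<dots> = (LINT \<eta>|count_space int_lattice. g \<eta> * (LINT x|torus. chi (- \<xi>) x * chi \<eta> x))"
    proof (rule Fubini_kernel[where C=1])
      show "pair_sigma_finite torus (count_space (int_lattice :: (real^'n) set))"
        by (intro pair_sigma_finite.intro sigma_finite_measure_count_space_countable torus.sigma_finite_measure_axioms) simp
      show "integrable torus (chi (- \<xi>))"
        by (rule integrable_torus_bounded[where B=1]) auto
      show "(\<lambda>(x, \<eta>). chi \<eta> x) \<in> borel_measurable (torus \<Otimes>\<^sub>M count_space (int_lattice :: (real^'n) set))"
      proof -
        have "(\<lambda>(\<eta>, x). chi \<eta> x) \<in> borel_measurable (count_space (int_lattice :: (real^'n) set) \<Otimes>\<^sub>M torus)"
          by (rule measurable_pair_measure_countable1) (auto intro!: measurable_torus)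
        then show ?thesis by (subst measurable_pair_swap_iff) (simp add: case_prod_unfold)
      qed
    qed (use g' in auto)
    also have "\<dots> = (LINT \<eta>|count_space int_lattice. (if \<eta> = \<xi> then g \<xi> else 0))"
    proof (intro Bochner_Integration.integral_cong refl)
      fix \<eta> :: "real^'n" assume "\<eta> \<in> space (count_space int_lattice)"
      then have "\<eta> - \<xi> \<in> int_lattice" using \<xi> by simp
      moreover have "chi (- \<xi>) x * chi \<eta> x = chi (\<eta> - \<xi>) x" for x
        by (simp flip: chi_add(1))
      ultimately show "g \<eta> * (LINT x|torus. chi (- \<xi>) x * chi \<eta> x) = (if \<eta> = \<xi> then g \<xi> else 0)"
        by (simp add: integral_chi)
    qed
    also have "\<dots> = (\<Sum>\<eta> | \<eta> \<in> int_lattice \<and> (if \<eta> = \<xi> then g \<xi> else 0) \<noteq> 0. if \<eta> = \<xi> then g \<xi> else 0)"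
      by (rule lebesgue_integral_count_space_finite_support) (rule finite_subset[of _ "{\<xi>}"], auto)
    also have "\<dots> = g \<xi>"
    proof (cases "g \<xi> = 0")
      case False
      then have "{\<eta>. \<eta> \<in> int_lattice \<and> (if \<eta> = \<xi> then g \<xi> else 0) \<noteq> 0} = {\<xi>}" using \<xi> by auto
      then show ?thesis by simp
    qed simp
    finally show ?thesis by simp
  qed
  moreover have "(\<lambda>x. cis (- 2 * pi * (x \<bullet> \<xi>))) = chi (- \<xi>)" for \<xi> :: "real^'n"
    by (simp add: chi_def fun_eq_iff)
  ultimately show ?thesis using Td by simp
qed

text \<open>Each Schwartz function is a transform, and on the torus the characters determine a distribution, so
  a distribution is determined by its transform.\<close>

lemma is_fourier_imp_eq_ft_dist:
  fixes g :: "real^'n \<Rightarrow> complex"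
  assumes f: "f \<in> tempered M" and g: "integrable (dual_measure M) g" and F: "is_fourier M f g"
  shows "f = ft_dist M g"
proof (cases M)
  case Rd
  show ?thesis
  proof
    fix \<psi>
    show "f \<psi> = ft_dist M g \<psi>"
    proof (cases "\<psi> \<in> schwartz")
      case True
      then obtain \<phi> where \<phi>: "\<phi> \<in> schwartz" "\<psi> = fourier \<phi>" using fourier_surj by blast
      have "f (fourier \<phi>) = (LINT \<xi>|lborel. g \<xi> * \<phi> \<xi>)" using F Rd \<phi> by simp
      also have "\<dots> = ft_dist M g (fourier \<phi>)" using is_fourier_ft_dist[OF g] Rd \<phi> by simp
      finally show ?thesis using \<phi> by simp
    next
      case False
      then show ?thesis using f Rd by (simp add: tempered_def ft_dist_def regular_dist_def)
    qed
  qed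
next
  case Td
  have T: "ft_dist Td g \<in> tempered Td" using ft_dist_tempered[OF g] Td by simp
  have "f (chi n) = ft_dist Td g (chi n)" if n: "n \<in> int_lattice" for n
  proof -
    have "(\<lambda>x. cis (- 2 * pi * (x \<bullet> (- n)))) = chi n" by (simp add: chi_def fun_eq_iff)
    then show ?thesis
      using F is_fourier_ft_dist[OF g] Td int_lattice_simps(4)[OF n] by (metis is_fourier.simps(2))
  qed
  then have "f = ft_dist Td g" using f Td by (intro tempered_Td_eqI T) auto
  then show ?thesis using Td by simp
qed

lemma is_fourier_measurable: "is_fourier M f g \<Longrightarrow> g \<in> borel_measurable (dual_measure M)"
  by (cases M) auto

lemma is_fourier_unique:
  fixes g h :: "real^'n \<Rightarrow> complex"
  assumes g: "is_fourier M f g" and h: "is_fourier M f h"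
  shows "AE \<xi> in dual_measure M. g \<xi> = h \<xi>"
proof (cases M)
  case Rd
  have [measurable]: "g \<in> borel_measurable borel" "h \<in> borel_measurable borel"
    using is_fourier_measurable[OF g] is_fourier_measurable[OF h] Rd by auto
  have "AE \<xi> in lborel. g \<xi> - h \<xi> = 0"
  proof (rule AE_eq_0_Rd)
    fix \<phi> :: "real^'n \<Rightarrow> complex" assume \<phi>: "\<phi> \<in> schwartz"
    have *: "integrable lborel (\<lambda>\<xi>. g \<xi> * \<phi> \<xi>)" "integrable lborel (\<lambda>\<xi>. h \<xi> * \<phi> \<xi>)"
      "(LINT \<xi>|lborel. g \<xi> * \<phi> \<xi>) = (LINT \<xi>|lborel. h \<xi> * \<phi> \<xi>)"
      using g h Rd \<phi> by auto
    then show "integrable lborel (\<lambda>\<xi>. (g \<xi> - h \<xi>) * \<phi> \<xi>)" "(LINT \<xi>|lborel. (g \<xi> - h \<xi>) * \<phi> \<xi>) = 0"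
      by (simp_all add: left_diff_distrib)
  qed measurable
  then have "AE \<xi> in lborel. g \<xi> = h \<xi>" by simp
  then show ?thesis unfolding Rd dual_measure.simps .
next
  case Td
  then show ?thesis using g h unfolding Td dual_measure.simps by (simp add: AE_count_space)
qed

lemma inverse_fourier_eq: "integrable (dual_measure M) g \<Longrightarrow> inverse_fourier M g = ft_dist M g"
  unfolding inverse_fourier_def
  by (intro the_equality) (auto intro: ft_dist_tempered is_fourier_ft_dist is_fourier_imp_eq_ft_dist)

lemma ft_dist_cong_AE:
  assumes "AE \<xi> in dual_measure M. g \<xi> = h \<xi>"
    and [measurable]: "g \<in> borel_measurable (dual_measure M)" "h \<in> borel_measurable (dual_measure M)"
  shows "ft_dist M g = ft_dist M h"
proof -
  have [measurable]: "(\<lambda>\<xi>. chi \<xi> x) \<in> borel_measurable (dual_measure M)" for x :: "real^'a"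
    by (intro measurable_dual_borel) measurable
  have "inv_ft M g = inv_ft M h"
    unfolding inv_ft_def using assms(1) by (intro ext integral_cong_AE) (measurable, auto)
  then show ?thesis by (simp add: ft_dist_def)
qed

section \<open>The amalgam space and the propagator on the Fourier side\<close>

definition in_amalg :: "domain \<Rightarrow> ennreal \<Rightarrow> (real^'n \<Rightarrow> complex) \<Rightarrow> bool" where
  "in_amalg M p g \<longleftrightarrow> g \<in> borel_measurable (dual_measure M) \<and> amalg M p (\<lambda>\<xi>. ennreal (norm (g \<xi>))) < \<infinity>"

lemma in_amalg_measurable: "in_amalg M p g \<Longrightarrow> g \<in> borel_measurable (dual_measure M)"
  by (simp add: in_amalg_def)

lemma in_amalg_integrable:
  assumes "in_amalg M p g" "1 \<le> p" shows "integrable (dual_measure M) g"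
proof (rule integrableI_bounded)
  show [measurable]: "g \<in> borel_measurable (dual_measure M)" using assms by (simp add: in_amalg_def)
  show "(\<integral>\<^sup>+\<xi>. ennreal (norm (g \<xi>)) \<partial>dual_measure M) < \<infinity>"
    using nn_integral_le_amalg[of "\<lambda>\<xi>. ennreal (norm (g \<xi>))" M p] assms
    by (auto simp: in_amalg_def intro: le_less_trans)
qed

text \<open>All transforms of a distribution agree almost everywhere, so the infimum is attained at \<open>g\<close>.\<close>

lemma w_norm_ft_dist:
  assumes g: "integrable (dual_measure M) g" and p: "1 \<le> p"
  shows "w_norm M p 1 (ft_dist M g) = amalg M p (\<lambda>\<xi>. ennreal (norm (g \<xi>)))"
  unfolding w_norm_def amalgam_norm_eq
proof (rule antisym)
  let ?G = "{h. is_fourier M (ft_dist M g) h}"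
  show "(INF h\<in>?G. amalg M p (\<lambda>\<xi>. ennreal (norm (h \<xi>)))) \<le> amalg M p (\<lambda>\<xi>. ennreal (norm (g \<xi>)))"
    using is_fourier_ft_dist[OF g] by (intro INF_lower2[of g]) auto
  show "amalg M p (\<lambda>\<xi>. ennreal (norm (g \<xi>))) \<le> (INF h\<in>?G. amalg M p (\<lambda>\<xi>. ennreal (norm (h \<xi>))))"
  proof (rule INF_greatest)
    fix h assume "h \<in> ?G"
    then have "is_fourier M (ft_dist M g) h" by simp
    then have "AE \<xi> in dual_measure M. g \<xi> = h \<xi>"
      by (rule is_fourier_unique[OF is_fourier_ft_dist[OF g]])
    moreover have [measurable]: "g \<in> borel_measurable (dual_measure M)" using g by simp
    ultimately show "amalg M p (\<lambda>\<xi>. ennreal (norm (g \<xi>))) \<le> amalg M p (\<lambda>\<xi>. ennreal (norm (h \<xi>)))"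
      using p by (intro amalg_mono_AE) auto
  qed
qed

text \<open>The space is the image of the amalgam space of functions under \<open>ft_dist\<close>, so that
  all estimates can be made on functions on the dual group.\<close>

lemma w_space_iff:
  assumes p: "1 \<le> p" shows "f \<in> w_space M p 1 \<longleftrightarrow> (\<exists>g. in_amalg M p g \<and> f = ft_dist M g)"
proof
  assume f: "f \<in> w_space M p 1"
  then have "w_norm M p 1 f < \<infinity>" by (simp add: w_space_def)
  then obtain g where g: "is_fourier M f g" "amalgam_norm M p 1 g < \<infinity>"
    unfolding w_norm_def by (auto simp: INF_less_iff)
  then have "in_amalg M p g" by (auto simp: in_amalg_def amalgam_norm_eq intro: is_fourier_measurable)
  moreover from this have "f = ft_dist M g"
    using f g(1) by (intro is_fourier_imp_eq_ft_dist in_amalg_integrable[OF _ p]) (auto simp: w_space_def)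
  ultimately show "\<exists>g. in_amalg M p g \<and> f = ft_dist M g" by blast
next
  assume "\<exists>g. in_amalg M p g \<and> f = ft_dist M g"
  then obtain g where g: "in_amalg M p g" "f = ft_dist M g" by blast
  then show "f \<in> w_space M p 1"
    using in_amalg_integrable[OF g(1) p] p
    by (simp add: w_space_def ft_dist_tempered w_norm_ft_dist) (simp add: in_amalg_def)
qed

lemma ft_dist_sum:
  fixes g :: "'i \<Rightarrow> real^'n \<Rightarrow> complex"
  assumes g: "\<And>i. i \<in> I \<Longrightarrow> integrable (dual_measure M) (g i)"
  shows "ft_dist M (\<lambda>\<xi>. \<Sum>i\<in>I. c i * g i \<xi>) = (\<lambda>\<phi>. \<Sum>i\<in>I. c i * ft_dist M (g i) \<phi>)"
proof
  fix \<phi>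
  show "ft_dist M (\<lambda>\<xi>. \<Sum>i\<in>I. c i * g i \<xi>) \<phi> = (\<Sum>i\<in>I. c i * ft_dist M (g i) \<phi>)"
  proof (cases "\<phi> \<in> test_space M")
    case True
    have "inv_ft M (\<lambda>\<xi>. \<Sum>i\<in>I. c i * g i \<xi>) x = (\<Sum>i\<in>I. c i * inv_ft M (g i) x)" for x
      unfolding inv_ft_def using integrable_times_chi[OF g]
      by (simp add: sum_distrib_right mult.assoc)
    then show ?thesis
      using True integrable_bcont_test[OF inv_ft_bcont[OF g] True]
      by (simp add: ft_dist_def regular_dist_def sum_distrib_right mult.assoc)
  qed (simp add: ft_dist_def regular_dist_def)
qed

lemma ft_dist_diff:
  assumes g: "integrable (dual_measure M) g" and h: "integrable (dual_measure M) h"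
  shows "ft_dist M (\<lambda>\<xi>. g \<xi> - h \<xi>) = (\<lambda>\<phi>. ft_dist M g \<phi> - ft_dist M h \<phi>)"
proof
  fix \<phi>
  show "ft_dist M (\<lambda>\<xi>. g \<xi> - h \<xi>) \<phi> = ft_dist M g \<phi> - ft_dist M h \<phi>"
  proof (cases "\<phi> \<in> test_space M")
    case True
    have "inv_ft M (\<lambda>\<xi>. g \<xi> - h \<xi>) x = inv_ft M g x - inv_ft M h x" for x
      unfolding inv_ft_def using integrable_times_chi[OF g] integrable_times_chi[OF h]
      by (simp add: left_diff_distrib)
    then show ?thesis
      using True integrable_bcont_test[OF inv_ft_bcont[OF g] True] integrable_bcont_test[OF inv_ft_bcont[OF h] True]
      by (simp add: ft_dist_def regular_dist_def left_diff_distrib)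
  qed (simp add: ft_dist_def regular_dist_def)
qed

definition heat :: "real \<Rightarrow> real \<Rightarrow> real^'n \<Rightarrow> real" where
  "heat \<beta> t \<xi> = exp (- t * norm \<xi> powr \<beta>)"

lemma heat_bounds: "0 < heat \<beta> t \<xi>" "0 \<le> t \<Longrightarrow> heat \<beta> t \<xi> \<le> 1"
  by (simp_all add: heat_def)

lemma measurable_heat [measurable (raw)]:
  assumes [measurable]: "f \<in> borel_measurable N" "g \<in> borel_measurable N"
  shows "(\<lambda>x. heat \<beta> (f x) (g x)) \<in> borel_measurable N"
  unfolding heat_def by measurable

lemma measurable_heat_dual [measurable]: "heat \<beta> t \<in> borel_measurable (dual_measure M)"
  by (intro measurable_dual_borel) measurable

lemma integrable_heat:
  fixes g :: "real^'n \<Rightarrow> complex"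
  assumes t: "0 \<le> t" and g: "integrable (dual_measure M) g"
  shows "integrable (dual_measure M) (\<lambda>\<xi>. of_real (heat \<beta> t \<xi>) * g \<xi>)"
proof (rule Bochner_Integration.integrable_bound[OF g])
  have [measurable]: "g \<in> borel_measurable (dual_measure M)" using g by simp
  show "(\<lambda>\<xi>. of_real (heat \<beta> t \<xi>) * g \<xi>) \<in> borel_measurable (dual_measure M)" by measurable
  show "AE \<xi> in dual_measure M. norm (of_real (heat \<beta> t \<xi>) * g \<xi>) \<le> norm (g \<xi>)"
  proof (rule AE_I2)
    fix \<xi> :: "real^'n"
    have "\<bar>heat \<beta> t \<xi>\<bar> \<le> 1" using heat_bounds(1)[of \<beta> t \<xi>] heat_bounds(2)[OF t, of \<beta> \<xi>] by simp
    then show "norm (of_real (heat \<beta> t \<xi>) * g \<xi>) \<le> norm (g \<xi>)"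
      unfolding norm_mult norm_of_real by (intro mult_left_le_one_le) auto
  qed
qed

text \<open>The propagator multiplies a transform chosen by \<open>fourier_fun\<close>, which agrees with \<open>g\<close> only almost
  everywhere.\<close>

lemma propagator_ft_dist:
  fixes g :: "real^'n \<Rightarrow> complex"
  assumes t: "0 \<le> t" and g: "integrable (dual_measure M) g"
  shows "propagator M \<beta> t (ft_dist M g) = ft_dist M (\<lambda>\<xi>. of_real (heat \<beta> t \<xi>) * g \<xi>)"
proof -
  let ?h = "fourier_fun M (ft_dist M g)"
  have F: "is_fourier M (ft_dist M g) ?h"
    unfolding fourier_fun_def by (rule someI[of _ g]) (rule is_fourier_ft_dist[OF g])
  have [measurable]: "g \<in> borel_measurable (dual_measure M)" using g by simp
  have [measurable]: "?h \<in> borel_measurable (dual_measure M)" by (rule is_fourier_measurable[OF F])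
  have ae: "AE \<xi> in dual_measure M. g \<xi> = ?h \<xi>"
    by (rule is_fourier_unique[OF is_fourier_ft_dist[OF g] F])
  have "integrable (dual_measure M) ?h \<longleftrightarrow> integrable (dual_measure M) g"
    by (intro Bochner_Integration.integrable_cong_AE) (use ae in auto)
  then have h: "integrable (dual_measure M) ?h" using g by simp
  have "propagator M \<beta> t (ft_dist M g) = inverse_fourier M (\<lambda>\<xi>. of_real (heat \<beta> t \<xi>) * ?h \<xi>)"
    by (simp add: propagator_def heat_def)
  also have "\<dots> = ft_dist M (\<lambda>\<xi>. of_real (heat \<beta> t \<xi>) * ?h \<xi>)"
    by (rule inverse_fourier_eq[OF integrable_heat[OF t h]])
  also have "\<dots> = ft_dist M (\<lambda>\<xi>. of_real (heat \<beta> t \<xi>) * g \<xi>)"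
    using ae by (intro ft_dist_cong_AE) auto
  finally show ?thesis .
qed

lemma cont_rep_ft_dist:
  fixes g :: "real^'n \<Rightarrow> complex"
  assumes g: "integrable (dual_measure M) g" shows "cont_rep M (ft_dist M g) = inv_ft M g"
  unfolding cont_rep_def
proof (rule the_equality)
  show "continuous_on UNIV (inv_ft M g) \<and> bounded (range (inv_ft M g)) \<and> (M = Td \<longrightarrow> periodic (inv_ft M g)) \<and> ft_dist M g = regular_dist M (inv_ft M g)"
    using inv_ft_bcont[OF g] by (simp add: bcont_def ft_dist_def)
next
  fix v :: "real^'n \<Rightarrow> complex"
  assume "continuous_on UNIV v \<and> bounded (range v) \<and> (M = Td \<longrightarrow> periodic v) \<and> ft_dist M g = regular_dist M v"
  then show "v = inv_ft M g"
    by (intro regular_dist_inj[OF _ inv_ft_bcont[OF g]]) (auto simp: bcont_def ft_dist_def)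
qed

section \<open>Convolution powers\<close>

definition cconv :: "domain \<Rightarrow> (real^'n \<Rightarrow> complex) \<Rightarrow> (real^'n \<Rightarrow> complex) \<Rightarrow> real^'n \<Rightarrow> complex" where
  "cconv M f g \<xi> = (LINT \<eta>|dual_measure M. f \<eta> * g (\<xi> - \<eta>))"

lemma measurable_cconv:
  assumes [measurable]: "f \<in> borel_measurable (dual_measure M)" "g \<in> borel_measurable (dual_measure M)"
  shows "cconv M f g \<in> borel_measurable (dual_measure M)"
  unfolding cconv_def by measurable

lemma norm_integral_le_nn_integral:
  fixes f :: "'a \<Rightarrow> complex"
  shows "ennreal (norm (LINT x|M. f x)) \<le> (\<integral>\<^sup>+x. ennreal (norm (f x)) \<partial>M)"
proof (cases "integrable M f")
  case True
  then show ?thesis by (rule integral_norm_bound_ennreal)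
qed (simp add: not_integrable_integral_eq)

lemma norm_cconv_le: "ennreal (norm (cconv M f g \<xi>)) \<le> nconv M (\<lambda>\<xi>. ennreal (norm (f \<xi>))) (\<lambda>\<xi>. ennreal (norm (g \<xi>))) \<xi>"
  using norm_integral_le_nn_integral[of "dual_measure M" "\<lambda>\<eta>. f \<eta> * g (\<xi> - \<eta>)"]
  by (simp add: cconv_def nconv_def norm_mult ennreal_mult)

lemma
  fixes f g :: "real^'n \<Rightarrow> complex"
  assumes f: "integrable (dual_measure M) f" and g: "integrable (dual_measure M) g"
  shows integrable_cconv: "integrable (dual_measure M) (cconv M f g)"
    and inv_ft_cconv: "inv_ft M (cconv M f g) x = inv_ft M f x * inv_ft M g x"
proof -
  let ?\<mu> = "dual_measure M :: (real^'n) measure"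
  have [measurable]: "f \<in> borel_measurable ?\<mu>" "g \<in> borel_measurable ?\<mu>" using f g by auto
  have [measurable]: "(\<lambda>\<xi>. chi \<xi> x) \<in> borel_measurable ?\<mu>" for x by (intro measurable_dual_borel) measurable
  have int: "integrable (?\<mu> \<Otimes>\<^sub>M ?\<mu>) (\<lambda>(\<eta>, \<xi>). f \<eta> * g (\<xi> - \<eta>) * chi \<xi> x)" for x
  proof (rule integrableI_bounded)
    have "(\<integral>\<^sup>+z. ennreal (norm (case z of (\<eta>, \<xi>) \<Rightarrow> f \<eta> * g (\<xi> - \<eta>) * chi \<xi> x)) \<partial>(?\<mu> \<Otimes>\<^sub>M ?\<mu>))
        = (\<integral>\<^sup>+\<eta>. (\<integral>\<^sup>+\<xi>. ennreal (norm (f \<eta>)) * ennreal (norm (g (\<xi> - \<eta>))) \<partial>?\<mu>) \<partial>?\<mu>)"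
      by (subst dual.nn_integral_fst[symmetric]) (auto simp: norm_mult ennreal_mult)
    also have "\<dots> = (\<integral>\<^sup>+\<eta>. ennreal (norm (f \<eta>)) * (\<integral>\<^sup>+\<xi>. ennreal (norm (g \<xi>)) \<partial>?\<mu>) \<partial>?\<mu>)"
    proof (intro nn_integral_cong)
      fix \<eta> assume \<eta>: "\<eta> \<in> space ?\<mu>"
      note [measurable] = measurable_shift[OF \<eta>]
      have "(\<integral>\<^sup>+\<xi>. ennreal (norm (f \<eta>)) * ennreal (norm (g (\<xi> - \<eta>))) \<partial>?\<mu>) = ennreal (norm (f \<eta>)) * (\<integral>\<^sup>+\<xi>. ennreal (norm (g (\<xi> - \<eta>))) \<partial>?\<mu>)"
        by (intro nn_integral_cmult) measurable
      also have "(\<integral>\<^sup>+\<xi>. ennreal (norm (g (\<xi> - \<eta>))) \<partial>?\<mu>) = (\<integral>\<^sup>+\<xi>. ennreal (norm (g \<xi>)) \<partial>?\<mu>)"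
        using \<eta> by (intro nn_integral_dual_shift[of "\<lambda>\<xi>. ennreal (norm (g \<xi>))"]) measurable
      finally show "(\<integral>\<^sup>+\<xi>. ennreal (norm (f \<eta>)) * ennreal (norm (g (\<xi> - \<eta>))) \<partial>?\<mu>) = ennreal (norm (f \<eta>)) * (\<integral>\<^sup>+\<xi>. ennreal (norm (g \<xi>)) \<partial>?\<mu>)" .
    qed
    also have "\<dots> = (\<integral>\<^sup>+\<eta>. ennreal (norm (f \<eta>)) \<partial>?\<mu>) * (\<integral>\<^sup>+\<xi>. ennreal (norm (g \<xi>)) \<partial>?\<mu>)"
      by (intro nn_integral_multc) measurable
    also have "\<dots> < \<infinity>"
      using f g by (simp add: integrable_iff_bounded ennreal_mult_less_top)
    finally show "(\<integral>\<^sup>+z. ennreal (norm (case z of (\<eta>, \<xi>) \<Rightarrow> f \<eta> * g (\<xi> - \<eta>) * chi \<xi> x)) \<partial>(?\<mu> \<Otimes>\<^sub>M ?\<mu>)) < \<infinity>" .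
  qed measurable
  have c: "(LINT \<eta>|?\<mu>. f \<eta> * g (\<xi> - \<eta>) * chi \<xi> x) = cconv M f g \<xi> * chi \<xi> x" for \<xi> x
    by (simp add: cconv_def)
  show "integrable ?\<mu> (cconv M f g)"
    using dual_pair.integrable_snd[OF int[of 0]] by (simp add: cconv_def[abs_def])
  have "inv_ft M (cconv M f g) x = (LINT \<xi>|?\<mu>. (LINT \<eta>|?\<mu>. f \<eta> * g (\<xi> - \<eta>) * chi \<xi> x))"
    by (simp only: inv_ft_def c)
  also have "\<dots> = (LINT \<eta>|?\<mu>. (LINT \<xi>|?\<mu>. f \<eta> * g (\<xi> - \<eta>) * chi \<xi> x))"
    using dual_pair.Fubini_integral[OF int[of x]] by simp
  also have "\<dots> = (LINT \<eta>|?\<mu>. (f \<eta> * chi \<eta> x) * inv_ft M g x)"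
  proof (intro Bochner_Integration.integral_cong refl)
    fix \<eta> assume \<eta>: "\<eta> \<in> space ?\<mu>"
    have "(LINT \<xi>|?\<mu>. f \<eta> * g (\<xi> - \<eta>) * chi \<xi> x) = (LINT \<xi>|?\<mu>. (f \<eta> * chi \<eta> x) * (g (\<xi> - \<eta>) * chi (\<xi> - \<eta>) x))"
    proof (intro Bochner_Integration.integral_cong refl)
      fix \<xi> :: "real^'n"
      have "chi \<xi> x = chi \<eta> x * chi (\<xi> - \<eta>) x" by (simp flip: chi_add(1))
      then show "f \<eta> * g (\<xi> - \<eta>) * chi \<xi> x = (f \<eta> * chi \<eta> x) * (g (\<xi> - \<eta>) * chi (\<xi> - \<eta>) x)" by simp
    qed
    also have "\<dots> = (f \<eta> * chi \<eta> x) * (LINT \<xi>|?\<mu>. g (\<xi> - \<eta>) * chi (\<xi> - \<eta>) x)"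
      by (rule integral_mult_right_zero)
    also have "(LINT \<xi>|?\<mu>. g (\<xi> - \<eta>) * chi (\<xi> - \<eta>) x) = (LINT \<xi>|distr ?\<mu> ?\<mu> (\<lambda>\<xi>. \<xi> - \<eta>). g \<xi> * chi \<xi> x)"
      by (rule integral_distr[symmetric, OF measurable_shift[OF \<eta>]]) measurable
    also have "\<dots> = inv_ft M g x" by (simp add: distr_dual_diff[OF \<eta>] inv_ft_def)
    finally show "(LINT \<xi>|?\<mu>. f \<eta> * g (\<xi> - \<eta>) * chi \<xi> x) = (f \<eta> * chi \<eta> x) * inv_ft M g x" .
  qed
  also have "\<dots> = inv_ft M f x * inv_ft M g x" by (simp add: inv_ft_def)
  finally show "inv_ft M (cconv M f g) x = inv_ft M f x * inv_ft M g x" .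
qed

text \<open>The convolution power with \<open>Suc m\<close> factors; there is no power with zero factors, as the convolution
  on \<open>\<real>\<^sup>d\<close> has no unit.\<close>

primrec cpow :: "domain \<Rightarrow> (real^'n \<Rightarrow> complex) \<Rightarrow> nat \<Rightarrow> real^'n \<Rightarrow> complex" where
  "cpow M g 0 = g"
| "cpow M g (Suc m) = cconv M g (cpow M g m)"

primrec npow :: "domain \<Rightarrow> (real^'n \<Rightarrow> ennreal) \<Rightarrow> nat \<Rightarrow> real^'n \<Rightarrow> ennreal" where
  "npow M h 0 = h"
| "npow M h (Suc m) = nconv M h (npow M h m)"

lemma integrable_cpow: "integrable (dual_measure M) g \<Longrightarrow> integrable (dual_measure M) (cpow M g m)"
  by (induction m) (auto intro: integrable_cconv)

text \<open>The product of two inversion integrals is the inversion integral of the convolution.\<close>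

lemma dist_power_ft_dist:
  assumes g: "integrable (dual_measure M) g"
  shows "dist_power M (ft_dist M g) (Suc m) = ft_dist M (cpow M g m)"
proof -
  have "inv_ft M (cpow M g m) x = inv_ft M g x ^ Suc m" for x
    by (induction m) (simp_all add: inv_ft_cconv integrable_cpow g)
  then have "inv_ft M (cpow M g m) = (\<lambda>x. inv_ft M g x ^ Suc m)" by (rule ext)
  then show ?thesis
    by (simp only: dist_power_def cont_rep_ft_dist[OF g]) (simp only: ft_dist_def)
qed

lemma measurable_cpow [measurable (raw)]:
  "g \<in> borel_measurable (dual_measure M) \<Longrightarrow> cpow M g m \<in> borel_measurable (dual_measure M)"
  by (induction m) (auto intro: measurable_cconv)

lemma measurable_npow [measurable (raw)]:
  "h \<in> borel_measurable (dual_measure M) \<Longrightarrow> npow M h m \<in> borel_measurable (dual_measure M)"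
  by (induction m) (auto intro: measurable_nconv)

section \<open>Majorants and Lipschitz bounds for convolution powers\<close>

lemma nconv_mono:
  assumes "\<And>\<xi>. \<xi> \<in> space (dual_measure M) \<Longrightarrow> f \<xi> \<le> f' \<xi>" "\<And>\<xi>. \<xi> \<in> space (dual_measure M) \<Longrightarrow> g \<xi> \<le> g' \<xi>"
    and "\<xi> \<in> space (dual_measure M)"
  shows "nconv M f g \<xi> \<le> nconv M f' g' \<xi>"
  unfolding nconv_def using assms by (intro nn_integral_mono mult_mono) (auto intro: dual_measure_closed)

lemma npow_mono:
  assumes "\<And>\<xi>. \<xi> \<in> space (dual_measure M) \<Longrightarrow> h \<xi> \<le> h' \<xi>" and "\<xi> \<in> space (dual_measure M)"
  shows "npow M h m \<xi> \<le> npow M h' m \<xi>"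
  using assms(2)
proof (induction m arbitrary: \<xi>)
  case (Suc m)
  then show ?case using nconv_mono[of M h h' "npow M h m" "npow M h' m" \<xi>] assms(1) by simp
qed (use assms in simp)

lemma ennreal_SUP_mult_incseq:
  fixes f g :: "nat \<Rightarrow> ennreal"
  assumes "incseq f" "incseq g"
  shows "(SUP i. f i) * (SUP i. g i) = (SUP i. f i * g i)"
proof (rule antisym)
  have "(SUP i. f i) * (SUP j. g j) = (SUP i. SUP j. f i * g j)"
    by (simp add: SUP_mult_left_ennreal SUP_mult_right_ennreal) (rule SUP_commute)
  also have "\<dots> \<le> (SUP i. f i * g i)"
  proof (intro SUP_least)
    fix i j
    have "f i * g j \<le> f (max i j) * g (max i j)"
      using assms by (intro mult_mono) (auto simp: incseq_def)
    then show "f i * g j \<le> (SUP i. f i * g i)" by (rule SUP_upper2[OF UNIV_I])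
  qed
  finally show "(SUP i. f i) * (SUP i. g i) \<le> (SUP i. f i * g i)" .
  show "(SUP i. f i * g i) \<le> (SUP i. f i) * (SUP i. g i)"
    by (intro SUP_least mult_mono SUP_upper) auto
qed

text \<open>Monotone convergence in every factor.  The cut-off by the dual group inside the proof makes the
  integrands increase at every point.\<close>

lemma npow_SUP:
  fixes h :: "nat \<Rightarrow> real^'n \<Rightarrow> ennreal"
  assumes h [measurable]: "\<And>i. h i \<in> borel_measurable (dual_measure M)"
    and inc: "\<And>\<xi>. incseq (\<lambda>i. h i \<xi>)" and \<xi>: "\<xi> \<in> space (dual_measure M)"
  shows "npow M (\<lambda>\<xi>. SUP i. h i \<xi>) m \<xi> = (SUP i. npow M (h i) m \<xi>)"
  using \<xi>
proof (induction m arbitrary: \<xi>)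
  case (Suc m)
  let ?\<mu> = "dual_measure M :: (real^'n) measure"
  note [measurable] = measurable_npow[OF h]
  have inc_npow: "incseq (\<lambda>i. npow M (h i) m \<xi>)" if "\<xi> \<in> space ?\<mu>" for \<xi>
    using inc that by (auto simp: incseq_def intro!: npow_mono)
  have "npow M (\<lambda>\<xi>. SUP i. h i \<xi>) (Suc m) \<xi> = (\<integral>\<^sup>+\<eta>. (SUP i. h i \<eta>) * (SUP i. npow M (h i) m (\<xi> - \<eta>)) \<partial>?\<mu>)"
    unfolding npow.simps nconv_def using Suc.prems
    by (intro nn_integral_cong) (simp add: Suc.IH[OF dual_measure_closed])
  also have "\<dots> = (\<integral>\<^sup>+\<eta>. (SUP i. h i \<eta> * npow M (h i) m (\<xi> - \<eta>)) \<partial>?\<mu>)"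
    using Suc.prems by (intro nn_integral_cong ennreal_SUP_mult_incseq inc inc_npow dual_measure_closed)
  also have "\<dots> = (\<integral>\<^sup>+\<eta>. (SUP i. indicator (space ?\<mu>) \<eta> * (h i \<eta> * npow M (h i) m (\<xi> - \<eta>))) \<partial>?\<mu>)"
    by (intro nn_integral_cong) simp
  also have "\<dots> = (SUP i. \<integral>\<^sup>+\<eta>. indicator (space ?\<mu>) \<eta> * (h i \<eta> * npow M (h i) m (\<xi> - \<eta>)) \<partial>?\<mu>)"
  proof (rule nn_integral_monotone_convergence_SUP)
    show "incseq (\<lambda>i \<eta>. indicator (space ?\<mu>) \<eta> * (h i \<eta> * npow M (h i) m (\<xi> - \<eta>)))"
    proof (intro incseq_SucI le_funI)
      fix i and \<eta> :: "real^'n"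
      show "indicator (space ?\<mu>) \<eta> * (h i \<eta> * npow M (h i) m (\<xi> - \<eta>)) \<le> indicator (space ?\<mu>) \<eta> * (h (Suc i) \<eta> * npow M (h (Suc i)) m (\<xi> - \<eta>))"
      proof (cases "\<eta> \<in> space ?\<mu>")
        case True
        have "h i \<eta> * npow M (h i) m (\<xi> - \<eta>) \<le> h (Suc i) \<eta> * npow M (h (Suc i)) m (\<xi> - \<eta>)"
          using inc inc_npow[OF dual_measure_closed[OF Suc.prems True]] by (intro mult_mono incseq_SucD) auto
        then show ?thesis by (intro mult_left_mono) auto
      qed simp
    qed
    show "(\<lambda>\<eta>. indicator (space ?\<mu>) \<eta> * (h i \<eta> * npow M (h i) m (\<xi> - \<eta>))) \<in> borel_measurable ?\<mu>" for i
      using Suc.prems by measurable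
  qed
  also have "\<dots> = (SUP i. npow M (h i) (Suc m) \<xi>)"
    unfolding npow.simps nconv_def by (intro SUP_cong refl nn_integral_cong) simp
  finally show ?case .
qed simp

lemma norm_cpow_le:
  assumes "\<And>\<xi>. \<xi> \<in> space (dual_measure M) \<Longrightarrow> ennreal (norm (f \<xi>)) \<le> h \<xi>" and "\<xi> \<in> space (dual_measure M)"
  shows "ennreal (norm (cpow M f m \<xi>)) \<le> npow M h m \<xi>"
  using assms(2)
proof (induction m arbitrary: \<xi>)
  case (Suc m)
  have "ennreal (norm (cpow M f (Suc m) \<xi>)) \<le> nconv M (\<lambda>\<xi>. ennreal (norm (f \<xi>))) (\<lambda>\<xi>. ennreal (norm (cpow M f m \<xi>))) \<xi>"
    by (simp add: norm_cconv_le)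
  also have "\<dots> \<le> nconv M h (npow M h m) \<xi>"
    by (intro nconv_mono assms(1) Suc)
  finally show ?case by simp
qed (use assms in simp)

abbreviation neighbours :: "'n::finite itself \<Rightarrow> ennreal" where
  "neighbours _ \<equiv> of_nat (card (unit_steps :: (real^'n) set))"

lemma amalg_npow:
  fixes h :: "real^'n \<Rightarrow> ennreal"
  assumes [measurable]: "h \<in> borel_measurable (dual_measure M)" and p: "1 \<le> p" and H: "amalg M p h \<le> H"
  shows "amalg M p (npow M h m) \<le> neighbours TYPE('n) ^ m * H ^ Suc m"
proof (induction m)
  case (Suc m)
  have "amalg M p (npow M h (Suc m)) \<le> neighbours TYPE('n) * amalg M p h * amalg M p (npow M h m)"
    unfolding npow.simps by (intro amalg_nconv p) measurable
  also have "\<dots> \<le> neighbours TYPE('n) * H * (neighbours TYPE('n) ^ m * H ^ Suc m)"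
    by (intro mult_mono Suc H order_refl) auto
  also have "\<dots> = neighbours TYPE('n) ^ Suc m * H ^ Suc (Suc m)" by (simp add: ac_simps)
  finally show ?case .
qed (use H in simp)

text \<open>A majorant for two successive iterates.  Besides the sizes it compares the increments, and it is these
  that make the iterates converge wherever their majorants do.\<close>

definition majorises :: "'a set \<Rightarrow> ('a \<Rightarrow> ennreal) \<Rightarrow> ('a \<Rightarrow> ennreal) \<Rightarrow> ('a \<Rightarrow> complex) \<Rightarrow> ('a \<Rightarrow> complex) \<Rightarrow> bool" where
  "majorises S h h' f f' \<longleftrightarrow> (\<forall>\<xi>\<in>S. ennreal (norm (f \<xi>)) \<le> h \<xi> \<and> h \<xi> + ennreal (norm (f' \<xi> - f \<xi>)) \<le> h' \<xi>)"

lemma majorisesD: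
  assumes "majorises S h h' f f'" "\<xi> \<in> S"
  shows "ennreal (norm (f \<xi>)) \<le> h \<xi>" "h \<xi> + ennreal (norm (f' \<xi> - f \<xi>)) \<le> h' \<xi>"
    "h \<xi> \<le> h' \<xi>" "ennreal (norm (f' \<xi>)) \<le> h' \<xi>"
proof -
  show 1: "ennreal (norm (f \<xi>)) \<le> h \<xi>" and 2: "h \<xi> + ennreal (norm (f' \<xi> - f \<xi>)) \<le> h' \<xi>"
    using assms by (auto simp: majorises_def)
  show "h \<xi> \<le> h' \<xi>" using 2 by (rule order_trans[rotated]) simp
  have "norm (f' \<xi>) \<le> norm (f \<xi>) + norm (f' \<xi> - f \<xi>)" using norm_triangle_ineq[of "f \<xi>" "f' \<xi> - f \<xi>"] by simp
  then have "ennreal (norm (f' \<xi>)) \<le> ennreal (norm (f \<xi>)) + ennreal (norm (f' \<xi> - f \<xi>))"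
    by (simp flip: ennreal_plus)
  also have "\<dots> \<le> h \<xi> + ennreal (norm (f' \<xi> - f \<xi>))" using 1 by (rule add_right_mono)
  finally show "ennreal (norm (f' \<xi>)) \<le> h' \<xi>" using 2 by (rule order_trans)
qed

text \<open>Expand \<open>f' g' - f g = (f' - f) g' + f (g' - g)\<close>; the same expansion for the bounds has nonnegative
  terms.\<close>

lemma majorises_cconv:
  fixes M :: domain and f f' g g' :: "real^'n \<Rightarrow> complex" and S :: "(real^'n) set"
  defines "S \<equiv> space (dual_measure M)"
  assumes f: "majorises S h h' f f'" and g: "majorises S k k' g g'"
    and [measurable]: "h \<in> borel_measurable (dual_measure M)" "h' \<in> borel_measurable (dual_measure M)"
      "k \<in> borel_measurable (dual_measure M)" "k' \<in> borel_measurable (dual_measure M)"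
      "f \<in> borel_measurable (dual_measure M)" "f' \<in> borel_measurable (dual_measure M)"
      "g \<in> borel_measurable (dual_measure M)" "g' \<in> borel_measurable (dual_measure M)"
  shows "majorises S (nconv M h k) (nconv M h' k') (cconv M f g) (cconv M f' g')"
  unfolding majorises_def
proof (intro ballI conjI)
  let ?\<mu> = "dual_measure M :: (real^'n) measure"
  fix \<xi> assume \<xi>: "\<xi> \<in> S"
  then have [simp]: "\<xi> \<in> space ?\<mu>" by (simp add: S_def)
  have cl: "\<xi> - \<eta> \<in> S" if "\<eta> \<in> space ?\<mu>" for \<eta> using \<xi> that by (simp add: S_def dual_measure_closed)
  note F = majorisesD[OF f] and G = majorisesD[OF g]
  show "ennreal (norm (cconv M f g \<xi>)) \<le> nconv M h k \<xi>"
    using \<xi> F(1) G(1) unfolding S_def by (intro order_trans[OF norm_cconv_le nconv_mono]) auto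
  show "nconv M h k \<xi> + ennreal (norm (cconv M f' g' \<xi> - cconv M f g \<xi>)) \<le> nconv M h' k' \<xi>"
  proof (cases "nconv M h' k' \<xi> = top")
    case False
    have int: "integrable ?\<mu> (\<lambda>\<eta>. u \<eta> * v (\<xi> - \<eta>))"
      if u: "\<And>\<eta>. \<eta> \<in> S \<Longrightarrow> ennreal (norm (u \<eta>)) \<le> h' \<eta>" and v: "\<And>\<eta>. \<eta> \<in> S \<Longrightarrow> ennreal (norm (v \<eta>)) \<le> k' \<eta>"
        and [measurable]: "u \<in> borel_measurable ?\<mu>" "v \<in> borel_measurable ?\<mu>" for u v :: "real^'n \<Rightarrow> complex"
    proof (rule integrableI_bounded)
      have "(\<integral>\<^sup>+\<eta>. ennreal (norm (u \<eta> * v (\<xi> - \<eta>))) \<partial>?\<mu>) \<le> nconv M h' k' \<xi>"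
        unfolding nconv_def norm_mult using u v cl
        by (intro nn_integral_mono) (auto simp: ennreal_mult S_def intro!: mult_mono)
      then show "(\<integral>\<^sup>+\<eta>. ennreal (norm (u \<eta> * v (\<xi> - \<eta>))) \<partial>?\<mu>) < \<infinity>" 
        using False by (simp add: top.not_eq_extremum le_less_trans)
    qed measurable
    have int1: "integrable ?\<mu> (\<lambda>\<eta>. f' \<eta> * g' (\<xi> - \<eta>))" by (rule int) (use F(4) G(4) in auto)
    have int2: "integrable ?\<mu> (\<lambda>\<eta>. f \<eta> * g (\<xi> - \<eta>))"
      by (rule int) (use order_trans[OF F(1) F(3)] order_trans[OF G(1) G(3)] in auto)
    have "cconv M f' g' \<xi> - cconv M f g \<xi> = (LINT \<eta>|?\<mu>. f' \<eta> * g' (\<xi> - \<eta>) - f \<eta> * g (\<xi> - \<eta>))"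
      unfolding cconv_def by (rule Bochner_Integration.integral_diff[symmetric, OF int1 int2])
    then have "nconv M h k \<xi> + ennreal (norm (cconv M f' g' \<xi> - cconv M f g \<xi>))
      \<le> nconv M h k \<xi> + (\<integral>\<^sup>+\<eta>. ennreal (norm (f' \<eta> * g' (\<xi> - \<eta>) - f \<eta> * g (\<xi> - \<eta>))) \<partial>?\<mu>)"
      by (simp only:) (intro add_left_mono norm_integral_le_nn_integral)
    also have "\<dots> = (\<integral>\<^sup>+\<eta>. h \<eta> * k (\<xi> - \<eta>) + ennreal (norm (f' \<eta> * g' (\<xi> - \<eta>) - f \<eta> * g (\<xi> - \<eta>))) \<partial>?\<mu>)"
      unfolding nconv_def by (intro nn_integral_add[symmetric]) measurable
    also have "\<dots> \<le> nconv M h' k' \<xi>"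
      unfolding nconv_def
    proof (rule nn_integral_mono)
      fix \<eta> assume \<eta>: "\<eta> \<in> space ?\<mu>"
      then have \<eta>': "\<eta> \<in> S" by (simp add: S_def)
      let ?\<zeta> = "\<xi> - \<eta>"
      have "f' \<eta> * g' ?\<zeta> - f \<eta> * g ?\<zeta> = (f' \<eta> - f \<eta>) * g' ?\<zeta> + f \<eta> * (g' ?\<zeta> - g ?\<zeta>)" by (simp add: algebra_simps)
      then have "norm (f' \<eta> * g' ?\<zeta> - f \<eta> * g ?\<zeta>) \<le> norm (f' \<eta> - f \<eta>) * norm (g' ?\<zeta>) + norm (f \<eta>) * norm (g' ?\<zeta> - g ?\<zeta>)"
        using norm_triangle_ineq[of "(f' \<eta> - f \<eta>) * g' ?\<zeta>" "f \<eta> * (g' ?\<zeta> - g ?\<zeta>)"] by (simp only: norm_mult)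
      then have "ennreal (norm (f' \<eta> * g' ?\<zeta> - f \<eta> * g ?\<zeta>))
          \<le> ennreal (norm (f' \<eta> - f \<eta>)) * ennreal (norm (g' ?\<zeta>)) + ennreal (norm (f \<eta>)) * ennreal (norm (g' ?\<zeta> - g ?\<zeta>))"
        by (simp flip: ennreal_mult ennreal_plus)
      also have "\<dots> \<le> ennreal (norm (f' \<eta> - f \<eta>)) * k' ?\<zeta> + h \<eta> * ennreal (norm (g' ?\<zeta> - g ?\<zeta>))"
        by (intro add_mono mult_left_mono mult_right_mono F(1)[OF \<eta>'] G(4)[OF cl[OF \<eta>]]) auto
      finally have "h \<eta> * k ?\<zeta> + ennreal (norm (f' \<eta> * g' ?\<zeta> - f \<eta> * g ?\<zeta>))
          \<le> h \<eta> * k ?\<zeta> + (ennreal (norm (f' \<eta> - f \<eta>)) * k' ?\<zeta> + h \<eta> * ennreal (norm (g' ?\<zeta> - g ?\<zeta>)))"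
        by (rule add_left_mono)
      also have "\<dots> = h \<eta> * (k ?\<zeta> + ennreal (norm (g' ?\<zeta> - g ?\<zeta>))) + ennreal (norm (f' \<eta> - f \<eta>)) * k' ?\<zeta>"
        by (simp add: distrib_left ac_simps)
      also have "\<dots> \<le> h \<eta> * k' ?\<zeta> + ennreal (norm (f' \<eta> - f \<eta>)) * k' ?\<zeta>"
        by (intro add_right_mono mult_left_mono G(2)[OF cl[OF \<eta>]]) auto
      also have "\<dots> = (h \<eta> + ennreal (norm (f' \<eta> - f \<eta>))) * k' ?\<zeta>" by (simp add: distrib_right)
      also have "\<dots> \<le> h' \<eta> * k' ?\<zeta>" by (intro mult_right_mono F(2)[OF \<eta>']) auto
      finally show "h \<eta> * k ?\<zeta> + ennreal (norm (f' \<eta> * g' ?\<zeta> - f \<eta> * g ?\<zeta>)) \<le> h' \<eta> * k' ?\<zeta>" .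
    qed
    finally show ?thesis .
  qed simp
qed

lemma majorises_cpow:
  assumes "majorises (space (dual_measure M)) h h' f f'"
    and "h \<in> borel_measurable (dual_measure M)" "h' \<in> borel_measurable (dual_measure M)"
      "f \<in> borel_measurable (dual_measure M)" "f' \<in> borel_measurable (dual_measure M)"
  shows "majorises (space (dual_measure M)) (npow M h m) (npow M h' m) (cpow M f m) (cpow M f' m)"
proof (induction m)
  case (Suc m)
  then show ?case
    unfolding npow.simps cpow.simps using assms
    by (intro majorises_cconv measurable_npow measurable_cpow)
qed (use assms in simp)

text \<open>The derivative of the convolution power at \<open>h\<close> in the direction \<open>D\<close>.\<close>

primrec dpow :: "domain \<Rightarrow> (real^'n \<Rightarrow> ennreal) \<Rightarrow> (real^'n \<Rightarrow> ennreal) \<Rightarrow> nat \<Rightarrow> real^'n \<Rightarrow> ennreal" where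
  "dpow M h D 0 = D"
| "dpow M h D (Suc m) = (\<lambda>\<xi>. nconv M h (dpow M h D m) \<xi> + nconv M D (npow M h m) \<xi>)"

lemma measurable_dpow [measurable (raw)]:
  assumes [measurable]: "h \<in> borel_measurable (dual_measure M)" "D \<in> borel_measurable (dual_measure M)"
  shows "dpow M h D m \<in> borel_measurable (dual_measure M)"
proof (induction m)
  case (Suc m)
  then show ?case
    unfolding dpow.simps by (intro borel_measurable_add measurable_nconv measurable_npow) (use assms in auto)
qed (use assms in simp)

text \<open>Telescoping, one factor at a time.  Finiteness of the power of the majorant makes the convolutions
  at \<open>\<xi>\<close> absolutely convergent, so that their difference is the integral of the difference.\<close>

lemma cpow_diff_le_dpow:
  fixes f g :: "real^'n \<Rightarrow> complex"
  assumes [measurable]: "f \<in> borel_measurable (dual_measure M)" "g \<in> borel_measurable (dual_measure M)"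
      "h \<in> borel_measurable (dual_measure M)" "D \<in> borel_measurable (dual_measure M)"
    and f: "\<And>\<xi>. \<xi> \<in> space (dual_measure M) \<Longrightarrow> ennreal (norm (f \<xi>)) \<le> h \<xi>"
    and g: "\<And>\<xi>. \<xi> \<in> space (dual_measure M) \<Longrightarrow> ennreal (norm (g \<xi>)) \<le> h \<xi>"
    and D: "\<And>\<xi>. \<xi> \<in> space (dual_measure M) \<Longrightarrow> ennreal (norm (f \<xi> - g \<xi>)) \<le> D \<xi>"
    and \<xi>: "\<xi> \<in> space (dual_measure M)" and fin: "npow M h m \<xi> \<noteq> top"
  shows "ennreal (norm (cpow M f m \<xi> - cpow M g m \<xi>)) \<le> dpow M h D m \<xi>"
  using \<xi> fin
proof (induction m arbitrary: \<xi>)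
  case 0
  show ?case unfolding cpow.simps dpow.simps by (rule D[OF 0(1)])
next
  case (Suc m)
  let ?\<mu> = "dual_measure M :: (real^'n) measure"
  have [simp]: "\<xi> \<in> space ?\<mu>" by (rule Suc.prems(1))
  have [measurable]: "npow M h m \<in> borel_measurable ?\<mu>" "dpow M h D m \<in> borel_measurable ?\<mu>"
    by (rule measurable_npow measurable_dpow; measurable)+
  have cl: "\<xi> - \<eta> \<in> space ?\<mu>" if "\<eta> \<in> space ?\<mu>" for \<eta> using that Suc.prems(1) by (rule dual_measure_closed[rotated])
  have fin: "nconv M h (npow M h m) \<xi> < top" using Suc.prems(2) by (simp add: top.not_eq_extremum)
  have int: "integrable ?\<mu> (\<lambda>\<eta>. u \<eta> * cpow M u m (\<xi> - \<eta>))"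
    if u: "\<And>\<eta>. \<eta> \<in> space ?\<mu> \<Longrightarrow> ennreal (norm (u \<eta>)) \<le> h \<eta>" and [measurable]: "u \<in> borel_measurable ?\<mu>" for u
  proof (rule integrableI_bounded)
    have [measurable]: "cpow M u m \<in> borel_measurable ?\<mu>" by (intro measurable_cpow that)
    show "(\<lambda>\<eta>. u \<eta> * cpow M u m (\<xi> - \<eta>)) \<in> borel_measurable ?\<mu>" by measurable
    have "(\<integral>\<^sup>+\<eta>. ennreal (norm (u \<eta> * cpow M u m (\<xi> - \<eta>))) \<partial>?\<mu>) \<le> nconv M h (npow M h m) \<xi>"
      unfolding nconv_def norm_mult using u cl
      by (intro nn_integral_mono) (auto simp: ennreal_mult intro!: mult_mono norm_cpow_le)
    then show "(\<integral>\<^sup>+\<eta>. ennreal (norm (u \<eta> * cpow M u m (\<xi> - \<eta>))) \<partial>?\<mu>) < \<infinity>" using fin by simp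
  qed
  have "cpow M f (Suc m) \<xi> - cpow M g (Suc m) \<xi> = (LINT \<eta>|?\<mu>. f \<eta> * cpow M f m (\<xi> - \<eta>) - g \<eta> * cpow M g m (\<xi> - \<eta>))"
    unfolding cpow.simps cconv_def
    by (intro Bochner_Integration.integral_diff[symmetric] int f g) measurable
  then have "ennreal (norm (cpow M f (Suc m) \<xi> - cpow M g (Suc m) \<xi>))
    \<le> (\<integral>\<^sup>+\<eta>. ennreal (norm (f \<eta> * cpow M f m (\<xi> - \<eta>) - g \<eta> * cpow M g m (\<xi> - \<eta>))) \<partial>?\<mu>)"
    by (simp add: norm_integral_le_nn_integral)
  also have "\<dots> \<le> (\<integral>\<^sup>+\<eta>. h \<eta> * dpow M h D m (\<xi> - \<eta>) + D \<eta> * npow M h m (\<xi> - \<eta>) \<partial>?\<mu>)"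
  proof (rule nn_integral_mono_AE)
    have "AE \<eta> in ?\<mu>. h \<eta> * npow M h m (\<xi> - \<eta>) \<noteq> \<infinity>"
    proof (rule nn_integral_PInf_AE)
      show "(\<lambda>\<eta>. h \<eta> * npow M h m (\<xi> - \<eta>)) \<in> borel_measurable ?\<mu>" by measurable
      show "(\<integral>\<^sup>+\<eta>. h \<eta> * npow M h m (\<xi> - \<eta>) \<partial>?\<mu>) \<noteq> \<infinity>" using fin by (simp add: nconv_def)
    qed
    then show "AE \<eta> in ?\<mu>. ennreal (norm (f \<eta> * cpow M f m (\<xi> - \<eta>) - g \<eta> * cpow M g m (\<xi> - \<eta>)))
        \<le> h \<eta> * dpow M h D m (\<xi> - \<eta>) + D \<eta> * npow M h m (\<xi> - \<eta>)"
      using AE_space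
    proof eventually_elim
      case (elim \<eta>)
      let ?\<zeta> = "\<xi> - \<eta>"
      have "f \<eta> * cpow M f m ?\<zeta> - g \<eta> * cpow M g m ?\<zeta> = f \<eta> * (cpow M f m ?\<zeta> - cpow M g m ?\<zeta>) + (f \<eta> - g \<eta>) * cpow M g m ?\<zeta>"
        by (simp add: algebra_simps)
      then have "norm (f \<eta> * cpow M f m ?\<zeta> - g \<eta> * cpow M g m ?\<zeta>)
          \<le> norm (f \<eta>) * norm (cpow M f m ?\<zeta> - cpow M g m ?\<zeta>) + norm (f \<eta> - g \<eta>) * norm (cpow M g m ?\<zeta>)"
        using norm_triangle_ineq[of "f \<eta> * (cpow M f m ?\<zeta> - cpow M g m ?\<zeta>)" "(f \<eta> - g \<eta>) * cpow M g m ?\<zeta>"] by (simp only: norm_mult)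
      then have "ennreal (norm (f \<eta> * cpow M f m ?\<zeta> - g \<eta> * cpow M g m ?\<zeta>))
          \<le> ennreal (norm (f \<eta>)) * ennreal (norm (cpow M f m ?\<zeta> - cpow M g m ?\<zeta>)) + ennreal (norm (f \<eta> - g \<eta>)) * ennreal (norm (cpow M g m ?\<zeta>))"
        by (simp flip: ennreal_mult ennreal_plus)
      also have "\<dots> \<le> h \<eta> * dpow M h D m ?\<zeta> + D \<eta> * npow M h m ?\<zeta>"
      proof (rule add_mono)
        show "ennreal (norm (f \<eta>)) * ennreal (norm (cpow M f m ?\<zeta> - cpow M g m ?\<zeta>)) \<le> h \<eta> * dpow M h D m ?\<zeta>"
        proof (cases "npow M h m ?\<zeta> = top")
          case True
          then have "h \<eta> = 0" using elim(1) by (simp add: ennreal_mult_eq_top_iff)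
          then have "norm (f \<eta>) = 0" using f[OF elim(2)] by (simp add: ennreal_eq_0_iff)
          then show ?thesis by simp
        next
          case False
          then show ?thesis by (intro mult_mono f elim Suc.IH cl) auto
        qed
        show "ennreal (norm (f \<eta> - g \<eta>)) * ennreal (norm (cpow M g m ?\<zeta>)) \<le> D \<eta> * npow M h m ?\<zeta>"
          by (intro mult_mono D norm_cpow_le[OF g] cl elim) auto
      qed
      finally show ?case .
    qed
  qed
  also have "\<dots> = dpow M h D (Suc m) \<xi>"
    unfolding dpow.simps nconv_def by (intro nn_integral_add) measurable
  finally show ?case .
qed

lemma amalg_dpow:
  fixes h :: "real^'n \<Rightarrow> ennreal"
  assumes [measurable]: "h \<in> borel_measurable (dual_measure M)" "D \<in> borel_measurable (dual_measure M)"
    and p: "1 \<le> p" and H: "amalg M p h \<le> H"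
  shows "amalg M p (dpow M h D m) \<le> of_nat (Suc m) * neighbours TYPE('n) ^ m * H ^ m * amalg M p D"
proof (induction m)
  case (Suc m)
  let ?C = "neighbours TYPE('n)"
  have "amalg M p (dpow M h D (Suc m)) \<le> amalg M p (nconv M h (dpow M h D m)) + amalg M p (nconv M D (npow M h m))"
    unfolding dpow.simps by (intro amalg_add p) measurable
  also have "\<dots> \<le> ?C * amalg M p h * amalg M p (dpow M h D m) + ?C * amalg M p D * amalg M p (npow M h m)"
    by (intro add_mono amalg_nconv p) measurable
  also have "\<dots> \<le> ?C * H * (of_nat (Suc m) * ?C ^ m * H ^ m * amalg M p D) + ?C * amalg M p D * (?C ^ m * H ^ Suc m)"
    by (intro add_mono mult_mono Suc H order_refl amalg_npow p) auto
  also have "\<dots> = of_nat (Suc (Suc m)) * ?C ^ Suc m * H ^ Suc m * amalg M p D"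
    by (simp add: algebra_simps)
  finally show ?case .
qed simp

section \<open>Existence by Picard iteration with a majorant\<close>

lemma norm_heat_mult_le: "0 \<le> u \<Longrightarrow> norm (of_real (heat \<beta> u \<xi>) * z :: complex) \<le> norm z"
  unfolding norm_mult using heat_bounds(1)[of \<beta> u \<xi>] heat_bounds(2)[of u \<beta> \<xi>] by (simp add: mult_left_le_one_le)

text \<open>A bound \<open>A\<close> for the data and a time \<open>T\<close> so short that the nonlinearity adds at most one to the norm on the
  ball of radius \<open>A + 1\<close>.\<close>

locale picard =
  fixes M :: domain and \<beta> :: real and m :: nat and p :: ennreal
    and g\<^sub>0 :: "real^'n \<Rightarrow> complex" and T :: real and A :: real
  assumes \<beta>: "0 < \<beta>" and p: "1 \<le> p" and g\<^sub>0: "in_amalg M p g\<^sub>0" and T: "0 < T"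
    and A: "0 \<le> A" "amalg M p (\<lambda>\<xi>. ennreal (norm (g\<^sub>0 \<xi>))) \<le> ennreal A"
    and small: "T * real (card (unit_steps :: (real^'n) set)) ^ m * (A + 1) ^ Suc m \<le> 1"
begin

abbreviation "\<mu> \<equiv> dual_measure M :: (real^'n) measure"

lemma measurable_g0 [measurable]: "g\<^sub>0 \<in> borel_measurable \<mu>"
  by (rule in_amalg_measurable[OF g\<^sub>0])

definition ua :: "real^'n \<Rightarrow> ennreal" where
  "ua \<xi> = ennreal (norm (g\<^sub>0 \<xi>))"

lemma measurable_ua [measurable]: "ua \<in> borel_measurable \<mu>"
  unfolding ua_def by measurable

text \<open>The Picard operator of the majorant equation.\<close>

definition mstep :: "(real^'n \<Rightarrow> ennreal) \<Rightarrow> real^'n \<Rightarrow> ennreal" where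
  "mstep h \<xi> = ua \<xi> + ennreal T * npow M h m \<xi>"

lemma measurable_mstep: "h \<in> borel_measurable \<mu> \<Longrightarrow> mstep h \<in> borel_measurable \<mu>"
proof -
  assume [measurable]: "h \<in> borel_measurable \<mu>"
  have [measurable]: "npow M h m \<in> borel_measurable \<mu>" by (rule measurable_npow) measurable
  show "mstep h \<in> borel_measurable \<mu>" unfolding mstep_def[abs_def] by measurable
qed

definition hs :: "nat \<Rightarrow> real^'n \<Rightarrow> ennreal" where
  "hs i = (mstep ^^ i) (\<lambda>\<xi>. 0)"

lemma hs_0: "hs 0 \<xi> = 0" and hs_Suc: "hs (Suc i) = mstep (hs i)"
  by (simp_all add: hs_def)

lemma measurable_hs [measurable]: "hs i \<in> borel_measurable \<mu>"
proof (induction i)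
  case (Suc i)
  then show ?case by (simp add: hs_Suc measurable_mstep)
qed (simp add: hs_def)

text \<open>The indicator makes the iterates increase at every point, as \<open>npow_SUP\<close> and \<open>amalg_SUP_le\<close> ask; on
  the dual group it is one.\<close>

definition hmaj :: "real^'n \<Rightarrow> ennreal" where
  "hmaj \<xi> = (SUP i. indicator (space \<mu>) \<xi> * hs i \<xi>)"

lemma hs_mono: "\<xi> \<in> space \<mu> \<Longrightarrow> hs i \<xi> \<le> hs (Suc i) \<xi>"
proof (induction i arbitrary: \<xi>)
  case (Suc i)
  have "mstep (hs i) \<xi> \<le> mstep (hs (Suc i)) \<xi>"
    unfolding mstep_def using Suc by (intro add_left_mono mult_left_mono npow_mono) auto
  then show ?case by (simp only: hs_Suc)
qed (simp add: hs_0)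

lemma incseq_hs: "incseq (\<lambda>i. indicator (space \<mu>) \<xi> * hs i \<xi>)"
  by (cases "\<xi> \<in> space \<mu>") (auto intro!: incseq_SucI hs_mono)

lemma measurable_hmaj [measurable]: "hmaj \<in> borel_measurable \<mu>"
  unfolding hmaj_def[abs_def] by measurable

lemma hmaj_eq: "\<xi> \<in> space \<mu> \<Longrightarrow> hmaj \<xi> = (SUP i. hs i \<xi>)"
  by (simp add: hmaj_def)

lemma hs_le_hmaj: "\<xi> \<in> space \<mu> \<Longrightarrow> hs i \<xi> \<le> hmaj \<xi>"
  unfolding hmaj_eq by (rule SUP_upper) simp

lemma hs_tendsto: "\<xi> \<in> space \<mu> \<Longrightarrow> (\<lambda>i. hs i \<xi>) \<longlonglongrightarrow> hmaj \<xi>"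
  unfolding hmaj_eq by (intro LIMSEQ_SUP incseq_SucI hs_mono)

lemma npow_hmaj:
  assumes "\<xi> \<in> space \<mu>" shows "npow M hmaj m \<xi> = (SUP i. npow M (hs i) m \<xi>)"
proof -
  have "npow M hmaj m \<xi> = (SUP i. npow M (\<lambda>\<xi>. indicator (space \<mu>) \<xi> * hs i \<xi>) m \<xi>)"
    unfolding hmaj_def[abs_def] using assms by (intro npow_SUP incseq_hs) measurable
  also have "\<dots> = (SUP i. npow M (hs i) m \<xi>)"
    using assms by (intro SUP_cong refl antisym npow_mono) auto
  finally show ?thesis .
qed

lemma hmaj_fixpoint:
  assumes "\<xi> \<in> space \<mu>" shows "hmaj \<xi> = ua \<xi> + ennreal T * npow M hmaj m \<xi>"
proof -
  have "(\<lambda>i. hs (Suc i) \<xi>) \<longlonglongrightarrow> hmaj \<xi>"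
    by (rule LIMSEQ_Suc[OF hs_tendsto[OF assms]])
  moreover have "(\<lambda>i. hs (Suc i) \<xi>) \<longlonglongrightarrow> ua \<xi> + ennreal T * npow M hmaj m \<xi>"
    unfolding hs_Suc mstep_def npow_hmaj[OF assms]
    by (intro tendsto_add tendsto_const ennreal_tendsto_cmult LIMSEQ_SUP incseq_SucI npow_mono hs_mono assms)
      (auto simp: hs_mono)
  ultimately show ?thesis by (rule LIMSEQ_unique)
qed

text \<open>By the choice of \<open>T\<close> the ball of radius \<open>A + 1\<close> is mapped to itself, and bounds on the norm
  pass to increasing limits.\<close>

lemma amalg_hmaj: "amalg M p hmaj \<le> ennreal (A + 1)"
  unfolding hmaj_def[abs_def]
proof (rule amalg_SUP_le[OF _ _ p])
  show "incseq (\<lambda>i \<xi>. indicator (space \<mu>) \<xi> * hs i \<xi>)"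
    using incseq_hs by (auto simp: incseq_def le_fun_def)
  fix i
  let ?C = "neighbours TYPE('n)"
  have "amalg M p (hs i) \<le> ennreal (A + 1)"
  proof (induction i)
    case 0
    have "hs 0 = (\<lambda>\<xi>. 0)" by (simp add: fun_eq_iff hs_0)
    then show ?case using p A by simp
  next
    case (Suc i)
    have [measurable]: "npow M (hs i) m \<in> borel_measurable \<mu>" by (rule measurable_npow) measurable
    have "amalg M p (hs (Suc i)) \<le> amalg M p ua + amalg M p (\<lambda>\<xi>. ennreal T * npow M (hs i) m \<xi>)"
      unfolding hs_Suc mstep_def[abs_def] by (intro amalg_add p) measurable
    also have "\<dots> \<le> ennreal A + ennreal T * (?C ^ m * ennreal (A + 1) ^ Suc m)"
    proof (intro add_mono)
      show "amalg M p ua \<le> ennreal A" using A by (simp add: ua_def[abs_def])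
      have "amalg M p (\<lambda>\<xi>. ennreal T * npow M (hs i) m \<xi>) \<le> ennreal T * amalg M p (npow M (hs i) m)"
        by (intro amalg_cmult p) measurable
      also have "\<dots> \<le> ennreal T * (?C ^ m * ennreal (A + 1) ^ Suc m)"
        by (intro mult_left_mono amalg_npow p Suc) auto
      finally show "amalg M p (\<lambda>\<xi>. ennreal T * npow M (hs i) m \<xi>) \<le> ennreal T * (?C ^ m * ennreal (A + 1) ^ Suc m)" .
    qed
    also have "\<dots> = ennreal (A + T * real (card (unit_steps :: (real^'n) set)) ^ m * (A + 1) ^ Suc m)"
      using A T by (simp add: ennreal_of_nat_eq_real_of_nat ennreal_power mult.assoc flip: ennreal_mult ennreal_plus)
    also have "\<dots> \<le> ennreal (A + 1)" using small by (intro ennreal_leI) simp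
    finally show ?case .
  qed
  moreover have "amalg M p (\<lambda>\<xi>. indicator (space \<mu>) \<xi> * hs i \<xi>) \<le> amalg M p (hs i)"
    by (intro amalg_mono p) auto
  ultimately show "amalg M p (\<lambda>\<xi>. indicator (space \<mu>) \<xi> * hs i \<xi>) \<le> ennreal (A + 1)"
    by (rule order_trans[rotated])
qed measurable

lemma AE_hmaj: "AE \<xi> in \<mu>. hmaj \<xi> \<noteq> \<infinity>"
proof (rule nn_integral_PInf_AE)
  have "(\<integral>\<^sup>+\<xi>. hmaj \<xi> \<partial>\<mu>) \<le> ennreal (A + 1)"
    using nn_integral_le_amalg[OF measurable_hmaj p] amalg_hmaj by (rule order_trans)
  then show "(\<integral>\<^sup>+\<xi>. hmaj \<xi> \<partial>\<mu>) \<noteq> \<infinity>" by (auto simp: top_unique)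
qed measurable

text \<open>The nonlinearity at a frequency is finite as soon as the majorant is, since it occurs on the right of
  the fixed-point equation with the positive factor \<open>T\<close>.\<close>

lemma npow_hmaj_finite:
  assumes "\<xi> \<in> space \<mu>" "hmaj \<xi> \<noteq> top" shows "npow M hmaj m \<xi> \<noteq> top"
proof
  assume "npow M hmaj m \<xi> = top"
  then have "hmaj \<xi> = top" using hmaj_fixpoint[OF assms(1)] T by (simp add: ennreal_mult_top)
  then show False using assms by simp
qed

text \<open>Joint measurability in time and frequency, needed to integrate over time at fixed frequency and to
  convolve at fixed time.\<close>

definition joint :: "(real \<Rightarrow> real^'n \<Rightarrow> complex) \<Rightarrow> bool" where
  "joint G \<longleftrightarrow> (\<lambda>x. G (fst x) (snd x)) \<in> borel_measurable (borel \<Otimes>\<^sub>M \<mu>)"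

lemma jointD:
  assumes "joint G" "f \<in> borel_measurable N" "h \<in> measurable N \<mu>"
  shows "(\<lambda>x. G (f x) (h x)) \<in> borel_measurable N"
  using measurable_compose[OF measurable_Pair[OF assms(2,3)], of "\<lambda>x. G (fst x) (snd x)"] assms(1)
  by (simp add: joint_def)

lemma jointD_snd: "joint G \<Longrightarrow> G t \<in> borel_measurable \<mu>"
  by (rule jointD[of G "\<lambda>_. t" \<mu> "\<lambda>\<xi>. \<xi>"]) auto

lemma jointD_fst: "joint G \<Longrightarrow> \<xi> \<in> space \<mu> \<Longrightarrow> (\<lambda>t. G t \<xi>) \<in> borel_measurable borel"
  by (rule jointD[of G "\<lambda>t. t" borel "\<lambda>_. \<xi>"]) auto

lemma joint_cpow: assumes G: "joint G" shows "joint (\<lambda>s. cpow M (G s) i)"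
proof (induction i)
  case (Suc i)
  let ?N = "(borel :: real measure) \<Otimes>\<^sub>M \<mu>"
  have 1 [measurable]: "(\<lambda>z. G (fst (fst z)) (snd z)) \<in> borel_measurable (?N \<Otimes>\<^sub>M \<mu>)"
    by (rule jointD[OF G]) measurable
  have 2 [measurable]: "(\<lambda>z. cpow M (G (fst (fst z))) i (snd (fst z) - snd z)) \<in> borel_measurable (?N \<Otimes>\<^sub>M \<mu>)"
    by (rule jointD[OF Suc]) measurable
  have "(\<lambda>x. LINT \<eta>|\<mu>. G (fst x) \<eta> * cpow M (G (fst x)) i (snd x - \<eta>)) \<in> borel_measurable ?N"
    using 1 2 by (intro dual.borel_measurable_lebesgue_integral) (simp add: split_beta')
  then show ?case by (simp add: joint_def cconv_def)
qed (use G in simp)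

text \<open>The integrand of the Duhamel term.  It vanishes outside \<open>{0..t}\<close>, so that the integral over time can
  be taken over the whole line for all \<open>t\<close>.\<close>

definition duhamel :: "(real \<Rightarrow> real^'n \<Rightarrow> complex) \<Rightarrow> real \<Rightarrow> real \<Rightarrow> real^'n \<Rightarrow> complex" where
  "duhamel G t s \<xi> = (if 0 \<le> s \<and> s \<le> t then of_real (heat \<beta> (t - s) \<xi>) * cpow M (G s) m \<xi> else 0)"

text \<open>The Picard operator, extended by zero in time.\<close>

definition pstep :: "(real \<Rightarrow> real^'n \<Rightarrow> complex) \<Rightarrow> real \<Rightarrow> real^'n \<Rightarrow> complex" where
  "pstep G t \<xi> = (if 0 \<le> t \<and> t \<le> T then of_real (heat \<beta> t \<xi>) * g\<^sub>0 \<xi> + (LINT s|lborel. duhamel G t s \<xi>) else 0)"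

lemma measurable_id_dual [measurable]: "(\<lambda>\<xi>. \<xi>) \<in> borel_measurable \<mu>"
  by (rule measurable_dual_borel) simp

lemma joint_pstep: assumes G: "joint G" shows "joint (pstep G)"
proof -
  let ?N = "(borel :: real measure) \<Otimes>\<^sub>M \<mu>"
  have [measurable]: "(\<lambda>x. snd x) \<in> borel_measurable ?N"
    by (rule measurable_compose[OF measurable_snd measurable_id_dual])
  have [measurable]: "(\<lambda>z. snd (fst z)) \<in> borel_measurable (?N \<Otimes>\<^sub>M lborel)"
    by (rule measurable_compose[OF measurable_fst]) measurable
  have [measurable]: "(\<lambda>z. cpow M (G (snd z)) m (snd (fst z))) \<in> borel_measurable (?N \<Otimes>\<^sub>M lborel)"
    by (rule jointD[OF joint_cpow[OF G]]) measurable
  have [measurable]: "(\<lambda>x. g\<^sub>0 (snd x)) \<in> borel_measurable ?N" by measurable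
  have "(\<lambda>x. LINT s|lborel. duhamel G (fst x) s (snd x)) \<in> borel_measurable ?N"
    unfolding duhamel_def by (intro lborel.borel_measurable_lebesgue_integral) (simp add: split_beta')
  then show ?thesis unfolding joint_def pstep_def by measurable
qed

lemma integrable_duhamel:
  assumes F: "joint F" and \<xi>: "\<xi> \<in> space \<mu>" and le: "\<And>s. ennreal (norm (cpow M (F s) m \<xi>)) \<le> N" and N: "N \<noteq> top"
  shows "integrable lborel (\<lambda>s. duhamel F t s \<xi>)"
proof -
  obtain c where c: "N = ennreal c" "0 \<le> c" using N by (metis ennreal_cases)
  show ?thesis
  proof (rule Bochner_Integration.integrable_bound)
    show "integrable lborel (\<lambda>s. c * indicator {0..t} s)"
      by (intro integrable_mult_right integrable_real_indicator) (auto simp: emeasure_lborel_Icc_eq)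
    have "(\<lambda>s. cpow M (F s) m \<xi>) \<in> borel_measurable borel" by (rule jointD_fst[OF joint_cpow[OF F] \<xi>])
    then show "(\<lambda>s. duhamel F t s \<xi>) \<in> borel_measurable lborel" unfolding duhamel_def by measurable
    show "AE s in lborel. norm (duhamel F t s \<xi>) \<le> norm (c * indicator {0..t} s)"
    proof (rule AE_I2)
      fix s
      have "norm (cpow M (F s) m \<xi>) \<le> c" using le[of s] c by simp
      then show "norm (duhamel F t s \<xi>) \<le> norm (c * indicator {0..t} s)"
        using norm_heat_mult_le[of "t - s" \<beta> \<xi> "cpow M (F s) m \<xi>"] c(2) by (auto simp: duhamel_def)
    qed
  qed
qed

text \<open>Convolution powers preserve majorants, the heat factors are at most one, and time is integrated over
  an interval of length at most \<open>T\<close>.\<close>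

lemma majorises_pstep:
  assumes G: "joint G" "joint G'" and [measurable]: "h \<in> borel_measurable \<mu>" "h' \<in> borel_measurable \<mu>"
    and maj: "\<And>t. majorises (space \<mu>) h h' (G t) (G' t)"
  shows "majorises (space \<mu>) (mstep h) (mstep h') (pstep G t) (pstep G' t)"
  unfolding majorises_def
proof
  fix \<xi> assume \<xi>: "\<xi> \<in> space \<mu>"
  have cp: "majorises (space \<mu>) (npow M h m) (npow M h' m) (cpow M (G s) m) (cpow M (G' s) m)" for s
    by (intro majorises_cpow maj jointD_snd G) measurable
  note C = majorisesD[OF cp \<xi>]
  let ?N = "npow M h m \<xi>" and ?N' = "npow M h' m \<xi>"
  have len: "(\<integral>\<^sup>+s. indicator {0..t} s * c \<partial>lborel) \<le> ennreal T * c" if "0 \<le> t" "t \<le> T" for c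
  proof -
    have "(\<integral>\<^sup>+s. indicator {0..t} s * c \<partial>lborel) = ennreal t * c"
      using that by (subst nn_integral_multc) auto
    also have "\<dots> \<le> ennreal T * c" using that by (intro mult_right_mono ennreal_leI) auto
    finally show ?thesis .
  qed
  show "ennreal (norm (pstep G t \<xi>)) \<le> mstep h \<xi> \<and> mstep h \<xi> + ennreal (norm (pstep G' t \<xi> - pstep G t \<xi>)) \<le> mstep h' \<xi>"
  proof (cases "0 \<le> t \<and> t \<le> T")
    case False
    have "mstep h \<xi> \<le> mstep h' \<xi>" unfolding mstep_def using C(3) by (intro add_left_mono mult_left_mono) auto
    then show ?thesis using False by (auto simp: pstep_def)
  next
    case t: True
    show ?thesis
    proof
      have "norm (pstep G t \<xi>) \<le> norm (g\<^sub>0 \<xi>) + norm (LINT s|lborel. duhamel G t s \<xi>)"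
        using t norm_heat_mult_le[of t \<beta> \<xi> "g\<^sub>0 \<xi>"] norm_triangle_ineq[of "of_real (heat \<beta> t \<xi>) * g\<^sub>0 \<xi>" "LINT s|lborel. duhamel G t s \<xi>"]
        by (simp add: pstep_def)
      then have "ennreal (norm (pstep G t \<xi>)) \<le> ua \<xi> + ennreal (norm (LINT s|lborel. duhamel G t s \<xi>))"
        by (simp add: ua_def flip: ennreal_plus)
      also have "\<dots> \<le> ua \<xi> + (\<integral>\<^sup>+s. ennreal (norm (duhamel G t s \<xi>)) \<partial>lborel)"
        by (intro add_left_mono norm_integral_le_nn_integral)
      also have "\<dots> \<le> ua \<xi> + (\<integral>\<^sup>+s. indicator {0..t} s * ?N \<partial>lborel)"
      proof (intro add_left_mono nn_integral_mono)
        fix s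
        show "ennreal (norm (duhamel G t s \<xi>)) \<le> indicator {0..t} s * ?N"
          using norm_heat_mult_le[of "t - s" \<beta> \<xi> "cpow M (G s) m \<xi>"] C(1)[of s]
          by (auto simp: duhamel_def intro: order_trans[OF ennreal_leI])
      qed
      also have "\<dots> \<le> mstep h \<xi>" unfolding mstep_def using t by (intro add_left_mono len) auto
      finally show "ennreal (norm (pstep G t \<xi>)) \<le> mstep h \<xi>" .
    next
      show "mstep h \<xi> + ennreal (norm (pstep G' t \<xi> - pstep G t \<xi>)) \<le> mstep h' \<xi>"
      proof (cases "?N' = top")
        case True
        then show ?thesis using T by (simp add: mstep_def ennreal_mult_top)
      next
        case False
        then have "?N \<noteq> top" using C(3) by (auto simp: top_unique)
        \<comment> \<open>The increment of the majorant of the nonlinearity bounds that of the nonlinearity at every time.\<close>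
        obtain e where e: "?N' = ?N + e" using C(3) by (metis le_iff_add)
        have diff: "ennreal (norm (cpow M (G' s) m \<xi> - cpow M (G s) m \<xi>)) \<le> e" for s
          using C(2)[of s] \<open>?N \<noteq> top\<close> unfolding e by (simp add: ennreal_add_left_cancel_le)
        have "pstep G' t \<xi> - pstep G t \<xi> = (LINT s|lborel. duhamel G' t s \<xi> - duhamel G t s \<xi>)"
          using t integrable_duhamel[OF G(2) \<xi> C(4) False] integrable_duhamel[OF G(1) \<xi> order_trans[OF C(1) C(3)] False]
          by (simp add: pstep_def)
        then have "ennreal (norm (pstep G' t \<xi> - pstep G t \<xi>)) \<le> (\<integral>\<^sup>+s. ennreal (norm (duhamel G' t s \<xi> - duhamel G t s \<xi>)) \<partial>lborel)"
          by (simp only:) (rule norm_integral_le_nn_integral)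
        also have "\<dots> \<le> (\<integral>\<^sup>+s. indicator {0..t} s * e \<partial>lborel)"
        proof (intro nn_integral_mono)
          fix s
          show "ennreal (norm (duhamel G' t s \<xi> - duhamel G t s \<xi>)) \<le> indicator {0..t} s * e"
            using norm_heat_mult_le[of "t - s" \<beta> \<xi> "cpow M (G' s) m \<xi> - cpow M (G s) m \<xi>"] diff[of s]
            by (auto simp: duhamel_def right_diff_distrib intro: order_trans[OF ennreal_leI])
        qed
        also have "\<dots> \<le> ennreal T * e" using t by (intro len) auto
        finally have "mstep h \<xi> + ennreal (norm (pstep G' t \<xi> - pstep G t \<xi>)) \<le> mstep h \<xi> + ennreal T * e"
          by (rule add_left_mono)
        also have "\<dots> = mstep h' \<xi>" by (simp add: mstep_def e distrib_left add.assoc)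
        finally show ?thesis .
      qed
    qed
  qed
qed

definition Gs :: "nat \<Rightarrow> real \<Rightarrow> real^'n \<Rightarrow> complex" where
  "Gs i = (pstep ^^ i) (\<lambda>t \<xi>. 0)"

lemma Gs_0: "Gs 0 t \<xi> = 0" and Gs_Suc: "Gs (Suc i) = pstep (Gs i)"
  by (simp_all add: Gs_def)

lemma joint_Gs: "joint (Gs i)"
proof (induction i)
  case (Suc i)
  then show ?case by (simp add: Gs_Suc joint_pstep)
qed (simp add: joint_def Gs_def)

lemma majorises_Gs: "majorises (space \<mu>) (hs i) (hs (Suc i)) (Gs i t) (Gs (Suc i) t)"
proof (induction i arbitrary: t)
  case 0
  have "majorises (space \<mu>) (hs 0) (hs 0) (Gs 0 t) (Gs 0 t)" for t
    by (simp add: majorises_def hs_0 Gs_0)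
  then have "majorises (space \<mu>) (mstep (hs 0)) (mstep (hs 0)) (pstep (Gs 0) t) (pstep (Gs 0) t)"
    by (intro majorises_pstep joint_Gs) measurable
  then show ?case by (simp add: majorises_def hs_0 Gs_0 flip: hs_Suc Gs_Suc)
next
  case (Suc i)
  then show ?case
    unfolding hs_Suc[of "Suc i"] Gs_Suc[of "Suc i"]
    by (subst hs_Suc, subst Gs_Suc) (intro majorises_pstep joint_Gs, auto simp flip: hs_Suc Gs_Suc)
qed

lemma majorises_trans:
  assumes "majorises S h h' f f'" "majorises S h' h'' f' f''" shows "majorises S h h'' f f''"
  unfolding majorises_def
proof (intro ballI conjI)
  fix \<xi> assume \<xi>: "\<xi> \<in> S"
  show "ennreal (norm (f \<xi>)) \<le> h \<xi>" by (rule majorisesD(1)[OF assms(1) \<xi>])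
  have "norm (f'' \<xi> - f \<xi>) \<le> norm (f' \<xi> - f \<xi>) + norm (f'' \<xi> - f' \<xi>)"
    using norm_triangle_ineq[of "f' \<xi> - f \<xi>" "f'' \<xi> - f' \<xi>"] by simp
  then have "h \<xi> + ennreal (norm (f'' \<xi> - f \<xi>)) \<le> h \<xi> + (ennreal (norm (f' \<xi> - f \<xi>)) + ennreal (norm (f'' \<xi> - f' \<xi>)))"
    by (intro add_left_mono) (simp flip: ennreal_plus)
  also have "\<dots> = (h \<xi> + ennreal (norm (f' \<xi> - f \<xi>))) + ennreal (norm (f'' \<xi> - f' \<xi>))" by (simp add: add.assoc)
  also have "\<dots> \<le> h' \<xi> + ennreal (norm (f'' \<xi> - f' \<xi>))" by (intro add_right_mono majorisesD(2)[OF assms(1) \<xi>])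
  also have "\<dots> \<le> h'' \<xi>" by (rule majorisesD(2)[OF assms(2) \<xi>])
  finally show "h \<xi> + ennreal (norm (f'' \<xi> - f \<xi>)) \<le> h'' \<xi>" .
qed

lemma majorises_Gs_le: "i \<le> j \<Longrightarrow> majorises (space \<mu>) (hs i) (hs j) (Gs i t) (Gs j t)"
proof (induction j rule: dec_induct)
  case base
  show ?case using majorisesD(1)[OF majorises_Gs] by (simp add: majorises_def)
next
  case (step j)
  then show ?case using majorises_trans majorises_Gs by blast
qed

definition G :: "real \<Rightarrow> real^'n \<Rightarrow> complex" where
  "G t \<xi> = lim (\<lambda>i. Gs i t \<xi>)"

lemma joint_G: "joint G"
  using joint_Gs unfolding joint_def G_def by (intro borel_measurable_lim_metric)

text \<open>The increments of the iterates are dominated by those of the increasing bounded sequence \<open>hs i \<xi>\<close>.\<close>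

lemma Gs_tendsto:
  assumes \<xi>: "\<xi> \<in> space \<mu>" and fin: "hmaj \<xi> \<noteq> top"
  shows "(\<lambda>i. Gs i t \<xi>) \<longlonglongrightarrow> G t \<xi>"
proof -
  have hfin: "hs i \<xi> \<noteq> top" for i using hs_le_hmaj[OF \<xi>, of i] fin by (auto simp: top_unique)
  define r where "r i = enn2real (hs i \<xi>)" for i
  have r: "hs i \<xi> = ennreal (r i)" "0 \<le> r i" for i using hfin[of i] by (simp_all add: r_def less_top)
  have r_lim: "r \<longlonglongrightarrow> enn2real (hmaj \<xi>)"
    unfolding r_def[abs_def] using hs_tendsto[OF \<xi>] fin by (intro tendsto_enn2real) (simp_all add: less_top)
  have le: "norm (Gs j t \<xi> - Gs i t \<xi>) \<le> r j - r i" if "i \<le> j" for i j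
  proof -
    have "ennreal (r i + norm (Gs j t \<xi> - Gs i t \<xi>)) \<le> ennreal (r j)"
      using majorisesD(2)[OF majorises_Gs_le[OF that] \<xi>, of t] r(2)[of i] by (simp add: r(1))
    then show ?thesis using r(2)[of j] by (simp add: ennreal_le_iff)
  qed
  have "Cauchy (\<lambda>i. Gs i t \<xi>)"
  proof (rule metric_CauchyI)
    fix e :: real assume "0 < e"
    then obtain N where N: "\<And>i j. N \<le> i \<Longrightarrow> N \<le> j \<Longrightarrow> dist (r i) (r j) < e"
      using LIMSEQ_imp_Cauchy[OF r_lim] unfolding Cauchy_def by meson
    have "dist (Gs i t \<xi>) (Gs j t \<xi>) < e" if "N \<le> i" "N \<le> j" for i j
      using le[of i j] le[of j i] N[OF that] by (cases "i \<le> j") (auto simp: dist_norm norm_minus_commute abs_less_iff)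
    then show "\<exists>N. \<forall>i\<ge>N. \<forall>j\<ge>N. dist (Gs i t \<xi>) (Gs j t \<xi>) < e" by blast
  qed
  then show ?thesis unfolding G_def by (simp add: Cauchy_convergent_iff convergent_LIMSEQ_iff)
qed

text \<open>The increments of the iterates telescope; let the upper index tend to infinity.\<close>

lemma majorises_G: "majorises (space \<mu>) (hs i) hmaj (Gs i t) (G t)"
  unfolding majorises_def
proof (intro ballI conjI)
  fix \<xi> assume \<xi>: "\<xi> \<in> space \<mu>"
  show "ennreal (norm (Gs i t \<xi>)) \<le> hs i \<xi>" by (rule majorisesD(1)[OF majorises_Gs \<xi>])
  show "hs i \<xi> + ennreal (norm (G t \<xi> - Gs i t \<xi>)) \<le> hmaj \<xi>"
  proof (cases "hmaj \<xi> = top")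
    case False
    have "(\<lambda>j. hs i \<xi> + ennreal (norm (Gs j t \<xi> - Gs i t \<xi>))) \<longlonglongrightarrow> hs i \<xi> + ennreal (norm (G t \<xi> - Gs i t \<xi>))"
      by (intro tendsto_add tendsto_const tendsto_ennrealI tendsto_norm tendsto_diff Gs_tendsto[OF \<xi> False])
    then show ?thesis
    proof (rule LIMSEQ_le_const2)
      have "hs i \<xi> + ennreal (norm (Gs j t \<xi> - Gs i t \<xi>)) \<le> hmaj \<xi>" if "i \<le> j" for j
        using majorisesD(2)[OF majorises_Gs_le[OF that] \<xi>, of t] hs_le_hmaj[OF \<xi>, of j] by (rule order_trans)
      then show "\<exists>N. \<forall>j\<ge>N. hs i \<xi> + ennreal (norm (Gs j t \<xi> - Gs i t \<xi>)) \<le> hmaj \<xi>" by blast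
    qed
  qed simp
qed

lemma norm_G_le: "\<xi> \<in> space \<mu> \<Longrightarrow> ennreal (norm (G t \<xi>)) \<le> hmaj \<xi>"
  using majorisesD(4)[OF majorises_G[of 0 t]] by simp

text \<open>Applied to \<open>majorises_G\<close>, the Picard operator brings \<open>pstep G\<close> within \<open>hmaj - hs (Suc i)\<close> of the next
  iterate, and this tends to zero.\<close>

lemma G_fixpoint:
  assumes \<xi>: "\<xi> \<in> space \<mu>" and fin: "hmaj \<xi> \<noteq> top"
  shows "G t \<xi> = pstep G t \<xi>"
proof -
  have maj: "majorises (space \<mu>) (mstep (hs i)) (mstep hmaj) (pstep (Gs i) t) (pstep G t)" for i
    by (intro majorises_pstep joint_Gs joint_G majorises_G) measurable
  have eq: "mstep hmaj \<xi> = hmaj \<xi>" using hmaj_fixpoint[OF \<xi>] by (simp add: mstep_def)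
  have "hs (Suc i) \<xi> + ennreal (norm (pstep G t \<xi> - Gs (Suc i) t \<xi>)) \<le> hmaj \<xi>" for i
    using majorisesD(2)[OF maj[of i] \<xi>] by (simp only: hs_Suc Gs_Suc eq)
  \<comment> \<open>Let \<open>i\<close> tend to infinity; \<open>hmaj \<xi>\<close> is finite and can be cancelled.\<close>
  then have "hmaj \<xi> + ennreal (norm (pstep G t \<xi> - G t \<xi>)) \<le> hmaj \<xi>"
    by (intro LIMSEQ_le_const2[OF tendsto_add[OF LIMSEQ_Suc[OF hs_tendsto[OF \<xi>]]
            tendsto_ennrealI[OF tendsto_norm[OF tendsto_diff[OF tendsto_const LIMSEQ_Suc[OF Gs_tendsto[OF \<xi> fin]]]]]]]) auto
  then have "hmaj \<xi> + ennreal (norm (pstep G t \<xi> - G t \<xi>)) \<le> hmaj \<xi> + 0" by simp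
  then have "ennreal (norm (pstep G t \<xi> - G t \<xi>)) \<le> 0"
    using fin by (simp only: ennreal_add_left_cancel_le) simp
  then show ?thesis by simp
qed

end

section \<open>The fixed point is a solution\<close>

lemma in_amalgI:
  assumes "g \<in> borel_measurable (dual_measure M)" and "1 \<le> p" and "amalg M p h < \<infinity>"
    and "AE \<xi> in dual_measure M. ennreal (norm (g \<xi>)) \<le> h \<xi>"
  shows "in_amalg M p g"
  unfolding in_amalg_def using amalg_mono_AE[OF _ assms(4) assms(2)] assms(1,3)
  by (auto intro: le_less_trans)

lemma in_amalg_diff:
  assumes "in_amalg M p f" "in_amalg M p g" and p: "1 \<le> p"
  shows "in_amalg M p (\<lambda>\<xi>. f \<xi> - g \<xi>)"
proof (rule in_amalgI[OF _ p])
  note [measurable] = assms(1,2)[THEN in_amalg_measurable]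
  show "(\<lambda>\<xi>. f \<xi> - g \<xi>) \<in> borel_measurable (dual_measure M)" by measurable
  have "amalg M p (\<lambda>\<xi>. ennreal (norm (f \<xi>)) + ennreal (norm (g \<xi>)))
      \<le> amalg M p (\<lambda>\<xi>. ennreal (norm (f \<xi>))) + amalg M p (\<lambda>\<xi>. ennreal (norm (g \<xi>)))"
    by (intro amalg_add p) measurable
  also have "\<dots> < \<infinity>" using assms by (simp add: in_amalg_def)
  finally show "amalg M p (\<lambda>\<xi>. ennreal (norm (f \<xi>)) + ennreal (norm (g \<xi>))) < \<infinity>" .
  show "AE \<xi> in dual_measure M. ennreal (norm (f \<xi> - g \<xi>)) \<le> ennreal (norm (f \<xi>)) + ennreal (norm (g \<xi>))"
    by (simp add: norm_triangle_ineq4 ennreal_leI flip: ennreal_plus)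
qed

lemma in_amalg_heat:
  assumes "in_amalg M p f" and p: "1 \<le> p" and t: "0 \<le> t"
  shows "in_amalg M p (\<lambda>\<xi>. of_real (heat \<beta> t \<xi>) * f \<xi>)"
proof (rule in_amalgI[OF _ p])
  note [measurable] = assms(1)[THEN in_amalg_measurable]
  show "(\<lambda>\<xi>. of_real (heat \<beta> t \<xi>) * f \<xi>) \<in> borel_measurable (dual_measure M)" by measurable
  show "amalg M p (\<lambda>\<xi>. ennreal (norm (f \<xi>))) < \<infinity>" using assms by (simp add: in_amalg_def)
  show "AE \<xi> in dual_measure M. ennreal (norm (of_real (heat \<beta> t \<xi>) * f \<xi>)) \<le> ennreal (norm (f \<xi>))"
    by (simp add: norm_heat_mult_le[OF t] ennreal_leI)
qed

lemma in_amalg_cpow: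
  fixes f :: "real^'n \<Rightarrow> complex"
  assumes f: "in_amalg M p f" and p: "1 \<le> p" shows "in_amalg M p (cpow M f m)"
proof (rule in_amalgI[OF _ p])
  note [measurable] = f[THEN in_amalg_measurable]
  show "cpow M f m \<in> borel_measurable (dual_measure M)" by (rule measurable_cpow) measurable
  have "amalg M p (npow M (\<lambda>\<xi>. ennreal (norm (f \<xi>))) m)
      \<le> neighbours TYPE('n) ^ m * amalg M p (\<lambda>\<xi>. ennreal (norm (f \<xi>))) ^ Suc m"
    by (intro amalg_npow p order_refl) measurable
  also have "\<dots> < \<infinity>" using f by (simp add: in_amalg_def ennreal_mult_less_top power_less_top_ennreal of_nat_less_top)
  finally show "amalg M p (npow M (\<lambda>\<xi>. ennreal (norm (f \<xi>))) m) < \<infinity>" .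
  show "AE \<xi> in dual_measure M. ennreal (norm (cpow M f m \<xi>)) \<le> npow M (\<lambda>\<xi>. ennreal (norm (f \<xi>))) m \<xi>"
    by (intro AE_I2 norm_cpow_le) simp_all
qed

lemma w_norm_diff_ft_dist:
  assumes f: "integrable (dual_measure M) f" and g: "integrable (dual_measure M) g" and p: "1 \<le> p"
  shows "w_norm M p 1 (\<lambda>\<phi>. ft_dist M f \<phi> - ft_dist M g \<phi>) = amalg M p (\<lambda>\<xi>. ennreal (norm (f \<xi> - g \<xi>)))"
  by (subst ft_dist_diff[OF f g, symmetric], subst w_norm_ft_dist) (use f g p in auto)

text \<open>From \<open>1 - exp (- y) \<le> y\<close>.\<close>

lemma heat_diff_le:
  assumes "0 \<le> a" "0 \<le> b" "\<bar>a - b\<bar> \<le> \<delta>"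
  shows "\<bar>heat \<beta> a \<xi> - heat \<beta> b \<xi>\<bar> \<le> min 1 (\<delta> * norm \<xi> powr \<beta>)"
proof -
  define x where "x = norm \<xi> powr \<beta>"
  have x: "0 \<le> x" by (simp add: x_def)
  have *: "\<bar>exp (- s * x) - exp (- t * x)\<bar> \<le> min 1 (\<delta> * x)" if "0 \<le> s" "s \<le> t" "t - s \<le> \<delta>" for s t
  proof -
    have "exp (- t * x) = exp (- s * x) * exp (- (t - s) * x)" by (simp add: algebra_simps flip: exp_add)
    then have eq: "exp (- s * x) - exp (- t * x) = exp (- s * x) * (1 - exp (- (t - s) * x))"
      by (simp add: right_diff_distrib)
    have "1 - exp (- (t - s) * x) \<le> (t - s) * x" using exp_ge_add_one_self[of "- (t - s) * x"] by linarith
    also have "\<dots> \<le> \<delta> * x" using that x by (intro mult_right_mono) auto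
    finally have "1 - exp (- (t - s) * x) \<le> min 1 (\<delta> * x)" by simp
    moreover have B: "0 \<le> 1 - exp (- (t - s) * x)" using mult_nonneg_nonneg[of "t - s" x] that x by (simp add: algebra_simps)
    moreover have "exp (- s * x) * (1 - exp (- (t - s) * x)) \<le> 1 - exp (- (t - s) * x)"
      by (rule mult_left_le_one_le[OF B]) (use that x in auto)
    moreover have "0 \<le> exp (- s * x) * (1 - exp (- (t - s) * x))" by (rule mult_nonneg_nonneg[OF _ B]) simp
    ultimately show ?thesis unfolding eq by (simp only: abs_of_nonneg)
  qed
  show ?thesis
    using *[of a b] *[of b a] assms unfolding heat_def x_def[symmetric] by (cases "a \<le> b") (auto simp: abs_minus_commute)
qed

text \<open>On each cell the integral differs from the value at the tag by at most \<open>w\<close> times the length.\<close>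

lemma riemann_sum_error:
  fixes f :: "real \<Rightarrow> complex"
  assumes f: "f integrable_on {0..t}" and D: "D tagged_division_of {0..t}" "(\<lambda>s. ball s \<delta>) fine D" and t: "0 \<le> t"
    and osc: "\<And>s s'. s \<in> {0..t} \<Longrightarrow> s' \<in> {0..t} \<Longrightarrow> \<bar>s - s'\<bar> < \<delta> \<Longrightarrow> norm (f s' - f s) \<le> w"
  shows "norm ((\<Sum>(s, K)\<in>D. of_real (measure lborel K) * f s) - integral {0..t} f) \<le> w * t"
proof -
  have D': "D tagged_division_of cbox 0 t" using D(1) by simp
  have "integral (cbox 0 t) f = (\<Sum>(s, K)\<in>D. integral K f)"
    by (rule integral_combine_tagged_division_topdown[OF _ D']) (use f in simp)
  then have "norm ((\<Sum>(s, K)\<in>D. of_real (measure lborel K) * f s) - integral {0..t} f)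
      = norm (\<Sum>(s, K)\<in>D. of_real (measure lborel K) * f s - integral K f)"
    by (simp add: sum_subtractf split_def)
  also have "\<dots> \<le> (\<Sum>(s, K)\<in>D. measure lborel K * w)"
  proof (rule sum_norm_le)
    fix z assume z: "z \<in> D"
    obtain s K where zK: "z = (s, K)" by (cases z)
    obtain a b where K: "K = cbox a b" using tagged_division_ofD(4)[OF D'] z zK by blast
    have sK: "s \<in> K" "K \<subseteq> {0..t}" using tagged_division_ofD(2,3)[OF D'] z zK by auto
    have Kb: "K \<subseteq> ball s \<delta>" using D(2) z zK by (auto simp: fine_def)
    have fK: "f integrable_on K" using integrable_on_subinterval[OF f, of a b] sK K by simp
    have "((\<lambda>x. f s - f x) has_integral (measure lborel K *\<^sub>R f s - integral K f)) K"
      unfolding K by (intro has_integral_diff has_integral_const integrable_integral) (use fK K in simp)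
    then have "norm (measure lborel K *\<^sub>R f s - integral K f) \<le> w * measure lborel K"
      unfolding K
    proof (rule has_integral_bound[rotated])
      show "0 \<le> w" using osc[of s s] sK Kb by (force simp: subset_iff)
      fix x assume "x \<in> cbox a b"
      then have "x \<in> K" by (simp add: K)
      then show "norm (f s - f x) \<le> w"
        using osc[of x s] sK Kb by (force simp: subset_iff dist_real_def abs_minus_commute)
    qed
    then show "norm (case z of (s, K) \<Rightarrow> of_real (measure lborel K) * f s - integral K f)
        \<le> (case z of (s, K) \<Rightarrow> measure lborel K * w)"
      by (simp add: zK scaleR_conv_of_real mult.commute)
  qed
  also have "\<dots> = (\<Sum>(s, K)\<in>D. measure lborel K) * w" by (simp add: sum_distrib_right split_def)
  also have "(\<Sum>(s, K)\<in>D. measure lborel K) = t" using additive_content_tagged_division[OF D'] t by simp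
  finally show ?thesis by (simp add: mult.commute)
qed

text \<open>The form in which the defining condition of \<open>has_w_integral\<close> is verified and used.\<close>

lemma w_norm_riemann_sum:
  fixes g :: "real \<Rightarrow> real^'n \<Rightarrow> complex"
  assumes D: "D tagged_division_of {a..b}" and p: "1 \<le> p"
    and F: "\<And>s. s \<in> {a..b} \<Longrightarrow> F s = ft_dist M (g s)"
    and g: "\<And>s. s \<in> {a..b} \<Longrightarrow> in_amalg M p (g s)" and J: "in_amalg M p J"
  shows "w_norm M p 1 (\<lambda>\<phi>. (\<Sum>(s, K)\<in>D. of_real (measure lborel K) * F s \<phi>) - ft_dist M J \<phi>)
    = amalg M p (\<lambda>\<xi>. ennreal (norm ((\<Sum>(s, K)\<in>D. of_real (measure lborel K) * g s \<xi>) - J \<xi>)))"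
proof -
  define c :: "real \<times> real set \<Rightarrow> complex" where "c z = of_real (measure lborel (snd z))" for z
  have D': "fst z \<in> {a..b}" if "z \<in> D" for z
    using tagged_division_ofD(2,3)[OF D, of "fst z" "snd z"] that by auto
  have int: "integrable (dual_measure M) (g (fst z))" if "z \<in> D" for z
    by (rule in_amalg_integrable[OF g p]) (rule D'[OF that])
  have intJ: "integrable (dual_measure M) J" by (rule in_amalg_integrable[OF J p])
  have ints: "integrable (dual_measure M) (\<lambda>\<xi>. \<Sum>z\<in>D. c z * g (fst z) \<xi>)"
    by (intro Bochner_Integration.integrable_sum integrable_mult_right int)
  have "(\<lambda>\<phi>. (\<Sum>(s, K)\<in>D. of_real (measure lborel K) * F s \<phi>) - ft_dist M J \<phi>)
      = (\<lambda>\<phi>. (\<Sum>z\<in>D. c z * ft_dist M (g (fst z)) \<phi>) - ft_dist M J \<phi>)"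
    by (intro ext arg_cong2[of _ _ _ _ "(-)"] sum.cong refl) (auto simp: c_def split_def F[OF D'])
  also have "\<dots> = (\<lambda>\<phi>. ft_dist M (\<lambda>\<xi>. \<Sum>z\<in>D. c z * g (fst z) \<xi>) \<phi> - ft_dist M J \<phi>)"
    by (subst ft_dist_sum[OF int]) auto
  finally have "w_norm M p 1 (\<lambda>\<phi>. (\<Sum>(s, K)\<in>D. of_real (measure lborel K) * F s \<phi>) - ft_dist M J \<phi>)
      = amalg M p (\<lambda>\<xi>. ennreal (norm ((\<Sum>z\<in>D. c z * g (fst z) \<xi>) - J \<xi>)))"
    using w_norm_diff_ft_dist[OF ints intJ p] by simp
  then show ?thesis by (simp add: c_def split_def)
qed

context picard
begin

text \<open>Bounds the change of the heat factor in time \<open>\<delta>\<close>.\<close>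

definition damp :: "real \<Rightarrow> real^'n \<Rightarrow> ennreal" where
  "damp \<delta> \<xi> = ennreal (min 1 (\<delta> * norm \<xi> powr \<beta>))"

text \<open>The free part moves by at most \<open>damp\<close> times \<open>ua\<close>, and the Duhamel term by \<open>damp\<close> times \<open>T npow\<close>, with
  sum \<open>damp\<close> times \<open>hmaj\<close>.  The longer interval of integration adds \<open>\<delta> npow\<close>, which is at most
  \<open>\<delta> / T\<close> times \<open>hmaj\<close>.\<close>

definition modulus :: "real \<Rightarrow> real^'n \<Rightarrow> ennreal" where
  "modulus \<delta> \<xi> = (damp \<delta> \<xi> + ennreal (\<delta> / T)) * hmaj \<xi>"

lemma measurable_damp [measurable]: "damp \<delta> \<in> borel_measurable \<mu>"
  unfolding damp_def[abs_def] by measurable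

lemma measurable_modulus [measurable]: "modulus \<delta> \<in> borel_measurable \<mu>"
  unfolding modulus_def[abs_def] by measurable

lemma measurable_npow_hmaj [measurable]: "npow M hmaj m \<in> borel_measurable \<mu>"
  by (rule measurable_npow) measurable

lemma joint_G_slice [measurable]: "G t \<in> borel_measurable \<mu>"
  by (rule jointD_snd[OF joint_G])

lemma norm_cpow_G_le: "\<xi> \<in> space \<mu> \<Longrightarrow> ennreal (norm (cpow M (G s) m \<xi>)) \<le> npow M hmaj m \<xi>"
  by (rule norm_cpow_le[OF norm_G_le])

lemma heat_diff_cpow_le:
  fixes z :: complex
  assumes "0 \<le> a" "0 \<le> b" "\<bar>a - b\<bar> \<le> \<delta>" "ennreal (norm z) \<le> c"
  shows "ennreal (norm (of_real (heat \<beta> a \<xi>) * z - of_real (heat \<beta> b \<xi>) * z)) \<le> damp \<delta> \<xi> * c"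
proof -
  have "norm (of_real (heat \<beta> a \<xi>) * z - of_real (heat \<beta> b \<xi>) * z) = \<bar>heat \<beta> a \<xi> - heat \<beta> b \<xi>\<bar> * norm z"
    by (simp flip: left_diff_distrib of_real_diff add: norm_mult)
  then have "ennreal (norm (of_real (heat \<beta> a \<xi>) * z - of_real (heat \<beta> b \<xi>) * z))
      = ennreal \<bar>heat \<beta> a \<xi> - heat \<beta> b \<xi>\<bar> * ennreal (norm z)"
    by (simp add: ennreal_mult)
  also have "\<dots> \<le> damp \<delta> \<xi> * c"
    unfolding damp_def using assms by (intro mult_mono ennreal_leI heat_diff_le) auto
  finally show ?thesis .
qed

lemma G_modulus_aux:
  assumes \<xi>: "\<xi> \<in> space \<mu>" and fin: "hmaj \<xi> \<noteq> top" and t: "0 \<le> t" "t \<le> t'" "t' < T" and \<delta>: "t' - t \<le> \<delta>"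
  shows "ennreal (norm (G t' \<xi> - G t \<xi>)) \<le> modulus \<delta> \<xi>"
proof -
  let ?N = "npow M hmaj m \<xi>"
  let ?d = "damp \<delta> \<xi>"
  note Nfin = npow_hmaj_finite[OF \<xi> fin]
  have int: "integrable lborel (\<lambda>s. duhamel G t s \<xi>)" for t
    by (rule integrable_duhamel[OF joint_G \<xi> norm_cpow_G_le[OF \<xi>] Nfin])
  define a where "a = of_real (heat \<beta> t' \<xi>) * g\<^sub>0 \<xi> - of_real (heat \<beta> t \<xi>) * g\<^sub>0 \<xi>"
  define b where "b = (LINT s|lborel. duhamel G t' s \<xi> - duhamel G t s \<xi>)"
  have "G t' \<xi> - G t \<xi> = a + b"
    using t int by (simp add: G_fixpoint[OF \<xi> fin] pstep_def a_def b_def)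
  then have "ennreal (norm (G t' \<xi> - G t \<xi>)) \<le> ennreal (norm a) + ennreal (norm b)"
    by (simp add: norm_triangle_ineq ennreal_leI flip: ennreal_plus)
  also have "ennreal (norm a) \<le> ?d * ua \<xi>"
    unfolding a_def using t \<delta> by (intro heat_diff_cpow_le) (auto simp: ua_def)
  also have "ennreal (norm b) \<le> (\<integral>\<^sup>+s. ennreal (norm (duhamel G t' s \<xi> - duhamel G t s \<xi>)) \<partial>lborel)"
    unfolding b_def by (rule norm_integral_le_nn_integral)
  also have "\<dots> \<le> (\<integral>\<^sup>+s. indicator {0..t} s * (?d * ?N) + indicator {t..t'} s * ?N \<partial>lborel)"
  proof (rule nn_integral_mono)
    fix s
    consider "0 \<le> s" "s \<le> t" | "t < s" "s \<le> t'" | "s < 0 \<or> t' < s" by linarith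
    then show "ennreal (norm (duhamel G t' s \<xi> - duhamel G t s \<xi>))
        \<le> indicator {0..t} s * (?d * ?N) + indicator {t..t'} s * ?N"
    proof cases
      case 1
      then have "ennreal (norm (duhamel G t' s \<xi> - duhamel G t s \<xi>)) \<le> ?d * ?N"
        using t \<delta> heat_diff_cpow_le[where a = "t' - s" and b = "t - s" and \<delta> = \<delta> and \<xi> = \<xi>, OF _ _ _ norm_cpow_G_le[OF \<xi>, of s]]
        by (simp add: duhamel_def)
      then show ?thesis using 1 by (simp add: add_increasing2)
    next
      case 2
      have "ennreal (norm (of_real (heat \<beta> (t' - s) \<xi>) * cpow M (G s) m \<xi>)) \<le> ennreal (norm (cpow M (G s) m \<xi>))"
        using 2 by (intro ennreal_leI norm_heat_mult_le) simp
      also have "\<dots> \<le> ?N" by (rule norm_cpow_G_le[OF \<xi>])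
      finally show ?thesis using 2 t by (simp add: duhamel_def)
    next
      case 3
      then have "duhamel G t' s \<xi> = 0" "duhamel G t s \<xi> = 0" using t by (auto simp: duhamel_def)
      then show ?thesis by simp
    qed
  qed
  also have "\<dots> = ennreal t * (?d * ?N) + ennreal (t' - t) * ?N"
    using t by (subst nn_integral_add) (auto simp: nn_integral_multc)
  also have "\<dots> \<le> ennreal T * (?d * ?N) + ennreal \<delta> * ?N"
    using t \<delta> by (intro add_mono mult_right_mono ennreal_leI) auto
  finally have "ennreal (norm (G t' \<xi> - G t \<xi>)) \<le> ?d * ua \<xi> + (ennreal T * (?d * ?N) + ennreal \<delta> * ?N)"
    by (simp add: add_mono)
  also have "\<dots> = ?d * (ua \<xi> + ennreal T * ?N) + ennreal (\<delta> / T) * (ennreal T * ?N)"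
  proof -
    have "ennreal (\<delta> / T) * ennreal T = ennreal \<delta>" using T t \<delta> by (simp flip: ennreal_mult)
    then have "ennreal (\<delta> / T) * (ennreal T * ?N) = ennreal \<delta> * ?N" by (metis mult.assoc)
    then show ?thesis by (simp add: distrib_left ac_simps)
  qed
  also have "\<dots> \<le> ?d * hmaj \<xi> + ennreal (\<delta> / T) * hmaj \<xi>"
    unfolding hmaj_fixpoint[OF \<xi>] by (intro add_mono mult_left_mono) auto
  also have "\<dots> = modulus \<delta> \<xi>" by (simp add: modulus_def distrib_right)
  finally show ?thesis .
qed

lemma G_modulus:
  assumes \<xi>: "\<xi> \<in> space \<mu>" and t: "t \<in> {0..<T}" "t' \<in> {0..<T}" and \<delta>: "0 < \<delta>" "\<bar>t' - t\<bar> \<le> \<delta>"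
  shows "ennreal (norm (G t' \<xi> - G t \<xi>)) \<le> modulus \<delta> \<xi>"
proof (cases "hmaj \<xi> = top")
  case True
  have "ennreal (\<delta> / T) \<noteq> 0" using \<delta> T by simp
  then show ?thesis using True by (simp add: modulus_def ennreal_mult_top)
next
  case False
  then show ?thesis
    using G_modulus_aux[OF \<xi> False, of t t' \<delta>] G_modulus_aux[OF \<xi> False, of t' t \<delta>] t \<delta>
    by (cases "t \<le> t'") (auto simp: norm_minus_commute)
qed

lemma damp_small:
  assumes "h \<in> borel_measurable \<mu>" "amalg M p h < \<infinity>" "0 < e"
  shows "\<exists>\<delta>>0. amalg M p (\<lambda>\<xi>. damp \<delta> \<xi> * h \<xi>) < e"
  unfolding damp_def by (rule amalg_damped_small[OF assms(1) p assms(2) \<beta> assms(3)])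

lemma damp_mono: "\<delta> \<le> \<delta>' \<Longrightarrow> damp \<delta> \<xi> \<le> damp \<delta>' \<xi>"
  unfolding damp_def by (intro ennreal_leI min.mono mult_right_mono) auto

lemma modulus_mono: "0 < \<delta> \<Longrightarrow> \<delta> \<le> \<delta>' \<Longrightarrow> modulus \<delta> \<xi> \<le> modulus \<delta>' \<xi>"
  unfolding modulus_def using T by (intro mult_right_mono add_mono damp_mono ennreal_leI divide_right_mono) auto

lemma modulus_small:
  assumes "0 < e" shows "\<exists>\<delta>>0. amalg M p (modulus \<delta>) < ennreal e"
proof -
  have fin: "amalg M p hmaj < \<infinity>" using amalg_hmaj by (rule le_less_trans) simp
  obtain \<delta>1 where \<delta>1: "\<delta>1 > 0" "amalg M p (\<lambda>\<xi>. damp \<delta>1 \<xi> * hmaj \<xi>) < ennreal (e / 2)"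
    using damp_small[OF measurable_hmaj fin, of "ennreal (e / 2)"] assms by auto
  define \<delta> where "\<delta> = min \<delta>1 (T * (e / 2) / (A + 1))"
  have \<delta>: "0 < \<delta>" "\<delta> \<le> \<delta>1" "\<delta> / T * (A + 1) \<le> e / 2"
  proof -
    show "0 < \<delta>" "\<delta> \<le> \<delta>1" using \<delta>1 T assms A by (auto simp: \<delta>_def)
    have "\<delta> \<le> T * (e / 2) / (A + 1)" by (simp add: \<delta>_def)
    then show "\<delta> / T * (A + 1) \<le> e / 2" using T A by (simp add: field_simps)
  qed
  have "amalg M p (modulus \<delta>) \<le> amalg M p (\<lambda>\<xi>. damp \<delta> \<xi> * hmaj \<xi>) + amalg M p (\<lambda>\<xi>. ennreal (\<delta> / T) * hmaj \<xi>)"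
    unfolding modulus_def[abs_def] distrib_right by (intro amalg_add p) measurable
  also have "amalg M p (\<lambda>\<xi>. damp \<delta> \<xi> * hmaj \<xi>) \<le> amalg M p (\<lambda>\<xi>. damp \<delta>1 \<xi> * hmaj \<xi>)"
    using \<delta> by (intro amalg_mono p mult_right_mono damp_mono) auto
  also have "amalg M p (\<lambda>\<xi>. ennreal (\<delta> / T) * hmaj \<xi>) \<le> ennreal (\<delta> / T) * ennreal (A + 1)"
    by (rule order_trans[OF amalg_cmult[OF measurable_hmaj p]]) (intro mult_left_mono amalg_hmaj, simp)
  also have "\<dots> \<le> ennreal (e / 2)"
  proof -
    have "ennreal (\<delta> / T) * ennreal (A + 1) = ennreal (\<delta> / T * (A + 1))" using \<delta> T A by (intro ennreal_mult[symmetric]) auto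
    then show ?thesis using \<delta>(3) by (metis ennreal_leI)
  qed
  finally have "amalg M p (modulus \<delta>) \<le> amalg M p (\<lambda>\<xi>. damp \<delta>1 \<xi> * hmaj \<xi>) + ennreal (e / 2)"
    by (simp add: add_mono)
  also have "\<dots> < ennreal (e / 2) + ennreal (e / 2)"
    using \<delta>1(2) by (simp add: ennreal_add_left_cancel_less add.commute)
  also have "\<dots> = ennreal e" using assms by (simp flip: ennreal_plus)
  finally show ?thesis using \<delta>(1) by blast
qed

lemma in_amalg_G: "in_amalg M p (G t)"
proof (rule in_amalgI[OF _ p])
  show "amalg M p hmaj < \<infinity>" using amalg_hmaj by (rule le_less_trans) simp
qed (auto intro: norm_G_le)

definition sol :: "real \<Rightarrow> 'n functional" where
  "sol t = ft_dist M (G t)"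

lemma w_continuous_sol: "w_continuous_on M p 1 {0..<T} sol"
  unfolding w_continuous_on_def
proof (intro ballI conjI)
  fix t assume t: "t \<in> {0..<T}"
  show "sol t \<in> w_space M p 1" using in_amalg_G by (auto simp: w_space_iff[OF p] sol_def)
  show "((\<lambda>s. w_norm M p 1 (\<lambda>\<phi>. sol s \<phi> - sol t \<phi>)) \<longlongrightarrow> 0) (at t within {0..<T})"
  proof (rule order_tendstoI)
    fix e :: ennreal assume "0 < e"
    then obtain e' where e': "0 < ennreal e'" "ennreal e' < e" by (metis dense ennreal_cases not_less_iff_gr_or_eq top.extremum_strict)
    then obtain \<delta> where \<delta>: "0 < \<delta>" "amalg M p (modulus \<delta>) < ennreal e'" using modulus_small[of e'] by auto
    have "w_norm M p 1 (\<lambda>\<phi>. sol s \<phi> - sol t \<phi>) < e" if "s \<in> {0..<T}" "dist s t < \<delta>" for s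
    proof -
      have "w_norm M p 1 (\<lambda>\<phi>. sol s \<phi> - sol t \<phi>) = amalg M p (\<lambda>\<xi>. ennreal (norm (G s \<xi> - G t \<xi>)))"
        unfolding sol_def by (intro w_norm_diff_ft_dist in_amalg_integrable[OF in_amalg_G] p)
      also have "\<dots> \<le> amalg M p (modulus \<delta>)"
        using that t \<delta> by (intro amalg_mono p G_modulus) (auto simp: dist_real_def)
      finally show ?thesis using \<delta>(2) e'(2) by simp
    qed
    then show "eventually (\<lambda>s. w_norm M p 1 (\<lambda>\<phi>. sol s \<phi> - sol t \<phi>) < e) (at t within {0..<T})"
      unfolding eventually_at using \<delta>(1) by blast
  qed simp
qed

text \<open>The Duhamel integrand changes through the heat factor and through the solution; the second effect is
  the derivative of the power in the direction \<open>modulus\<close>.\<close>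

definition oscillation :: "real \<Rightarrow> real^'n \<Rightarrow> ennreal" where
  "oscillation \<delta> \<xi> = damp \<delta> \<xi> * npow M hmaj m \<xi> + dpow M hmaj (modulus \<delta>) m \<xi>"

lemma measurable_oscillation [measurable]: "oscillation \<delta> \<in> borel_measurable \<mu>"
proof -
  have [measurable]: "dpow M hmaj (modulus \<delta>) m \<in> borel_measurable \<mu>" by (rule measurable_dpow) measurable
  show ?thesis unfolding oscillation_def[abs_def] by measurable
qed

lemma amalg_oscillation_small:
  assumes "0 < e" shows "\<exists>\<delta>>0. amalg M p (oscillation \<delta>) < ennreal e"
proof -
  let ?C = "real (card (unit_steps :: (real^'n) set))"
  \<comment> \<open>The Lipschitz constant of the convolution power on the ball of radius \<open>A + 1\<close>.\<close>
  define k where "k = real (Suc m) * ?C ^ m * (A + 1) ^ m"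
  have k: "0 \<le> k" using A by (simp add: k_def)
  have k_eq: "of_nat (Suc m) * neighbours TYPE('n) ^ m * ennreal (A + 1) ^ m = ennreal k"
    using A by (simp add: k_def ennreal_of_nat_eq_real_of_nat ennreal_power ennreal_mult del: ennreal_plus)
  have "amalg M p (npow M hmaj m) \<le> neighbours TYPE('n) ^ m * ennreal (A + 1) ^ Suc m"
    by (rule amalg_npow[OF measurable_hmaj p amalg_hmaj])
  also have "\<dots> < \<infinity>" by (simp add: ennreal_mult_less_top power_less_top_ennreal of_nat_less_top)
  finally obtain \<delta>1 where \<delta>1: "\<delta>1 > 0" "amalg M p (\<lambda>\<xi>. damp \<delta>1 \<xi> * npow M hmaj m \<xi>) < ennreal (e / 2)"
    using damp_small[OF measurable_npow_hmaj, of "ennreal (e / 2)"] assms by auto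
  obtain \<delta>2 where \<delta>2: "\<delta>2 > 0" "amalg M p (modulus \<delta>2) < ennreal (e / (2 * (k + 1)))"
    using modulus_small[of "e / (2 * (k + 1))"] assms k by auto
  define \<delta> where "\<delta> = min \<delta>1 \<delta>2"
  have \<delta>: "0 < \<delta>" "\<delta> \<le> \<delta>1" "\<delta> \<le> \<delta>2" using \<delta>1 \<delta>2 by (auto simp: \<delta>_def)
  have [measurable]: "dpow M hmaj (modulus \<delta>) m \<in> borel_measurable \<mu>" by (rule measurable_dpow) measurable
  have "amalg M p (oscillation \<delta>) \<le> amalg M p (\<lambda>\<xi>. damp \<delta> \<xi> * npow M hmaj m \<xi>) + amalg M p (dpow M hmaj (modulus \<delta>) m)"
    unfolding oscillation_def[abs_def] by (intro amalg_add p) measurable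
  also have "\<dots> \<le> amalg M p (\<lambda>\<xi>. damp \<delta>1 \<xi> * npow M hmaj m \<xi>) + ennreal (e / 2)"
  proof (rule add_mono)
    show "amalg M p (\<lambda>\<xi>. damp \<delta> \<xi> * npow M hmaj m \<xi>) \<le> amalg M p (\<lambda>\<xi>. damp \<delta>1 \<xi> * npow M hmaj m \<xi>)"
      using \<delta> by (intro amalg_mono p mult_right_mono damp_mono) auto
    have "amalg M p (modulus \<delta>) \<le> amalg M p (modulus \<delta>2)"
      using \<delta> by (intro amalg_mono p modulus_mono) auto
    then have "amalg M p (modulus \<delta>) \<le> ennreal (e / (2 * (k + 1)))" using \<delta>2(2) by simp
    then have "amalg M p (dpow M hmaj (modulus \<delta>) m) \<le> ennreal k * ennreal (e / (2 * (k + 1)))"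
      using amalg_dpow[OF measurable_hmaj measurable_modulus p amalg_hmaj, of \<delta> m] unfolding k_eq
      by (meson mult_left_mono order_trans zero_le)
    also have "\<dots> = ennreal (k * (e / (2 * (k + 1))))" using k assms by (intro ennreal_mult[symmetric]) auto
    also have "\<dots> \<le> ennreal (e / 2)" using k assms by (intro ennreal_leI) (simp add: field_simps)
    finally show "amalg M p (dpow M hmaj (modulus \<delta>) m) \<le> ennreal (e / 2)" .
  qed
  also have "\<dots> < ennreal (e / 2) + ennreal (e / 2)"
    using \<delta>1(2) by (simp add: ennreal_add_left_cancel_less add.commute)
  also have "\<dots> = ennreal e" using assms by (simp flip: ennreal_plus)
  finally show ?thesis using \<delta>(1) by blast
qed

lemma duhamel_oscillation:
  assumes \<xi>: "\<xi> \<in> space \<mu>" and fin: "hmaj \<xi> \<noteq> top" and t: "t < T"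
    and s: "s \<in> {0..t}" "s' \<in> {0..t}" "\<bar>s - s'\<bar> < \<delta>"
  shows "ennreal (norm (duhamel G t s' \<xi> - duhamel G t s \<xi>)) \<le> oscillation \<delta> \<xi>"
proof -
  let ?a = "of_real (heat \<beta> (t - s') \<xi>) * cpow M (G s') m \<xi> - of_real (heat \<beta> (t - s) \<xi>) * cpow M (G s') m \<xi>"
  let ?b = "of_real (heat \<beta> (t - s) \<xi>) * (cpow M (G s') m \<xi> - cpow M (G s) m \<xi>)"
  have "duhamel G t s' \<xi> - duhamel G t s \<xi> = ?a + ?b" using s by (simp add: duhamel_def algebra_simps)
  then have "ennreal (norm (duhamel G t s' \<xi> - duhamel G t s \<xi>)) \<le> ennreal (norm ?a) + ennreal (norm ?b)"
    by (simp add: norm_triangle_ineq ennreal_leI flip: ennreal_plus)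
  also have "\<dots> \<le> oscillation \<delta> \<xi>"
    unfolding oscillation_def
  proof (rule add_mono)
    show "ennreal (norm ?a) \<le> damp \<delta> \<xi> * npow M hmaj m \<xi>"
      using s by (intro heat_diff_cpow_le norm_cpow_G_le \<xi>) auto
    have "ennreal (norm ?b) \<le> ennreal (norm (cpow M (G s') m \<xi> - cpow M (G s) m \<xi>))"
      using s by (intro ennreal_leI norm_heat_mult_le) auto
    also have "\<dots> \<le> dpow M hmaj (modulus \<delta>) m \<xi>"
      using s t by (intro cpow_diff_le_dpow norm_G_le G_modulus npow_hmaj_finite \<xi> fin) (auto simp: abs_minus_commute)
    finally show "ennreal (norm ?b) \<le> dpow M hmaj (modulus \<delta>) m \<xi>" .
  qed
  finally show ?thesis .
qed

lemma has_integral_duhamel: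
  assumes \<xi>: "\<xi> \<in> space \<mu>" and fin: "hmaj \<xi> \<noteq> top" and t: "0 \<le> t" "t < T"
  shows "((\<lambda>s. duhamel G t s \<xi>) has_integral G t \<xi> - of_real (heat \<beta> t \<xi>) * g\<^sub>0 \<xi>) {0..t}"
proof -
  have "integrable lborel (\<lambda>s. duhamel G t s \<xi>)"
    by (rule integrable_duhamel[OF joint_G \<xi> norm_cpow_G_le[OF \<xi>] npow_hmaj_finite[OF \<xi> fin]])
  then have "((\<lambda>s. duhamel G t s \<xi>) has_integral (LINT s|lborel. duhamel G t s \<xi>)) UNIV"
    by (rule has_integral_integral_lborel)
  also have "(LINT s|lborel. duhamel G t s \<xi>) = G t \<xi> - of_real (heat \<beta> t \<xi>) * g\<^sub>0 \<xi>"
    using t by (simp add: G_fixpoint[OF \<xi> fin] pstep_def)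
  also have "(\<lambda>s. duhamel G t s \<xi>) = (\<lambda>s. if s \<in> {0..t} then duhamel G t s \<xi> else 0)"
    by (auto simp: duhamel_def)
  finally show ?thesis by (simp only: has_integral_restrict_UNIV)
qed

lemma has_w_integral_sol:
  assumes t: "t \<in> {0..<T}"
  shows "has_w_integral M p 1 (\<lambda>s. propagator M \<beta> (t - s) (dist_power M (sol s) (Suc m))) 0 t
    (\<lambda>\<phi>. sol t \<phi> - propagator M \<beta> t (ft_dist M g\<^sub>0) \<phi>)"
proof -
  let ?F = "\<lambda>s. propagator M \<beta> (t - s) (dist_power M (sol s) (Suc m))"
  let ?J = "\<lambda>\<xi>. G t \<xi> - of_real (heat \<beta> t \<xi>) * g\<^sub>0 \<xi>"
  note int_G = in_amalg_integrable[OF in_amalg_G p] and int_g0 = in_amalg_integrable[OF g\<^sub>0 p]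
  have duh: "duhamel G t s = (\<lambda>\<xi>. of_real (heat \<beta> (t - s) \<xi>) * cpow M (G s) m \<xi>)" if "s \<in> {0..t}" for s
    using that by (simp add: duhamel_def fun_eq_iff)
  have amalg_duh: "in_amalg M p (duhamel G t s)" if "s \<in> {0..t}" for s
    unfolding duh[OF that] using that by (intro in_amalg_heat in_amalg_cpow in_amalg_G p) auto
  have amalg_J: "in_amalg M p ?J" using t by (intro in_amalg_diff in_amalg_G in_amalg_heat g\<^sub>0 p) auto
  have F: "?F s = ft_dist M (duhamel G t s)" if "s \<in> {0..t}" for s
    unfolding sol_def dist_power_ft_dist[OF int_G] duh[OF that]
    using that by (intro propagator_ft_dist integrable_cpow int_G) auto
  have I: "(\<lambda>\<phi>. sol t \<phi> - propagator M \<beta> t (ft_dist M g\<^sub>0) \<phi>) = ft_dist M ?J"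
    using t unfolding sol_def by (subst propagator_ft_dist) (auto intro!: ft_dist_diff[symmetric] integrable_heat int_G int_g0)
  show ?thesis
    unfolding has_w_integral_def I
  proof (intro conjI ballI allI impI)
    show "?F s \<in> w_space M p 1" if "s \<in> {0..t}" for s
      using amalg_duh[OF that] F[OF that] by (auto simp: w_space_iff[OF p])
    show "ft_dist M ?J \<in> w_space M p 1" using amalg_J by (auto simp: w_space_iff[OF p])
    fix e :: real assume "0 < e"
    then obtain \<delta> where \<delta>: "0 < \<delta>" "amalg M p (oscillation \<delta>) < ennreal (e / T)"
      using amalg_oscillation_small[of "e / T"] T by auto
    have "w_norm M p 1 (\<lambda>\<phi>. (\<Sum>(s, K)\<in>D. of_real (measure lborel K) * ?F s \<phi>) - ft_dist M ?J \<phi>) < ennreal e"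
      if D: "D tagged_division_of {0..t}" "(\<lambda>s. ball s \<delta>) fine D" for D
    proof -
      let ?R = "\<lambda>\<xi>. (\<Sum>(s, K)\<in>D. of_real (measure lborel K) * duhamel G t s \<xi>) - ?J \<xi>"
      have meas: "(\<lambda>\<xi>. duhamel G t s \<xi>) \<in> borel_measurable \<mu>" if "(s, K) \<in> D" for s K
        using in_amalg_measurable[OF amalg_duh] tagged_division_ofD(2,3)[OF D(1) that] by auto
      have "w_norm M p 1 (\<lambda>\<phi>. (\<Sum>(s, K)\<in>D. of_real (measure lborel K) * ?F s \<phi>) - ft_dist M ?J \<phi>)
          = amalg M p (\<lambda>\<xi>. ennreal (norm (?R \<xi>)))"
        by (rule w_norm_riemann_sum[OF D(1) p F amalg_duh amalg_J])
      also have "\<dots> \<le> amalg M p (\<lambda>\<xi>. ennreal T * oscillation \<delta> \<xi>)"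
      proof (rule amalg_mono_AE[OF _ _ p])
        have "?R \<in> borel_measurable \<mu>"
          using meas in_amalg_measurable[OF amalg_J]
          by (intro borel_measurable_diff borel_measurable_sum) (auto simp: split_def)
        then show "(\<lambda>\<xi>. ennreal (norm (?R \<xi>))) \<in> borel_measurable \<mu>" by measurable
        show "AE \<xi> in \<mu>. ennreal (norm (?R \<xi>)) \<le> ennreal T * oscillation \<delta> \<xi>"
          using AE_hmaj AE_space
        proof eventually_elim
          case (elim \<xi>)
          then have fin: "hmaj \<xi> \<noteq> top" by simp
          show ?case
          proof (cases "oscillation \<delta> \<xi>")
            case (real w)
            have "norm (?R \<xi>) \<le> w * t"
              using has_integral_duhamel[OF elim(2) fin, of t] t D
                duhamel_oscillation[OF elim(2) fin, of t _ _ \<delta>] real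
              by (subst integral_unique[symmetric], simp) (intro riemann_sum_error, auto intro: has_integral_integrable)
            also have "\<dots> \<le> T * w" using t real(1) by (simp add: mult.commute mult_right_mono)
            finally show ?thesis using real T by (simp add: ennreal_leI flip: ennreal_mult)
          qed (use T in \<open>simp add: ennreal_mult_top\<close>)
        qed
      qed
      also have "\<dots> \<le> ennreal T * amalg M p (oscillation \<delta>)" by (intro amalg_cmult p) measurable
      also have "\<dots> < ennreal T * ennreal (e / T)"
        using \<delta>(2) T by (intro ennreal_mult_strict_left_mono) auto
      also have "\<dots> = ennreal e" using T \<open>0 < e\<close> by (simp flip: ennreal_mult)
      finally show ?thesis .
    qed
    then show "\<exists>\<delta>>0. \<forall>D. D tagged_division_of {0..t} \<and> (\<lambda>s. ball s \<delta>) fine D \<longrightarrow>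
        w_norm M p 1 (\<lambda>\<phi>. (\<Sum>(s, K)\<in>D. of_real (measure lborel K) * ?F s \<phi>) - ft_dist M ?J \<phi>) < ennreal e"
      using \<delta>(1) by blast
  qed
qed

lemma is_solution_sol: "is_solution M p \<beta> (Suc m) (ft_dist M g\<^sub>0) T sol"
  unfolding is_solution_def using w_continuous_sol has_w_integral_sol by blast

end

section \<open>Uniqueness\<close>

text \<open>The norm as a real number, meaningful on functions of finite amalgam norm.\<close>

definition anorm :: "domain \<Rightarrow> ennreal \<Rightarrow> (real^'n \<Rightarrow> complex) \<Rightarrow> real" where
  "anorm M p g = enn2real (amalg M p (\<lambda>\<xi>. ennreal (norm (g \<xi>))))"

lemma enn2real_less: "x < ennreal e \<Longrightarrow> enn2real x < e"
  by (cases x) (auto simp: ennreal_less_iff)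

lemma anorm_nonneg: "0 \<le> anorm M p g"
  by (simp add: anorm_def)

lemma amalg_eq_anorm: "in_amalg M p g \<Longrightarrow> amalg M p (\<lambda>\<xi>. ennreal (norm (g \<xi>))) = ennreal (anorm M p g)"
  by (simp add: anorm_def in_amalg_def)

lemma anorm_leI:
  assumes "g \<in> borel_measurable (dual_measure M)" and p: "1 \<le> p" and "amalg M p h \<le> ennreal B" "0 \<le> B"
    and "AE \<xi> in dual_measure M. ennreal (norm (g \<xi>)) \<le> h \<xi>"
  shows "in_amalg M p g" and "anorm M p g \<le> B"
proof -
  show g: "in_amalg M p g"
    using assms(3) by (intro in_amalgI[OF assms(1) p _ assms(5)]) (auto intro: le_less_trans)
  have "amalg M p (\<lambda>\<xi>. ennreal (norm (g \<xi>))) \<le> ennreal B"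
    using amalg_mono_AE[OF _ assms(5) p] assms(1,3) by (auto intro: order_trans)
  then show "anorm M p g \<le> B" using assms(4) by (simp add: amalg_eq_anorm[OF g])
qed

lemma amalg_add_anorm:
  assumes "in_amalg M p f" "in_amalg M p g" and p: "1 \<le> p"
  shows "amalg M p (\<lambda>\<xi>. ennreal (norm (f \<xi>)) + ennreal (norm (g \<xi>))) \<le> ennreal (anorm M p f + anorm M p g)"
proof -
  note [measurable] = assms(1,2)[THEN in_amalg_measurable]
  have "amalg M p (\<lambda>\<xi>. ennreal (norm (f \<xi>)) + ennreal (norm (g \<xi>)))
      \<le> amalg M p (\<lambda>\<xi>. ennreal (norm (f \<xi>))) + amalg M p (\<lambda>\<xi>. ennreal (norm (g \<xi>)))"
    by (intro amalg_add p) measurable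
  then show ?thesis using assms(1,2) by (simp add: amalg_eq_anorm anorm_nonneg)
qed

lemma anorm_add:
  assumes "in_amalg M p f" "in_amalg M p g" and p: "1 \<le> p"
  shows "in_amalg M p (\<lambda>\<xi>. f \<xi> + g \<xi>)" "anorm M p (\<lambda>\<xi>. f \<xi> + g \<xi>) \<le> anorm M p f + anorm M p g"
proof -
  note [measurable] = assms(1,2)[THEN in_amalg_measurable]
  have m: "(\<lambda>\<xi>. f \<xi> + g \<xi>) \<in> borel_measurable (dual_measure M)" by measurable
  have le: "AE \<xi> in dual_measure M. ennreal (norm (f \<xi> + g \<xi>)) \<le> ennreal (norm (f \<xi>)) + ennreal (norm (g \<xi>))"
    by (simp add: norm_triangle_ineq ennreal_leI flip: ennreal_plus)
  note * = anorm_leI[OF m p amalg_add_anorm[OF assms] _ le]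
  show "in_amalg M p (\<lambda>\<xi>. f \<xi> + g \<xi>)" "anorm M p (\<lambda>\<xi>. f \<xi> + g \<xi>) \<le> anorm M p f + anorm M p g"
    by (rule *, simp add: anorm_nonneg)+
qed

lemma anorm_cmult:
  assumes "in_amalg M p f" and p: "1 \<le> p"
  shows "in_amalg M p (\<lambda>\<xi>. c * f \<xi>)" "anorm M p (\<lambda>\<xi>. c * f \<xi>) \<le> norm c * anorm M p f"
proof -
  note [measurable] = assms(1)[THEN in_amalg_measurable]
  have m: "(\<lambda>\<xi>. c * f \<xi>) \<in> borel_measurable (dual_measure M)" by measurable
  have "amalg M p (\<lambda>\<xi>. ennreal (norm c) * ennreal (norm (f \<xi>))) \<le> ennreal (norm c) * amalg M p (\<lambda>\<xi>. ennreal (norm (f \<xi>)))"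
    by (intro amalg_cmult p) measurable
  then have le: "amalg M p (\<lambda>\<xi>. ennreal (norm c) * ennreal (norm (f \<xi>))) \<le> ennreal (norm c * anorm M p f)"
    using assms(1) by (simp add: amalg_eq_anorm anorm_nonneg ennreal_mult)
  have "AE \<xi> in dual_measure M. ennreal (norm (c * f \<xi>)) \<le> ennreal (norm c) * ennreal (norm (f \<xi>))"
    by (simp add: norm_mult ennreal_mult)
  note * = anorm_leI[OF m p le _ this]
  show "in_amalg M p (\<lambda>\<xi>. c * f \<xi>)" "anorm M p (\<lambda>\<xi>. c * f \<xi>) \<le> norm c * anorm M p f"
    by (rule *, simp add: anorm_nonneg)+
qed

lemma anorm_diff:
  assumes "in_amalg M p f" "in_amalg M p g" and p: "1 \<le> p"
  shows "anorm M p (\<lambda>\<xi>. f \<xi> - g \<xi>) \<le> anorm M p f + anorm M p g"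
  using anorm_add(2)[OF assms(1) anorm_cmult(1)[OF assms(2) p, of "-1"] p] anorm_cmult(2)[OF assms(2) p, of "-1"] by simp

lemma anorm_triangle:
  assumes "in_amalg M p f" "in_amalg M p g" and p: "1 \<le> p"
  shows "\<bar>anorm M p f - anorm M p g\<bar> \<le> anorm M p (\<lambda>\<xi>. f \<xi> - g \<xi>)"
proof -
  have d: "in_amalg M p (\<lambda>\<xi>. f \<xi> - g \<xi>)" by (intro in_amalg_diff assms)
  show ?thesis
    using anorm_add(2)[OF d assms(2) p] anorm_diff[OF assms(1) d p] by simp
qed

lemma anorm_heat:
  assumes f: "in_amalg M p f" and p: "1 \<le> p" and t: "0 \<le> t"
  shows "anorm M p (\<lambda>\<xi>. of_real (heat \<beta> t \<xi>) * f \<xi>) \<le> anorm M p f"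
proof (rule anorm_leI(2)[OF _ p])
  show "(\<lambda>\<xi>. of_real (heat \<beta> t \<xi>) * f \<xi>) \<in> borel_measurable (dual_measure M)"
    using in_amalg_heat[OF f p t] by (rule in_amalg_measurable)
  show "AE \<xi> in dual_measure M. ennreal (norm (of_real (heat \<beta> t \<xi>) * f \<xi>)) \<le> ennreal (norm (f \<xi>))"
    by (simp add: norm_heat_mult_le[OF t] ennreal_leI)
qed (use f in \<open>simp_all add: amalg_eq_anorm anorm_nonneg\<close>)

lemma anorm_sum:
  assumes "finite I" and "\<And>i. i \<in> I \<Longrightarrow> in_amalg M p (f i)" and p: "1 \<le> p"
  shows "in_amalg M p (\<lambda>\<xi>. \<Sum>i\<in>I. c i * f i \<xi>)
    \<and> anorm M p (\<lambda>\<xi>. \<Sum>i\<in>I. c i * f i \<xi>) \<le> (\<Sum>i\<in>I. norm (c i) * anorm M p (f i))"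
  using assms(1,2)
proof (induction I)
  case empty
  then show ?case using p by (simp add: in_amalg_def anorm_def)
next
  case (insert i I)
  then have f: "in_amalg M p (f i)" and IH: "in_amalg M p (\<lambda>\<xi>. \<Sum>i\<in>I. c i * f i \<xi>)"
      "anorm M p (\<lambda>\<xi>. \<Sum>i\<in>I. c i * f i \<xi>) \<le> (\<Sum>i\<in>I. norm (c i) * anorm M p (f i))" by auto
  note cf = anorm_cmult[OF f p, of "c i"]
  show ?case using anorm_add[OF cf(1) IH(1) p] cf(2) IH(2) insert.hyps by simp
qed

text \<open>The sum of the moduli is a majorant of both functions; its power is integrable, so
  \<open>cpow_diff_le_dpow\<close> applies at almost every frequency.\<close>

lemma anorm_cpow_diff_le:
  fixes f g :: "real^'n \<Rightarrow> complex"
  assumes f: "in_amalg M p f" "anorm M p f \<le> R" and g: "in_amalg M p g" "anorm M p g \<le> R" and p: "1 \<le> p"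
  shows "anorm M p (\<lambda>\<xi>. cpow M f m \<xi> - cpow M g m \<xi>)
    \<le> real (Suc m) * real (card (unit_steps :: (real^'n) set)) ^ m * (2 * R) ^ m * anorm M p (\<lambda>\<xi>. f \<xi> - g \<xi>)"
proof (rule anorm_leI(2)[OF _ p])
  let ?\<mu> = "dual_measure M :: (real^'n) measure"
  note [measurable] = f(1)[THEN in_amalg_measurable] g(1)[THEN in_amalg_measurable]
  define h :: "real^'n \<Rightarrow> ennreal" where "h \<xi> = ennreal (norm (f \<xi>)) + ennreal (norm (g \<xi>))" for \<xi>
  define D :: "real^'n \<Rightarrow> ennreal" where "D \<xi> = ennreal (norm (f \<xi> - g \<xi>))" for \<xi>
  have [measurable]: "h \<in> borel_measurable ?\<mu>" "D \<in> borel_measurable ?\<mu>"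
    unfolding h_def[abs_def] D_def[abs_def] by measurable
  have [measurable]: "npow M h m \<in> borel_measurable ?\<mu>" by (rule measurable_npow) measurable
  have R: "0 \<le> R" using f(2) anorm_nonneg[of M p f] by simp
  have h: "amalg M p h \<le> ennreal (2 * R)"
    unfolding h_def[abs_def] using f(2) g(2)
    by (intro order_trans[OF amalg_add_anorm[OF f(1) g(1) p]] ennreal_leI) simp
  have "amalg M p (dpow M h D m) \<le> of_nat (Suc m) * neighbours TYPE('n) ^ m * ennreal (2 * R) ^ m * amalg M p D"
    by (intro amalg_dpow p h) measurable
  also have "amalg M p D = ennreal (anorm M p (\<lambda>\<xi>. f \<xi> - g \<xi>))"
    unfolding D_def[abs_def] by (intro amalg_eq_anorm in_amalg_diff f g p)
  finally show "amalg M p (dpow M h D m)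
    \<le> ennreal (real (Suc m) * real (card (unit_steps :: (real^'n) set)) ^ m * (2 * R) ^ m * anorm M p (\<lambda>\<xi>. f \<xi> - g \<xi>))"
    using R by (simp add: ennreal_of_nat_eq_real_of_nat ennreal_power[symmetric] ennreal_mult anorm_nonneg power_mult_distrib del: of_nat_Suc)
  show "0 \<le> real (Suc m) * real (card (unit_steps :: (real^'n) set)) ^ m * (2 * R) ^ m * anorm M p (\<lambda>\<xi>. f \<xi> - g \<xi>)"
    using R by (simp add: anorm_nonneg)
  have [measurable]: "cpow M f m \<in> borel_measurable ?\<mu>" "cpow M g m \<in> borel_measurable ?\<mu>"
    by (rule measurable_cpow; measurable)+
  show "(\<lambda>\<xi>. cpow M f m \<xi> - cpow M g m \<xi>) \<in> borel_measurable ?\<mu>" by measurable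
  have "AE \<xi> in ?\<mu>. npow M h m \<xi> \<noteq> \<infinity>"
  proof (rule nn_integral_PInf_AE)
    have "(\<integral>\<^sup>+\<xi>. npow M h m \<xi> \<partial>?\<mu>) \<le> amalg M p (npow M h m)" by (intro nn_integral_le_amalg p) measurable
    also have "\<dots> \<le> neighbours TYPE('n) ^ m * ennreal (2 * R) ^ Suc m" by (intro amalg_npow p h) measurable
    also have "\<dots> < \<infinity>" by (simp add: ennreal_mult_less_top power_less_top_ennreal of_nat_less_top)
    finally show "(\<integral>\<^sup>+\<xi>. npow M h m \<xi> \<partial>?\<mu>) \<noteq> \<infinity>" by simp
  qed measurable
  then show "AE \<xi> in ?\<mu>. ennreal (norm (cpow M f m \<xi> - cpow M g m \<xi>)) \<le> dpow M h D m \<xi>"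
    using AE_space
  proof eventually_elim
    case (elim \<xi>)
    show ?case by (rule cpow_diff_le_dpow) (use elim in \<open>auto simp: h_def D_def\<close>)
  qed
qed

lemma solution_representative:
  assumes "is_solution M p \<beta> k u\<^sub>0 T u" and p: "1 \<le> p"
  obtains U where "\<And>t. t \<in> {0..<T} \<Longrightarrow> in_amalg M p (U t)" "\<And>t. t \<in> {0..<T} \<Longrightarrow> u t = ft_dist M (U t)"
proof -
  have "\<forall>t\<in>{0..<T}. \<exists>g. in_amalg M p g \<and> u t = ft_dist M g"
    using assms(1) unfolding is_solution_def w_continuous_on_def w_space_iff[OF p] by blast
  then show ?thesis using that by (metis bchoice)
qed

lemma solution_riemann_sum:
  fixes U :: "real \<Rightarrow> real^'n \<Rightarrow> complex"
  assumes sol: "is_solution M p \<beta> (Suc m) (ft_dist M g\<^sub>0) T u" and p: "1 \<le> p" and g\<^sub>0: "in_amalg M p g\<^sub>0"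
    and U: "\<And>t. t \<in> {0..<T} \<Longrightarrow> in_amalg M p (U t)" "\<And>t. t \<in> {0..<T} \<Longrightarrow> u t = ft_dist M (U t)"
    and t: "t \<in> {0..<T}" and e: "0 < e"
  shows "\<exists>\<delta>>0. \<forall>D. D tagged_division_of {0..t} \<and> (\<lambda>s. ball s \<delta>) fine D \<longrightarrow>
    anorm M p (\<lambda>\<xi>. (\<Sum>(s, K)\<in>D. of_real (measure lborel K) * (of_real (heat \<beta> (t - s) \<xi>) * cpow M (U s) m \<xi>))
      - (U t \<xi> - of_real (heat \<beta> t \<xi>) * g\<^sub>0 \<xi>)) < e"
proof -
  let ?F = "\<lambda>s. propagator M \<beta> (t - s) (dist_power M (u s) (Suc m))"
  let ?f = "\<lambda>s \<xi>. of_real (heat \<beta> (t - s) \<xi>) * cpow M (U s) m \<xi>"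
  let ?J = "\<lambda>\<xi>. U t \<xi> - of_real (heat \<beta> t \<xi>) * g\<^sub>0 \<xi>"
  note int_U = in_amalg_integrable[OF U(1) p] and int_g0 = in_amalg_integrable[OF g\<^sub>0 p]
  have f: "in_amalg M p (?f s)" if "s \<in> {0..t}" for s
    using that t by (intro in_amalg_heat in_amalg_cpow U p) auto
  have J: "in_amalg M p ?J" using t by (intro in_amalg_diff U in_amalg_heat g\<^sub>0 p) auto
  have F: "?F s = ft_dist M (?f s)" if "s \<in> {0..t}" for s
  proof -
    have s: "s \<in> {0..<T}" using that t by auto
    show ?thesis unfolding U(2)[OF s] dist_power_ft_dist[OF int_U[OF s]]
      using that by (intro propagator_ft_dist integrable_cpow int_U[OF s]) auto
  qed
  have "has_w_integral M p 1 ?F 0 t (\<lambda>\<phi>. u t \<phi> - propagator M \<beta> t (ft_dist M g\<^sub>0) \<phi>)"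
    using sol t by (simp add: is_solution_def)
  also have "(\<lambda>\<phi>. u t \<phi> - propagator M \<beta> t (ft_dist M g\<^sub>0) \<phi>) = ft_dist M ?J"
    using t U(2)[OF t] int_U[OF t] int_g0
    by (subst propagator_ft_dist) (auto intro!: ft_dist_diff[symmetric] integrable_heat)
  finally obtain \<delta> where \<delta>: "0 < \<delta>" "\<And>D. D tagged_division_of {0..t} \<Longrightarrow> (\<lambda>s. ball s \<delta>) fine D \<Longrightarrow>
      w_norm M p 1 (\<lambda>\<phi>. (\<Sum>(s, K)\<in>D. of_real (measure lborel K) * ?F s \<phi>) - ft_dist M ?J \<phi>) < ennreal e"
    using e unfolding has_w_integral_def by meson
  have "anorm M p (\<lambda>\<xi>. (\<Sum>(s, K)\<in>D. of_real (measure lborel K) * ?f s \<xi>) - ?J \<xi>) < e"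
    if D: "D tagged_division_of {0..t}" "(\<lambda>s. ball s \<delta>) fine D" for D
  proof -
    have "amalg M p (\<lambda>\<xi>. ennreal (norm ((\<Sum>(s, K)\<in>D. of_real (measure lborel K) * ?f s \<xi>) - ?J \<xi>))) < ennreal e"
      using \<delta>(2)[OF D] by (subst (asm) w_norm_riemann_sum[OF D(1) p F f J])
    then show ?thesis unfolding anorm_def by (rule enn2real_less)
  qed
  then show ?thesis using \<delta>(1) by blast
qed

text \<open>Both Duhamel integrals and the integral of \<open>\<phi>\<close> are approximated over one partition, fine enough for
  all three.  The free parts cancel.\<close>

lemma solution_diff_le:
  fixes M :: domain and p :: ennreal and U V :: "real \<Rightarrow> real^'n \<Rightarrow> complex"
  defines "\<phi> \<equiv> (\<lambda>s. anorm M p (\<lambda>\<xi>. U s \<xi> - V s \<xi>))"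
  assumes u: "is_solution M p \<beta> (Suc m) (ft_dist M g\<^sub>0) T u" and v: "is_solution M p \<beta> (Suc m) (ft_dist M g\<^sub>0) T v"
    and p: "1 \<le> p" and g\<^sub>0: "in_amalg M p g\<^sub>0"
    and U: "\<And>t. t \<in> {0..<T} \<Longrightarrow> in_amalg M p (U t)" "\<And>t. t \<in> {0..<T} \<Longrightarrow> u t = ft_dist M (U t)"
    and V: "\<And>t. t \<in> {0..<T} \<Longrightarrow> in_amalg M p (V t)" "\<And>t. t \<in> {0..<T} \<Longrightarrow> v t = ft_dist M (V t)"
    and t: "t \<in> {0..<T}" and L: "0 < L"
    and lip: "\<And>s. s \<in> {0..t} \<Longrightarrow> anorm M p (\<lambda>\<xi>. cpow M (U s) m \<xi> - cpow M (V s) m \<xi>) \<le> L * \<phi> s"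
    and int: "\<phi> integrable_on {0..t}"
  shows "\<phi> t \<le> L * integral {0..t} \<phi>"
proof (rule field_le_epsilon)
  fix e :: real assume e: "0 < e"
  have e3: "0 < e / 3" "0 < e / (3 * L)" using e L by auto
  let ?f = "\<lambda>U s \<xi>. of_real (heat \<beta> (t - s) \<xi>) * cpow M (U s) m \<xi>"
  let ?S = "\<lambda>D U \<xi>. (\<Sum>(s, K)\<in>D. of_real (measure lborel K) * ?f U s \<xi>)"
  let ?J = "\<lambda>U \<xi>. U t \<xi> - of_real (heat \<beta> t \<xi>) * g\<^sub>0 \<xi>"
  obtain \<delta>u where \<delta>u: "0 < \<delta>u" "\<And>D. D tagged_division_of {0..t} \<Longrightarrow> (\<lambda>s. ball s \<delta>u) fine D \<Longrightarrow>
      anorm M p (\<lambda>\<xi>. ?S D U \<xi> - ?J U \<xi>) < e / 3"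
    using solution_riemann_sum[OF u p g\<^sub>0 U t e3(1)] by blast
  obtain \<delta>v where \<delta>v: "0 < \<delta>v" "\<And>D. D tagged_division_of {0..t} \<Longrightarrow> (\<lambda>s. ball s \<delta>v) fine D \<Longrightarrow>
      anorm M p (\<lambda>\<xi>. ?S D V \<xi> - ?J V \<xi>) < e / 3"
    using solution_riemann_sum[OF v p g\<^sub>0 V t e3(1)] by blast
  obtain \<gamma> where \<gamma>: "gauge \<gamma>" "\<And>D. D tagged_division_of {0..t} \<Longrightarrow> \<gamma> fine D \<Longrightarrow>
      norm ((\<Sum>(s, K)\<in>D. measure lborel K *\<^sub>R \<phi> s) - integral {0..t} \<phi>) < e / (3 * L)"
    using integrable_integral[OF int] e3(2) unfolding has_integral_real by meson
  have "gauge (\<lambda>s. (ball s \<delta>u \<inter> ball s \<delta>v) \<inter> \<gamma> s)"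
    using \<delta>u(1) \<delta>v(1) \<gamma>(1) by (intro gauge_Int gauge_ball) auto
  then obtain D where D: "D tagged_division_of {0..t}" and "(\<lambda>s. (ball s \<delta>u \<inter> ball s \<delta>v) \<inter> \<gamma> s) fine D"
    using fine_division_exists_real by blast
  then have fine: "(\<lambda>s. ball s \<delta>u) fine D" "(\<lambda>s. ball s \<delta>v) fine D" "\<gamma> fine D"
    by (simp_all only: fine_Int)
  define W where "W z = (\<lambda>\<xi>. ?f U (fst z) \<xi> - ?f V (fst z) \<xi>)" for z :: "real \<times> real set"
  define c :: "real \<times> real set \<Rightarrow> complex" where "c z = of_real (measure lborel (snd z))" for z
  have tag: "fst z \<in> {0..t}" if "z \<in> D" for z
    using tagged_division_ofD(2,3)[OF D, of "fst z" "snd z"] that by auto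
  have in_f: "in_amalg M p (?f Z s)" if "s \<in> {0..t}" "\<And>t. t \<in> {0..<T} \<Longrightarrow> in_amalg M p (Z t)" for Z s
    using that t by (intro in_amalg_heat in_amalg_cpow that(2) p) auto
  have W: "in_amalg M p (W z)" "anorm M p (W z) \<le> L * \<phi> (fst z)" if "z \<in> D" for z
  proof -
    note s = tag[OF that]
    then have s': "fst z \<in> {0..<T}" using t by auto
    show "in_amalg M p (W z)" unfolding W_def by (intro in_amalg_diff in_f s U V p)
    have "anorm M p (W z) = anorm M p (\<lambda>\<xi>. of_real (heat \<beta> (t - fst z) \<xi>) * (cpow M (U (fst z)) m \<xi> - cpow M (V (fst z)) m \<xi>))"
      by (simp add: W_def algebra_simps)
    also have "\<dots> \<le> anorm M p (\<lambda>\<xi>. cpow M (U (fst z)) m \<xi> - cpow M (V (fst z)) m \<xi>)"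
      using s by (intro anorm_heat in_amalg_diff in_amalg_cpow U V s' p) auto
    also have "\<dots> \<le> L * \<phi> (fst z)" by (rule lip[OF s])
    finally show "anorm M p (W z) \<le> L * \<phi> (fst z)" .
  qed
  have fin: "finite D" using D by blast
  have SW: "in_amalg M p (\<lambda>\<xi>. \<Sum>z\<in>D. c z * W z \<xi>)"
      "anorm M p (\<lambda>\<xi>. \<Sum>z\<in>D. c z * W z \<xi>) \<le> (\<Sum>z\<in>D. norm (c z) * anorm M p (W z))"
    using anorm_sum[of D M p W c, OF fin W(1) p] by auto
  have in_S: "in_amalg M p (\<lambda>\<xi>. ?S D Z \<xi> - ?J Z \<xi>)" if Z: "\<And>t. t \<in> {0..<T} \<Longrightarrow> in_amalg M p (Z t)" for Z
  proof -
    have "in_amalg M p (\<lambda>\<xi>. \<Sum>z\<in>D. c z * ?f Z (fst z) \<xi>)"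
      by (rule anorm_sum[THEN conjunct1, OF fin in_f p]) (use tag Z in auto)
    then show ?thesis using t by (intro in_amalg_diff in_amalg_heat Z g\<^sub>0 p) (auto simp: c_def split_def)
  qed
  have SU: "in_amalg M p (\<lambda>\<xi>. ?S D U \<xi> - ?J U \<xi>)" and SV: "in_amalg M p (\<lambda>\<xi>. ?S D V \<xi> - ?J V \<xi>)"
    by (rule in_S[OF U(1)], assumption, rule in_S[OF V(1)], assumption)
  have "\<phi> t = anorm M p (\<lambda>\<xi>. ((\<Sum>z\<in>D. c z * W z \<xi>) - (?S D U \<xi> - ?J U \<xi>)) + (?S D V \<xi> - ?J V \<xi>))"
    by (simp add: \<phi>_def W_def c_def split_def right_diff_distrib sum_subtractf)
  also have "\<dots> \<le> anorm M p (\<lambda>\<xi>. \<Sum>z\<in>D. c z * W z \<xi>) + anorm M p (\<lambda>\<xi>. ?S D U \<xi> - ?J U \<xi>) + anorm M p (\<lambda>\<xi>. ?S D V \<xi> - ?J V \<xi>)"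
    using anorm_diff[OF SW(1) SU p] anorm_add(2)[OF in_amalg_diff[OF SW(1) SU p] SV p] by linarith
  also have "\<dots> \<le> (\<Sum>z\<in>D. measure lborel (snd z) * (L * \<phi> (fst z))) + e / 3 + e / 3"
  proof -
    have "(\<Sum>z\<in>D. norm (c z) * anorm M p (W z)) \<le> (\<Sum>z\<in>D. measure lborel (snd z) * (L * \<phi> (fst z)))"
      by (intro sum_mono) (auto simp: c_def intro!: mult_mono W anorm_nonneg)
    then show ?thesis using SW(2) \<delta>u(2)[OF D fine(1)] \<delta>v(2)[OF D fine(2)] by linarith
  qed
  also have "(\<Sum>z\<in>D. measure lborel (snd z) * (L * \<phi> (fst z))) = L * (\<Sum>(s, K)\<in>D. measure lborel K *\<^sub>R \<phi> s)"
    by (simp add: sum_distrib_left split_def mult.left_commute)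
  also have "\<dots> \<le> L * (integral {0..t} \<phi> + e / (3 * L))"
  proof (intro mult_left_mono)
    show "(\<Sum>(s, K)\<in>D. measure lborel K *\<^sub>R \<phi> s) \<le> integral {0..t} \<phi> + e / (3 * L)"
      using \<gamma>(2)[OF D fine(3)] unfolding real_norm_def by linarith
  qed (use L in simp)
  also have "\<dots> + e / 3 + e / 3 = L * integral {0..t} \<phi> + e" using L by (simp add: field_simps)
  finally show "\<phi> t \<le> L * integral {0..t} \<phi> + e" by simp
qed

text \<open>At a maximum of \<open>\<phi> s\<close> weighted by \<open>exp (- 2 K s)\<close> the integral inequality loses a factor of two, so
  the maximum is zero.\<close>

lemma gronwall_zero:
  fixes \<phi> :: "real \<Rightarrow> real"
  assumes cont: "continuous_on {0..a} \<phi>" and pos: "\<And>t. t \<in> {0..a} \<Longrightarrow> 0 \<le> \<phi> t" and K: "0 < K" and a: "0 \<le> a"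
    and le: "\<And>t. t \<in> {0..a} \<Longrightarrow> \<phi> t \<le> K * integral {0..t} \<phi>"
  shows "\<phi> a = 0"
proof -
  let ?w = "\<lambda>s. exp (- (2 * K * s)) * \<phi> s"
  have "continuous_on {0..a} ?w" by (intro continuous_intros cont)
  then obtain r where r: "r \<in> {0..a}" "\<And>s. s \<in> {0..a} \<Longrightarrow> ?w s \<le> ?w r"
    using continuous_attains_sup[of "{0..a}" ?w] a by auto
  have bound: "\<phi> s \<le> ?w r * exp (2 * K * s)" if "s \<in> {0..a}" for s
  proof -
    have "\<phi> s = ?w s * exp (2 * K * s)" by (simp add: exp_minus)
    also have "\<dots> \<le> ?w r * exp (2 * K * s)" by (intro mult_right_mono r that) simp
    finally show ?thesis .
  qed
  have FTC: "((\<lambda>s. ?w r * exp (2 * K * s)) has_integral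
      ?w r * exp (2 * K * r) / (2 * K) - ?w r * exp (2 * K * 0) / (2 * K)) {0..r}"
    using r(1) K by (intro fundamental_theorem_of_calculus)
      (auto intro!: derivative_eq_intros simp flip: has_real_derivative_iff_has_vector_derivative)
  have "integral {0..r} \<phi> \<le> ?w r * exp (2 * K * r) / (2 * K) - ?w r * exp (2 * K * 0) / (2 * K)"
  proof (rule has_integral_le[OF _ FTC])
    show "(\<phi> has_integral integral {0..r} \<phi>) {0..r}"
      using r(1) by (intro integrable_integral integrable_continuous_real continuous_on_subset[OF cont]) auto
  qed (use bound r(1) in auto)
  then have "K * integral {0..r} \<phi> \<le> K * (?w r * exp (2 * K * r) / (2 * K) - ?w r * exp (2 * K * 0) / (2 * K))"
    using K by (intro mult_left_mono) auto
  also have "\<dots> = (\<phi> r - ?w r) / 2" using K by (simp add: field_simps exp_minus)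
  finally have "\<phi> r \<le> (\<phi> r - ?w r) / 2" using le[OF r(1)] by linarith
  moreover have "0 \<le> \<phi> r" "0 \<le> ?w r" using pos[OF r(1)] by auto
  ultimately have "?w r \<le> 0" by argo
  then have "?w a \<le> 0" using r(2)[of a] a by simp
  then have "\<phi> a \<le> 0" by (simp add: mult_le_0_iff)
  then show ?thesis using pos[of a] a by simp
qed

lemma continuous_on_dominated:
  fixes f :: "real \<Rightarrow> real"
  assumes "\<And>t. t \<in> S \<Longrightarrow> ((\<lambda>s. d s t) \<longlongrightarrow> 0) (at t within S)"
    and "\<And>s t. s \<in> S \<Longrightarrow> t \<in> S \<Longrightarrow> \<bar>f s - f t\<bar> \<le> d s t"
  shows "continuous_on S f"
  unfolding continuous_on_def
proof
  fix t assume t: "t \<in> S"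
  have "((\<lambda>s. f s - f t) \<longlongrightarrow> 0) (at t within S)"
  proof (rule Lim_null_comparison[OF _ assms(1)[OF t]])
    show "eventually (\<lambda>s. norm (f s - f t) \<le> d s t) (at t within S)"
      using assms(2) t by (auto simp: eventually_at_filter)
  qed
  then show "(f \<longlongrightarrow> f t) (at t within S)" by (simp add: LIM_zero_iff)
qed

lemma anorm_tendsto_0:
  assumes u: "w_continuous_on M p 1 S u" and p: "1 \<le> p"
    and U: "\<And>t. t \<in> S \<Longrightarrow> in_amalg M p (U t)" "\<And>t. t \<in> S \<Longrightarrow> u t = ft_dist M (U t)" and t: "t \<in> S"
  shows "((\<lambda>s. anorm M p (\<lambda>\<xi>. U s \<xi> - U t \<xi>)) \<longlongrightarrow> 0) (at t within S)"
proof -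
  have "w_norm M p 1 (\<lambda>\<phi>. u s \<phi> - u t \<phi>) = ennreal (anorm M p (\<lambda>\<xi>. U s \<xi> - U t \<xi>))" if "s \<in> S" for s
  proof -
    have "w_norm M p 1 (\<lambda>\<phi>. u s \<phi> - u t \<phi>) = amalg M p (\<lambda>\<xi>. ennreal (norm (U s \<xi> - U t \<xi>)))"
      unfolding U(2)[OF that] U(2)[OF t] by (intro w_norm_diff_ft_dist in_amalg_integrable[OF U(1)] that t p)
    also have "\<dots> = ennreal (anorm M p (\<lambda>\<xi>. U s \<xi> - U t \<xi>))"
      by (intro amalg_eq_anorm in_amalg_diff U that t p)
    finally show ?thesis .
  qed
  then have ev: "eventually (\<lambda>s. w_norm M p 1 (\<lambda>\<phi>. u s \<phi> - u t \<phi>) = ennreal (anorm M p (\<lambda>\<xi>. U s \<xi> - U t \<xi>))) (at t within S)"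
    by (auto simp: eventually_at_filter)
  have "((\<lambda>s. w_norm M p 1 (\<lambda>\<phi>. u s \<phi> - u t \<phi>)) \<longlongrightarrow> 0) (at t within S)"
    using u t by (simp add: w_continuous_on_def)
  then have "((\<lambda>s. ennreal (anorm M p (\<lambda>\<xi>. U s \<xi> - U t \<xi>))) \<longlongrightarrow> ennreal 0) (at t within S)"
    by (simp only: tendsto_cong[OF ev] ennreal_0)
  then show ?thesis by (rule tendsto_ennrealD) (simp_all add: anorm_nonneg)
qed

lemma solution_unique:
  fixes g\<^sub>0 :: "real^'n \<Rightarrow> complex"
  assumes u: "is_solution M p \<beta> (Suc m) (ft_dist M g\<^sub>0) T u" and v: "is_solution M p \<beta> (Suc m) (ft_dist M g\<^sub>0) T v"
    and p: "1 \<le> p" and g\<^sub>0: "in_amalg M p g\<^sub>0" and a: "a \<in> {0..<T}"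
  shows "u a = v a"
proof -
  obtain U where U: "\<And>t. t \<in> {0..<T} \<Longrightarrow> in_amalg M p (U t)" "\<And>t. t \<in> {0..<T} \<Longrightarrow> u t = ft_dist M (U t)"
    using solution_representative[OF u p] by blast
  obtain V where V: "\<And>t. t \<in> {0..<T} \<Longrightarrow> in_amalg M p (V t)" "\<And>t. t \<in> {0..<T} \<Longrightarrow> v t = ft_dist M (V t)"
    using solution_representative[OF v p] by blast
  have cu: "w_continuous_on M p 1 {0..<T} u" and cv: "w_continuous_on M p 1 {0..<T} v"
    using u v by (auto simp: is_solution_def)
  define \<phi> where "\<phi> s = anorm M p (\<lambda>\<xi>. U s \<xi> - V s \<xi>)" for s
  have dU: "((\<lambda>s. anorm M p (\<lambda>\<xi>. U s \<xi> - U t \<xi>)) \<longlongrightarrow> 0) (at t within {0..<T})"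
    and dV: "((\<lambda>s. anorm M p (\<lambda>\<xi>. V s \<xi> - V t \<xi>)) \<longlongrightarrow> 0) (at t within {0..<T})" if "t \<in> {0..<T}" for t
    by (rule anorm_tendsto_0[OF cu p U that], assumption+) (rule anorm_tendsto_0[OF cv p V that], assumption+)
  have "continuous_on {0..<T} (\<lambda>s. anorm M p (U s))"
    by (rule continuous_on_dominated[OF dU anorm_triangle[OF U(1) U(1) p]])
  moreover have "continuous_on {0..<T} (\<lambda>s. anorm M p (V s))"
    by (rule continuous_on_dominated[OF dV anorm_triangle[OF V(1) V(1) p]])
  ultimately have "continuous_on {0..a} (\<lambda>s. anorm M p (U s) + anorm M p (V s))"
    using a by (intro continuous_on_add) (auto elim!: continuous_on_subset)
  then have "\<exists>x\<in>{0..a}. \<forall>s\<in>{0..a}. anorm M p (U s) + anorm M p (V s) \<le> anorm M p (U x) + anorm M p (V x)"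
    using a by (intro continuous_attains_sup) auto
  then obtain R where R: "\<And>s. s \<in> {0..a} \<Longrightarrow> anorm M p (U s) + anorm M p (V s) \<le> R" by blast
  have UR: "anorm M p (U s) \<le> R" and VR: "anorm M p (V s) \<le> R" if "s \<in> {0..a}" for s
    using R[OF that] anorm_nonneg[of M p "U s"] anorm_nonneg[of M p "V s"] by linarith+
  have R0: "0 \<le> R" using UR[of a] anorm_nonneg[of M p "U a"] a by simp
  have "continuous_on {0..<T} \<phi>"
  proof (rule continuous_on_dominated)
    show "((\<lambda>s. anorm M p (\<lambda>\<xi>. U s \<xi> - U t \<xi>) + anorm M p (\<lambda>\<xi>. V s \<xi> - V t \<xi>)) \<longlongrightarrow> 0) (at t within {0..<T})"
      if "t \<in> {0..<T}" for t using tendsto_add[OF dU[OF that] dV[OF that]] by simp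
    fix s t assume st: "s \<in> {0..<T}" "t \<in> {0..<T}"
    note d = in_amalg_diff[OF U(1)[OF st(1)] U(1)[OF st(2)] p] in_amalg_diff[OF V(1)[OF st(1)] V(1)[OF st(2)] p]
    have "\<bar>\<phi> s - \<phi> t\<bar> \<le> anorm M p (\<lambda>\<xi>. (U s \<xi> - V s \<xi>) - (U t \<xi> - V t \<xi>))"
      unfolding \<phi>_def by (intro anorm_triangle in_amalg_diff U V st p)
    also have "\<dots> = anorm M p (\<lambda>\<xi>. (U s \<xi> - U t \<xi>) - (V s \<xi> - V t \<xi>))" by (simp add: algebra_simps)
    also have "\<dots> \<le> anorm M p (\<lambda>\<xi>. U s \<xi> - U t \<xi>) + anorm M p (\<lambda>\<xi>. V s \<xi> - V t \<xi>)"
      by (rule anorm_diff[OF d p])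
    finally show "\<bar>\<phi> s - \<phi> t\<bar> \<le> anorm M p (\<lambda>\<xi>. U s \<xi> - U t \<xi>) + anorm M p (\<lambda>\<xi>. V s \<xi> - V t \<xi>)" .
  qed
  then have cont: "continuous_on {0..a} \<phi>" using a by (auto elim!: continuous_on_subset)
  \<comment> \<open>One is added to make \<open>L\<close> positive even when \<open>R\<close> is zero.\<close>
  define L where "L = real (Suc m) * real (card (unit_steps :: (real^'n) set)) ^ m * (2 * R) ^ m + 1"
  have L: "0 < L" using R0 by (simp add: L_def add_nonneg_pos)
  have lip: "anorm M p (\<lambda>\<xi>. cpow M (U s) m \<xi> - cpow M (V s) m \<xi>) \<le> L * \<phi> s" if s: "s \<in> {0..a}" for s
  proof -
    have s': "s \<in> {0..<T}" using s a by auto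
    have "anorm M p (\<lambda>\<xi>. cpow M (U s) m \<xi> - cpow M (V s) m \<xi>) \<le> (L - 1) * \<phi> s"
      using anorm_cpow_diff_le[OF U(1)[OF s'] UR[OF s] V(1)[OF s'] VR[OF s] p, of m] by (simp add: L_def \<phi>_def)
    also have "\<dots> \<le> L * \<phi> s" by (intro mult_right_mono) (auto simp: \<phi>_def anorm_nonneg)
    finally show ?thesis .
  qed
  have "\<phi> a = 0"
  proof (rule gronwall_zero[OF cont _ L])
    show "0 \<le> a" using a by simp
    show "0 \<le> \<phi> t" for t by (simp add: \<phi>_def anorm_nonneg)
    fix t assume t: "t \<in> {0..a}"
    have "\<phi> integrable_on {0..t}" using t by (intro integrable_continuous_real continuous_on_subset[OF cont]) auto
    then show "\<phi> t \<le> L * integral {0..t} \<phi>"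
      unfolding \<phi>_def[abs_def] using t a lip
      by (intro solution_diff_le[OF u v p g\<^sub>0 U V _ L]) (auto simp: \<phi>_def)
  qed
  moreover have d: "in_amalg M p (\<lambda>\<xi>. U a \<xi> - V a \<xi>)" by (intro in_amalg_diff U V a p)
  ultimately have "amalg M p (\<lambda>\<xi>. ennreal (norm (U a \<xi> - V a \<xi>))) = 0"
    by (simp add: amalg_eq_anorm \<phi>_def)
  note [measurable] = U(1)[OF a, THEN in_amalg_measurable] V(1)[OF a, THEN in_amalg_measurable]
  \<comment> \<open>Distance zero makes the transforms equal almost everywhere, and then the distributions coincide.\<close>
  have "(\<integral>\<^sup>+\<xi>. ennreal (norm (U a \<xi> - V a \<xi>)) \<partial>dual_measure M) \<le> amalg M p (\<lambda>\<xi>. ennreal (norm (U a \<xi> - V a \<xi>)))"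
    by (intro nn_integral_le_amalg p) measurable
  then have "(\<integral>\<^sup>+\<xi>. ennreal (norm (U a \<xi> - V a \<xi>)) \<partial>dual_measure M) = 0"
    by (simp add: \<open>amalg M p _ = 0\<close>)
  then have "AE \<xi> in dual_measure M. U a \<xi> = V a \<xi>"
    by (subst (asm) nn_integral_0_iff_AE) (auto simp: ennreal_eq_0_iff)
  then have "ft_dist M (U a) = ft_dist M (V a)" by (rule ft_dist_cong_AE) measurable
  then show ?thesis using U(2)[OF a] V(2)[OF a] by simp
qed

section \<open>Local well-posedness\<close>

text \<open>With \<open>A\<close> the norm of the data, \<open>T\<close> is chosen so small that the majorant equation is solvable in the
  ball of radius \<open>A + 1\<close>; uniqueness holds on every interval.\<close>

theorem theoremB:
  fixes M :: domain and \<beta> :: real and k :: nat and p :: ennreal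
    and u\<^sub>0 :: "'n::finite functional"
  assumes "0 < \<beta>" and "1 \<le> k" and "1 \<le> p"
    and "u\<^sub>0 \<in> w_space M p 1"
  shows "\<exists>T\<^sub>1>0. (\<exists>u. is_solution M p \<beta> k u\<^sub>0 T\<^sub>1 u) \<and>
           (\<forall>u v. is_solution M p \<beta> k u\<^sub>0 T\<^sub>1 u \<longrightarrow> is_solution M p \<beta> k u\<^sub>0 T\<^sub>1 v \<longrightarrow>
              (\<forall>t\<in>{0..<T\<^sub>1}. u t = v t))"
proof -
  obtain g where g: "in_amalg M p g" and u\<^sub>0: "u\<^sub>0 = ft_dist M g"
    using assms(4) unfolding w_space_iff[OF assms(3)] by blast
  obtain m where k: "k = Suc m" using assms(2) by (cases k) auto
  let ?C = "real (card (unit_steps :: (real^'n) set))"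
  let ?A = "anorm M p g"
  \<comment> \<open>One is added to the denominator to make it visibly positive.\<close>
  define T where "T = 1 / (?C ^ m * (?A + 1) ^ Suc m + 1)"
  have pos: "0 \<le> ?C ^ m * (?A + 1) ^ Suc m" using anorm_nonneg[of M p g] by (intro mult_nonneg_nonneg zero_le_power) auto
  have T: "0 < T" using pos by (simp add: T_def)
  interpret picard M \<beta> m p g T ?A
  proof
    show "T * ?C ^ m * (?A + 1) ^ Suc m \<le> 1"
      using pos by (simp add: T_def mult.assoc)
  qed (use assms g T in \<open>simp_all add: anorm_nonneg amalg_eq_anorm\<close>)
  show ?thesis
    unfolding k u\<^sub>0 using T is_solution_sol solution_unique[OF _ _ assms(3) g] by blast
qed

end
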